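(* Fix a positive integer $N$. Let $\Gamma$ be a MOY graph and $\Delta$ a simple circuit of $\Gamma$ all of whose edges have color at most $N$. Let $\Gamma'$ be the MOY graph obtained from $\Gamma$ by reversing the orientation of every edge of $\Delta$ and replacing the color $k$ of every edge of $\Delta$ by $N-k$ (other edges are unchanged). Then, up to an overall shift of the $\mathbb{Z}_2$-grading, there is a homotopy equivalence of graded matrix factorizations, preserving the quantum grading, $$C_N(\Gamma)\simeq C_N(\Gamma').$$
   Context: **MOY graphs.** Oriented trivalent graphs may contain vertexless oriented circles, each counted as an edge. A MOY coloring of an oriented trivalent graph assigns to each edge $e$ an integer $\mathsf{c}(e)\ge 0$ such that at every vertex either two edges $e_1,e_2$ enter and one edge $e$ leaves, or one edge $e$ enters and two edges $e_1,e_2$ leave, and $\mathsf{c}(e)=\mathsf{c}(e_1)+\mathsf{c}(e_2)$. A MOY graph is an oriented trivalent graph with a MOY coloring embedded in the plane $\mathbb{R}^2$. **Simple circuit.** A simple circuit of $\Gamma$ is a subgraph $\Delta$ that is a (piecewise smoothly) embedded circle in $\mathbb{R}^2$ such that the orientations of all its edges coincide with one orientation of this circle. **Graded matrix factorizations.** All rings are over $\mathbb{C}$ and every variable in an alphabet has (quantum) degree $2$. $\{q^k\}$ means shifting the quantum grading up by $k$. For a graded commutative ring $R$ and a homogeneous $w\in R$ of degree $2N+2$, a graded matrix factorization of $w$ over $R$ is a $\mathbb{Z}_2$-graded graded free $R$-module $M=M_0\oplus M_1$ with $R$-linear maps $d_0:M_0\to M_1$, $d_1:M_1\to M_0$, homogeneous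 of quantum degree $N+1$, with $d_1d_0=w$ and $d_0d_1=w$. Morphisms, homotopies and homotopy equivalences are defined as for $\mathbb{Z}_2$-graded complexes; tensor products add potentials $w$. For homogeneous $a,b\in R$ with $\deg a+\deg b=2N+2$, $(a,b)_R$ is the factorization $R\xrightarrow{a}R\{q^{N+1-\deg a}\}\xrightarrow{b}R$ of $ab$ (with $M_0=R$), and the Koszul factorization of a sequence of pairs $(a_j,b_j)$ is $\bigotimes_j (a_j,b_j)_R$ over $R$. **The matrix factorization $C_N(\Gamma)$.** Choose marked points in the interiors of the edges of $\Gamma$, at least two on every edge, and assign to each marked point on an edge of color $c$ an alphabet of $c$ independent variables, different alphabets being disjoint. Cutting at the marked points decomposes $\Gamma$ into pieces, each an oriented arc or a neighborhood of a vertex. For a piece, let $\mathbb{Y}_1,\dots,\mathbb{Y}_l$ be the alphabets at its incoming end points and $\mathbb{X}_1,\dots,\mathbb{X}_k$ those at its outgoing end points; put $\mathbb{X}=\bigcup_s\mathbb{X}_s$, $\mathbb{Y}=\bigcup_t\mathbb{Y}_t$ (both have the same cardinality $m$), let $X_j,Y_j$ be the $j$-th elementary symmetric polynomials in $\mathbb{X},\mathbb{Y}$, and let $R=\mathrm{Sym}(\mathbb{X}_1|\cdots|\mathbb{X}_k|\mathbb{Y}_1|\cdots|\mathbb{Y}_l)$ be the ring of polynomials symmetric in each alphabet separately. Let $p$ be the polynomial with $p(X_1,\dots,X_m)=\sum_{x\in\mathbb{X}}x^{N+1}$, and $$U_j=\frac{p(Y_1,\dots,Y_{j-1},X_j,\dots,X_m)-p(Y_1,\dots,Y_j,X_{j+1},\dots,X_m)}{X_j-Y_j}.$$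 The factorization of the piece is the Koszul factorization over $R$ of the pairs $(U_j,X_j-Y_j)$, $1\le j\le m$, with quantum shift $\{q^{-\sum_{1\le s<t\le k}|\mathbb{X}_s||\mathbb{X}_t|}\}$. $C_N(\Gamma)$ is the tensor product of the factorizations of all pieces, taken over the rings $\mathrm{Sym}(\mathbb{X})$ of the alphabets $\mathbb{X}$ at the common marked points. It is regarded as a $\mathbb{Z}_2\oplus\mathbb{Z}$-graded matrix factorization of potential $0$ over $\mathbb{C}$ (the $\mathbb{Z}$-grading is the quantum grading). Its homotopy type does not depend on the choice of marked points. *)

theory Defs
  imports "HOL-Analysis.Analysis" "HOL-Library.Poly_Mapping"
begin

section \<open>MOY graphs in the plane\<close>

text \<open>The plane is \<^typ>\<open>complex\<close>. Every edge, vertexless circles included, carries a parametrization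
  over \<open>[0,1]\<close> whose direction is the orientation of the edge.\<close>

record 'e plane_graph =
  verts :: "complex set"
  edges :: "'e set"
  curve :: "'e \<Rightarrow> real \<Rightarrow> complex"
  color :: "'e \<Rightarrow> nat"

definition is_circle :: "'e plane_graph \<Rightarrow> 'e \<Rightarrow> bool" where
  "is_circle G e \<longleftrightarrow> path_image (curve G e) \<inter> verts G = {}"

definition in_edges :: "'e plane_graph \<Rightarrow> complex \<Rightarrow> 'e set" where
  "in_edges G v = {e \<in> edges G. \<not> is_circle G e \<and> pathfinish (curve G e) = v}"

definition out_edges :: "'e plane_graph \<Rightarrow> complex \<Rightarrow> 'e set" where
  "out_edges G v = {e \<in> edges G. \<not> is_circle G e \<and> pathstart (curve G e) = v}"

text \<open>\<^const>\<open>simple_path\<close> allows the two ends to coincide, as is needed for circles and for edges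
  that start and end at the same vertex; such a loop counts once in \<^const>\<open>in_edges\<close> and once in
  \<^const>\<open>out_edges\<close>. \<^const>\<open>valid_path\<close> is piecewise continuous differentiability.\<close>

definition moy_graph :: "'e plane_graph \<Rightarrow> bool" where
  "moy_graph G \<longleftrightarrow>
     finite (verts G) \<and> finite (edges G) \<and>
     (\<forall>e \<in> edges G. simple_path (curve G e) \<and> valid_path (curve G e) \<and>
        (if is_circle G e then pathfinish (curve G e) = pathstart (curve G e)
         else path_image (curve G e) \<inter> verts G
                = {pathstart (curve G e), pathfinish (curve G e)})) \<and>
     (\<forall>e \<in> edges G. \<forall>f \<in> edges G. e \<noteq> f \<longrightarrow>
        path_image (curve G e) \<inter> path_image (curve G f) \<subseteq> verts G) \<and>
     (\<forall>v \<in> verts G.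
        (card (in_edges G v) = 2 \<and> card (out_edges G v) = 1 \<or>
         card (in_edges G v) = 1 \<and> card (out_edges G v) = 2) \<and>
        (\<Sum>e\<in>in_edges G v. color G e) = (\<Sum>e\<in>out_edges G v. color G e))"

fun traverse :: "(real \<Rightarrow> complex) list \<Rightarrow> real \<Rightarrow> complex" where
  "traverse [] = linepath 0 0"
| "traverse [p] = p"
| "traverse (p # q # ps) = p +++ traverse (q # ps)"

text \<open>The subgraph is given by its set \<open>D\<close> of edges: run through one after the other, each along its
  orientation, they form one embedded circle.\<close>

definition simple_circuit :: "'e plane_graph \<Rightarrow> 'e set \<Rightarrow> bool" where
  "simple_circuit G D \<longleftrightarrow> D \<subseteq> edges G \<and>
     (\<exists>es. es \<noteq> [] \<and> distinct es \<and> set es = D \<and>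
        (\<forall>i. Suc i < length es \<longrightarrow>
           pathfinish (curve G (es ! i)) = pathstart (curve G (es ! Suc i))) \<and>
        simple_path (traverse (map (curve G) es)) \<and>
        pathfinish (traverse (map (curve G) es)) = pathstart (traverse (map (curve G) es)))"

definition reverse_circuit :: "nat \<Rightarrow> 'e set \<Rightarrow> 'e plane_graph \<Rightarrow> 'e plane_graph" where
  "reverse_circuit N D G =
     G\<lparr>curve := (\<lambda>e. if e \<in> D then reversepath (curve G e) else curve G e),
       color := (\<lambda>e. if e \<in> D then N - color G e else color G e)\<rparr>"


section \<open>Polynomials over the complex numbers\<close>

type_synonym 'x mpol = "('x \<Rightarrow>\<^sub>0 nat) \<Rightarrow>\<^sub>0 complex"

definition Var :: "'x \<Rightarrow> 'x mpol" where
  "Var x = Poly_Mapping.single (Poly_Mapping.single x 1) 1"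

definition Cst :: "complex \<Rightarrow> 'x mpol" where
  "Cst c = Poly_Mapping.single 0 c"

definition pvars :: "'x mpol \<Rightarrow> 'x set" where
  "pvars f = (\<Union>t\<in>Poly_Mapping.keys f. Poly_Mapping.keys t)"

definition subst :: "('x \<Rightarrow> 'y mpol) \<Rightarrow> 'x mpol \<Rightarrow> 'y mpol" where
  "subst s f = (\<Sum>t\<in>Poly_Mapping.keys f. Cst (Poly_Mapping.lookup f t) *
     (\<Prod>x\<in>Poly_Mapping.keys t. s x ^ Poly_Mapping.lookup t x))"

text \<open>Homogeneity refers to the quantum grading, in which every variable has degree 2.\<close>

definition homogeneous :: "int \<Rightarrow> 'x mpol \<Rightarrow> bool" where
  "homogeneous k f \<longleftrightarrow> (\<forall>t\<in>Poly_Mapping.keys f.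
     2 * int (\<Sum>x\<in>Poly_Mapping.keys t. Poly_Mapping.lookup t x) = k)"

definition esym :: "nat \<Rightarrow> 'x set \<Rightarrow> 'x mpol" where
  "esym j A = (\<Sum>B | B \<subseteq> A \<and> card B = j. \<Prod>x\<in>B. Var x)"

text \<open>The ring \<open>Sym(A\<^sub>1|\<dots>|A\<^sub>n)\<close> of polynomials symmetric in each of a set of disjoint alphabets.\<close>

definition Sym :: "'x set set \<Rightarrow> 'x mpol set" where
  "Sym \<A> = {f. pvars f \<subseteq> \<Union>\<A> \<and>
     (\<forall>A\<in>\<A>. \<forall>\<pi>. \<pi> permutes A \<longrightarrow> subst (\<lambda>x. Var (\<pi> x)) f = f)}"

text \<open>The polynomial \<open>p\<close> expressing the \<open>n\<close>-th power sum of \<open>m\<close> variables in terms of their elementary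
  symmetric polynomials; the variable \<open>j\<close> of \<open>p\<close> stands for the \<open>j\<close>-th of these.\<close>

definition power_sum_poly :: "nat \<Rightarrow> nat \<Rightarrow> nat mpol" where
  "power_sum_poly m n = (THE p. pvars p \<subseteq> {1..m} \<and>
     subst (\<lambda>j. esym j {1..m}) p = (\<Sum>i=1..m. Var i ^ n))"

text \<open>The exact quotient \<open>U\<^sub>j\<close> for the total alphabets \<open>X\<close> (outgoing) and \<open>Y\<close> (incoming) of a piece.\<close>

definition U_quot :: "nat \<Rightarrow> 'x set \<Rightarrow> 'x set \<Rightarrow> nat \<Rightarrow> 'x mpol" where
  "U_quot N X Y j = (let p = power_sum_poly (card X) (N + 1) in
     THE u. u * (esym j X - esym j Y) =
       subst (\<lambda>i. if i < j then esym i Y else esym i X) p -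
       subst (\<lambda>i. if i \<le> j then esym i Y else esym i X) p)"


section \<open>Graded matrix factorizations\<close>

text \<open>A factorization on a graded free module over the ring \<open>Sym (alph M)\<close> with finite homogeneous
  basis \<open>gens M\<close>: \<open>odd_gen M b\<close> says that \<open>b\<close> lies in \<open>M\<^sub>1\<close>, \<open>qdeg M b\<close> is its quantum degree, and
  \<open>mat M b b'\<close> is the coefficient of \<open>b'\<close> in \<open>d b\<close>.\<close>

record ('b, 'x) factorization =
  alph :: "'x set set"
  gens :: "'b set"
  odd_gen :: "'b \<Rightarrow> bool"
  qdeg :: "'b \<Rightarrow> int"
  mat :: "'b \<Rightarrow> 'b \<Rightarrow> 'x mpol"

definition qshift :: "int \<Rightarrow> ('b, 'x) factorization \<Rightarrow> ('b, 'x) factorization" where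
  "qshift k M = M\<lparr>qdeg := (\<lambda>b. qdeg M b + k)\<rparr>"

definition z2shift :: "('b, 'x) factorization \<Rightarrow> ('b, 'x) factorization" where
  "z2shift M = M\<lparr>odd_gen := (\<lambda>b. \<not> odd_gen M b)\<rparr>"

text \<open>The factorization \<open>(a, b)\<^sub>R\<close> for \<open>R = Sym \<A>\<close>. The degree of \<open>a\<close> is passed as the argument
  \<open>da\<close>, since \<open>a\<close> can be zero.\<close>

definition two_term :: "nat \<Rightarrow> 'x set set \<Rightarrow> 'x mpol \<Rightarrow> int \<Rightarrow> 'x mpol \<Rightarrow> (bool, 'x) factorization"
  where
  "two_term N \<A> a da b =
     \<lparr>alph = \<A>, gens = UNIV, odd_gen = (\<lambda>g. g),
      qdeg = (\<lambda>g. if g then int N + 1 - da else 0),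
      mat = (\<lambda>g h. if \<not> g \<and> h then a else if g \<and> \<not> h then b else 0)\<rparr>"

text \<open>Tensor product over the ring of symmetric polynomials in the common alphabets of the two
  factors: by \<open>Sym \<A> \<otimes> Sym \<B> = Sym (\<A> \<union> \<B>)\<close>, tensored over \<open>Sym (\<A> \<inter> \<B>)\<close>, it is free over the
  latter ring on the pairs of generators, with \<open>d(x \<otimes> y) = dx \<otimes> y + (-1)\<^bsup>|x|\<^esup> x \<otimes> dy\<close>. The pair
  \<open>x \<otimes> y\<close> is encoded as the list \<open>x # y\<close>, so that tensor products can be iterated.\<close>

definition tensor ::
  "('b, 'x) factorization \<Rightarrow> ('b list, 'x) factorization \<Rightarrow> ('b list, 'x) factorization" where
  "tensor M M' =
     \<lparr>alph = alph M \<union> alph M',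
      gens = {b # bs | b bs. b \<in> gens M \<and> bs \<in> gens M'},
      odd_gen = (\<lambda>x. odd_gen M (hd x) \<noteq> odd_gen M' (tl x)),
      qdeg = (\<lambda>x. qdeg M (hd x) + qdeg M' (tl x)),
      mat = (\<lambda>x y. (if tl x = tl y then mat M (hd x) (hd y) else 0) +
        (if hd x = hd y
         then (if odd_gen M (hd x) then - mat M' (tl x) (tl y) else mat M' (tl x) (tl y))
         else 0))\<rparr>"

definition unit_factorization :: "'x set set \<Rightarrow> ('b list, 'x) factorization" where
  "unit_factorization \<A> =
     \<lparr>alph = \<A>, gens = {[]}, odd_gen = (\<lambda>_. False), qdeg = (\<lambda>_. 0), mat = (\<lambda>_ _. 0)\<rparr>"

definition koszul ::
  "nat \<Rightarrow> 'x set set \<Rightarrow> ('x mpol \<times> int \<times> 'x mpol) list \<Rightarrow> (bool list, 'x) factorization" where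
  "koszul N \<A> fs =
     foldr tensor (map (\<lambda>(a, da, b). two_term N \<A> a da b) fs) (unit_factorization \<A>)"


section \<open>Homotopy equivalence over the complex numbers\<close>

text \<open>An element of the underlying module is given by its family of coefficients.\<close>

definition elems :: "('b, 'x) factorization \<Rightarrow> ('b \<Rightarrow> 'x mpol) set" where
  "elems M = {u. \<forall>b. if b \<in> gens M then u b \<in> Sym (alph M) else u b = 0}"

definition component :: "('b, 'x) factorization \<Rightarrow> bool \<Rightarrow> int \<Rightarrow> ('b \<Rightarrow> 'x mpol) set" where
  "component M \<epsilon> k = {u \<in> elems M. \<forall>b\<in>gens M.
     (odd_gen M b \<noteq> \<epsilon> \<longrightarrow> u b = 0) \<and> homogeneous (k - qdeg M b) (u b)}"

definition diffl :: "('b, 'x) factorization \<Rightarrow> ('b \<Rightarrow> 'x mpol) \<Rightarrow> 'b \<Rightarrow> 'x mpol" where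
  "diffl M u = (\<lambda>b'. if b' \<in> gens M then \<Sum>b\<in>gens M. u b * mat M b b' else 0)"

text \<open>\<open>\<complex>\<close>-linear maps that are homogeneous of \<open>\<int>\<^sub>2\<close>-degree \<open>\<delta>\<close> (\<^const>\<open>True\<close> for odd) and quantum
  degree \<open>k\<close>.\<close>

definition hom_map :: "('b, 'x) factorization \<Rightarrow> ('c, 'y) factorization \<Rightarrow> bool \<Rightarrow> int \<Rightarrow>
    (('b \<Rightarrow> 'x mpol) \<Rightarrow> ('c \<Rightarrow> 'y mpol)) \<Rightarrow> bool" where
  "hom_map M M' \<delta> k F \<longleftrightarrow>
     (\<forall>u\<in>elems M. F u \<in> elems M') \<and>
     (\<forall>u\<in>elems M. \<forall>v\<in>elems M. F (\<lambda>b. u b + v b) = (\<lambda>b. F u b + F v b)) \<and>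
     (\<forall>c. \<forall>u\<in>elems M. F (\<lambda>b. Cst c * u b) = (\<lambda>b. Cst c * F u b)) \<and>
     (\<forall>\<epsilon> j. \<forall>u\<in>component M \<epsilon> j. F u \<in> component M' (\<epsilon> \<noteq> \<delta>) (j + k))"

definition mf_morphism :: "('b, 'x) factorization \<Rightarrow> ('c, 'y) factorization \<Rightarrow>
    (('b \<Rightarrow> 'x mpol) \<Rightarrow> ('c \<Rightarrow> 'y mpol)) \<Rightarrow> bool" where
  "mf_morphism M M' F \<longleftrightarrow> hom_map M M' False 0 F \<and>
     (\<forall>u\<in>elems M. F (diffl M u) = diffl M' (F u))"

text \<open>Since \<open>d\<close> has quantum degree \<open>N + 1\<close>, a homotopy between maps of degree 0 has quantum degree
  \<open>-(N + 1)\<close>.\<close>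

definition mf_homotopic :: "nat \<Rightarrow> ('b, 'x) factorization \<Rightarrow> ('c, 'y) factorization \<Rightarrow>
    (('b \<Rightarrow> 'x mpol) \<Rightarrow> ('c \<Rightarrow> 'y mpol)) \<Rightarrow> (('b \<Rightarrow> 'x mpol) \<Rightarrow> ('c \<Rightarrow> 'y mpol)) \<Rightarrow> bool" where
  "mf_homotopic N M M' F G \<longleftrightarrow> (\<exists>h. hom_map M M' True (- (int N + 1)) h \<and>
     (\<forall>u\<in>elems M. (\<lambda>b. F u b - G u b) = (\<lambda>b. diffl M' (h u) b + h (diffl M u) b)))"

definition mf_homotopy_equivalent ::
  "nat \<Rightarrow> ('b, 'x) factorization \<Rightarrow> ('c, 'y) factorization \<Rightarrow> bool" where
  "mf_homotopy_equivalent N M M' \<longleftrightarrow> (\<exists>F G. mf_morphism M M' F \<and> mf_morphism M' M G \<and>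
     mf_homotopic N M M (G \<circ> F) id \<and> mf_homotopic N M' M' (F \<circ> G) id)"


section \<open>The matrix factorization of a MOY graph\<close>

text \<open>Only the number \<open>m e\<close> of marked points on each edge \<open>e\<close> matters for what follows. The marked
  points on \<open>e\<close> are denoted \<open>(e, 0), \<dots>, (e, m e - 1)\<close> in the order of the orientation of \<open>e\<close>, for a
  circle starting anywhere.\<close>

definition marking :: "'e plane_graph \<Rightarrow> ('e \<Rightarrow> nat) \<Rightarrow> bool" where
  "marking G m \<longleftrightarrow> (\<forall>e\<in>edges G. 2 \<le> m e)"

text \<open>A piece is encoded by its incoming and its outgoing end points.\<close>

definition pieces :: "'e plane_graph \<Rightarrow> ('e \<Rightarrow> nat) \<Rightarrow> (('e \<times> nat) set \<times> ('e \<times> nat) set) set" where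
  "pieces G m =
     {({(e, i)}, {(e, Suc i)}) | e i. e \<in> edges G \<and> Suc i < m e} \<union>
     {({(e, m e - 1)}, {(e, 0)}) | e. e \<in> edges G \<and> is_circle G e} \<union>
     {((\<lambda>e. (e, m e - 1)) ` in_edges G v, (\<lambda>e. (e, 0)) ` out_edges G v) | v. v \<in> verts G}"

definition alphabet :: "'e plane_graph \<Rightarrow> 'e \<times> nat \<Rightarrow> ('e \<times> nat \<times> nat) set" where
  "alphabet G = (\<lambda>(e, i). {(e, i, k) | k. k < color G e})"

text \<open>The degree of \<open>U\<^sub>j\<close> is \<open>2N + 2 - 2j\<close>; \<open>U\<^sub>j = 0\<close> whenever \<open>j > N + 1\<close>.\<close>

definition piece_factorization ::
  "nat \<Rightarrow> 'e plane_graph \<Rightarrow> ('e \<times> nat) set \<times> ('e \<times> nat) set \<Rightarrow>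
     (bool list, 'e \<times> nat \<times> nat) factorization" where
  "piece_factorization N G = (\<lambda>(ins, outs).
     let X = (\<Union>s\<in>outs. alphabet G s); Y = (\<Union>t\<in>ins. alphabet G t) in
     qshift (- int (\<Sum>B | B \<subseteq> outs \<and> card B = 2. \<Prod>s\<in>B. card (alphabet G s)))
       (koszul N (alphabet G ` (outs \<union> ins))
          (map (\<lambda>j. (U_quot N X Y j, 2 * int N + 2 - 2 * int j, esym j X - esym j Y))
             [1..<Suc (card X)])))"

text \<open>The argument \<open>ps\<close> lists the pieces of \<open>G\<close> for a choice of marked points.\<close>

definition C_N ::
  "nat \<Rightarrow> 'e plane_graph \<Rightarrow> (('e \<times> nat) set \<times> ('e \<times> nat) set) list \<Rightarrow>
     (bool list list, 'e \<times> nat \<times> nat) factorization" where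
  "C_N N G ps = foldr tensor (map (piece_factorization N G) ps) (unit_factorization {})"

end

(* C_N(G) is a Koszul factorization over a weighted polynomial ring. Its homotopy type is unchanged by
   row operations, by eliminating a variable that is a second entry, and, over a regular sequence, depends
   only on the potential. Along the circuit we insert loops of color N - k beside each edge of color k,
   merge them into edges of color N, exchange the ends of these cyclically, and remove the original edges
   of color k; what is left is the Koszul factorization of the reversed circuit. *)
theory Submission
 imports Defs "HOL-Library.Function_Algebras"
begin

section \<open>Polynomials\<close>

text \<open>The number N is singled out by degrees. Row j of a block has entries of degrees 2N + 2 -
  2j and 2j, so its first entry is as heavy as a variable of index k = N + 1 - j, and the mixed
  second derivative of the power sum of exponent N + 1 in the elementary symmetric polynomials of
  such indices j and k is a nonzero constant (\<open>psum_hessian\<close>). Once the two entries of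
  a row are interchanged, first entries thus become second entries that are triangular in variables.
  This removes loops (\<open>pkeq_loop\<close>) and exchanges ends of edges of color N
  (\<open>swap_universal\<close>), where the quantum shifts of the N rows cancel. The shifts of the
  loops account exactly for the changed shifts at splitting vertices. Two obstacles shape the rest.
  Eliminating a variable changes the base ring, so homotopies are linear over the complex numbers
  only; they are built degree by degree and glued. First entries are unwieldy, so they are hardly
  ever computed: equivalences are derived in universal rings, where the second entries are regular
  and the potential decides, and are then specialized.\<close>

abbreviation "keys \<equiv> Poly_Mapping.keys"

abbreviation lkp :: "('a \<Rightarrow>\<^sub>0 'b::zero) => 'a => 'b" where "lkp \<equiv> Poly_Mapping.lookup"

lemma mpol_expand: "f = (\<Sum>t\<in>keys f. Poly_Mapping.single t (lkp f t))"
 by (rule poly_mapping_eqI)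
  (simp add: lookup_sum lookup_single when_def in_keys_iff sum.delta' cong: if_cong)

lemma mpol_single_induct [case_names single add]:
 assumes "!!t c. P (Poly_Mapping.single t c)" "!!f g. P f ==> P g ==> P (f + g)"
 shows "P (f :: 'a \<Rightarrow>\<^sub>0 'b::comm_monoid_add)"
proof -
 have "P (\<Sum>t\<in>A. Poly_Mapping.single t (lkp f t))" if "finite A" for A
  using that
 proof (induction A rule: finite_induct)
  case empty
  then show ?case using assms(1)[of undefined 0] by simp
 qed (simp add: assms)
 from this[of "keys f"] show ?thesis
  using mpol_expand[of f] by simp
qed

lemma Cst_add: "Cst (a + b) = Cst a + Cst b"
 by (simp add: Cst_def single_add)
lemma Cst_mult: "Cst (a * b) = Cst a * Cst b"
 by (simp add: Cst_def mult_single)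
lemma Cst_0 [simp]: "Cst 0 = 0" and Cst_1 [simp]: "Cst 1 = 1"
 by (simp_all add: Cst_def)
lemma Cst_minus: "Cst (- a) = - Cst a"
 by (simp add: Cst_def single_uminus)
lemma Cst_of_nat: "Cst (of_nat n) = of_nat n"
 by (simp add: Cst_def)

lemma lookup_Cst_mult: "lkp (Cst c * f) t = c * lkp f t"
proof (induction f rule: mpol_single_induct)
 case (single s a)
 then show ?case by (simp add: Cst_def mult_single lookup_single when_def)
qed (simp add: distrib_left lookup_add)

lemma lookup_Cst: "lkp (Cst c) t = (if t = 0 then c else 0)"
 by (auto simp: Cst_def lookup_single when_def)

lemma lookup_Var: "lkp (Var x) t = (if t = Poly_Mapping.single x 1 then 1 else 0)"
 by (auto simp: Var_def lookup_single when_def)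

text \<open>The inner product of \<open>subst\<close>, isolated because it turns addition of
  exponents into multiplication.\<close>

definition mprod :: "('x => 'r::comm_monoid_mult) => ('x \<Rightarrow>\<^sub>0 nat) => 'r" where
 "mprod s t = (\<Prod>x\<in>keys t. s x ^ lkp t x)"

lemma mprod_superset:
 "finite A ==> keys t <= A ==> mprod s t = (\<Prod>x\<in>A. s x ^ lkp t x)"
 unfolding mprod_def by (rule prod.mono_neutral_left) (auto simp: in_keys_iff)

lemma mprod_add: "mprod s (t + u) = mprod s t * mprod s u"
proof -
 let ?A = "keys t \<union> keys u"
 have "keys (t + u) <= ?A" by (rule keys_add)
 then have "mprod s (t + u) = (\<Prod>x\<in>?A. s x ^ lkp (t + u) x)" by (intro mprod_superset) auto
 also have "\<dots> = (\<Prod>x\<in>?A. s x ^ lkp t x) * (\<Prod>x\<in>?A. s x ^ lkp u x)"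
  by (simp add: lookup_add power_add prod.distrib)
 also have "\<dots> = mprod s t * mprod s u" by (simp add: mprod_superset[of ?A])
 finally show ?thesis .
qed

lemma mprod_0 [simp]: "mprod s 0 = 1" by (simp add: mprod_def)
lemma mprod_single [simp]: "mprod s (Poly_Mapping.single x n) = s x ^ n"
 by (cases "n = 0") (simp_all add: mprod_def)

lemma mprod_cong: "(!!x. x \<in> keys t ==> s x = s' x) ==> mprod s t = mprod s' t"
 by (simp add: mprod_def)

lemma subst_superset:
 assumes "finite A" "keys f <= A"
 shows "subst s f = (\<Sum>t\<in>A. Cst (lkp f t) * mprod s t)"
 unfolding subst_def mprod_def[symmetric] using assms
 by (intro sum.mono_neutral_left) (auto simp: in_keys_iff)

lemma subst_add: "subst s (f + g) = subst s f + subst s g"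
proof -
 let ?A = "keys f \<union> keys g"
 have "keys (f + g) <= ?A" by (rule keys_add)
 then show ?thesis
  by (simp add: subst_superset[of ?A] lookup_add Cst_add distrib_right sum.distrib)
qed

lemma subst_single: "subst s (Poly_Mapping.single t c) = Cst c * mprod s t"
 by (subst subst_superset[of "{t}"]) auto

lemma subst_0 [simp]: "subst s 0 = 0" by (simp add: subst_def)

lemma subst_mult: "subst s (f * g) = subst s f * subst s g"
proof (induction f rule: mpol_single_induct)
 case (single t c)
 show ?case
 proof (induction g rule: mpol_single_induct)
  case (single u d)
  show ?case by (simp add: mult_single subst_single Cst_mult mprod_add mult_ac)
 qed (simp add: distrib_left subst_add)
qed (simp add: distrib_right subst_add)

lemma subst_Cst [simp]: "subst s (Cst c) = Cst c"
 using subst_single[of s 0 c] by (simp flip: Cst_def)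
lemma subst_Var [simp]: "subst s (Var x) = s x"
 by (simp add: Var_def subst_single)
lemma subst_1 [simp]: "subst s 1 = 1"
 using subst_Cst[of s 1] by simp
lemma subst_uminus: "subst s (- f) = - subst s f"
 using subst_add[of s f "- f"] by (simp add: eq_neg_iff_add_eq_0 add.commute)
lemma subst_diff: "subst s (f - g) = subst s f - subst s g"
 using subst_add[of s f "- g"] by (simp add: subst_uminus)
lemma subst_power: "subst s (f ^ n) = subst s f ^ n"
 by (induction n) (auto simp: subst_mult)
lemma subst_sum: "subst s (sum f A) = (\<Sum>a\<in>A. subst s (f a))"
 by (induction A rule: infinite_finite_induct) (auto simp: subst_add)
lemma subst_prod: "subst s (prod f A) = (\<Prod>a\<in>A. subst s (f a))"
 by (induction A rule: infinite_finite_induct) (auto simp: subst_mult)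

lemmas subst_simps = subst_add subst_mult subst_uminus subst_diff subst_power subst_sum subst_prod

lemma subst_of_nat [simp]: "subst s (of_nat n) = of_nat n"
 using subst_Cst[of s "of_nat n"] by (simp add: Cst_of_nat)

lemma subst_mprod: "subst s (mprod r t) = mprod (%x. subst s (r x)) t"
 by (simp add: mprod_def subst_simps)

lemma subst_subst: "subst s (subst r f) = subst (%x. subst s (r x)) f"
 by (induction f rule: mpol_single_induct)
  (auto simp: subst_single subst_simps subst_mprod)

lemma subst_cong:
 assumes "!!x. x \<in> pvars f ==> s x = r x"
 shows "subst s f = subst r f"
proof -
 have "mprod s t = mprod r t" if "t \<in> keys f" for t
  using that assms by (intro mprod_cong) (auto simp: pvars_def)
 then show ?thesis unfolding subst_def mprod_def[symmetric] by simp
qed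

lemma mprod_Var: "mprod Var t = Poly_Mapping.single t 1"
proof (induction t rule: mpol_single_induct)
 case (single x n)
 have "Var x ^ n = Poly_Mapping.single (Poly_Mapping.single x n) 1" for x :: 'a and n
  by (induction n) (auto simp: Var_def mult_single simp flip: single_add)
 then show ?case by simp
qed (simp add: mprod_add mult_single)

lemma subst_id: "subst Var f = f"
 by (induction f rule: mpol_single_induct)
  (auto simp: subst_single subst_simps mprod_Var Cst_def mult_single)

lemma subst_ident: "(!!x. x \<in> pvars f ==> s x = Var x) ==> subst s f = f"
 using subst_cong[of f s Var] by (simp add: subst_id)

lemma pvars_add: "pvars (f + g) <= pvars f \<union> pvars g"
 using keys_add[of f g] by (auto simp: pvars_def)
lemma pvars_uminus [simp]: "pvars (- f) = pvars f"
 by (simp add: pvars_def in_keys_iff set_eq_iff)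
lemma pvars_diff: "pvars (f - g) <= pvars f \<union> pvars g"
 using pvars_add[of f "- g"] by simp
lemma pvars_mult: "pvars (f * g) <= pvars f \<union> pvars g"
proof
 fix x assume "x \<in> pvars (f * g)"
 then obtain t where t: "t \<in> keys (f * g)" "x \<in> keys t"
  by (auto simp: pvars_def)
 then obtain a b where ab: "t = a + b" "a \<in> keys f" "b \<in> keys g"
  using keys_mult[of f g] by auto
 then have "x \<in> keys a \<union> keys b"
  using t(2) keys_add[of a b] by auto
 then show "x \<in> pvars f \<union> pvars g" using ab by (auto simp: pvars_def)
qed
lemma pvars_Cst [simp]: "pvars (Cst c) = {}"
 by (auto simp: pvars_def Cst_def split: if_splits)
lemma pvars_Var [simp]: "pvars (Var x) = {x}"
 by (auto simp: pvars_def Var_def)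
lemma pvars_0 [simp]: "pvars 0 = {}" and pvars_1 [simp]: "pvars 1 = {}"
 using pvars_Cst[of 0] pvars_Cst[of 1] by simp_all
lemma pvars_sum: "pvars (sum f A) <= (\<Union>a\<in>A. pvars (f a))"
proof (induction A rule: infinite_finite_induct)
 case (insert x F)
 then show ?case using pvars_add[of "f x" "sum f F"] by auto
qed auto
lemma pvars_prod: "pvars (prod f A) <= (\<Union>a\<in>A. pvars (f a))"
proof (induction A rule: infinite_finite_induct)
 case (insert x F)
 then show ?case using pvars_mult[of "f x" "prod f F"] by auto
qed auto
lemma pvars_power: "pvars (f ^ n) <= pvars f"
proof (induction n)
 case (Suc n)
 then show ?case using pvars_mult[of f "f ^ n"] by auto
qed simp
lemma finite_pvars [simp]: "finite (pvars f)"
 by (auto simp: pvars_def)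

lemma pvars_subst: "pvars (subst s f) <= (\<Union>x\<in>pvars f. pvars (s x))"
proof -
 have "pvars (Cst (lkp f t) * mprod s t) <= (\<Union>x\<in>pvars f. pvars (s x))"
  if "t \<in> keys f" for t
 proof -
  have "pvars (mprod s t) <= (\<Union>x\<in>keys t. pvars (s x ^ lkp t x))"
   unfolding mprod_def by (rule pvars_prod)
  also have "\<dots> <= (\<Union>x\<in>keys t. pvars (s x))"
   by (intro UN_mono pvars_power) auto
  also have "\<dots> <= (\<Union>x\<in>pvars f. pvars (s x))"
   using that by (intro UN_mono) (auto simp: pvars_def)
  finally show ?thesis using pvars_mult[of "Cst (lkp f t)" "mprod s t"] by auto
 qed
 then have "(\<Union>t\<in>keys f. pvars (Cst (lkp f t) * mprod s t)) <= (\<Union>x\<in>pvars f. pvars (s x))"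
  by (rule UN_least)
 then show ?thesis unfolding subst_def mprod_def[symmetric]
  by (rule order_trans[OF pvars_sum])
qed

subsection \<open>Weighted homogeneous polynomials\<close>

definition wdeg :: "('x => int) => ('x \<Rightarrow>\<^sub>0 nat) => int" where
 "wdeg w t = (\<Sum>x\<in>keys t. w x * int (lkp t x))"

lemma wdeg_superset:
 "finite A ==> keys t <= A ==> wdeg w t = (\<Sum>x\<in>A. w x * int (lkp t x))"
 unfolding wdeg_def by (rule sum.mono_neutral_left) (auto simp: in_keys_iff)

lemma wdeg_add: "wdeg w (t + u) = wdeg w t + wdeg w u"
proof -
 let ?A = "keys t \<union> keys u"
 have "keys (t + u) <= ?A" by (rule keys_add)
 then show ?thesis
  by (simp add: wdeg_superset[of ?A] lookup_add distrib_left sum.distrib)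
qed
lemma wdeg_0 [simp]: "wdeg w 0 = 0" by (simp add: wdeg_def)
lemma wdeg_single [simp]: "wdeg w (Poly_Mapping.single x n) = w x * int n"
 by (cases "n = 0") (simp_all add: wdeg_def)

text \<open>Weights are arbitrary because two gradings occur: letters of an alphabet all have weight
  2, whereas a variable standing for the elementary symmetric polynomial of index j has weight 2j.
  The variable set is part of the notion, so that membership also tells over which ring a
  coefficient lives. Zero has every degree.\<close>

definition hmg :: "('x => int) => 'x set => int => 'x mpol set" where
 "hmg w V d = {f. pvars f <= V & (\<forall>t\<in>keys f. wdeg w t = d)}"

lemma hmgI: "pvars f <= V ==> (!!t. t \<in> keys f ==> wdeg w t = d) ==> f \<in> hmg w V d"
 by (simp add: hmg_def)
lemma hmg_pvars: "f \<in> hmg w V d ==> pvars f <= V"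
 by (simp add: hmg_def)
lemma hmg_wdeg: "f \<in> hmg w V d ==> t \<in> keys f ==> wdeg w t = d"
 by (simp add: hmg_def)
lemma hmg_mono: "f \<in> hmg w V d ==> V <= V' ==> f \<in> hmg w V' d"
 by (auto simp: hmg_def)
lemma hmg_0 [simp]: "0 \<in> hmg w V d" by (simp add: hmg_def)
lemma hmg_add: "f \<in> hmg w V d ==> g \<in> hmg w V d ==> f + g \<in> hmg w V d"
 using pvars_add[of f g] keys_add[of f g] unfolding hmg_def mem_Collect_eq by (meson UnE Un_least order_trans subsetD)
lemma hmg_uminus [simp]: "- f \<in> hmg w V d \<longleftrightarrow> f \<in> hmg w V d"
 by (simp add: hmg_def in_keys_iff)
lemma hmg_diff: "f \<in> hmg w V d ==> g \<in> hmg w V d ==> f - g \<in> hmg w V d"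
 using hmg_add[of f w V d "- g"] by simp
lemma hmg_mult:
 assumes "f \<in> hmg w V d" "g \<in> hmg w V e"
 shows "f * g \<in> hmg w V (d + e)"
proof (rule hmgI)
 show "pvars (f * g) <= V" using pvars_mult[of f g] assms by (auto simp: hmg_def)
 fix t assume "t \<in> keys (f * g)"
 then obtain a b where "t = a + b" "a \<in> keys f" "b \<in> keys g"
  using keys_mult[of f g] by auto
 then show "wdeg w t = d + e" using assms by (simp add: hmg_def wdeg_add)
qed
lemma hmg_mult': "f \<in> hmg w V d ==> g \<in> hmg w V e ==> d + e = k ==> f * g \<in> hmg w V k"
 using hmg_mult by blast
lemma hmg_Cst [simp]: "Cst c \<in> hmg w V 0"
 by (auto simp: hmg_def in_keys_iff lookup_Cst split: if_splits)
lemma hmg_Cst_mult: "f \<in> hmg w V d ==> Cst c * f \<in> hmg w V d"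
 using hmg_mult[of "Cst c" w V 0 f d] by simp
lemma hmg_1 [simp]: "1 \<in> hmg w V 0"
 using hmg_Cst[of 1] by simp
lemma hmg_Var: "x \<in> V ==> Var x \<in> hmg w V (w x)"
 by (auto simp: hmg_def in_keys_iff lookup_Var split: if_splits)
lemma hmg_sum: "(!!a. a \<in> A ==> f a \<in> hmg w V d) ==> sum f A \<in> hmg w V d"
 by (induction A rule: infinite_finite_induct) (auto intro: hmg_add)
lemma hmg_prod: "(!!a. a \<in> A ==> f a \<in> hmg w V (d a)) ==> prod f A \<in> hmg w V (sum d A)"
 by (induction A rule: infinite_finite_induct) (auto intro: hmg_mult)
lemma hmg_power: "f \<in> hmg w V d ==> f ^ n \<in> hmg w V (d * int n)"
 by (induction n) (auto intro!: hmg_mult' simp: algebra_simps)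

lemma hmg_single_part:
 assumes "f \<in> hmg w V d" "t \<in> keys f"
 shows "keys t <= V" "wdeg w t = d"
 using assms by (auto simp: hmg_def pvars_def)

lemma hmg_mprod:
 assumes "!!x. x \<in> keys t ==> s x \<in> hmg w' V' (w x)"
 shows "mprod s t \<in> hmg w' V' (wdeg w t)"
 unfolding mprod_def wdeg_def using assms by (intro hmg_prod hmg_power)

lemma hmg_subst:
 assumes "f \<in> hmg w V d" "!!x. x \<in> V ==> s x \<in> hmg w' V' (w x)"
 shows "subst s f \<in> hmg w' V' d"
 unfolding subst_def mprod_def[symmetric]
proof (rule hmg_sum, rule hmg_Cst_mult)
 fix t assume "t \<in> keys f"
 then show "mprod s t \<in> hmg w' V' d"
  using hmg_single_part[OF assms(1)] hmg_mprod[of t s w' V' w] assms(2) by blast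
qed

lemma hmg_neg:
 assumes "f \<in> hmg w V d" "d < 0" "!!x. x \<in> V ==> 0 <= w x"
 shows "f = 0"
proof (rule ccontr)
 assume "f ~= 0"
 then obtain t where t: "t \<in> keys f" by (metis keys_eq_empty equals0I)
 have "0 <= wdeg w t" unfolding wdeg_def
  using hmg_single_part[OF assms(1) t] assms(3) by (intro sum_nonneg) auto
 then show False using hmg_single_part[OF assms(1) t] assms(2) by simp
qed

lemma hmg_const:
 assumes "f \<in> hmg w V 0" "!!x. x \<in> V ==> 0 < w x"
 shows "f = Cst (lkp f 0)"
proof (rule poly_mapping_eqI)
 fix t
 show "lkp f t = lkp (Cst (lkp f 0)) t"
 proof (cases "t = 0 \<or> t \<notin> keys f")
  case False
  then obtain x where x: "x \<in> keys t" by (metis keys_eq_empty equals0I)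
  have t: "keys t <= V" "wdeg w t = 0"
   using hmg_single_part[OF assms(1)] False by auto
  have pos: "0 < w i" if "i \<in> keys t" for i using that t(1) assms(2) by auto
  have "0 < wdeg w t" unfolding wdeg_def
   using x pos by (intro sum_pos) (auto simp: in_keys_iff intro!: mult_pos_pos)
  then show ?thesis using t by simp
 qed (auto simp: lookup_Cst in_keys_iff)
qed

text \<open>All weights are positive, so a monomial of weight \<open>w v\<close> that contains
  \<open>v\<close> leaves no room for any other factor and is \<open>v\<close> itself.\<close>

lemma hmg_linear_part:
 assumes f: "f \<in> hmg w V (w v)" and w: "!!x. x \<in> V ==> 0 < w x" and v: "v \<in> V"
 obtains c g where "f = Cst c * Var v + g" "g \<in> hmg w (V - {v}) (w v)"
proof -
 define c where "c = lkp f (Poly_Mapping.single v 1)"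
 define g where "g = f - Cst c * Var v"
 have g: "g \<in> hmg w V (w v)" unfolding g_def
  using f v by (intro hmg_diff hmg_Cst_mult hmg_Var)
 have "v \<notin> keys t" if t: "t \<in> keys g" for t
 proof
  assume v': "v \<in> keys t"
  note t' = hmg_single_part[OF g t]
  have "wdeg w t = w v * int (lkp t v) + (\<Sum>x\<in>keys t - {v}. w x * int (lkp t x))"
   unfolding wdeg_def using v' by (subst sum.remove[of _ v]) auto
  moreover have "w v * int (lkp t v) \<ge> w v * 1"
   using v' w[OF v] by (intro mult_left_mono) (auto simp: in_keys_iff)
  moreover have nn: "\<forall>x\<in>keys t - {v}. 0 < w x * int (lkp t x)"
   using t' w by (auto simp: in_keys_iff)
  moreover from nn have "0 <= (\<Sum>x\<in>keys t - {v}. w x * int (lkp t x))"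
   by (intro sum_nonneg) force
  ultimately have 1: "w v * int (lkp t v) = w v"
   "(\<Sum>x\<in>keys t - {v}. w x * int (lkp t x)) = 0"
   using t' by linarith+
  have "keys t - {v} = {}"
   using 1(2) nn sum_pos[of "keys t - {v}" "%x. w x * int (lkp t x)"] by force
  moreover have "lkp t v = 1" using 1(1) w[OF v] by simp
  ultimately have "t = Poly_Mapping.single v 1"
   by (intro poly_mapping_eqI) (metis Diff_eq_empty_iff empty_iff in_keys_iff insert_iff
     lookup_single_eq lookup_single_not_eq subset_iff)
  then show False using t by (simp add: g_def in_keys_iff lookup_minus lookup_Cst_mult c_def lookup_Var)
 qed
 then have "g \<in> hmg w (V - {v}) (w v)"
  using g by (auto simp: hmg_def pvars_def)
 then show thesis using that[of c g] by (simp add: g_def)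
qed

lemma factor_power:
 assumes "a \<in> hmg w V d" "b \<in> hmg w V d"
 shows "\<exists>q \<in> hmg w V (d * int n - d). a ^ n - b ^ n = (a - b) * (q :: 'x mpol)"
proof (induction n)
 case 0
 show ?case by (intro bexI[of _ 0]) auto
next
 case (Suc n)
 then obtain q where q: "q \<in> hmg w V (d * int n - d)" "a ^ n - b ^ n = (a - b) * q" by blast
 have "a ^ Suc n - b ^ Suc n = a * (a ^ n - b ^ n) + (a - b) * b ^ n"
  by (simp add: algebra_simps)
 also have "\<dots> = (a - b) * (a * q + b ^ n)" by (simp add: q algebra_simps)
 finally have "a ^ Suc n - b ^ Suc n = (a - b) * (a * q + b ^ n)" .
 moreover have "a * q + b ^ n \<in> hmg w V (d * int (Suc n) - d)"
  using q assms by (intro hmg_add hmg_mult'[of a w V d q]) (auto simp: algebra_simps intro!: hmg_power)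
 ultimately show ?case by blast
qed

text \<open>Monomial by monomial: the power of \<open>v\<close> is split off and
  \<open>factor_power\<close> is applied to it. The weight of the quotient is recorded because such
  quotients become coefficients of homogeneous row operations.\<close>

lemma factor_theorem:
 assumes f: "f \<in> hmg w V d" and g: "g \<in> hmg w V (w v)" and v: "v \<in> V"
 shows "\<exists>q \<in> hmg w V (d - w v). f - subst (Var(v := g)) f = (Var v - g) * q"
proof -
 let ?s = "Var(v := g)"
 have "\<exists>q \<in> hmg w V (d - w v).
   Cst (lkp f t) * (mprod Var t - mprod ?s t) = (Var v - g) * q" if t: "t \<in> keys f" for t
 proof -
  note t' = hmg_single_part[OF f t]
  let ?K = "keys t"
  define r where "r = mprod Var (t - Poly_Mapping.single v (lkp t v))"
  define n where "n = lkp t v"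
  have split: "t = Poly_Mapping.single v n + (t - Poly_Mapping.single v n)"
   by (intro poly_mapping_eqI) (auto simp: lookup_add lookup_minus lookup_single when_def n_def)
  have nv: "v \<notin> keys (t - Poly_Mapping.single v n)"
   by (simp add: in_keys_iff lookup_minus n_def)
  have sub: "keys (t - Poly_Mapping.single v n) <= ?K"
   by (auto simp: in_keys_iff lookup_minus)
  have 1: "mprod Var t = Var v ^ n * r" "mprod ?s t = g ^ n * r"
  proof -
   show "mprod Var t = Var v ^ n * r"
    by (subst split, subst mprod_add) (simp add: r_def n_def)
   have "mprod ?s (t - Poly_Mapping.single v n) = r" unfolding r_def n_def[symmetric]
    using nv by (intro mprod_cong) auto
   then show "mprod ?s t = g ^ n * r"
    by (subst split, subst mprod_add) simp
  qed
  have r: "r \<in> hmg w V (d - w v * int n)"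
  proof -
   have "mprod Var (t - Poly_Mapping.single v n) \<in> hmg w V (wdeg w (t - Poly_Mapping.single v n))"
    using sub t' by (intro hmg_mprod hmg_Var) auto
   moreover have "wdeg w t = w v * int n + wdeg w (t - Poly_Mapping.single v n)"
    by (subst split, subst wdeg_add) simp
   ultimately show ?thesis using t' by (simp add: r_def n_def)
  qed
  obtain q where q: "q \<in> hmg w V (w v * int n - w v)" "Var v ^ n - g ^ n = (Var v - g) * q"
   using factor_power[OF hmg_Var[OF v] g] by blast
  have "Cst (lkp f t) * (mprod Var t - mprod ?s t) = (Var v - g) * (Cst (lkp f t) * (q * r))"
   unfolding 1 left_diff_distrib[symmetric] q(2) by (simp add: mult_ac)
  moreover have "Cst (lkp f t) * (q * r) \<in> hmg w V (d - w v)"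
   using q(1) r by (intro hmg_Cst_mult hmg_mult') auto
  ultimately show ?thesis by blast
 qed
 then obtain q where q: "!!t. t \<in> keys f ==> q t \<in> hmg w V (d - w v)"
  "!!t. t \<in> keys f ==> Cst (lkp f t) * (mprod Var t - mprod ?s t) = (Var v - g) * q t"
  by metis
 have "f - subst ?s f = subst Var f - subst ?s f" by (simp add: subst_id)
 also have "\<dots> = (\<Sum>t\<in>keys f. Cst (lkp f t) * (mprod Var t - mprod ?s t))"
  unfolding subst_def mprod_def[symmetric] sum_subtractf[symmetric] right_diff_distrib ..
 also have "\<dots> = (\<Sum>t\<in>keys f. (Var v - g) * q t)"
  by (rule sum.cong[OF refl q(2)])
 also have "\<dots> = (Var v - g) * (\<Sum>t\<in>keys f. q t)"
  by (rule sum_distrib_left[symmetric])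
 finally show ?thesis by (rule bexI) (rule hmg_sum, rule q(1))
qed

lemma hmg_subst_fresh:
 assumes "f \<in> hmg w (insert v V) d" "g \<in> hmg w V (w v)"
 shows "subst (Var(v := g)) f \<in> hmg w V d"
proof (rule hmg_subst[OF assms(1)])
 fix x assume "x \<in> insert v V"
 then show "(Var(v := g)) x \<in> hmg w V (w x)"
  using assms(2) by (cases "x = v") (auto intro: hmg_Var)
qed

text \<open>Iterates \<open>factor_theorem\<close> with value 0, one variable at a time: modulo its
  restriction to the common zero locus a polynomial lies in the ideal of the variables, with
  homogeneous coefficients.\<close>

lemma zero_locus_ideal:
 assumes "distinct vs" "set vs <= V" "f \<in> hmg w V d"
 shows "\<exists>q. (\<forall>v\<in>set vs. q v \<in> hmg w V (d - w v)) &
   f - subst (%x. if x \<in> set vs then 0 else Var x) f = (\<Sum>v\<in>set vs. Var v * q v)"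
 using assms
proof (induction vs arbitrary: f)
 case Nil
 then show ?case by (simp add: subst_id)
next
 case (Cons v vs)
 obtain q0 where q0: "q0 \<in> hmg w V (d - w v)" "f - subst (Var(v := 0)) f = Var v * q0"
  using factor_theorem[of f w V d 0 v] Cons.prems by auto
 let ?f = "subst (Var(v := 0)) f"
 have "?f \<in> hmg w V d"
 proof (rule hmg_subst[OF Cons.prems(3)])
  fix x assume "x \<in> V"
  then show "(Var(v := 0)) x \<in> hmg w V (w x)" by (cases "x = v") (auto intro: hmg_Var)
 qed
 moreover have "distinct vs" "set vs <= V" using Cons.prems by auto
 ultimately obtain q where q: "\<forall>v\<in>set vs. q v \<in> hmg w V (d - w v)"
  "?f - subst (%x. if x \<in> set vs then 0 else Var x) ?f = (\<Sum>v\<in>set vs. Var v * q v)"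
  using Cons.IH[of ?f] by blast
 have "subst (%x. if x \<in> set vs then 0 else Var x) ?f =
   subst (%x. if x \<in> set (v # vs) then 0 else Var x) f"
  unfolding subst_subst using Cons.prems(1)
  by (intro arg_cong[where f = "%s. subst s f"]) (auto simp: fun_eq_iff)
 moreover have "(\<Sum>x\<in>set (v # vs). Var x * (q(v := q0)) x) = Var v * q0 + (\<Sum>v\<in>set vs. Var v * q v)"
  using Cons.prems(1) by (auto intro!: sum.cong)
 ultimately have "f - subst (%x. if x \<in> set (v # vs) then 0 else Var x) f =
   (\<Sum>x\<in>set (v # vs). Var x * (q(v := q0)) x)"
  using q(2) q0(2) by (simp add: algebra_simps)
 moreover have "\<forall>x\<in>set (v # vs). (q(v := q0)) x \<in> hmg w V (d - w x)"
  using q q0 by auto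
 ultimately show ?case by blast
qed

section \<open>Homotopy equivalence of graded complexes\<close>

lemma group_shuffle:
 fixes a :: "'g::ab_group_add"
 shows "a - b = c + e ==> a - x = c + e + (b - x)" "c + e + (p + q) = (p + c) + (q + e)"
  "a - (b + c) = (a - b) - c" "a - (b - c) = (a - b) + c"
 by (simp_all add: algebra_simps)

definition scl :: "complex => ('b => 'x mpol) => 'b => 'x mpol" where
 "scl c u = (%b. Cst c * u b)"

lemma vector_space_scl: "vector_space scl"
 by standard (auto simp: scl_def fun_eq_iff distrib_left Cst_add Cst_mult distrib_right mult_ac)

text \<open>Linearity relative to a subset: maps are controlled on graded pieces, while as functions
  they are total.\<close>

definition lin :: "('b => 'x mpol) set => (('b => 'x mpol) => 'c => 'y mpol) => bool" where
 "lin S F \<longleftrightarrow> (\<forall>u\<in>S. \<forall>v\<in>S. F (u + v) = F u + F v) & (\<forall>c. \<forall>u\<in>S. F (scl c u) = scl c (F u))"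

definition sub :: "('b => 'x mpol) set => bool" where
 "sub S \<longleftrightarrow> 0 \<in> S & (\<forall>u\<in>S. \<forall>v\<in>S. u + v \<in> S) & (\<forall>c. \<forall>u\<in>S. scl c u \<in> S)"

lemma scl_zero [simp]: "scl c 0 = 0" and scl_0 [simp]: "scl 0 u = 0" and scl_1 [simp]: "scl 1 u = u"
 by (auto simp: scl_def fun_eq_iff)
lemma scl_m1: "scl (- 1) u = - u"
 by (auto simp: scl_def fun_eq_iff Cst_minus)
lemma scl_add: "scl c (u + v) = scl c u + scl c v"
 by (auto simp: scl_def fun_eq_iff distrib_left)
lemma scl_diff: "scl c (u - v) = scl c u - scl c v"
 by (auto simp: scl_def fun_eq_iff right_diff_distrib)

lemma subD:
 assumes "sub S"
 shows "0 \<in> S" "u \<in> S ==> v \<in> S ==> u + v \<in> S" "u \<in> S ==> scl c u \<in> S"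
  "u \<in> S ==> v \<in> S ==> u - v \<in> S"
proof -
 show "0 \<in> S" "u \<in> S ==> v \<in> S ==> u + v \<in> S" "u \<in> S ==> scl c u \<in> S" for u v c
  using assms by (auto simp: sub_def)
 from this(2)[of u "- v"] this(3)[of v "- 1"] show "u \<in> S ==> v \<in> S ==> u - v \<in> S"
  by (simp add: scl_m1)
qed

lemma linD:
 assumes "lin S F"
 shows "u \<in> S ==> v \<in> S ==> F (u + v) = F u + F v" "u \<in> S ==> F (scl c u) = scl c (F u)"
 using assms by (auto simp: lin_def)

lemma lin_0: "lin S F ==> 0 \<in> S ==> F 0 = 0"
 using linD(2)[of S F 0 0] by simp
lemma lin_diff: "lin S F ==> sub S ==> u \<in> S ==> v \<in> S ==> F (u - v) = F u - F v"
 using linD(1)[of S F u "scl (-1) v"] linD(2)[of S F v "-1"] subD(3)[of S v "-1"]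
 by (simp add: scl_m1)
lemma lin_subset: "lin S F ==> T <= S ==> lin T F"
 unfolding lin_def by blast
lemma lin_comp: "lin S F ==> lin T G ==> F ` S <= T ==> lin S (%u. G (F u))"
 unfolding lin_def by (simp add: image_subset_iff)
lemma lin_plus: "lin S F ==> lin S G ==> lin S (%u. F u + G u)"
 unfolding lin_def by (simp add: scl_add add_ac)
lemma lin_minus: "lin S F ==> lin S G ==> lin S (%u. F u - G u)"
 unfolding lin_def by (simp add: scl_diff)
lemma lin_ident: "lin S (%u. u)"
 by (simp add: lin_def)
lemma lin_zero: "lin S (%u. 0)"
 by (simp add: lin_def)

text \<open>Linear algebra over the field of complex numbers. The section is in general not linear
  over the polynomial ring, which is why all complexes are compared as complexes of vector
  spaces.\<close>

lemma right_inverse_on: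
 assumes "lin UNIV d" "sub S"
 obtains g where "lin UNIV g" "!!u. g u \<in> S" "!!u. u \<in> d ` S ==> d (g u) = u"
proof -
 interpret V1: vector_space scl by (rule vector_space_scl)
 interpret V2: vector_space scl by (rule vector_space_scl)
 interpret VP: vector_space_pair scl scl ..
 have "Vector_Spaces.linear scl scl d"
  using assms(1) by unfold_locales (auto simp: lin_def)
 moreover have "V1.subspace S"
  using assms(2) by (auto simp: V1.subspace_def sub_def)
 ultimately obtain g where g: "range g <= S" "Vector_Spaces.linear scl scl g" "\<forall>v\<in>d ` S. d (g v) = v"
  using VP.linear_exists_right_inverse_on by metis
 interpret g: Vector_Spaces.linear scl scl g by fact
 show thesis
  using g by (intro that[of g]) (auto simp: lin_def g.add g.scale)
qed

type_synonym ('b, 'x) grading = "bool => int => ('b => 'x mpol) set"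

text \<open>One differential serves all pieces, but it has to square to zero only on them, since
  functions outside the module are not controlled.\<close>

definition cplx :: "int => ('b, 'x) grading => (('b => 'x mpol) => 'b => 'x mpol) => bool" where
 "cplx n C d \<longleftrightarrow> lin UNIV d & (\<forall>ep k. sub (C ep k) & d ` C ep k <= C (~ ep) (k + n) &
   (\<forall>x\<in>C ep k. d (d x) = 0))"

text \<open>A family with one map for each bidegree, because sections and homotopies are chosen
  separately in each bidegree. The passage to a single map on the whole module is made by
  \<open>tot\<close>.\<close>

definition gmap :: "('b, 'x) grading => ('c, 'y) grading =>
  (bool => int => ('b => 'x mpol) => 'c => 'y mpol) => bool" where
 "gmap C C' F \<longleftrightarrow> (\<forall>ep k. lin (C ep k) (F ep k) & F ep k ` C ep k <= C' ep k)"

definition cmap where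
 "cmap n C d C' d' F \<longleftrightarrow> gmap C C' F &
   (\<forall>ep k. \<forall>x\<in>C ep k. F (~ ep) (k + n) (d x) = d' (F ep k x))"

definition hty :: "int => ('b, 'x) grading => (('b => 'x mpol) => 'b => 'x mpol) =>
  (bool => int => ('b => 'x mpol) => 'b => 'x mpol) => bool" where
 "hty n C d P \<longleftrightarrow> (\<exists>h. gmap C (%ep k. C (~ ep) (k - n)) h &
   (\<forall>ep k. \<forall>x\<in>C ep k. P ep k x - x = d (h ep k x) + h (~ ep) (k + n) (d x)))"

definition heq :: "int => ('b, 'x) grading => (('b => 'x mpol) => 'b => 'x mpol) =>
  ('c, 'y) grading => (('c => 'y mpol) => 'c => 'y mpol) => bool" where
 "heq n C d C' d' \<longleftrightarrow> (\<exists>F G. cmap n C d C' d' F & cmap n C' d' C d G &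
   hty n C d (%ep k x. G ep k (F ep k x)) & hty n C' d' (%ep k x. F ep k (G ep k x)))"

text \<open>The shift {q^t}, which moves elements up by \<open>t\<close>, combined with a change of
  parity if \<open>dl\<close> holds.\<close>

definition shf :: "bool => int => ('b, 'x) grading => ('b, 'x) grading" where
 "shf dl t C = (%ep k. C (ep ~= dl) (k - t))"

lemma shf_shf: "shf dl t (shf dl' t' C) = shf (dl ~= dl') (t + t') C"
 by (cases dl; cases dl') (simp_all add: shf_def fun_eq_iff diff_diff_eq)
lemma shf_0 [simp]: "shf False 0 C = C"
 by (simp add: shf_def)

lemma gmapD: "gmap C C' F ==> lin (C ep k) (F ep k)" "gmap C C' F ==> x \<in> C ep k ==> F ep k x \<in> C' ep k"
 unfolding gmap_def by blast+
lemma cmapD: "cmap n C d C' d' F ==> gmap C C' F"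
 "cmap n C d C' d' F ==> x \<in> C ep k ==> F (~ ep) (k + n) (d x) = d' (F ep k x)"
 unfolding cmap_def by blast+
lemma cplxD:
 assumes "cplx n C d"
 shows "lin UNIV d" "sub (C ep k)" "x \<in> C ep k ==> d x \<in> C (~ ep) (k + n)" "x \<in> C ep k ==> d (d x) = 0"
 using assms unfolding cplx_def by blast+

lemma cplx_lower: "cplx n C d ==> x \<in> C (~ ep) (k - n) ==> d x \<in> C ep k"
 using cplxD(3)[of n C d x "~ ep" "k - n"] by simp

lemma cmap_comp:
 assumes "cmap n C d C' d' F" "cmap n C' d' C'' d'' G"
 shows "cmap n C d C'' d'' (%ep k x. G ep k (F ep k x))"
proof -
 note F = cmapD(1)[OF assms(1)] and G = cmapD(1)[OF assms(2)]
 have im: "F ep k ` C ep k <= C' ep k" for ep k using gmapD(2)[OF F] by blast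
 have "gmap C C'' (%ep k x. G ep k (F ep k x))"
  unfolding gmap_def using lin_comp[OF gmapD(1)[OF F] gmapD(1)[OF G] im] gmapD(2)[OF F] gmapD(2)[OF G]
  by blast
 then show ?thesis
  unfolding cmap_def using cmapD(2)[OF assms(1)] cmapD(2)[OF assms(2) gmapD(2)[OF F]] by simp
qed

lemma heq_sym: "heq n C d C' d' ==> heq n C' d' C d"
 unfolding heq_def by blast

text \<open>The homotopy is \<open>h + G h' F\<close>. With a round trip on the middle complex in
  the place of \<open>P\<close> this gives transitivity of \<open>heq\<close>.\<close>

lemma hty_comp:
 assumes C: "cplx n C d" and C': "cplx n C' d'"
  and F: "cmap n C d C' d' F" and G: "cmap n C' d' C d G"
  and h1: "hty n C d (%ep k x. G ep k (F ep k x))" and h2: "hty n C' d' P" and P: "gmap C' C' P"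
 shows "hty n C d (%ep k x. G ep k (P ep k (F ep k x)))"
proof -
 obtain h where h0: "gmap C (%ep k. C (~ ep) (k - n)) h &
   (\<forall>ep k. \<forall>x\<in>C ep k. G ep k (F ep k x) - x = d (h ep k x) + h (~ ep) (k + n) (d x))"
  using h1 unfolding hty_def ..
 note h = h0[THEN conjunct1] h0[THEN conjunct2, rule_format]
 obtain h' where h'0: "gmap C' (%ep k. C' (~ ep) (k - n)) h' &
   (\<forall>ep k. \<forall>x\<in>C' ep k. P ep k x - x = d' (h' ep k x) + h' (~ ep) (k + n) (d' x))"
  using h2 unfolding hty_def ..
 note h' = h'0[THEN conjunct1] h'0[THEN conjunct2, rule_format]
 note gF = gmapD[OF cmapD(1)[OF F]] and gG = gmapD[OF cmapD(1)[OF G]]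
 define H where "H = (%ep k x. h ep k x + G (~ ep) (k - n) (h' ep k (F ep k x)))"
 have "gmap C (%ep k. C (~ ep) (k - n)) H"
  unfolding gmap_def H_def
 proof (intro allI conjI)
  fix ep k
  have i1: "F ep k ` C ep k <= C' ep k" using gF(2) by blast
  have i2: "(%x. h' ep k (F ep k x)) ` C ep k <= C' (~ ep) (k - n)"
   using gmapD(2)[OF h'(1) gF(2)] by blast
  have "lin (C ep k) (%x. G (~ ep) (k - n) (h' ep k (F ep k x)))"
   by (rule lin_comp[OF lin_comp[OF gF(1) gmapD(1)[OF h'(1)] i1] gG(1) i2])
  then show "lin (C ep k) (%x. h ep k x + G (~ ep) (k - n) (h' ep k (F ep k x)))"
   by (rule lin_plus[OF gmapD(1)[OF h(1)]])
  show "(%x. h ep k x + G (~ ep) (k - n) (h' ep k (F ep k x))) ` C ep k <= C (~ ep) (k - n)"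
   using subD(2)[OF cplxD(2)[OF C] gmapD(2)[OF h(1)] gG(2)[OF gmapD(2)[OF h'(1) gF(2)]]] by blast
 qed
 moreover have "G ep k (P ep k (F ep k x)) - x = d (H ep k x) + H (~ ep) (k + n) (d x)"
  if x: "x \<in> C ep k" for ep k x
 proof -
  have Fx: "F ep k x \<in> C' ep k" using gF x by blast
  have hF: "h' ep k (F ep k x) \<in> C' (~ ep) (k - n)" using gmapD(2)[OF h'(1)] Fx by blast
  have hd: "h' (~ ep) (k + n) (d' (F ep k x)) \<in> C' ep k"
   using gmapD(2)[OF h'(1) cplxD(3)[OF C' Fx]] by simp
  have "G ep k (P ep k (F ep k x)) - G ep k (F ep k x) = G ep k (P ep k (F ep k x) - F ep k x)"
   using gmapD(2)[OF P Fx] Fx by (intro lin_diff[symmetric, OF gG(1)] cplxD(2)[OF C'])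
  also have "\<dots> = G ep k (d' (h' ep k (F ep k x))) + G ep k (h' (~ ep) (k + n) (d' (F ep k x)))"
   unfolding h'(2)[OF Fx] using cplx_lower[OF C' hF] hd by (intro linD(1)[OF gG(1)])
  also have "G ep k (d' (h' ep k (F ep k x))) = d (G (~ ep) (k - n) (h' ep k (F ep k x)))"
   using cmapD(2)[OF G hF] by simp
  also have "d' (F ep k x) = F (~ ep) (k + n) (d x)" using cmapD(2)[OF F x] by simp
  finally have "G ep k (P ep k (F ep k x)) - x = d (G (~ ep) (k - n) (h' ep k (F ep k x)))
    + G ep k (h' (~ ep) (k + n) (F (~ ep) (k + n) (d x))) + (G ep k (F ep k x) - x)"
   by (rule group_shuffle)
  then show ?thesis unfolding h(2)[OF x] H_def linD(1)[OF cplxD(1)[OF C] UNIV_I UNIV_I]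
   group_shuffle(2) by simp
 qed
 ultimately show ?thesis unfolding hty_def by blast
qed

lemma heq_trans:
 assumes C: "cplx n C d" and C': "cplx n C' d'" and C'': "cplx n C'' d''"
  and "heq n C d C' d'" "heq n C' d' C'' d''"
 shows "heq n C d C'' d''"
proof -
 obtain F G where 1: "cmap n C d C' d' F" "cmap n C' d' C d G"
   "hty n C d (%ep k x. G ep k (F ep k x))" "hty n C' d' (%ep k x. F ep k (G ep k x))"
  using assms(4) unfolding heq_def by blast
 obtain F' G' where 2: "cmap n C' d' C'' d'' F'" "cmap n C'' d'' C' d' G'"
   "hty n C' d' (%ep k x. G' ep k (F' ep k x))" "hty n C'' d'' (%ep k x. F' ep k (G' ep k x))"
  using assms(5) unfolding heq_def by blast
 note hc1 = hty_comp[OF C C' 1(1,2,3) 2(3) cmapD(1)[OF cmap_comp[OF 2(1,2)]]]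
 note hc2 = hty_comp[OF C'' C' 2(2,1,4) 1(4) cmapD(1)[OF cmap_comp[OF 1(2,1)]]]
 show ?thesis unfolding heq_def
  by (rule exI[of _ "%ep k x. F' ep k (F ep k x)"], rule exI[of _ "%ep k x. G ep k (G' ep k x)"])
   (intro conjI cmap_comp[OF 1(1) 2(1)] cmap_comp[OF 2(2) 1(2)] hc1 hc2)
qed

lemma shf_index:
 "((~ ep) ~= dl) = (~ (ep ~= dl))" "k + n - t = k - t + n" "k - n - t = k - t - (n :: int)"
 by auto

lemma cplx_shf:
 assumes C: "cplx n C d"
 shows "cplx n (shf dl t C) d"
 unfolding cplx_def shf_def
proof (intro conjI allI ballI)
 show "lin UNIV d" by (rule cplxD(1)[OF C])
 fix ep k
 show "sub (C (ep ~= dl) (k - t))" by (rule cplxD(2)[OF C])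
 show "d ` C (ep ~= dl) (k - t) <= C ((~ ep) ~= dl) (k + n - t)"
  unfolding shf_index using cplxD(3)[OF C] by blast
 show "d (d x) = 0" if "x \<in> C (ep ~= dl) (k - t)" for x
  using that by (rule cplxD(4)[OF C])
qed

lemma gmap_shf: "gmap C C' F ==> gmap (shf dl t C) (shf dl t C') (%ep k. F (ep ~= dl) (k - t))"
 unfolding gmap_def shf_def by blast

lemma cmap_shf:
 assumes "cmap n C d C' d' F"
 shows "cmap n (shf dl t C) d (shf dl t C') d' (%ep k. F (ep ~= dl) (k - t))"
 using gmap_shf[OF cmapD(1)[OF assms]] cmapD(2)[OF assms] unfolding cmap_def shf_index shf_def by blast

lemma hty_shf:
 assumes "hty n C d P"
 shows "hty n (shf dl t C) d (%ep k. P (ep ~= dl) (k - t))"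
proof -
 obtain h where h0: "gmap C (%ep k. C (~ ep) (k - n)) h &
   (\<forall>ep k. \<forall>x\<in>C ep k. P ep k x - x = d (h ep k x) + h (~ ep) (k + n) (d x))"
  using assms unfolding hty_def ..
 note h = h0[THEN conjunct1] h0[THEN conjunct2, rule_format]
 show ?thesis unfolding hty_def
 proof (rule exI[of _ "%ep k. h (ep ~= dl) (k - t)"], intro conjI allI ballI)
  show "gmap (shf dl t C) (%ep k. shf dl t C (~ ep) (k - n)) (%ep k. h (ep ~= dl) (k - t))"
   unfolding gmap_def shf_def
  proof (intro allI conjI)
   fix ep k
   show "lin (C (ep ~= dl) (k - t)) (h (ep ~= dl) (k - t))" by (rule gmapD(1)[OF h(1)])
   have "k - n - t = k - t - n" by simp
   then show "h (ep ~= dl) (k - t) ` C (ep ~= dl) (k - t) <= C ((~ ep) ~= dl) (k - n - t)"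
    unfolding shf_index(1) using gmapD(2)[OF h(1)] by (simp only:) blast
  qed
  fix ep k x assume "x \<in> shf dl t C ep k"
  then show "P (ep ~= dl) (k - t) x - x =
    d (h (ep ~= dl) (k - t) x) + h ((~ ep) ~= dl) (k + n - t) (d x)"
   unfolding shf_def shf_index by (rule h(2))
 qed
qed

lemma heq_shf:
 assumes "heq n C d C' d'"
 shows "heq n (shf dl t C) d (shf dl t C') d'"
proof -
 obtain F G where 1: "cmap n C d C' d' F" "cmap n C' d' C d G"
   "hty n C d (%ep k x. G ep k (F ep k x))" "hty n C' d' (%ep k x. F ep k (G ep k x))"
  using assms unfolding heq_def by blast
 show ?thesis unfolding heq_def
  by (rule exI[of _ "%ep k. F (ep ~= dl) (k - t)"], rule exI[of _ "%ep k. G (ep ~= dl) (k - t)"])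
   (intro conjI cmap_shf[OF 1(1)] cmap_shf[OF 1(2)] hty_shf[OF 1(3)] hty_shf[OF 1(4)])
qed

text \<open>For bijections on the pieces the inverse is a chain map by itself, and both homotopies
  are zero.\<close>

lemma heq_iso:
 assumes C: "!!ep k. sub (C ep k)" "!!ep k. sub (C' ep k)" "lin UNIV d" "lin UNIV d'"
  and F: "cmap n C d C' d' F" and G: "gmap C' C G"
  and d': "!!ep k x. x \<in> C' ep k ==> d' x \<in> C' (~ ep) (k + n)"
  and d: "!!ep k x. x \<in> C ep k ==> d x \<in> C (~ ep) (k + n)"
  and GF: "!!ep k x. x \<in> C ep k ==> G ep k (F ep k x) = x" and FG: "!!ep k x. x \<in> C' ep k ==> F ep k (G ep k x) = x"
 shows "heq n C d C' d'"
proof -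
 have "G (~ ep) (k + n) (d' x) = d (G ep k x)" if x: "x \<in> C' ep k" for ep k x
 proof -
  have "d' x = F (~ ep) (k + n) (d (G ep k x))"
   using cmapD(2)[OF F gmapD(2)[OF G x]] FG[OF x] by simp
  then show ?thesis using GF d gmapD(2)[OF G x] by metis
 qed
 then have "cmap n C' d' C d G" using G by (simp add: cmap_def)
 moreover have "hty n C d (%ep k x. G ep k (F ep k x))"
  unfolding hty_def using GF lin_0[OF C(3)] subD(1)[OF C(1)]
  by (intro exI[of _ "%_ _ _. 0"]) (auto simp: gmap_def lin_zero)
 moreover have "hty n C' d' (%ep k x. F ep k (G ep k x))"
  unfolding hty_def using FG lin_0[OF C(4)] subD(1)[OF C(2)]
  by (intro exI[of _ "%_ _ _. 0"]) (auto simp: gmap_def lin_zero)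
 ultimately show ?thesis using F unfolding heq_def by blast
qed

text \<open>Correct a linear section by a contraction of the kernel.\<close>

lemma heq_surj_acyclic:
 assumes C: "cplx n C d" and C': "cplx n C' d'" and linF: "lin UNIV F"
  and F: "!!ep k x. x \<in> C ep k ==> F x \<in> C' ep k"
  and ch: "!!ep k x. x \<in> C ep k ==> F (d x) = d' (F x)"
  and surj: "!!ep k. C' ep k <= F ` C ep k"
  and ac: "!!ep k x. x \<in> C ep k ==> F x = 0 ==> d x = 0 ==> \<exists>y\<in>C (~ ep) (k - n). F y = 0 & d y = x"
 shows "heq n C d C' d'"
proof -
 define K where "K ep k = {x \<in> C ep k. F x = 0}" for ep k
 note sC = subD[OF cplxD(2)[OF C]] and sC' = subD[OF cplxD(2)[OF C']]
 have F0: "F 0 = 0" using lin_0[OF linF] by simp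
 have Fd: "F (u - v) = F u - F v" for u v
  by (rule lin_diff[OF linF]) (simp_all add: sub_def)
 have dd: "d (u - v) = d u - d v" for u v
  by (rule lin_diff[OF cplxD(1)[OF C]]) (simp_all add: sub_def)
 have d0: "d 0 = 0" using lin_0[OF cplxD(1)[OF C]] by simp
 have subK: "sub (K ep k)" for ep k
  unfolding sub_def K_def using sC linD[OF linF] F0 by auto
 have dK: "d x \<in> K (~ ep) (k + n)" if "x \<in> K ep k" for x ep k
  using that ch[of x ep k] cplxD(3)[OF C] lin_0[OF cplxD(1)[OF C']] by (auto simp: K_def)
 have dK': "d x \<in> K ep k" if "x \<in> K (~ ep) (k - n)" for x ep k
  using dK[OF that] by simp
 have "\<exists>s. lin UNIV s & (\<forall>u. s u \<in> K (~ ep) (k - n)) & (\<forall>u \<in> d ` K (~ ep) (k - n). d (s u) = u)" for ep k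
  using right_inverse_on[OF cplxD(1)[OF C] subK] by metis
 then obtain s where s: "!!ep k. lin UNIV (s ep k)" "!!ep k u. s ep k u \<in> K (~ ep) (k - n)"
  "!!ep k u. u \<in> d ` K (~ ep) (k - n) ==> d (s ep k u) = u"
  by metis
 have cyc: "d (s ep k x) = x" if "x \<in> K ep k" "d x = 0" for x ep k
  using that ac[of x ep k] by (intro s(3)) (force simp: K_def)
 \<comment> \<open>On boundaries of the kernel \<open>s\<close> is a section of \<open>d\<close>.
   Subtracting \<open>s (d x)\<close> from \<open>x\<close> leaves a cycle of the kernel, which is a
   boundary by acyclicity and is lifted by \<open>s\<close> again. Hence \<open>kp\<close> contracts
   the kernel.\<close>
 define kp where "kp = (%ep k x. s ep k (x - s (~ ep) (k + n) (d x)))"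
 have kpK: "kp ep k x \<in> K (~ ep) (k - n)" for ep k x unfolding kp_def by (rule s(2))
 have linkp: "lin UNIV (kp ep k)" for ep k
 proof -
  have "lin UNIV (%x. x - s (~ ep) (k + n) (d x))"
   using lin_comp[OF cplxD(1)[OF C] s(1)[of "~ ep" "k + n"]] by (intro lin_minus lin_ident) auto
  then show ?thesis unfolding kp_def using lin_comp[OF _ s(1)] by blast
 qed
 have contr: "d (kp ep k x) + kp (~ ep) (k + n) (d x) = x" if x: "x \<in> K ep k" for ep k x
 proof -
  have x': "x \<in> C ep k" using x by (simp add: K_def)
  have ddx: "d (d x) = 0" using cplxD(4)[OF C x'] .
  have sd: "s (~ ep) (k + n) (d x) \<in> K ep k" using s(2)[of "~ ep" "k + n"] by simp
  have "d (x - s (~ ep) (k + n) (d x)) = 0"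
   using cyc[OF dK[OF x] ddx] by (simp add: dd)
  then have "d (kp ep k x) = x - s (~ ep) (k + n) (d x)"
   unfolding kp_def using subD(4)[OF subK x sd] by (intro cyc)
  moreover have "kp (~ ep) (k + n) (d x) = s (~ ep) (k + n) (d x)"
   unfolding kp_def ddx using lin_0[OF s(1)] by simp
  ultimately show ?thesis by simp
 qed
 have "\<exists>tau. lin UNIV tau & (\<forall>u. tau u \<in> C ep k) & (\<forall>u \<in> F ` C ep k. F (tau u) = u)" for ep k
  using right_inverse_on[OF linF cplxD(2)[OF C]] by metis
 then obtain tau where tau: "!!ep k. lin UNIV (tau ep k)" "!!ep k u. tau ep k u \<in> C ep k"
  "!!ep k u. u \<in> F ` C ep k ==> F (tau ep k u) = u"
  by metis
 have Ftau: "F (tau ep k u) = u" if "u \<in> C' ep k" for u ep k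
  using tau(3) surj that by blast
 \<comment> \<open>The failure of the linear section \<open>tau\<close> to be a chain map. It takes
   values in the kernel of \<open>F\<close>, so that subtracting its contraction from
   \<open>tau\<close> repairs the section without changing what \<open>F\<close> makes of
   it.\<close>
 define \<omega> where "\<omega> = (%ep k u. d (tau ep k u) - tau (~ ep) (k + n) (d' u))"
 have \<omega>K: "\<omega> ep k u \<in> K (~ ep) (k + n)" if u: "u \<in> C' ep k" for u ep k
 proof -
  have "\<omega> ep k u \<in> C (~ ep) (k + n)"
   unfolding \<omega>_def using cplxD(3)[OF C tau(2)] tau(2) by (intro sC(4)) auto
  moreover have "F (\<omega> ep k u) = 0"
   unfolding \<omega>_def Fd ch[OF tau(2)] Ftau[OF u] Ftau[OF cplxD(3)[OF C' u]] by simp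
  ultimately show ?thesis by (simp add: K_def)
 qed
 have lin\<omega>: "lin UNIV (\<omega> ep k)" for ep k
  unfolding \<omega>_def
  using lin_comp[OF tau(1) cplxD(1)[OF C], of ep k] lin_comp[OF cplxD(1)[OF C'] tau(1)[of "~ ep" "k + n"]]
  by (intro lin_minus) auto
 define G where "G = (%ep k u. tau ep k u - kp (~ ep) (k + n) (\<omega> ep k u))"
 have kp\<omega>: "kp (~ ep) (k + n) u \<in> K ep k" for ep k u
  using kpK[of "~ ep" "k + n" u] by simp
 have linG: "lin UNIV (G ep k)" for ep k
  unfolding G_def using lin_comp[OF lin\<omega> linkp] by (intro lin_minus tau(1)) auto
 have GC: "G ep k u \<in> C ep k" for ep k u
  unfolding G_def using tau(2) kp\<omega> by (intro sC(4)) (auto simp: K_def)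
 have FG: "F (G ep k u) = u" if "u \<in> C' ep k" for ep k u
  using kp\<omega>[of ep k "\<omega> ep k u"] Ftau[OF that] by (simp add: G_def Fd K_def)
 have Gch: "G (~ ep) (k + n) (d' u) = d (G ep k u)" if u: "u \<in> C' ep k" for ep k u
 proof -
  let ?e = "~ ep" and ?k = "k + n"
  have c: "d (kp ?e ?k (\<omega> ep k u)) = \<omega> ep k u - kp (~ ?e) (?k + n) (d (\<omega> ep k u))"
   using contr[OF \<omega>K[OF u]] by (simp add: eq_diff_eq)
  have "d (\<omega> ep k u) = - d (tau ?e ?k (d' u))"
   unfolding \<omega>_def dd using cplxD(4)[OF C tau(2)] by simp
  moreover have "\<omega> ?e ?k (d' u) = d (tau ?e ?k (d' u))"
   unfolding \<omega>_def using cplxD(4)[OF C' u] lin_0[OF tau(1)] by simp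
  ultimately have "d (\<omega> ep k u) = 0 - \<omega> ?e ?k (d' u)" by simp
  then have "kp (~ ?e) (?k + n) (d (\<omega> ep k u)) = - kp (~ ?e) (?k + n) (\<omega> ?e ?k (d' u))"
   using lin_diff[OF linkp, of 0 "\<omega> ?e ?k (d' u)"] lin_0[OF linkp] by (simp add: sub_def)
  with c have "d (kp ?e ?k (\<omega> ep k u)) = \<omega> ep k u + kp (~ ?e) (?k + n) (\<omega> ?e ?k (d' u))" by simp
  then show ?thesis unfolding G_def dd by (simp only: \<omega>_def group_shuffle(3,4)) (simp add: add_ac)
 qed
 have cF: "cmap n C d C' d' (%_ _. F)"
  unfolding cmap_def gmap_def using lin_subset[OF linF] F ch by blast
 have cG: "cmap n C' d' C d G"
  unfolding cmap_def gmap_def using lin_subset[OF linG] GC Gch by blast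
 have h1: "hty n C' d' (%ep k x. F (G ep k x))"
  unfolding hty_def using FG lin_0[OF cplxD(1)[OF C']] sC'
  by (intro exI[of _ "%_ _ _. 0"]) (auto simp: gmap_def lin_zero)
 \<comment> \<open>The round trip differs from the identity by elements of the kernel, which
   \<open>kp\<close> contracts.\<close>
 define h where "h = (%ep k x. kp ep k (G ep k (F x) - x))"
 have "gmap C (%ep k. C (~ ep) (k - n)) h"
 proof -
  have "lin UNIV (%x. G ep k (F x) - x)" for ep k
   using lin_comp[OF linF linG] by (intro lin_minus lin_ident) auto
  then have "lin UNIV (h ep k)" for ep k unfolding h_def using lin_comp[OF _ linkp] by blast
  then show ?thesis unfolding gmap_def using lin_subset kpK unfolding h_def K_def by blast
 qed
 moreover have "G ep k (F x) - x = d (h ep k x) + h (~ ep) (k + n) (d x)" if x: "x \<in> C ep k" for ep k x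
 proof -
  have 1: "G ep k (F x) - x \<in> K ep k"
   using FG[OF F[OF x]] sC(4)[OF GC x] by (simp add: K_def Fd)
  have "d (G ep k (F x) - x) = G (~ ep) (k + n) (F (d x)) - d x"
   unfolding dd Gch[OF F[OF x], symmetric] ch[OF x] ..
  then show ?thesis using contr[OF 1] by (simp add: h_def)
 qed
 ultimately have "hty n C d (%ep k x. G ep k (F x))" unfolding hty_def by blast
 then show ?thesis unfolding heq_def using cF cG h1 by blast
qed

section \<open>Leading monomials\<close>

text \<open>Monomials are renamed to numbered variables so that the linear order on exponent
  functions of natural numbers is available. It is lexicographic, the smallest index deciding, and
  compatible with addition.\<close>

definition rnm :: "('x => nat) => ('x \<Rightarrow>\<^sub>0 nat) => (nat \<Rightarrow>\<^sub>0 nat)" where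
 "rnm \<iota> t = (\<Sum>x\<in>keys t. Poly_Mapping.single (\<iota> x) (lkp t x))"

lemma rnm_superset:
 "finite A ==> keys t <= A ==> rnm \<iota> t = (\<Sum>x\<in>A. Poly_Mapping.single (\<iota> x) (lkp t x))"
 unfolding rnm_def by (rule sum.mono_neutral_left) (auto simp: in_keys_iff)

lemma rnm_add: "rnm \<iota> (t + u) = rnm \<iota> t + rnm \<iota> u"
proof -
 let ?A = "keys t \<union> keys u"
 have "keys (t + u) <= ?A" by (rule keys_add)
 then show ?thesis
  by (simp add: rnm_superset[of ?A] lookup_add single_add sum.distrib)
qed

lemma lookup_rnm:
 assumes "inj_on \<iota> A" "finite A" "keys t <= A" "x \<in> A"
 shows "lkp (rnm \<iota> t) (\<iota> x) = lkp t x"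
proof -
 have "lkp (rnm \<iota> t) (\<iota> x) = (\<Sum>y\<in>A. if y = x then lkp t y else 0)"
  unfolding rnm_superset[OF assms(2,3)] lookup_sum
  using assms by (intro sum.cong refl) (auto simp: lookup_single when_def inj_on_def)
 then show ?thesis using assms by simp
qed

lemma inj_on_rnm:
 assumes "inj_on \<iota> A" "finite A"
 shows "inj_on (rnm \<iota>) {t. keys t <= A}"
proof (rule inj_onI)
 fix t u assume tu: "t \<in> {t. keys t <= A}" "u \<in> {t. keys t <= A}"
  "rnm \<iota> t = rnm \<iota> u"
 show "t = u"
 proof (rule poly_mapping_eqI)
  fix x
  show "lkp t x = lkp u x"
  proof (cases "x \<in> A")
   case True
   then show ?thesis using lookup_rnm[OF assms, of t x] lookup_rnm[OF assms, of u x] tu by simp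
  next
   case False
   then have "x \<notin> keys t" "x \<notin> keys u" using tu by auto
   then show ?thesis by (simp add: in_keys_iff)
  qed
 qed
qed

lemma lookup_mult_keys:
 "lkp (f * g) u = (\<Sum>t\<in>keys f. \<Sum>s\<in>keys g.
   if t + s = u then lkp f t * lkp g s else 0)" for f g :: "'x mpol"
proof -
 have "f * g = (\<Sum>t\<in>keys f. Poly_Mapping.single t (lkp f t)) *
  (\<Sum>s\<in>keys g. Poly_Mapping.single s (lkp g s))"
  using mpol_expand[of f] mpol_expand[of g] by simp
 also have "\<dots> = (\<Sum>t\<in>keys f. \<Sum>s\<in>keys g.
   Poly_Mapping.single (t + s) (lkp f t * lkp g s))"
  by (simp add: sum_product mult_single)
 finally show ?thesis
  by (simp add: lookup_sum lookup_single when_def)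
qed

text \<open>Only the pair \<open>t0\<close>, \<open>s0\<close> can add up to \<open>t0 + s0\<close>:
  a smaller first summand would require a larger second one. Both are upper bounds that may
  themselves be absent from \<open>f\<close> and \<open>g\<close>, so the coefficients on the right
  may be 0.\<close>

lemma leading_mult:
 fixes f g :: "'x mpol" and R :: "('x \<Rightarrow>\<^sub>0 nat) => (nat \<Rightarrow>\<^sub>0 nat)"
 assumes R: "!!s t. R (s + t) = R s + R t"
  and f: "!!t. t \<in> keys f ==> R t <= R t0" "inj_on R (insert t0 (keys f))"
  and g: "!!t. t \<in> keys g ==> R t <= R s0" "inj_on R (insert s0 (keys g))"
 shows "lkp (f * g) (t0 + s0) = lkp f t0 * lkp g s0"
  and "!!u. u \<in> keys (f * g) ==> R u <= R (t0 + s0)"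
proof -
 have *: "t + s = t0 + s0 \<longleftrightarrow> t = t0 & s = s0"
  if "t \<in> keys f" "s \<in> keys g" for t s
 proof
  assume "t + s = t0 + s0"
  then have e: "R t + R s = R t0 + R s0" using R by metis
  have "R t = R t0"
  proof (rule ccontr)
   assume "R t ~= R t0"
   then have "R t < R t0" using f(1)[OF that(1)] by simp
   then have "R t + R s < R t0 + R s0" using g(1)[OF that(2)] by (rule add_less_le_mono)
   then show False using e by simp
  qed
  moreover from this e have "R s = R s0" by simp
  ultimately show "t = t0 & s = s0"
   using that f(2) g(2) by (metis inj_onD insertI1 insertI2)
 qed simp
 have "lkp (f * g) (t0 + s0) = (\<Sum>t\<in>keys f. \<Sum>s\<in>keys g.
   if t = t0 then if s = s0 then lkp f t * lkp g s else 0 else 0)"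
  unfolding lookup_mult_keys using * by (intro sum.cong refl) auto
 also have "\<dots> = (\<Sum>t\<in>keys f. if t = t0 then
   \<Sum>s\<in>keys g. if s = s0 then lkp f t * lkp g s else 0 else 0)"
  by (intro sum.cong refl) auto
 also have "\<dots> = lkp f t0 * lkp g s0"
  by (auto simp: sum.delta in_keys_iff)
 finally show "lkp (f * g) (t0 + s0) = lkp f t0 * lkp g s0" .
 fix u assume "u \<in> keys (f * g)"
 then obtain a b where "u = a + b" "a \<in> keys f" "b \<in> keys g"
  using keys_mult[of f g] by auto
 then show "R u <= R (t0 + s0)" using f(1) g(1) by (simp add: R add_mono)
qed

lemma exists_leading:
 fixes f :: "'x mpol" and R :: "('x \<Rightarrow>\<^sub>0 nat) => (nat \<Rightarrow>\<^sub>0 nat)"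
 assumes "f ~= 0"
 obtains t where "t \<in> keys f" "!!s. s \<in> keys f ==> R s <= R t"
proof -
 have "finite (R ` keys f)" "R ` keys f ~= {}"
  using assms by (auto simp: keys_eq_empty)
 then obtain t where "t \<in> keys f" "R t = Max (R ` keys f)"
  using Max_in by (metis (no_types, lifting) imageE)
 then show thesis using that[of t] by simp
qed

text \<open>The product of the leading coefficients survives. Only finitely many variables occur in
  \<open>f\<close> and \<open>g\<close>, so a numbering exists whatever the type of
  variables.\<close>

lemma mpol_no_zero_divisors:
 fixes f g :: "'x mpol"
 assumes "f * g = 0"
 shows "f = 0 \<or> g = 0"
proof (rule ccontr)
 assume "~ (f = 0 \<or> g = 0)"
 let ?X = "pvars f \<union> pvars g"
 obtain \<iota> :: "'x => nat" where \<iota>: "inj_on \<iota> ?X"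
  using finite_imp_inj_to_nat_seg[of ?X] by auto
 have inj: "inj_on (rnm \<iota>) {t. keys t <= ?X}" using inj_on_rnm[OF \<iota>] by simp
 have sub: "keys f <= {t. keys t <= ?X}"
  "keys g <= {t. keys t <= ?X}" by (auto simp: pvars_def)
 obtain t0 where t0: "t0 \<in> keys f" "!!s. s \<in> keys f ==> rnm \<iota> s <= rnm \<iota> t0"
  using exists_leading[of f "rnm \<iota>"] \<open>~ _\<close> by auto
 obtain s0 where s0: "s0 \<in> keys g" "!!s. s \<in> keys g ==> rnm \<iota> s <= rnm \<iota> s0"
  using exists_leading[of g "rnm \<iota>"] \<open>~ _\<close> by auto
 have "lkp (f * g) (t0 + s0) = lkp f t0 * lkp g s0"
  using sub t0 s0 by (intro leading_mult[where R = "rnm \<iota>"] rnm_add inj_on_subset[OF inj]) auto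
 then show False using assms t0 s0 by (simp add: in_keys_iff)
qed

lemma Var_minus_nonzero:
 assumes "c ~= 0" "v \<notin> pvars g"
 shows "Cst c * Var v + g ~= 0"
proof
 assume "Cst c * Var v + g = 0"
 then have "lkp (Cst c * Var v + g) (Poly_Mapping.single v 1) = 0" by simp
 moreover have "Poly_Mapping.single v (1::nat) \<notin> keys g"
  using assms(2) by (force simp: pvars_def)
 ultimately show False using assms(1) by (simp add: lookup_add lookup_Cst_mult lookup_Var in_keys_iff)
qed

section \<open>Koszul complexes\<close>

text \<open>A row \<open>(a, b, d)\<close> stands for the factor \<open>(a, b)\<close> with \<open>deg b = d\<close>. A basis element of the tensor
 product is a list of booleans, one for each row. Throughout \<open>n = N + 1\<close>.\<close>

definition wt :: "'m \<times> nat => int" where "wt v = 2 * int (snd v)"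

abbreviation hm :: "('m \<times> nat) set => int => ('m \<times> nat) mpol set" where "hm \<equiv> hmg wt"

type_synonym 'v row = "'v mpol \<times> 'v mpol \<times> int"

text \<open>The result is given by its coefficient at a basis element: \<open>b\<close> leads from
  the odd generator to the even one and \<open>a\<close> back, and the minus sign comes from moving
  the differential of the other rows past the odd generator. The degree entry plays its part in
  \<open>qd\<close> and \<open>row_ok\<close>.\<close>

fun kd :: "('r::comm_ring_1 \<times> 'r \<times> 'd) list => (bool list => 'r) => bool list => 'r" where
 "kd [] u x = 0"
| "kd ((a, b, d) # rs) u [] = 0"
| "kd ((a, b, d) # rs) u (False # x) = b * u (True # x) + kd rs (%y. u (False # y)) x"
| "kd ((a, b, d) # rs) u (True # x) = a * u (False # x) - kd rs (%y. u (True # y)) x"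

text \<open>The odd generator of \<open>(a, b)\<close> has degree \<open>n - deg a\<close>, and
  \<open>deg a = 2 * n - d\<close>; this gives \<open>d - n\<close>.\<close>

fun qd :: "int => ('r \<times> 'r \<times> int) list => bool list => int" where
 "qd n ((a, b, d) # rs) (c # x) = (if c then d - n else 0) + qd n rs x"
| "qd n _ _ = 0"

fun par :: "bool list => bool" where
 "par [] = False"
| "par (c # x) = (c ~= par x)"

definition pot :: "('r::comm_ring_1 \<times> 'r \<times> 'd) list => 'r" where
 "pot rs = (\<Sum>(a, b, d)\<leftarrow>rs. a * b)"

lemma pot_simps [simp]: "pot [] = 0" "pot ((a, b, d) # rs) = a * b + pot rs"
 "pot (rs @ rs') = pot rs + pot rs'"
 by (simp_all add: pot_def)

lemma kd_add: "kd rs (%x. u x + v x) x = kd rs u x + kd rs v x"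
proof (induction rs u x arbitrary: v rule: kd.induct)
 case (3 a b d rs u x)
 then show ?case by (simp add: 3 algebra_simps)
next
 case (4 a b d rs u x)
 then show ?case by (simp add: 4 algebra_simps)
qed simp_all
lemma kd_smult: "kd rs (%x. c * u x) x = c * kd rs u x"
 by (induction rs u x rule: kd.induct) (simp_all add: algebra_simps)
lemma kd_uminus: "kd rs (%x. - u x) x = - kd rs u x"
 using kd_smult[of rs "-1" u x] by simp
lemma kd_diff: "kd rs (%x. u x - v x) x = kd rs u x - kd rs v x"
 using kd_add[of rs u "%x. - v x" x] by (simp add: kd_uminus)
lemma kd_0: "kd rs (%x. 0) x = 0"
 using kd_smult[of rs 0 "%x. 0" x] by simp

text \<open>Elements of a free module are functions on all lists; pinning the values at lists of the
  wrong length to 0 makes equality of elements an equality of functions.\<close>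

definition supp :: "nat => (bool list => 'r::zero) set" where
 "supp n = {u. \<forall>x. length x ~= n --> u x = 0}"

lemma supp_slice: "u \<in> supp (Suc n) ==> (%x. u (c # x)) \<in> supp n"
 by (auto simp: supp_def)
lemma suppD: "u \<in> supp n ==> length x ~= n ==> u x = 0"
 by (auto simp: supp_def)

lemma kd_supp: "u \<in> supp (length rs) ==> kd rs u \<in> supp (length rs)"
proof -
 have "u \<in> supp (length rs) ==> length x ~= length rs ==> kd rs u x = 0" for x
  by (induction rs u x rule: kd.induct) (auto simp: supp_slice suppD)
 then show "u \<in> supp (length rs) ==> kd rs u \<in> supp (length rs)" by (simp add: supp_def)
qed

text \<open>Cross terms of two different rows cancel by the sign in the odd slice, and each single
  row contributes the product of its entries.\<close>

lemma kd_kd: "u \<in> supp (length rs) ==> kd rs (kd rs u) x = pot rs * u x"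
proof (induction rs u x rule: kd.induct)
 case (3 a b d rs u x)
 have "kd rs (%y. kd ((a, b, d) # rs) u (False # y)) x =
   b * kd rs (%y. u (True # y)) x + kd rs (kd rs (%y. u (False # y))) x"
  by (simp add: kd_add kd_smult)
 then show ?case using 3 by (simp add: supp_slice algebra_simps)
next
 case (4 a b d rs u x)
 have "kd rs (%y. kd ((a, b, d) # rs) u (True # y)) x =
   a * kd rs (%y. u (False # y)) x - kd rs (kd rs (%y. u (True # y))) x"
  by (simp add: kd_diff kd_smult)
 then show ?case using 4 by (simp add: supp_slice algebra_simps)
qed (auto simp: supp_def)

definition row_ok :: "int => ('m \<times> nat) set => ('m \<times> nat) row => bool" where
 "row_ok n V = (%(a, b, d). a \<in> hm V (2 * n - d) & b \<in> hm V d)"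

definition Kc :: "int => ('m \<times> nat) set => ('m \<times> nat) row list => (bool list, 'm \<times> nat) grading" where
 "Kc n V rs = (%ep k. {u \<in> supp (length rs). \<forall>x. length x = length rs -->
   (par x ~= ep --> u x = 0) & u x \<in> hm V (k - qd n rs x)})"

lemma KcI:
 assumes "u \<in> supp (length rs)" "!!x. length x = length rs ==> par x ~= ep ==> u x = 0"
  "!!x. length x = length rs ==> u x \<in> hm V (k - qd n rs x)"
 shows "u \<in> Kc n V rs ep k"
 using assms by (simp add: Kc_def)
lemma KcD:
 assumes "u \<in> Kc n V rs ep k"
 shows "u \<in> supp (length rs)" "length x = length rs ==> par x ~= ep ==> u x = 0"
  "length x = length rs ==> u x \<in> hm V (k - qd n rs x)"
 using assms by (simp_all add: Kc_def)

lemma sub_Kc: "sub (Kc n V rs ep k)"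
 unfolding sub_def
proof (intro conjI ballI allI)
 show "0 \<in> Kc n V rs ep k" by (rule KcI) (simp_all add: supp_def)
 show "scl c u \<in> Kc n V rs ep k" if u: "u \<in> Kc n V rs ep k" for c u
  unfolding scl_def using KcD[OF u] by (intro KcI) (auto simp: supp_def intro: hmg_Cst_mult)
 show "u + v \<in> Kc n V rs ep k" if u: "u \<in> Kc n V rs ep k" and v: "v \<in> Kc n V rs ep k" for u v
  unfolding plus_fun_def using KcD[OF u] KcD[OF v] by (intro KcI) (simp_all add: supp_def hmg_add)
qed

lemma lin_kd: "lin UNIV (kd rs)"
 unfolding lin_def by (simp add: fun_eq_iff scl_def kd_add kd_smult plus_fun_def)

lemma Kc_slice:
 assumes "u \<in> Kc n V ((a, b, d) # rs) ep k"
 shows "(%x. u (c # x)) \<in> Kc n V rs (ep ~= c) (k - (if c then d - n else 0))"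
proof (rule KcI)
 show "(%x. u (c # x)) \<in> supp (length rs)" using KcD(1)[OF assms] by (simp add: supp_slice)
 fix x :: "bool list" assume x: "length x = length rs"
 show "u (c # x) = 0" if "par x ~= (ep ~= c)"
  using KcD(2)[OF assms, of "c # x"] x that by auto
 show "u (c # x) \<in> hm V (k - (if c then d - n else 0) - qd n rs x)"
  using KcD(3)[OF assms, of "c # x"] x by (simp add: algebra_simps split: if_splits)
qed

lemma Kc_cons:
 assumes "!!c. (%x. u (c # x)) \<in> Kc n V rs (ep ~= c) (k - (if c then d - n else 0))" "u [] = 0"
 shows "u \<in> Kc n V ((a, b, d) # rs) ep k"
proof (rule KcI)
 show "u \<in> supp (length ((a, b, d) # rs))"
  unfolding supp_def
 proof (intro CollectI allI impI)
  fix x :: "bool list" assume "length x ~= length ((a, b, d) # rs)"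
  then show "u x = 0" using assms KcD(1)[OF assms(1)] by (cases x) (auto dest: suppD)
 qed
 fix x :: "bool list" assume x: "length x = length ((a, b, d) # rs)"
 then obtain c y where y: "x = c # y" "length y = length rs" by (cases x) auto
 show "u x = 0" if "par x ~= ep"
  using KcD(2)[OF assms(1), of y c] y that by auto
 show "u x \<in> hm V (k - qd n ((a, b, d) # rs) x)"
  using KcD(3)[OF assms(1), of y c] y by (simp add: algebra_simps split: if_splits)
qed

lemma Kc_add: "u \<in> Kc n V rs ep k ==> v \<in> Kc n V rs ep k ==> (%x. u x + v x) \<in> Kc n V rs ep k"
 using subD(2)[OF sub_Kc] by (simp add: plus_fun_def)
lemma Kc_mult:
 assumes "u \<in> Kc n V rs ep k" "r \<in> hm V e" "k + e = l"
 shows "(%x. r * u x) \<in> Kc n V rs ep l"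
proof (rule KcI)
 show "(%x. r * u x) \<in> supp (length rs)" using KcD(1)[OF assms(1)] by (simp add: supp_def)
 fix x :: "bool list" assume x: "length x = length rs"
 show "r * u x = 0" if "par x ~= ep" using KcD(2)[OF assms(1) x that] by simp
 show "r * u x \<in> hm V (l - qd n rs x)"
  using assms(3) by (intro hmg_mult'[OF assms(2) KcD(3)[OF assms(1) x]]) simp
qed
lemma Kc_uminus: "u \<in> Kc n V rs ep k ==> (%x. - u x) \<in> Kc n V rs ep k"
 using Kc_mult[of u n V rs ep k "-1" 0 k] by simp
lemma Kc_diff: "u \<in> Kc n V rs ep k ==> v \<in> Kc n V rs ep k ==> (%x. u x - v x) \<in> Kc n V rs ep k"
 using Kc_add[of u n V rs ep k "%x. - v x"] Kc_uminus by force

lemma kd_Kc: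
 assumes "\<forall>r\<in>set rs. row_ok n V r" "u \<in> Kc n V rs ep k"
 shows "kd rs u \<in> Kc n V rs (~ ep) (k + n)"
 using assms
proof (induction rs arbitrary: u ep k)
 case Nil
 then show ?case by (auto simp: Kc_def supp_def)
next
 case (Cons r rs)
 obtain a b d where r: "r = (a, b, d)" by (cases r) auto
 have ok: "a \<in> hm V (2 * n - d)" "b \<in> hm V d" using Cons.prems by (auto simp: r row_ok_def)
 note sl = Kc_slice[OF Cons.prems(2)[unfolded r]]
 have IH: "kd rs (%x. u (c # x)) \<in> Kc n V rs (~ (ep ~= c)) (k - (if c then d - n else 0) + n)" for c
  using Cons.prems(1) sl by (intro Cons.IH) auto
 show ?case unfolding r
 proof (rule Kc_cons)
  fix c
  show "(%x. kd ((a, b, d) # rs) u (c # x)) \<in> Kc n V rs ((~ ep) ~= c) (k + n - (if c then d - n else 0))"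
  proof (cases c)
   case True
   have "(%x. a * u (False # x)) \<in> Kc n V rs ep (k + (2 * n - d))"
    using sl[of False] by (intro Kc_mult[OF _ ok(1)]) auto
   then show ?thesis using Kc_diff[OF _ IH[of True]] True by (simp add: algebra_simps)
  next
   case False
   have "(%x. b * u (True # x)) \<in> Kc n V rs (~ ep) (k + n)"
    using sl[of True] by (intro Kc_mult[OF _ ok(2)]) auto
   then show ?thesis using Kc_add[OF _ IH[of False]] False by simp
  qed
 qed simp
qed

lemma cplx_Kc:
 assumes "\<forall>r\<in>set rs. row_ok n V r" "pot rs = 0"
 shows "cplx n (Kc n V rs) (kd rs)"
 unfolding cplx_def
proof (intro conjI allI ballI)
 fix ep k
 show "kd rs ` Kc n V rs ep k <= Kc n V rs (~ ep) (k + n)" using kd_Kc[OF assms(1)] by blast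
 show "kd rs (kd rs x) = 0" if "x \<in> Kc n V rs ep k" for x
  using kd_kd[OF KcD(1)[OF that]] assms(2) by (simp add: fun_eq_iff)
qed (simp_all add: lin_kd sub_Kc)

subsection \<open>Row equivalence\<close>

text \<open>A calculus of derivations instead of a relation of isomorphism, so that it can be
  transported along substitutions. \<open>dl\<close> and \<open>t\<close> record the shift that
  relates the two complexes. \<open>transv\<close> combines two shears of a pair of rows:
  \<open>c\<close> changes second entries and acts dually on first entries, while \<open>k\<close>
  adds multiples of second entries crosswise to first entries, which cancel in the potential. The
  degree conditions make the shears homogeneous.\<close>

inductive req :: "int => ('m \<times> nat) set => bool => int => ('m \<times> nat) row list => ('m \<times> nat) row list => bool"
 for n V where
 ident: "req n V False 0 rs rs"
| comp: "req n V dl t rs rs' ==> req n V dl' t' rs' rs'' ==> req n V (dl ~= dl') (t + t') rs rs''"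
| inv: "req n V dl t rs rs' ==> req n V dl (- t) rs' rs"
| tail: "req n V dl t rs rs' ==> req n V dl t (r # rs) (r # rs')"
| exch: "req n V False 0 (r # r' # rs) (r' # r # rs)"
| transv: "k \<in> hm V (2 * n - d - d') ==> c \<in> hm V (d' - d) ==>
  req n V False 0 ((a, b, d) # (a', b', d') # rs)
   ((a + k * b' + c * a' - k * c * b, b, d) # (a' - k * b, b' - c * b, d') # rs)"
| scale: "c ~= 0 ==> req n V False 0 ((a, b, d) # rs) ((Cst c * a, Cst (1 / c) * b, d) # rs)"
| abswap: "req n V True (d - n) ((a, b, d) # rs) ((b, a, 2 * n - d) # rs)"

section \<open>Chain isomorphisms that realize the row operations\<close>

definition Rlin :: "((bool list => 'v mpol) => bool list => 'v mpol) => bool" where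
 "Rlin F \<longleftrightarrow> (\<forall>u v. F (%x. u x + v x) = (%x. F u x + F v x)) & (\<forall>r u. F (%x. r * u x) = (%x. r * F u x))"

definition kmap :: "int => ('m \<times> nat) set => bool => int => ('m \<times> nat) row list => ('m \<times> nat) row list =>
  ((bool list => ('m \<times> nat) mpol) => bool list => ('m \<times> nat) mpol) => bool" where
 "kmap n V dl t rs rs' F \<longleftrightarrow> Rlin F & (\<forall>u \<in> supp (length rs). F u \<in> supp (length rs')) &
   (\<forall>ep k. F ` Kc n V rs ep k <= Kc n V rs' (ep ~= dl) (k - t)) &
   (\<forall>u \<in> supp (length rs). F (kd rs u) = kd rs' (F u))"

definition kiso where
 "kiso n V dl t rs rs' \<longleftrightarrow> length rs = length rs' & (\<exists>F G. kmap n V dl t rs rs' F & kmap n V dl (- t) rs' rs G &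
   (\<forall>u \<in> supp (length rs). G (F u) = u) & (\<forall>u \<in> supp (length rs). F (G u) = u))"

lemma kmapD:
 assumes "kmap n V dl t rs rs' F"
 shows "Rlin F" "u \<in> supp (length rs) ==> F u \<in> supp (length rs')"
  "u \<in> Kc n V rs ep k ==> F u \<in> Kc n V rs' (ep ~= dl) (k - t)"
  "u \<in> supp (length rs) ==> F (kd rs u) = kd rs' (F u)"
 using assms unfolding kmap_def by blast+

lemma RlinD: "Rlin F ==> F (%x. u x + v x) = (%x. F u x + F v x)" "Rlin F ==> F (%x. r * u x) = (%x. r * F u x)"
 unfolding Rlin_def by blast+

lemma Rlin_diff: "Rlin F ==> F (%x. u x - v x) = (%x. F u x - F v x)"
 using RlinD(1)[of F u "%x. -1 * v x"] RlinD(2)[of F "-1" v] by (simp add: fun_eq_iff)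

lemma Rlin_lin: "Rlin F ==> lin S F"
 unfolding lin_def Rlin_def scl_def plus_fun_def by blast

text \<open>The inverse of a bijective chain map commutes with the differentials by itself, so for
  \<open>G\<close> only linearity, support and degrees are asked.\<close>

lemma kmap_inverse:
 assumes "length rs = length rs'"
  and F: "Rlin F" "!!u. u \<in> supp (length rs) ==> F u \<in> supp (length rs')"
   "!!ep k u. u \<in> Kc n V rs ep k ==> F u \<in> Kc n V rs' (ep ~= dl) (k - t)"
   "!!u. u \<in> supp (length rs) ==> F (kd rs u) = kd rs' (F u)"
  and G: "Rlin G" "!!u. u \<in> supp (length rs) ==> G u \<in> supp (length rs')"
   "!!ep k u. u \<in> Kc n V rs' ep k ==> G u \<in> Kc n V rs (ep ~= dl) (k + t)"
  and GF: "!!u. u \<in> supp (length rs) ==> G (F u) = u" and FG: "!!u. u \<in> supp (length rs) ==> F (G u) = u"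
 shows "kiso n V dl t rs rs'"
proof -
 have "G (kd rs' u) = kd rs (G u)" if u: "u \<in> supp (length rs')" for u
 proof -
  have Gu: "G u \<in> supp (length rs)" using G(2) u assms(1) by simp
  have "kd rs' u = F (kd rs (G u))" using F(4)[OF Gu] FG u assms(1) by simp
  then show ?thesis using GF[OF kd_supp[OF Gu]] by simp
 qed
 then have "kmap n V dl (- t) rs' rs G" unfolding kmap_def using G assms(1) by (simp add: image_subset_iff)
 moreover have "kmap n V dl t rs rs' F" unfolding kmap_def using F by (simp add: image_subset_iff)
 ultimately show ?thesis unfolding kiso_def using assms(1) GF FG by blast
qed

lemma kiso_refl: "kiso n V False 0 rs rs"
 by (rule kmap_inverse[where F = "%u. u" and G = "%u. u"]) (simp_all add: Rlin_def)

lemma kiso_sym: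
 assumes "kiso n V dl t rs rs'"
 shows "kiso n V dl (- t) rs' rs"
proof -
 obtain F G where 1: "length rs = length rs'" "kmap n V dl t rs rs' F" "kmap n V dl (- t) rs' rs G"
   "\<forall>u \<in> supp (length rs). G (F u) = u" "\<forall>u \<in> supp (length rs). F (G u) = u"
  using assms unfolding kiso_def by blast
 show ?thesis unfolding kiso_def
  by (rule conjI, simp add: 1(1), rule exI[of _ G], rule exI[of _ F]) (use 1 in simp)
qed

lemma kiso_trans:
 assumes "kiso n V dl t rs rs'" "kiso n V dl' t' rs' rs''"
 shows "kiso n V (dl ~= dl') (t + t') rs rs''"
proof -
 obtain F G where 1: "length rs = length rs'" "kmap n V dl t rs rs' F" "kmap n V dl (- t) rs' rs G"
   "\<forall>u \<in> supp (length rs). G (F u) = u" "\<forall>u \<in> supp (length rs). F (G u) = u"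
  using assms(1) unfolding kiso_def by blast
 obtain F' G' where 2: "length rs' = length rs''" "kmap n V dl' t' rs' rs'' F'" "kmap n V dl' (- t') rs'' rs' G'"
   "\<forall>u \<in> supp (length rs'). G' (F' u) = u" "\<forall>u \<in> supp (length rs'). F' (G' u) = u"
  using assms(2) unfolding kiso_def by blast
 have p: "((ep ~= dl) ~= dl') = (ep ~= (dl ~= dl'))" "((ep ~= dl') ~= dl) = (ep ~= (dl ~= dl'))" for ep by auto
 show ?thesis
 proof (rule kmap_inverse[where F = "%u. F' (F u)" and G = "%u. G (G' u)"])
  show "Rlin (%u. F' (F u))" "Rlin (%u. G (G' u))"
   unfolding Rlin_def using RlinD[OF kmapD(1)[OF 1(2)]] RlinD[OF kmapD(1)[OF 2(2)]]
    RlinD[OF kmapD(1)[OF 1(3)]] RlinD[OF kmapD(1)[OF 2(3)]] by simp_all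
  show "F' (F u) \<in> Kc n V rs'' (ep ~= (dl ~= dl')) (k - (t + t'))" if "u \<in> Kc n V rs ep k" for u ep k
   using kmapD(3)[OF 2(2) kmapD(3)[OF 1(2) that]] unfolding p by (simp add: diff_diff_eq)
  show "G (G' u) \<in> Kc n V rs (ep ~= (dl ~= dl')) (k + (t + t'))" if "u \<in> Kc n V rs'' ep k" for u ep k
   using kmapD(3)[OF 1(3) kmapD(3)[OF 2(3) that]] unfolding p by (simp add: add_ac)
  show "F' (F (kd rs u)) = kd rs'' (F' (F u))" if u: "u \<in> supp (length rs)" for u
   using kmapD(4)[OF 1(2) u] kmapD(4)[OF 2(2) kmapD(2)[OF 1(2) u]] by simp
  show "F' (F u) \<in> supp (length rs'')" "G (G' u) \<in> supp (length rs'')" "G (G' (F' (F u))) = u" "F' (F (G (G' u))) = u"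
   if u: "u \<in> supp (length rs)" for u
   using u kmapD(2)[OF 1(2)] kmapD(2)[OF 2(2)] kmapD(2)[OF 1(3)] kmapD(2)[OF 2(3)] 1(1,4,5) 2(1,4,5) by simp_all
 qed (simp add: 1(1) 2(1))
qed

text \<open>The identity of the first tensor factor tensored with \<open>F\<close>. No sign is
  inserted even if \<open>F\<close> changes parity, because \<open>kmap\<close> demands strict
  commutation with the differentials.\<close>

definition slicewise where
 "slicewise F u x = (case x of [] => 0 | c # y => F (%z. u (c # z)) y)"

lemma slicewise_simps [simp]: "slicewise F u [] = 0" "slicewise F u (c # y) = F (%z. u (c # z)) y"
 by (simp_all add: slicewise_def)

lemma supp_ext:
 assumes "u \<in> supp (Suc m)" "v \<in> supp (Suc m)" "!!c y. length y = m ==> u (c # y) = v (c # y)"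
 shows "u = v"
proof
 fix x :: "bool list"
 show "u x = v x"
  using assms by (cases "length x = Suc m") (auto simp: length_Suc_conv suppD)
qed

lemma supp_Suc:
 assumes "!!c. (%x. u (c # x)) \<in> supp m" "u [] = 0"
 shows "u \<in> supp (Suc m)"
 unfolding supp_def
proof (intro CollectI allI impI)
 fix x :: "bool list" assume "length x ~= Suc m"
 then show "u x = 0" using assms(2) suppD[OF assms(1)] by (cases x) auto
qed

lemma kmap_slicewise:
 assumes F: "kmap n V dl t rs rs' F" and len: "length rs = length rs'"
 shows "kmap n V dl t (r # rs) (r # rs') (slicewise F)"
proof -
 obtain a b d where r: "r = (a, b, d)" by (cases r) auto
 have R: "Rlin (slicewise F)"
  unfolding Rlin_def fun_eq_iff slicewise_def
  using RlinD[OF kmapD(1)[OF F]] by (auto split: list.split)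
 have S: "slicewise F u \<in> supp (length (r # rs'))" if "u \<in> supp (length (r # rs))" for u
  unfolding list.size(4) add_Suc_right add_0_right
  using that by (intro supp_Suc) (auto intro!: kmapD(2)[OF F] supp_slice)
 have K: "slicewise F u \<in> Kc n V (r # rs') (ep ~= dl) (k - t)" if u: "u \<in> Kc n V (r # rs) ep k" for u ep k
  unfolding r
 proof (rule Kc_cons)
  fix c
  have "((ep ~= c) ~= dl) = ((ep ~= dl) ~= c)" by auto
  then show "(%x. slicewise F u (c # x)) \<in> Kc n V rs' ((ep ~= dl) ~= c) (k - t - (if c then d - n else 0))"
   using kmapD(3)[OF F Kc_slice[OF u[unfolded r], of c]] by (simp add: algebra_simps)
 qed simp
 have D: "slicewise F (kd (r # rs) u) = kd (r # rs') (slicewise F u)" if u: "u \<in> supp (length (r # rs))" for u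
 proof
  fix x
  have u': "(%z. u (c # z)) \<in> supp (length rs)" for c using u by (simp add: supp_slice)
  have ch: "F (kd rs (%z. u (c # z))) = kd rs' (F (%z. u (c # z)))" for c
   by (rule kmapD(4)[OF F u'])
  show "slicewise F (kd (r # rs) u) x = kd (r # rs') (slicewise F u) x"
  proof (cases x)
   case (Cons c y)
   have "F (%z. b * u (True # z) + kd rs (%z. u (False # z)) z) =
     (%y. b * F (%z. u (True # z)) y + kd rs' (F (%z. u (False # z))) y)"
    by (subst RlinD(1)[OF kmapD(1)[OF F]], subst RlinD(2)[OF kmapD(1)[OF F]]) (simp add: ch)
   moreover have "F (%z. a * u (False # z) - kd rs (%z. u (True # z)) z) =
     (%y. a * F (%z. u (False # z)) y - kd rs' (F (%z. u (True # z))) y)"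
    by (subst Rlin_diff[OF kmapD(1)[OF F]], subst RlinD(2)[OF kmapD(1)[OF F]]) (simp add: ch)
   ultimately show ?thesis by (cases c) (simp_all add: Cons r)
  qed (simp add: r)
 qed
 show ?thesis unfolding kmap_def using R S K D by (simp add: image_subset_iff)
qed

lemma kiso_cong:
 assumes "kiso n V dl t rs rs'"
 shows "kiso n V dl t (r # rs) (r # rs')"
proof -
 obtain F G where 1: "length rs = length rs'" "kmap n V dl t rs rs' F" "kmap n V dl (- t) rs' rs G"
   "\<forall>u \<in> supp (length rs). G (F u) = u" "\<forall>u \<in> supp (length rs). F (G u) = u"
  using assms unfolding kiso_def by blast
 note k1 = kmap_slicewise[OF 1(2,1), of r] and k2 = kmap_slicewise[OF 1(3) 1(1)[symmetric], of r]
 have "slicewise G (slicewise F u) = u" "slicewise F (slicewise G u) = u" if u: "u \<in> supp (length (r # rs))" for u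
 proof -
  have s: "(%z. u (c # z)) \<in> supp (length rs)" for c using u by (simp add: supp_slice)
  have "G (F (%z. u (c # z))) = (%z. u (c # z))" "F (G (%z. u (c # z))) = (%z. u (c # z))" for c
   using 1(4,5) s by auto
  then show "slicewise G (slicewise F u) = u" "slicewise F (slicewise G u) = u"
   using u by (auto simp: slicewise_def fun_eq_iff suppD split: list.split)
 qed
 then show ?thesis unfolding kiso_def using k1 k2 1(1) by (metis length_Cons)
qed

lemma len2: "length x = Suc (Suc m) ==> \<exists>c1 c2 y. x = c1 # c2 # y & length y = m"
 by (auto simp: length_Suc_conv)

lemma supp_ext2:
 assumes "u \<in> supp (Suc (Suc m))" "v \<in> supp (Suc (Suc m))"
  "!!c1 c2 y. length y = m ==> u (c1 # c2 # y) = v (c1 # c2 # y)"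
 shows "u = v"
proof
 fix x :: "bool list"
 show "u x = v x"
  using assms(3) suppD[OF assms(1), of x] suppD[OF assms(2), of x] len2[of x m]
  by (cases "length x = Suc (Suc m)") auto
qed

text \<open>A map that touches the first two tensor factors only: \<open>f c1 c2\<close> computes
  the new coefficient at \<open>(c1, c2)\<close> from the four old ones.\<close>

definition front2 where
 "front2 f u x = (case x of c1 # c2 # y => f c1 c2 (%c1 c2. u (c1 # c2 # y)) | _ => 0)"

lemma front2_simps [simp]: "front2 f u [] = 0" "front2 f u [c] = 0"
 "front2 f u (c1 # c2 # y) = f c1 c2 (%c1 c2. u (c1 # c2 # y))"
 by (simp_all add: front2_def)

lemma Rlin_front2:
 assumes "!!c1 c2 p q. f c1 c2 (%a b. p a b + q a b) = f c1 c2 p + f c1 c2 q"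
  "!!c1 c2 r p. f c1 c2 (%a b. r * p a b) = r * f c1 c2 p"
 shows "Rlin (front2 f)"
 unfolding Rlin_def front2_def fun_eq_iff by (auto simp: assms split: list.split)

lemma supp_front2:
 assumes "!!c1 c2. f c1 c2 (%a b. 0) = 0" "u \<in> supp (Suc (Suc m))"
 shows "front2 f u \<in> supp (Suc (Suc m))"
 unfolding supp_def
proof (intro CollectI allI impI)
 fix x :: "bool list" assume x: "length x ~= Suc (Suc m)"
 show "front2 f u x = 0"
 proof (cases x)
  case (Cons c1 z)
  then show ?thesis
  proof (cases z)
   case (Cons c2 y)
   have "u (a # b # y) = 0" for a b
    using x by (intro suppD[OF assms(2)]) (simp add: \<open>x = _\<close> Cons)
   then show ?thesis by (simp add: \<open>x = _\<close> Cons assms(1))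
  qed simp
 qed simp
qed

lemma front2_Kc:
 fixes V :: "('m \<times> nat) set"
 assumes h0: "!!c1 c2. h c1 c2 (%a b. 0) = 0"
  and hK: "!!ep k p c1 c2. (!!c1 c2. ((c1 ~= c2) ~= ep --> p c1 c2 = 0) &
    p c1 c2 \<in> hm V (k - ((if c1 then e1 - n else 0) + (if c2 then e2 - n else 0)))) ==>
    ((c1 ~= c2) ~= ep --> h c1 c2 p = 0) &
    h c1 c2 p \<in> hm V (k - ((if c1 then e1' - n else 0) + (if c2 then e2' - n else 0)))"
  and u: "u \<in> Kc n V ((A1, B1, e1) # (A2, B2, e2) # rs) ep k"
 shows "front2 h u \<in> Kc n V ((A1', B1', e1') # (A2', B2', e2') # rs) ep k"
proof (rule KcI)
 show "front2 h u \<in> supp (length ((A1', B1', e1') # (A2', B2', e2') # rs))"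
  using supp_front2[of h, OF h0] KcD(1)[OF u] by simp
 fix x :: "bool list" assume "length x = length ((A1', B1', e1') # (A2', B2', e2') # rs)"
 then obtain c1 c2 y where x: "x = c1 # c2 # y" "length y = length rs" using len2[of x] by auto
 have "((c1 ~= c2) ~= (ep ~= par y) --> u (c1 # c2 # y) = 0) &
   u (c1 # c2 # y) \<in> hm V (k - qd n rs y - ((if c1 then e1 - n else 0) + (if c2 then e2 - n else 0)))"
  for c1 c2
 proof
  show "(c1 ~= c2) ~= (ep ~= par y) --> u (c1 # c2 # y) = 0"
   using KcD(2)[OF u, of "c1 # c2 # y"] x(2) by auto
  show "u (c1 # c2 # y) \<in> hm V (k - qd n rs y - ((if c1 then e1 - n else 0) + (if c2 then e2 - n else 0)))"
   using KcD(3)[OF u, of "c1 # c2 # y"] x(2) by (simp add: algebra_simps)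
 qed
 note * = hK[of "ep ~= par y" "%c1 c2. u (c1 # c2 # y)" "k - qd n rs y", OF this, of c1 c2]
 show "front2 h u x = 0" if "par x ~= ep"
  using * that by (auto simp: x)
 show "front2 h u x \<in> hm V (k - qd n ((A1', B1', e1') # (A2', B2', e2') # rs) x)"
  using *[THEN conjunct2] by (simp add: x algebra_simps)
qed

lemma kiso_front2:
 assumes f: "!!c1 c2 p q. f c1 c2 (%a b. p a b + q a b) = f c1 c2 p + f c1 c2 q"
  "!!c1 c2 r p. f c1 c2 (%a b. r * p a b) = r * f c1 c2 p"
  and g: "!!c1 c2 p q. g c1 c2 (%a b. p a b + q a b) = g c1 c2 p + g c1 c2 q"
  "!!c1 c2 r p. g c1 c2 (%a b. r * p a b) = r * g c1 c2 p"
  and gf: "!!c1 c2 p. g c1 c2 (%a b. f a b p) = p c1 c2"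
  and fg: "!!c1 c2 p. f c1 c2 (%a b. g a b p) = p c1 c2"
  and fK: "!!ep k p c1 c2. (!!c1 c2. ((c1 ~= c2) ~= ep --> p c1 c2 = 0) &
    p c1 c2 \<in> hm V (k - ((if c1 then d1 - n else 0) + (if c2 then d2 - n else 0)))) ==>
    ((c1 ~= c2) ~= ep --> f c1 c2 p = 0) &
    f c1 c2 p \<in> hm V (k - ((if c1 then d1' - n else 0) + (if c2 then d2' - n else 0)))"
  and gK: "!!ep k p c1 c2. (!!c1 c2. ((c1 ~= c2) ~= ep --> p c1 c2 = 0) &
    p c1 c2 \<in> hm V (k - ((if c1 then d1' - n else 0) + (if c2 then d2' - n else 0)))) ==>
    ((c1 ~= c2) ~= ep --> g c1 c2 p = 0) &
    g c1 c2 p \<in> hm V (k - ((if c1 then d1 - n else 0) + (if c2 then d2 - n else 0)))"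
  and D: "!!u c1 c2 y. front2 f (kd ((a1, b1, d1) # (a2, b2, d2) # rs) u) (c1 # c2 # y) =
    kd ((a1', b1', d1') # (a2', b2', d2') # rs) (front2 f u) (c1 # c2 # y)"
 shows "kiso n V False 0 ((a1, b1, d1) # (a2, b2, d2) # rs) ((a1', b1', d1') # (a2', b2', d2') # rs)"
  (is "kiso _ _ _ _ ?rs ?rs'")
proof (rule kmap_inverse[where F = "front2 f" and G = "front2 g"])
 have f0: "f c1 c2 (%a b. 0) = 0" and g0: "g c1 c2 (%a b. 0) = 0" for c1 c2
  using f(2)[of c1 c2 0] g(2)[of c1 c2 0] by simp_all
 show "Rlin (front2 f)" "Rlin (front2 g)" using f g by (simp_all add: Rlin_front2)
 show sf: "front2 f u \<in> supp (length ?rs')" if "u \<in> supp (length ?rs)" for u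
  using supp_front2[of f, OF f0] that by simp
 show sg: "front2 g u \<in> supp (length ?rs')" if "u \<in> supp (length ?rs)" for u
  using supp_front2[of g, OF g0] that by simp
 show "front2 f u \<in> Kc n V ?rs' (ep ~= False) (k - 0)" if u: "u \<in> Kc n V ?rs ep k" for u ep k
 proof -
  have "front2 f u \<in> Kc n V ?rs' ep k" by (rule front2_Kc[of f, OF f0 _ u]) (rule fK, assumption)
  then show ?thesis by simp
 qed
 show "front2 g u \<in> Kc n V ?rs (ep ~= False) (k + 0)" if u: "u \<in> Kc n V ?rs' ep k" for u ep k
 proof -
  have "front2 g u \<in> Kc n V ?rs ep k" by (rule front2_Kc[of g, OF g0 _ u]) (rule gK, assumption)
  then show ?thesis by simp
 qed
 show "front2 f (kd ?rs u) = kd ?rs' (front2 f u)" if u: "u \<in> supp (length ?rs)" for u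
  using D supp_front2[of f, OF f0 kd_supp[OF u, simplified]] kd_supp[of "front2 f u" ?rs'] sf[OF u]
  by (intro supp_ext2[where m = "length rs"]) simp_all
 show "front2 g (front2 f u) = u" if u: "u \<in> supp (length ?rs)" for u
  using u supp_front2[of f, OF f0] supp_front2[of g, OF g0]
  by (intro supp_ext2[where m = "length rs"]) (simp_all add: gf)
 show "front2 f (front2 g u) = u" if u: "u \<in> supp (length ?rs)" for u
  using u supp_front2[of f, OF f0] supp_front2[of g, OF g0]
  by (intro supp_ext2[where m = "length rs"]) (simp_all add: fg)
qed simp

lemma kd_minus_slice: "kd rs (%y. - u y) = (%x. - kd rs u x)"
 by (rule ext) (rule kd_uminus)

lemma kiso_exch: "kiso n V False 0 (r1 # r2 # rs) (r2 # r1 # rs)"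
proof -
 obtain a1 b1 d1 a2 b2 d2 where r: "r1 = (a1, b1, d1)" "r2 = (a2, b2, d2)" by (cases r1; cases r2) auto
 \<comment> \<open>Transposing two odd generators costs the Koszul sign.\<close>
 define f :: "bool => bool => (bool => bool => ('a \<times> nat) mpol) => ('a \<times> nat) mpol"
  where "f = (%c1 c2 p. if c1 & c2 then - p c2 c1 else p c2 c1)"
 show ?thesis unfolding r
 proof (rule kiso_front2[where f = f and g = f])
  show "front2 f (kd ((a1, b1, d1) # (a2, b2, d2) # rs) u) (c1 # c2 # y) =
    kd ((a2, b2, d2) # (a1, b1, d1) # rs) (front2 f u) (c1 # c2 # y)" for u c1 c2 y
   by (cases c1; cases c2) (simp_all add: f_def kd_minus_slice algebra_simps)
 next
  have K: "((c1 ~= c2) ~= ep --> f c1 c2 p = 0) &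
    f c1 c2 p \<in> hm V (k - ((if c1 then e2 - n else 0) + (if c2 then e1 - n else 0)))"
   if p: "!!c1 c2. ((c1 ~= c2) ~= ep --> p c1 c2 = 0) &
    p c1 c2 \<in> hm V (k - ((if c1 then e1 - n else 0) + (if c2 then e2 - n else 0)))"
   for ep k p c1 c2 and e1 e2 :: int
   using p[of c2 c1] by (cases c1; cases c2) (simp_all add: f_def add.commute)
  fix ep k p c1 c2
  show "((c1 ~= c2) ~= ep --> f c1 c2 p = 0) &
    f c1 c2 p \<in> hm V (k - ((if c1 then d2 - n else 0) + (if c2 then d1 - n else 0)))"
   if p: "!!c1 c2. ((c1 ~= c2) ~= ep --> p c1 c2 = 0) &
    p c1 c2 \<in> hm V (k - ((if c1 then d1 - n else 0) + (if c2 then d2 - n else 0)))"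
   by (rule K[OF p])
  show "((c1 ~= c2) ~= ep --> f c1 c2 p = 0) &
    f c1 c2 p \<in> hm V (k - ((if c1 then d1 - n else 0) + (if c2 then d2 - n else 0)))"
   if p: "!!c1 c2. ((c1 ~= c2) ~= ep --> p c1 c2 = 0) &
    p c1 c2 \<in> hm V (k - ((if c1 then d2 - n else 0) + (if c2 then d1 - n else 0)))"
   by (rule K[OF p])
 qed (simp_all add: f_def)
qed

lemma kiso_transv:
 assumes k: "k \<in> hm V (2 * n - d1 - d2)" and c: "c \<in> hm V (d2 - d1)"
 shows "kiso n V False 0 ((a1, b1, d1) # (a2, b2, d2) # rs)
   ((a1 + k * b2 + c * a2 - k * c * b1, b1, d1) # (a2 - k * b1, b2 - c * b1, d2) # rs)"
proof -
 \<comment> \<open>A unipotent map: \<open>k\<close> sends the generator that is even in both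
   factors to the one that is odd in both, and \<open>c\<close> sends the one odd in the second
   factor to the one odd in the first. The images have no further terms, so negating
   \<open>k\<close> and \<open>c\<close> gives the inverse.\<close>
 define f :: "('a \<times> nat) mpol => ('a \<times> nat) mpol =>
   bool => bool => (bool => bool => ('a \<times> nat) mpol) => ('a \<times> nat) mpol"
  where "f = (%k c c1 c2 p. if c1 then p c1 c2 + (if c2 then k else c) * p False (~ c2) else p c1 c2)"
 have K: "((c1 ~= c2) ~= ep --> f k c c1 c2 p = 0) &
   f k c c1 c2 p \<in> hm V (l - ((if c1 then d1 - n else 0) + (if c2 then d2 - n else 0)))"
  if p: "!!c1 c2. ((c1 ~= c2) ~= ep --> p c1 c2 = 0) &
   p c1 c2 \<in> hm V (l - ((if c1 then d1 - n else 0) + (if c2 then d2 - n else 0)))"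
  and k: "k \<in> hm V (2 * n - d1 - d2)" and c: "c \<in> hm V (d2 - d1)" for ep l p c1 c2 k c
 proof -
  have "k * p False False \<in> hm V (l - (d1 - n + (d2 - n)))"
   using p[of False False] by (intro hmg_mult'[OF k, of _ l]) auto
  moreover have "c * p False True \<in> hm V (l - (d1 - n))"
   using p[of False True] by (intro hmg_mult'[OF c, of _ "l - (d2 - n)"]) auto
  ultimately show ?thesis
   using p[of True True] p[of True False] p[of False False] p[of False True]
   by (cases c1; cases c2; cases ep) (auto simp: f_def intro!: hmg_add)
 qed
 show ?thesis
 proof (rule kiso_front2[where f = "f k c" and g = "f (- k) (- c)"])
  show "front2 (f k c) (kd ((a1, b1, d1) # (a2, b2, d2) # rs) u) (c1 # c2 # y) =
    kd ((a1 + k * b2 + c * a2 - k * c * b1, b1, d1) # (a2 - k * b1, b2 - c * b1, d2) # rs) (front2 (f k c) u) (c1 # c2 # y)"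
   for u c1 c2 y
   by (cases c1; cases c2) (simp_all add: f_def kd_add kd_smult kd_minus_slice algebra_simps)
 next
  fix ep l p c1 c2
  assume p: "!!c1 c2. ((c1 ~= c2) ~= ep --> p c1 c2 = 0) &
   p c1 c2 \<in> hm V (l - ((if c1 then d1 - n else 0) + (if c2 then d2 - n else 0)))"
  show "((c1 ~= c2) ~= ep --> f k c c1 c2 p = 0) &
   f k c c1 c2 p \<in> hm V (l - ((if c1 then d1 - n else 0) + (if c2 then d2 - n else 0)))"
   by (rule K[OF p k c])
  show "((c1 ~= c2) ~= ep --> f (- k) (- c) c1 c2 p = 0) &
   f (- k) (- c) c1 c2 p \<in> hm V (l - ((if c1 then d1 - n else 0) + (if c2 then d2 - n else 0)))"
   by (rule K[OF p]) (use k c in auto)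
 qed (simp_all add: f_def algebra_simps)
qed

text \<open>\<open>f\<close> also sees the rest \<open>y\<close> of the basis element, because
  \<open>kiso_abswap\<close> needs a sign that depends on its parity.\<close>

definition front1 where
 "front1 f u x = (case x of c # y => f y c (%c. u (c # y)) | _ => 0)"

lemma front1_simps [simp]: "front1 f u [] = 0" "front1 f u (c # y) = f y c (%c. u (c # y))"
 by (simp_all add: front1_def)

lemma front1_supp:
 assumes "!!y c. h y c (%a. 0) = 0" "u \<in> supp (Suc m)"
 shows "front1 h u \<in> supp (Suc m)"
 unfolding supp_def
proof (intro CollectI allI impI)
 fix x :: "bool list" assume x: "length x ~= Suc m"
 show "front1 h u x = 0"
 proof (cases x)
  case (Cons c y)
  have "u (c # y) = 0" for c using x assms(2) by (intro suppD[OF assms(2)]) (simp add: Cons)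
  then show ?thesis by (simp add: Cons assms(1))
 qed simp
qed

lemma front1_Kc:
 fixes V :: "('m \<times> nat) set"
 assumes h0: "!!y c. h y c (%a. 0) = 0"
  and hK: "!!y ep k p c. (!!c. (c ~= ep --> p c = 0) & p c \<in> hm V (k - (if c then e - n else 0))) ==>
    (c ~= (ep ~= dl) --> h y c p = 0) & h y c p \<in> hm V (k + s - (if c then e' - n else 0))"
  and u: "u \<in> Kc n V ((A, B, e) # rs) ep k"
 shows "front1 h u \<in> Kc n V ((A', B', e') # rs) (ep ~= dl) (k + s)"
proof (rule KcI)
 show "front1 h u \<in> supp (length ((A', B', e') # rs))"
  using front1_supp[of h, OF h0] KcD(1)[OF u] by simp
 fix x :: "bool list" assume "length x = length ((A', B', e') # rs)"
 then obtain c y where x: "x = c # y" "length y = length rs" by (cases x) auto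
 have "(c ~= (ep ~= par y) --> u (c # y) = 0) & u (c # y) \<in> hm V (k - qd n rs y - (if c then e - n else 0))" for c
 proof
  show "c ~= (ep ~= par y) --> u (c # y) = 0"
   using KcD(2)[OF u, of "c # y"] x(2) by auto
  show "u (c # y) \<in> hm V (k - qd n rs y - (if c then e - n else 0))"
   using KcD(3)[OF u, of "c # y"] x(2) by (simp add: algebra_simps)
 qed
 note * = hK[of "ep ~= par y" "%c. u (c # y)" "k - qd n rs y", OF this, of c y]
 show "front1 h u x = 0" if "par x ~= (ep ~= dl)"
  using *[THEN conjunct1] that by (cases c; cases ep; cases dl; cases "par y") (simp_all add: x)
 show "front1 h u x \<in> hm V (k + s - qd n ((A', B', e') # rs) x)"
  using *[THEN conjunct2] by (simp add: x algebra_simps)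
qed

lemma kiso_front1:
 assumes f: "!!y c p q. f y c (%a. p a + q a) = f y c p + f y c q"
  "!!y c r p. f y c (%a. r * p a) = r * f y c p"
  and g: "!!y c p q. g y c (%a. p a + q a) = g y c p + g y c q"
  "!!y c r p. g y c (%a. r * p a) = r * g y c p"
  and gf: "!!y c p. g y c (%a. f y a p) = p c"
  and fg: "!!y c p. f y c (%a. g y a p) = p c"
  and fK: "!!y ep k p c. (!!c. (c ~= ep --> p c = 0) & p c \<in> hm V (k - (if c then d - n else 0))) ==>
    (c ~= (ep ~= dl) --> f y c p = 0) & f y c p \<in> hm V (k - t - (if c then d' - n else 0))"
  and gK: "!!y ep k p c. (!!c. (c ~= ep --> p c = 0) & p c \<in> hm V (k - (if c then d' - n else 0))) ==>
    (c ~= (ep ~= dl) --> g y c p = 0) & g y c p \<in> hm V (k + t - (if c then d - n else 0))"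
  and D: "!!u c y. front1 f (kd ((a, b, d) # rs) u) (c # y) = kd ((a', b', d') # rs) (front1 f u) (c # y)"
 shows "kiso n V dl t ((a, b, d) # rs) ((a', b', d') # rs)" (is "kiso _ _ _ _ ?rs ?rs'")
proof (rule kmap_inverse[where F = "front1 f" and G = "front1 g"])
 have f0: "f y c (%a. 0) = 0" and g0: "g y c (%a. 0) = 0" for y c
  using f(2)[of y c 0] g(2)[of y c 0] by simp_all
 show "Rlin (front1 f)" "Rlin (front1 g)"
  unfolding Rlin_def front1_def fun_eq_iff using f g by (auto split: list.split)
 show sf: "front1 f u \<in> supp (length ?rs')" if "u \<in> supp (length ?rs)" for u
  using front1_supp[of f, OF f0] that by simp
 show "front1 g u \<in> supp (length ?rs')" if "u \<in> supp (length ?rs)" for u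
  using front1_supp[of g, OF g0] that by simp
 show "front1 f u \<in> Kc n V ?rs' (ep ~= dl) (k - t)" if u: "u \<in> Kc n V ?rs ep k" for u ep k
 proof -
  have "front1 f u \<in> Kc n V ?rs' (ep ~= dl) (k + - t)"
   by (rule front1_Kc[of f, OF f0 _ u], unfold add_uminus_conv_diff) (rule fK, assumption)
  then show ?thesis by simp
 qed
 show "front1 g u \<in> Kc n V ?rs (ep ~= dl) (k + t)" if u: "u \<in> Kc n V ?rs' ep k" for u ep k
  by (rule front1_Kc[of g, OF g0 _ u]) (rule gK, assumption)
 show "front1 f (kd ?rs u) = kd ?rs' (front1 f u)" if u: "u \<in> supp (length ?rs)" for u
  using D front1_supp[of f, OF f0 kd_supp[OF u, simplified]] kd_supp[of "front1 f u" ?rs'] sf[OF u]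
  by (intro supp_ext[where m = "length rs"]) simp_all
 show "front1 g (front1 f u) = u" if u: "u \<in> supp (length ?rs)" for u
  using u front1_supp[of f, OF f0] front1_supp[of g, OF g0]
  by (intro supp_ext[where m = "length rs"]) (simp_all add: gf)
 show "front1 f (front1 g u) = u" if u: "u \<in> supp (length ?rs)" for u
  using u front1_supp[of f, OF f0] front1_supp[of g, OF g0]
  by (intro supp_ext[where m = "length rs"]) (simp_all add: fg)
qed simp

lemma kiso_scale:
 fixes V :: "('b \<times> nat) set"
 assumes "c ~= 0"
 shows "kiso n V False 0 ((a, b, d) # rs) ((Cst c * a, Cst (1 / c) * b, d) # rs)"
proof (rule kiso_front1[where f = "%y e p. if e then Cst c * p e else p e"
   and g = "%y e p. if e then Cst (1 / c) * p e else p e"])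
 have c1: "Cst c * Cst (1 / c) = (1 :: ('b \<times> nat) mpol)" "Cst (1 / c) * Cst c = (1 :: ('b \<times> nat) mpol)"
  using assms by (simp_all flip: Cst_mult)
 have c2: "Cst c * (Cst (1 / c) * p) = p" "Cst (1 / c) * (Cst c * p) = p" for p :: "('b \<times> nat) mpol"
  by (simp_all only: mult.assoc[symmetric] c1 mult_1)
 show "(if e then Cst (1 / c) * (if e then Cst c * p e else p e) else if e then Cst c * p e else p e) = p e"
  "(if e then Cst c * (if e then Cst (1 / c) * p e else p e) else if e then Cst (1 / c) * p e else p e) = p e" for e and p :: "bool => ('b \<times> nat) mpol"
  using c2 by simp_all
 show "front1 (%y e p. if e then Cst c * p e else p e) (kd ((a, b, d) # rs) u) (e # y) =
   kd ((Cst c * a, Cst (1 / c) * b, d) # rs) (front1 (%y e p. if e then Cst c * p e else p e) u) (e # y)" for u e y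
 proof (cases e)
  case False
  have "Cst (1 / c) * b * (Cst c * u (True # y)) = b * (Cst c * (Cst (1 / c) * u (True # y)))"
   by (simp only: mult_ac)
  then show ?thesis using False c2 by simp
 qed (simp add: kd_smult algebra_simps)
next
 fix y :: "bool list" and ep e :: bool and k and p :: "bool => ('b \<times> nat) mpol"
 assume p: "!!e. (e ~= ep --> p e = 0) & p e \<in> hm V (k - (if e then d - n else 0))"
 show "(e ~= (ep ~= False) --> (if e then Cst c * p e else p e) = 0) &
   (if e then Cst c * p e else p e) \<in> hm V (k - 0 - (if e then d - n else 0))"
  using p[of e] hmg_Cst_mult[of "p e" wt V "k - (if e then d - n else 0)" c] by auto
 show "(e ~= (ep ~= False) --> (if e then Cst (1 / c) * p e else p e) = 0) &
   (if e then Cst (1 / c) * p e else p e) \<in> hm V (k + 0 - (if e then d - n else 0))"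
  using p[of e] hmg_Cst_mult[of "p e" wt V "k - (if e then d - n else 0)" "1 / c"] by auto
qed (simp_all add: distrib_left mult.left_commute)

definition sgn1 :: "bool list => 'r::comm_ring_1" where "sgn1 y = (if par y then - 1 else 1)"

lemma sgn1_simps [simp]: "sgn1 (False # y) = sgn1 y" "sgn1 (True # y) = - sgn1 y" "sgn1 y * sgn1 y = 1"
 by (simp_all add: sgn1_def)
lemma sgn1_mult2 [simp]: "sgn1 y * (sgn1 y * z) = z"
 by (simp flip: mult.assoc)

lemma kd_sgn1: "kd rs (%y. sgn1 y * u y) x = - (sgn1 x * kd rs u x)"
proof (induction rs u x rule: kd.induct)
 case (4 a b d rs u x)
 have "kd rs (%y. - (sgn1 y * u (True # y))) x = sgn1 x * kd rs (%y. u (True # y)) x"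
  by (simp add: kd_uminus 4)
 then show ?case by (simp add: algebra_simps)
qed (simp_all add: algebra_simps)

text \<open>Flipping the first generator changes the sign with which the remaining rows act.
  Multiplication by \<open>sgn1\<close> of the remaining generators anticommutes with their
  differential and restores it. The new second entry \<open>a\<close> has degree
  \<open>2 * n - d\<close>.\<close>

lemma kiso_abswap: "kiso n V True (d - n) ((a, b, d) # rs) ((b, a, 2 * n - d) # rs)"
proof (rule kiso_front1[where f = "%y e p. sgn1 y * p (~ e)" and g = "%y e p. sgn1 y * p (~ e)"])
 show "front1 (%y e p. sgn1 y * p (~ e)) (kd ((a, b, d) # rs) u) (e # y) =
   kd ((b, a, 2 * n - d) # rs) (front1 (%y e p. sgn1 y * p (~ e)) u) (e # y)" for u e y
  by (cases e) (simp_all add: kd_sgn1 algebra_simps)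
next
 fix y :: "bool list" and ep e :: bool and k and p :: "bool => ('a \<times> nat) mpol"
 have s: "sgn1 y * q \<in> hm V l \<longleftrightarrow> q \<in> hm V l" for q :: "('a \<times> nat) mpol" and l
  by (simp add: sgn1_def)
 show "(e ~= (ep ~= True) --> sgn1 y * p (~ e) = 0) &
   sgn1 y * p (~ e) \<in> hm V (k - (d - n) - (if e then 2 * n - d - n else 0))"
  if p: "!!e. (e ~= ep --> p e = 0) & p e \<in> hm V (k - (if e then d - n else 0))"
  using p[of "~ e"] unfolding s by (cases e; cases ep) simp_all
 show "(e ~= (ep ~= True) --> sgn1 y * p (~ e) = 0) &
   sgn1 y * p (~ e) \<in> hm V (k + (d - n) - (if e then d - n else 0))"
  if p: "!!e. (e ~= ep --> p e = 0) & p e \<in> hm V (k - (if e then 2 * n - d - n else 0))"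
  using p[of "~ e"] unfolding s by (cases e; cases ep) (simp_all add: algebra_simps)
qed (simp_all add: distrib_left mult.left_commute)

lemma req_kiso: "req n V dl t rs rs' ==> kiso n V dl t rs rs'"
proof (induction rule: req.induct)
 case (comp dl t rs rs' dl' t' rs'')
 show ?case by (rule kiso_trans[OF comp.IH])
next
 case (transv k d d' c a b a' b' rs)
 then show ?case by (rule kiso_transv)
qed (auto intro: kiso_refl kiso_sym kiso_cong kiso_exch kiso_scale kiso_abswap)


text \<open>Equivalence up to shift of Koszul complexes over possibly different rings. Homogeneity
  of the rows and vanishing of the potentials are built in, so that steps can be chained without
  side conditions.\<close>

definition pkeq :: "int => bool => int => ('m \<times> nat) set => ('m \<times> nat) row list =>
  ('m \<times> nat) set => ('m \<times> nat) row list => bool" where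
 "pkeq n dl t V rs V' rs' \<longleftrightarrow> (\<forall>r\<in>set rs. row_ok n V r) & (\<forall>r\<in>set rs'. row_ok n V' r) &
   pot rs = 0 & pot rs' = 0 & heq n (Kc n V rs) (kd rs) (shf dl t (Kc n V' rs')) (kd rs')"

lemma pkeqD:
 assumes "pkeq n dl t V rs V' rs'"
 shows "\<forall>r\<in>set rs. row_ok n V r" "\<forall>r\<in>set rs'. row_ok n V' r" "pot rs = 0" "pot rs' = 0"
  "heq n (Kc n V rs) (kd rs) (shf dl t (Kc n V' rs')) (kd rs')"
 using assms unfolding pkeq_def by simp_all

lemma pkeq_trans:
 assumes "pkeq n dl t V rs V' rs'" "pkeq n dl' t' V' rs' V'' rs''"
 shows "pkeq n (dl ~= dl') (t + t') V rs V'' rs''"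
proof -
 note 1 = pkeqD[OF assms(1)] and 2 = pkeqD[OF assms(2)]
 have "heq n (Kc n V rs) (kd rs) (shf dl t (shf dl' t' (Kc n V'' rs''))) (kd rs'')"
  by (rule heq_trans[OF cplx_Kc[OF 1(1,3)] cplx_shf[OF cplx_Kc[OF 1(2,4)]]
     cplx_shf[OF cplx_shf[OF cplx_Kc[OF 2(2,4)]]] 1(5) heq_shf[OF 2(5)]])
 then show ?thesis unfolding pkeq_def shf_shf using 1(1,3) 2(2,4) by simp
qed

lemma pkeq_sym:
 assumes "pkeq n dl t V rs V' rs'"
 shows "pkeq n dl (- t) V' rs' V rs"
proof -
 note 1 = pkeqD[OF assms]
 have "heq n (shf dl (- t) (shf dl t (Kc n V' rs'))) (kd rs') (shf dl (- t) (Kc n V rs)) (kd rs)"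
  by (rule heq_shf[OF heq_sym[OF 1(5)]])
 then show ?thesis using 1(1-4) unfolding pkeq_def shf_shf by simp
qed

lemma pkeq_refl:
 assumes "\<forall>r\<in>set rs. row_ok n V r" "pot rs = 0"
 shows "pkeq n False 0 V rs V rs"
proof -
 have "heq n (Kc n V rs) (kd rs) (Kc n V rs) (kd rs)"
 proof (rule heq_iso[where F = "%_ _ x. x" and G = "%_ _ x. x"])
  show "cmap n (Kc n V rs) (kd rs) (Kc n V rs) (kd rs) (%_ _ x. x)" "gmap (Kc n V rs) (Kc n V rs) (%_ _ x. x)"
   by (simp_all add: cmap_def gmap_def lin_ident)
 qed (simp_all add: sub_Kc lin_kd kd_Kc[OF assms(1)])
 then show ?thesis using assms unfolding pkeq_def shf_0 by simp
qed

lemma row_ok_transv: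
 assumes "row_ok n V (a, b, d)" "row_ok n V (a', b', d')" "k \<in> hm V (2 * n - d - d')" "c \<in> hm V (d' - d)"
 shows "row_ok n V (a + k * b' + c * a' - k * c * b, b, d)" "row_ok n V (a' - k * b, b' - c * b, d')"
proof -
 have "k * b' \<in> hm V (2 * n - d)" "c * a' \<in> hm V (2 * n - d)" "k * c * b \<in> hm V (2 * n - d)"
  "k * b \<in> hm V (2 * n - d')" "c * b \<in> hm V d'"
  using assms by (auto simp: row_ok_def intro!: hmg_mult'[of k _ _ _ b'] hmg_mult'[of c _ _ _ a']
    hmg_mult'[of "k * c" _ _ "2 * n - d - d' + (d' - d)" b] hmg_mult[of k _ _ _ c]
    hmg_mult'[of k _ _ _ b] hmg_mult'[of c _ _ _ b])
 then show "row_ok n V (a + k * b' + c * a' - k * c * b, b, d)" "row_ok n V (a' - k * b, b' - c * b, d')"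
  using assms by (auto simp: row_ok_def intro!: hmg_add hmg_diff)
qed

text \<open>An equivalence is needed since the rule \<open>inv\<close> runs derivations backwards; a
  transvection is undone by the one with negated parameters.\<close>

lemma req_row_ok:
 assumes "req n V dl t rs rs'"
 shows "(\<forall>r\<in>set rs. row_ok n V r) \<longleftrightarrow> (\<forall>r\<in>set rs'. row_ok n V r)"
 using assms
proof (induction rule: req.induct)
 case (transv k d d' c a b a' b' rs)
 have e: "row_ok n V (a, b, d) & row_ok n V (a', b', d')"
  if ok: "row_ok n V (a + k * b' + c * a' - k * c * b, b, d)" "row_ok n V (a' - k * b, b' - c * b, d')"
 proof -
  have e1: "a' - k * b - - k * b = a'" "b' - c * b - - c * b = b'"
   "(a + k * b' + c * a' - k * c * b) + - k * (b' - c * b) + - c * (a' - k * b) - (- k) * (- c) * b = a"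
   by (simp_all add: algebra_simps)
  have "- k \<in> hm V (2 * n - d - d')" "- c \<in> hm V (d' - d)" using transv by simp_all
  from row_ok_transv[OF ok this] show ?thesis unfolding e1 by blast
 qed
 have "row_ok n V (a, b, d) & row_ok n V (a', b', d') \<longleftrightarrow>
   row_ok n V (a + k * b' + c * a' - k * c * b, b, d) & row_ok n V (a' - k * b, b' - c * b, d')"
  using e row_ok_transv[of n V a b d a' b' d' k c] transv by metis
 then show ?case unfolding list.set(2) ball_simps by (simp only: conj_assoc[symmetric])
next
 case (scale c a b d rs)
 have e: "Cst c * x \<in> hm V l \<longleftrightarrow> x \<in> hm V l" if "c ~= 0" for c x l
 proof
  assume "Cst c * x \<in> hm V l"
  then have "Cst (1 / c) * (Cst c * x) \<in> hm V l" by (rule hmg_Cst_mult)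
  also have "Cst (1 / c) * (Cst c * x) = x"
   using that by (simp add: mult.assoc[symmetric] Cst_mult[symmetric])
  finally show "x \<in> hm V l" .
 qed (rule hmg_Cst_mult)
 show ?case using e[OF scale] e[of "1 / c"] scale by (simp add: row_ok_def)
qed (auto simp: row_ok_def)

lemma req_pot: "req n V dl t rs rs' ==> pot rs = pot rs'"
proof (induction rule: req.induct)
 case (scale c a b d rs)
 have "Cst c * a * (Cst (1 / c) * b) = (Cst c * Cst (1 / c)) * (a * b)" by (simp only: mult_ac)
 also have "\<dots> = a * b" using scale by (simp add: Cst_mult[symmetric])
 finally show ?case by simp
next
 case (exch r r' rs)
 then show ?case by (cases r; cases r') simp
next
 case (tail dl t rs rs' r)
 then show ?case by (cases r) simp
qed (simp_all add: algebra_simps)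

lemma req_pkeq:
 assumes "req n V dl t rs rs'" "\<forall>r\<in>set rs. row_ok n V r" "pot rs = 0"
 shows "pkeq n dl t V rs V rs'"
proof -
 have ok': "\<forall>r\<in>set rs'. row_ok n V r" "pot rs' = 0"
  using req_row_ok[OF assms(1)] req_pot[OF assms(1)] assms(2,3) by auto
 obtain F G where 1: "length rs = length rs'" "kmap n V dl t rs rs' F" "kmap n V dl (- t) rs' rs G"
   "\<forall>u \<in> supp (length rs). G (F u) = u" "\<forall>u \<in> supp (length rs). F (G u) = u"
  using req_kiso[OF assms(1)] unfolding kiso_def by blast
 have p: "((ep ~= dl) ~= dl) = ep" for ep by auto
 have "heq n (Kc n V rs) (kd rs) (shf dl t (Kc n V rs')) (kd rs')"
 proof (rule heq_iso[where F = "%_ _. F" and G = "%_ _. G"])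
  show "sub (Kc n V rs ep k)" "sub (shf dl t (Kc n V rs') ep k)" for ep k
   by (simp_all add: sub_Kc shf_def)
  show "lin UNIV (kd rs)" "lin UNIV (kd rs')" by (simp_all add: lin_kd)
  show "cmap n (Kc n V rs) (kd rs) (shf dl t (Kc n V rs')) (kd rs') (%_ _. F)"
   unfolding cmap_def gmap_def shf_def
   using kmapD(3)[OF 1(2)] kmapD(4)[OF 1(2) KcD(1)] Rlin_lin[OF kmapD(1)[OF 1(2)]]
   by (auto simp: image_subset_iff)
  show "gmap (shf dl t (Kc n V rs')) (Kc n V rs) (%_ _. G)"
   unfolding gmap_def shf_def
  proof (intro allI conjI)
   fix ep k
   show "lin (Kc n V rs' (ep ~= dl) (k - t)) G" by (rule Rlin_lin[OF kmapD(1)[OF 1(3)]])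
   show "G ` Kc n V rs' (ep ~= dl) (k - t) <= Kc n V rs ep k"
    using kmapD(3)[OF 1(3), of _ "ep ~= dl" "k - t"] unfolding p by auto
  qed
  show "kd rs x \<in> Kc n V rs (~ ep) (k + n)" if "x \<in> Kc n V rs ep k" for x ep k
   by (rule kd_Kc[OF assms(2) that])
  show "kd rs' x \<in> shf dl t (Kc n V rs') (~ ep) (k + n)" if "x \<in> shf dl t (Kc n V rs') ep k" for x ep k
   using cplxD(3)[OF cplx_shf[OF cplx_Kc[OF ok']] that] .
  show "G (F x) = x" if "x \<in> Kc n V rs ep k" for x ep k using 1(4) KcD(1)[OF that] by blast
  show "F (G x) = x" if "x \<in> shf dl t (Kc n V rs') ep k" for x ep k
   using 1(1,5) KcD(1)[of x n V rs'] that by (auto simp: shf_def)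
 qed
 then show ?thesis using assms ok' unfolding pkeq_def by blast
qed

section \<open>Substitution in rows and elimination of a variable\<close>

definition mrow :: "('v mpol => 'w mpol) => 'v row => 'w row" where
 "mrow f = (%(a, b, d). (f a, f b, d))"

lemma mrow_simp [simp]: "mrow f (a, b, d) = (f a, f b, d)"
 by (simp add: mrow_def)

lemma subst_kd: "subst s (kd rs u x) = kd (map (mrow (subst s)) rs) (%y. subst s (u y)) x"
 by (induction rs u x rule: kd.induct) (simp_all add: subst_simps)

lemma subst_pot: "subst s (pot rs) = pot (map (mrow (subst s)) rs)"
proof (induction rs)
 case (Cons r rs)
 then show ?case by (cases r) (simp add: subst_simps)
qed simp

lemma row_ok_subst:
 assumes "row_ok n V r" "!!x. x \<in> V ==> s x \<in> hm V' (wt x)"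
 shows "row_ok n V' (mrow (subst s) r)"
proof -
 obtain a b d where r: "r = (a, b, d)" by (cases r) auto
 show ?thesis using assms(1) hmg_subst[of _ wt V _ s wt V', OF _ assms(2)] by (simp add: r row_ok_def)
qed

lemma mrow_ident:
 assumes "row_ok n V r" "!!x. x \<in> V ==> s x = Var x"
 shows "mrow (subst s) r = r"
proof -
 obtain a b d where r: "r = (a, b, d)" by (cases r) auto
 have "subst s f = f" if "f \<in> hm V e" for f e
  using hmg_pvars[OF that] assms(2) by (intro subst_ident) auto
 then show ?thesis using assms(1) by (auto simp: r row_ok_def)
qed

text \<open>Let \<open>h\<close> be the value of \<open>v\<close> at which the second entry
  \<open>b\<close> vanishes. Keeping the part at the even generator and setting \<open>v\<close> to
  \<open>h\<close> is a chain map, because \<open>b\<close> goes to 0 and \<open>rs\<close> is free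
  of \<open>v\<close>; for the latter reason it is also surjective. Its kernel is acyclic since
  \<open>b\<close> is not a zero divisor, so \<open>heq_surj_acyclic\<close> applies.\<close>

lemma pkeq_elim:
 assumes ok: "\<forall>r\<in>set rs. row_ok n V r" and a: "a \<in> hm (insert v V) (2 * n - wt v)"
  and c: "c ~= 0" and g: "g \<in> hm V (wt v)" and v: "v \<notin> V"
  and p0: "pot ((a, Cst c * Var v + g, wt v) # rs) = 0"
 shows "pkeq n False 0 (insert v V) ((a, Cst c * Var v + g, wt v) # rs) V rs"
proof -
 define b where "b = Cst c * Var v + g"
 define h where "h = Cst (- 1 / c) * g"
 let ?s = "Var(v := h)" and ?V = "insert v V" and ?rs = "(a, b, wt v) # rs"
 have h: "h \<in> hm V (wt v)" unfolding h_def using g by (rule hmg_Cst_mult)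
 have vg: "v \<notin> pvars g" using hmg_pvars[OF g] v by auto
 have b0: "b ~= 0" unfolding b_def by (rule Var_minus_nonzero[OF c vg])
 have b_eq: "b = Cst c * (Var v - h)"
 proof -
  have "Cst c * h = - g" using c unfolding h_def
   by (simp add: mult.assoc[symmetric] Cst_mult[symmetric] Cst_minus)
  then show ?thesis by (simp add: b_def right_diff_distrib)
 qed
 have fix1: "subst ?s f = f" if "f \<in> hm V e" for f e
  using hmg_pvars[OF that] v by (intro subst_ident) auto
 have sb: "subst ?s b = 0" unfolding b_eq using fix1[OF h] by (simp add: subst_simps)
 have bV: "b \<in> hm ?V (wt v)" unfolding b_def
  using hmg_mono[OF g, of ?V] by (intro hmg_add hmg_Cst_mult hmg_Var) auto
 have okV: "\<forall>r\<in>set rs. row_ok n ?V r"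
  using ok unfolding row_ok_def by (auto intro: hmg_mono[of _ _ V])
 have ok': "\<forall>r\<in>set ?rs. row_ok n ?V r" using okV a bV by (simp add: row_ok_def)
 have fixr: "map (mrow (subst ?s)) rs = rs"
 proof (rule map_idI)
  fix r assume "r \<in> set rs"
  then show "mrow (subst ?s) r = r" using ok v by (intro mrow_ident[of n V]) auto
 qed
 have pot': "pot ?rs = 0" using p0 by (simp add: b_def)
 have pot_rs: "pot rs = 0"
 proof -
  have "subst ?s (pot rs) = pot rs" using subst_pot[of ?s rs] fixr by simp
  moreover have "subst ?s (pot ?rs) = 0" using pot' by simp
  ultimately show ?thesis using sb by (simp add: subst_simps)
 qed
 define F where "F u = (%x. subst ?s (u (False # x)))" for u :: "bool list => ('a \<times> nat) mpol"
 have KV: "Kc n V rs ep k <= Kc n ?V rs ep k" for ep k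
  by (auto simp: Kc_def intro: hmg_mono[of _ _ V])
 have "heq n (Kc n ?V ?rs) (kd ?rs) (Kc n V rs) (kd rs)"
 proof (rule heq_surj_acyclic[where F = F])
  show "cplx n (Kc n ?V ?rs) (kd ?rs)" by (rule cplx_Kc[OF ok' pot'])
  show "cplx n (Kc n V rs) (kd rs)" by (rule cplx_Kc[OF ok pot_rs])
  show "lin UNIV F" by (simp add: lin_def F_def fun_eq_iff subst_simps scl_def)
  show "F u \<in> Kc n V rs ep k" if u: "u \<in> Kc n ?V ?rs ep k" for u ep k
  proof (rule KcI)
   note u0 = Kc_slice[OF u, of False]
   show "F u \<in> supp (length rs)" using KcD(1)[OF u0] by (simp add: supp_def F_def)
   fix x :: "bool list" assume x: "length x = length rs"
   show "F u x = 0" if "par x ~= ep" using KcD(2)[OF u0 x] that by (simp add: F_def)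
   show "F u x \<in> hm V (k - qd n rs x)"
    using hmg_subst_fresh[OF _ h, of "u (False # x)" "k - qd n rs x"] KcD(3)[OF u0 x] by (simp add: F_def)
  qed
  show "F (kd ?rs u) = kd rs (F u)" for u
   unfolding F_def by (simp add: fun_eq_iff subst_simps sb subst_kd fixr)
  show "Kc n V rs ep k <= F ` Kc n ?V ?rs ep k" for ep k
  proof
   fix u assume u: "u \<in> Kc n V rs ep k"
   define w where "w x = (case x of False # y => u y | _ => 0)" for x
   have "w \<in> Kc n ?V ?rs ep k"
   proof (rule Kc_cons)
    fix e
    show "(%x. w (e # x)) \<in> Kc n ?V rs (ep ~= e) (k - (if e then wt v - n else 0))"
     using u KV subD(1)[OF sub_Kc] by (cases e) (auto simp: w_def zero_fun_def)
   qed (simp add: w_def)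
   moreover have "F w = u"
   proof
    fix x
    show "F w x = u x"
     using KcD(1,3)[OF u] fix1 by (cases "length x = length rs") (auto simp: F_def w_def suppD)
   qed
   ultimately show "u \<in> F ` Kc n ?V ?rs ep k" by blast
  qed
  fix ep k u assume u: "u \<in> Kc n ?V ?rs ep k" and Fu: "F u = 0" and du: "kd ?rs u = 0"
  note u0 = Kc_slice[OF u, of False, simplified]
  \<comment> \<open>In the kernel the even part is divisible by \<open>b\<close>. The quotient,
    placed at the odd generator, will be the preimage under the differential; it is set to 0
    wherever the coefficient has to vanish, so that it stays in the right graded piece.\<close>
  have "\<exists>q. (length x = length rs --> q \<in> hm ?V (k - n - (wt v - n) - qd n rs x)) &
    (length x ~= length rs \<or> par x ~= ep --> q = 0) & u (False # x) = b * q" for x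
  proof (cases "length x ~= length rs \<or> par x ~= ep")
   case True
   then have "u (False # x) = 0" using KcD(1,2)[OF u0] suppD by blast
   then show ?thesis using True by (intro exI[of _ 0]) auto
  next
   case False
   then have "u (False # x) \<in> hm ?V (k - qd n rs x)" using KcD(3)[OF u0] by auto
   moreover have "h \<in> hm ?V (wt v)" using h by (rule hmg_mono) auto
   ultimately obtain q where q: "q \<in> hm ?V (k - qd n rs x - wt v)"
    "u (False # x) - subst ?s (u (False # x)) = (Var v - h) * q"
    using factor_theorem[of "u (False # x)" wt ?V "k - qd n rs x" h v] by auto
   have "subst ?s (u (False # x)) = 0" using Fu by (simp add: F_def fun_eq_iff)
   then have "u (False # x) = (Cst c * Cst (1 / c)) * ((Var v - h) * q)"
    using q(2) c by (simp add: Cst_mult[symmetric])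
   also have "\<dots> = b * (Cst (1 / c) * q)" unfolding b_eq by (simp only: mult_ac)
   finally show ?thesis using hmg_Cst_mult[OF q(1), of "1 / c"] False
    by (intro exI[of _ "Cst (1 / c) * q"]) (simp add: algebra_simps)
  qed
  then obtain q where q: "!!x. length x = length rs ==> q x \<in> hm ?V (k - n - (wt v - n) - qd n rs x)"
    "!!x. length x ~= length rs \<or> par x ~= ep ==> q x = 0" "!!x. u (False # x) = b * q x"
   by metis
  define y where "y x = (case x of True # z => q z | _ => 0)" for x
  have qK: "q \<in> Kc n ?V rs ep (k - n - (wt v - n))"
   using q by (intro KcI) (auto simp: supp_def)
  have "y \<in> Kc n ?V ?rs (~ ep) (k - n)"
  proof (rule Kc_cons)
   fix e
   show "(%x. y (e # x)) \<in> Kc n ?V rs ((~ ep) ~= e) (k - n - (if e then wt v - n else 0))"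
    using qK subD(1)[OF sub_Kc] by (cases e) (auto simp: y_def zero_fun_def)
  qed (simp add: y_def)
  moreover have "F y = 0" by (simp add: F_def y_def fun_eq_iff)
  moreover have "kd ?rs y = u"
  proof
   fix x
   show "kd ?rs y x = u x"
   proof (cases x)
    case Nil
    then show ?thesis using KcD(1)[OF u] by (simp add: supp_def)
   next
    case (Cons e z)
    show ?thesis
    proof (cases e)
     case True
     \<comment> \<open>The even part of the cycle condition determines the odd part of
       \<open>u\<close> after \<open>b\<close> is cancelled.\<close>
     have "0 = kd ?rs u (False # z)" using du by simp
     also have "\<dots> = b * u (True # z) + kd rs (%x. b * q x) z" by (simp add: q(3))
     also have "\<dots> = b * (u (True # z) + kd rs q z)" by (simp add: kd_smult distrib_left)
     finally have "u (True # z) = - kd rs q z"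
      using mpol_no_zero_divisors b0 by (metis eq_neg_iff_add_eq_0)
     then show ?thesis using Cons True by (simp add: y_def)
    next
     case False
     then show ?thesis using Cons by (simp add: y_def kd_0 q(3))
    qed
   qed
  qed
  ultimately show "\<exists>y\<in>Kc n ?V ?rs (~ ep) (k - n). F y = 0 & kd ?rs y = u" by blast
 qed
 then show ?thesis unfolding pkeq_def using ok ok' pot' pot_rs by (simp add: b_def)
qed

text \<open>Row equivalences can be derived over a universal ring and then specialized.\<close>

lemma req_subst:
 assumes "req n V dl t rs rs'" "!!x. x \<in> V ==> s x \<in> hm V' (wt x)"
 shows "req n V' dl t (map (mrow (subst s)) rs) (map (mrow (subst s)) rs')"
 using assms(1)
proof (induction rule: req.induct)
 case (transv k d d' c a b a' b' rs)
 have "req n V' False 0 (map (mrow (subst s)) ((a, b, d) # (a', b', d') # rs))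
   ((subst s a + subst s k * subst s b' + subst s c * subst s a' - subst s k * subst s c * subst s b, subst s b, d) #
   (subst s a' - subst s k * subst s b, subst s b' - subst s c * subst s b, d') # map (mrow (subst s)) rs)"
  unfolding list.map mrow_simp
  using hmg_subst[OF transv(1), of s wt V'] hmg_subst[OF transv(2), of s wt V'] assms(2)
  by (intro req.transv) auto
 then show ?case by (simp add: subst_simps)
next
 case (scale c a b d rs)
 have "req n V' False 0 (map (mrow (subst s)) ((a, b, d) # rs))
   ((Cst c * subst s a, Cst (1 / c) * subst s b, d) # map (mrow (subst s)) rs)"
  unfolding list.map mrow_simp by (rule req.scale[OF scale])
 then show ?case by (simp add: subst_simps)
next
 case (comp dl t rs rs' dl' t' rs'')
 then show ?case by (intro req.comp)
qed (auto intro: req.intros)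

subsection \<open>Derived row operations\<close>

lemma req_trans0: "req n V False 0 rs rs' ==> req n V False 0 rs' rs'' ==> req n V False 0 rs rs''"
 using req.comp[of n V False 0 rs rs' False 0 rs''] by simp
lemma req_sym0: "req n V False 0 rs rs' ==> req n V False 0 rs' rs"
 using req.inv[of n V False 0 rs rs'] by simp
lemma req_trans1: "req n V False 0 rs rs' ==> req n V dl t rs' rs'' ==> req n V dl t rs rs''"
 using req.comp[of n V False 0 rs rs' dl t rs''] by simp
lemma req_trans2: "req n V dl t rs rs' ==> req n V False 0 rs' rs'' ==> req n V dl t rs rs''"
 using req.comp[of n V dl t rs rs' False 0 rs''] by simp

lemma req_append_left: "req n V dl t rs rs' ==> req n V dl t (xs @ rs) (xs @ rs')"
 by (induction xs) (auto intro: req.tail)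

lemma req_append_right: "req n V dl t rs rs' ==> req n V dl t (rs @ ys) (rs' @ ys)"
proof (induction rule: req.induct)
 case (comp dl t rs rs' dl' t' rs'')
 then show ?case by (intro req.comp)
next
 case (transv k d d' c a b a' b' rs)
 then show ?case unfolding append_Cons by (intro req.transv)
qed (auto intro: req.intros)

lemma req_move: "req n V False 0 (xs @ r # ys) (r # xs @ ys)"
proof (induction xs)
 case Nil
 show ?case by (simp add: req.ident)
next
 case (Cons x xs)
 have "req n V False 0 (x # xs @ r # ys) (x # r # xs @ ys)" by (rule req.tail[OF Cons])
 moreover have "req n V False 0 (x # r # xs @ ys) (r # x # xs @ ys)" by (rule req.exch)
 ultimately show ?case by (simp add: req_trans0)
qed

lemma req_perm: "mset rs = mset rs' ==> req n V False 0 rs rs'"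
proof (induction rs arbitrary: rs')
 case Nil
 then show ?case by (simp add: req.ident)
next
 case (Cons r rs)
 then have "r \<in> set rs'" by (metis list.set_intros(1) set_mset_mset)
 then obtain xs ys where rs': "rs' = xs @ r # ys" by (meson split_list)
 then have "mset rs = mset (xs @ ys)" using Cons.prems by simp
 then have "req n V False 0 (r # rs) (r # xs @ ys)" by (intro req.tail Cons.IH)
 moreover have "req n V False 0 (r # xs @ ys) rs'" unfolding rs' by (rule req_sym0[OF req_move])
 ultimately show ?case by (rule req_trans0)
qed

lemma req_abswap_all:
 "req n V (odd (length rs)) (\<Sum>(a, b, d)\<leftarrow>rs. d - n) rs (map (%(a, b, d). (b, a, 2 * n - d)) rs)"
proof (induction rs)
 case Nil
 show ?case by (simp add: req.ident)
next
 case (Cons r rs)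
 obtain a b d where r: "r = (a, b, d)" by (cases r) auto
 have "req n V (True ~= odd (length rs)) (d - n + (\<Sum>(a, b, d)\<leftarrow>rs. d - n)) (r # rs)
   ((b, a, 2 * n - d) # map (%(a, b, d). (b, a, 2 * n - d)) rs)"
  unfolding r by (rule req.comp[OF req.abswap req.tail[OF Cons]])
 then show ?case by (simp add: r)
qed

text \<open>One row serves as pivot for all others. Its own first entry is left unspecified; where
  it matters it is recovered from the potential.\<close>

lemma req_transv_all:
 assumes "!!j. j \<in> set js ==> k j \<in> hm V (2 * n - d - D j)" "!!j. j \<in> set js ==> c j \<in> hm V (D j - d)"
 shows "\<exists>a'. req n V False 0 ((a, b, d) # map (%j. (A j, B j, D j)) js)
   ((a', b, d) # map (%j. (A j - k j * b, B j - c j * b, D j)) js)"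
 using assms
proof (induction js arbitrary: a)
 case Nil
 show ?case by (auto intro: req.ident)
next
 case (Cons j js)
 let ?s = "(A j - k j * b, B j - c j * b, D j)"
 let ?a = "a + k j * B j + c j * A j - k j * c j * b"
 let ?M = "map (%j. (A j - k j * b, B j - c j * b, D j)) js"
 obtain a' where a': "req n V False 0 ((?a, b, d) # map (%j. (A j, B j, D j)) js) ((a', b, d) # ?M)"
  using Cons.IH[of ?a] Cons.prems by auto
 have "req n V False 0 ((a, b, d) # (A j, B j, D j) # map (%j. (A j, B j, D j)) js)
   ((?a, b, d) # ?s # map (%j. (A j, B j, D j)) js)"
  using Cons.prems by (intro req.transv) auto
 also have "req n V False 0 \<dots> (?s # (?a, b, d) # map (%j. (A j, B j, D j)) js)" by (rule req.exch)
 also (req_trans0) have "req n V False 0 \<dots> (?s # (a', b, d) # ?M)" by (rule req.tail[OF a'])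
 also (req_trans0) have "req n V False 0 \<dots> ((a', b, d) # ?s # ?M)" by (rule req.exch)
 finally (req_trans0) show ?case by auto
qed

lemma pot_map: "pot (map (%j. (A j, B j, D j)) js) = (\<Sum>j\<leftarrow>js. A j * B j)"
 by (induction js) simp_all

text \<open>The differences of the first entries are a syzygy of the second entries. For a regular
  sequence every syzygy is a combination of Koszul syzygies, and those are realized by
  transvections. Regularity takes a concrete form here: each second entry is monic and linear in a
  variable of its own that the later ones do not contain, so dividing it out is a substitution that
  fixes the later ones.\<close>

lemma req_twist:
 fixes V :: "('m \<times> nat) set"
 assumes "!!j. j \<in> set js ==> B j = Var (v j) - f j & v j \<in> V & f j \<in> hm V (wt (v j)) & v j \<notin> pvars (f j)"
  and "sorted_wrt (%i j. v i \<notin> pvars (B j)) js"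
  and "!!j. j \<in> set js ==> A j \<in> hm V (2 * n - wt (v j)) & A' j \<in> hm V (2 * n - wt (v j))"
  and "(\<Sum>j\<leftarrow>js. A j * B j) = (\<Sum>j\<leftarrow>js. A' j * B j)"
 shows "req n V False 0 (map (%j. (A j, B j, wt (v j))) js) (map (%j. (A' j, B j, wt (v j))) js)"
 using assms
proof (induction js arbitrary: A A')
 case Nil
 show ?case by (simp add: req.ident)
next
 case (Cons i js)
 let ?s = "Var(v i := f i)"
 define c where "c j = A j - A' j" for j
 have i: "B i = Var (v i) - f i" "v i \<in> V" "f i \<in> hm V (wt (v i))" "v i \<notin> pvars (f i)"
  using Cons.prems(1) by auto
 have cV: "c j \<in> hm V (2 * n - wt (v j))" if "j \<in> set (i # js)" for j
  using Cons.prems(3)[OF that] by (auto simp: c_def intro: hmg_diff)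
 have sV: "?s x \<in> hm V (wt x)" if "x \<in> V" for x
  using i that by (cases "x = v i") (auto intro: hmg_Var)
 have scV: "subst ?s (c j) \<in> hm V (2 * n - wt (v j))" if "j \<in> set (i # js)" for j
  by (rule hmg_subst[OF cV[OF that] sV])
 have "\<exists>q \<in> hm V (2 * n - wt (v j) - wt (v i)). c j - subst ?s (c j) = (Var (v i) - f i) * q"
  if "j \<in> set js" for j
  using that by (intro factor_theorem cV i) auto
 then obtain q where q: "!!j. j \<in> set js ==> q j \<in> hm V (2 * n - wt (v j) - wt (v i))"
  "!!j. j \<in> set js ==> c j - subst ?s (c j) = B i * q j"
  unfolding i(1) by metis
 have sB: "subst ?s (B i) = 0" "!!j. j \<in> set js ==> subst ?s (B j) = B j"
 proof -
  have "subst ?s (f i) = f i" using i by (intro subst_ident) auto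
  then show "subst ?s (B i) = 0" by (simp add: i(1) subst_simps)
  show "subst ?s (B j) = B j" if "j \<in> set js" for j
   using Cons.prems(2) that by (intro subst_ident) auto
 qed
 \<comment> \<open>The part of each difference that is divisible by \<open>B i\<close> is moved into
   the first row; the second entries stay as they are, hence the parameter 0.\<close>
 obtain a' where a': "req n V False 0 ((A i, B i, wt (v i)) # map (%j. (A j, B j, wt (v j))) js)
   ((a', B i, wt (v i)) # map (%j. (A j - q j * B i, B j - 0 * B i, wt (v j))) js)"
  using req_transv_all[of js q V n "wt (v i)" "%j. wt (v j)" "%_. 0" "A i" "B i" A B] q(1)
  by (auto simp: algebra_simps)
 have m1: "map (%j. (A j - q j * B i, B j - 0 * B i, wt (v j))) js =
   map (%j. (A' j + subst ?s (c j), B j, wt (v j))) js"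
 proof (rule map_cong[OF refl])
  fix j assume "j \<in> set js"
  then have "A j - A' j - subst ?s (c j) = B i * q j" using q(2)[of j] by (simp add: c_def)
  then show "(A j - q j * B i, B j - 0 * B i, wt (v j)) = (A' j + subst ?s (c j), B j, wt (v j))"
   by (simp add: algebra_simps)
 qed
 have sum0: "c i * B i + (\<Sum>j\<leftarrow>js. c j * B j) = 0"
 proof -
  have "(\<Sum>j\<leftarrow>js. c j * B j) = (\<Sum>j\<leftarrow>js. A j * B j) - (\<Sum>j\<leftarrow>js. A' j * B j)"
   by (simp add: c_def left_diff_distrib sum_list_subtractf)
  moreover have "c i * B i = A i * B i - A' i * B i" by (simp add: c_def left_diff_distrib)
  moreover have "x - x' + (S - S') = 0" if "x + S = x' + S'" for x x' S S' :: "('m \<times> nat) mpol"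
   using that by (simp add: algebra_simps)
  ultimately show ?thesis using Cons.prems(4) by simp
 qed
 have "subst ?s (\<Sum>j\<leftarrow>l. c j * B j) = (\<Sum>j\<leftarrow>l. subst ?s (c j) * B j)" if "set l <= set js" for l
  using that by (induction l) (simp_all add: subst_simps sB)
 \<comment> \<open>Substituting the zero of \<open>B i\<close> kills its term, so what remains of
   the differences is a syzygy of the shorter sequence.\<close>
 then have sum1: "(\<Sum>j\<leftarrow>js. subst ?s (c j) * B j) = 0"
  using arg_cong[OF sum0, of "subst ?s"] by (simp add: subst_simps sB)
 have r2: "req n V False 0 (map (%j. (A' j + subst ?s (c j), B j, wt (v j))) js) (map (%j. (A' j, B j, wt (v j))) js)"
 proof (rule Cons.IH)
  show "sorted_wrt (%i j. v i \<notin> pvars (B j)) js" using Cons.prems(2) by simp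
  show "(\<Sum>j\<leftarrow>js. (A' j + subst ?s (c j)) * B j) = (\<Sum>j\<leftarrow>js. A' j * B j)"
   by (simp add: distrib_right sum_list_addf sum1)
  show "A' j + subst ?s (c j) \<in> hm V (2 * n - wt (v j)) & A' j \<in> hm V (2 * n - wt (v j))" if "j \<in> set js" for j
   using Cons.prems(3) scV that by (auto intro: hmg_add)
 qed (use Cons.prems(1) in auto)
 have r3: "req n V False 0 (map (%j. (A j, B j, wt (v j))) (i # js))
   ((a', B i, wt (v i)) # map (%j. (A' j, B j, wt (v j))) js)"
  using req_trans0[OF a'[unfolded m1] req.tail[OF r2]] by simp
 \<comment> \<open>The unknown first entry of the pivot row is now forced by the potential, because
   \<open>B i\<close> is not zero.\<close>
 have "pot (map (%j. (A j, B j, wt (v j))) (i # js)) = a' * B i + (\<Sum>j\<leftarrow>js. A' j * B j)"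
  using req_pot[OF r3] by (simp add: pot_map)
 then have "(a' - A' i) * B i = 0"
  using Cons.prems(4) by (simp add: pot_map algebra_simps)
 moreover have "B i ~= 0" using Var_minus_nonzero[of 1 "v i" "- f i"] i by simp
 ultimately have "a' = A' i" using mpol_no_zero_divisors by fastforce
 then show ?case using r3 by simp
qed

lemma upt_split:
 assumes "i < m"
 shows "[1..<Suc m] = [1..<Suc i] @ Suc i # [Suc (Suc i)..<Suc m]"
proof -
 have "[1..<Suc i + (m - i)] = [1..<Suc i] @ [Suc i..<Suc i + (m - i)]"
  by (rule upt_add_eq_append) simp
 moreover have "Suc i + (m - i) = Suc m" using assms by simp
 ultimately have "[1..<Suc m] = [1..<Suc i] @ [Suc i..<Suc m]" by (simp only:)
 also have "[Suc i..<Suc m] = Suc i # [Suc (Suc i)..<Suc m]" using assms by (intro upt_conv_Cons) simp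
 finally show ?thesis .
qed

text \<open>Gaussian elimination by columns: as soon as row i has second entry \<open>bt i\<close>,
  its multiples are subtracted from the later rows. A transvection of this kind changes only the
  first entry of the pivot, and only rows up to \<open>r\<close> become pivots, so the rows after
  \<open>r\<close> keep their first entries while their second entries are reduced to 0.\<close>

lemma req_triangular:
 fixes V :: "('m \<times> nat) set" and T :: "nat => nat => ('m \<times> nat) mpol"
 assumes "r <= m"
  and B: "!!j. j \<in> {1..m} ==> B j = (\<Sum>l=1..min j r. T j l * bt l)"
  and T1: "!!j. j \<in> {1..r} ==> T j j = Cst (c j) & c j ~= 0"
  and T: "!!j l. 1 <= l ==> l < j ==> j <= m ==> l <= r ==> T j l \<in> hm V (D j - D l)"
 shows "\<exists>A'. (\<forall>j. r < j --> A' j = A j) &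
   req n V False 0 (map (%j. (A j, B j, D j)) [1..<Suc m])
    (map (%j. (A' j, if j <= r then bt j else 0, D j)) [1..<Suc m])"
proof -
 \<comment> \<open>The state after \<open>i\<close> columns: rows up to \<open>i\<close> are
   finished, and the later ones have lost the summands of index at most \<open>i\<close>.\<close>
 define Bi where "Bi i j = (if j <= i then bt j else \<Sum>l=Suc i..min j r. T j l * bt l)" for i j
 have "i <= r ==> \<exists>A'. (\<forall>j. r < j --> A' j = A j) &
   req n V False 0 (map (%j. (A j, B j, D j)) [1..<Suc m]) (map (%j. (A' j, Bi i j, D j)) [1..<Suc m])" for i
 proof (induction i)
  case 0
  have e: "map (%j. (A j, B j, D j)) [1..<Suc m] = map (%j. (A j, Bi 0 j, D j)) [1..<Suc m]"
   using B by (intro map_cong) (auto simp: Bi_def simp del: upt_Suc)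
  show ?case by (rule exI[of _ A]) (simp only: e req.ident simp_thms)
 next
  case (Suc i)
  then obtain A1 where A1: "\<forall>j. r < j --> A1 j = A j"
   "req n V False 0 (map (%j. (A j, B j, D j)) [1..<Suc m]) (map (%j. (A1 j, Bi i j, D j)) [1..<Suc m])"
   by auto
  let ?k = "Suc i" and ?js = "[Suc (Suc i)..<Suc m]" and ?P = "map (%j. (A1 j, Bi i j, D j)) [1..<Suc i]"
  have im: "i < m" using Suc assms(1) by simp
  have ck: "T ?k ?k = Cst (c ?k)" "c ?k ~= 0" using T1[of ?k] Suc.prems by auto
  have Bk: "Bi i ?k = Cst (c ?k) * bt ?k" using Suc.prems ck by (simp add: Bi_def)
  have sc: "req n V False 0 ((A1 ?k, Bi i ?k, D ?k) # map (%j. (A1 j, Bi i j, D j)) ?js)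
    ((Cst (c ?k) * A1 ?k, bt ?k, D ?k) # map (%j. (A1 j, Bi i j, D j)) ?js)"
  proof -
   have "Cst (1 / c ?k) * Bi i ?k = bt ?k"
    unfolding Bk using ck(2) by (simp add: mult.assoc[symmetric] Cst_mult[symmetric])
   then show ?thesis using req.scale[OF ck(2), of n V "A1 ?k" "Bi i ?k" "D ?k"] by simp
  qed
  have tk: "T j ?k \<in> hm V (D j - D ?k)" if "j \<in> set ?js" for j
   using that Suc.prems by (intro T) auto
  obtain a' where a': "req n V False 0 ((Cst (c ?k) * A1 ?k, bt ?k, D ?k) # map (%j. (A1 j, Bi i j, D j)) ?js)
    ((a', bt ?k, D ?k) # map (%j. (A1 j - 0 * bt ?k, Bi i j - T j ?k * bt ?k, D j)) ?js)"
   using req_transv_all[of ?js "%_. 0" V n "D ?k" D "%j. T j ?k" "Cst (c ?k) * A1 ?k" "bt ?k" A1 "Bi i"] tk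
   by (auto simp del: upt_Suc)
  define A2 where "A2 = A1(?k := a')"
  have split: "map (%j. (X j, Y j, D j)) [1..<Suc m] = map (%j. (X j, Y j, D j)) [1..<Suc i] @
   (X ?k, Y ?k, D ?k) # map (%j. (X j, Y j, D j)) ?js" for X Y :: "nat => ('m \<times> nat) mpol"
   unfolding upt_split[OF im] by (simp del: upt_Suc)
  have e1: "map (%j. (A2 j, Bi ?k j, D j)) [1..<Suc i] = ?P"
   by (intro map_cong) (auto simp: A2_def Bi_def simp del: upt_Suc)
  have e2: "map (%j. (A2 j, Bi ?k j, D j)) ?js =
    map (%j. (A1 j - 0 * bt ?k, Bi i j - T j ?k * bt ?k, D j)) ?js"
  proof (rule map_cong[OF refl])
   fix j assume j: "j \<in> set ?js"
   have "(\<Sum>l=Suc i..min j r. T j l * bt l) = T j ?k * bt ?k + (\<Sum>l=Suc ?k..min j r. T j l * bt l)"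
    using j Suc.prems by (subst sum.atLeast_Suc_atMost) (auto simp del: upt_Suc)
   then show "(A2 j, Bi ?k j, D j) = (A1 j - 0 * bt ?k, Bi i j - T j ?k * bt ?k, D j)"
    using j by (simp add: A2_def Bi_def del: upt_Suc)
  qed
  have "req n V False 0 (map (%j. (A1 j, Bi i j, D j)) [1..<Suc m]) (map (%j. (A2 j, Bi ?k j, D j)) [1..<Suc m])"
   unfolding split e1 e2 using req_append_left[OF req_trans0[OF sc a'], of ?P]
   by (simp add: A2_def Bi_def del: upt_Suc)
  then show ?case using A1 Suc.prems by (intro exI[of _ A2]) (auto simp: A2_def intro: req_trans0)
 qed
 from this[of r] obtain A' where A': "\<forall>j. r < j --> A' j = A j"
  "req n V False 0 (map (%j. (A j, B j, D j)) [1..<Suc m]) (map (%j. (A' j, Bi r j, D j)) [1..<Suc m])"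
  by auto
 have "Bi r j = (if j <= r then bt j else 0)" for j by (simp add: Bi_def)
 then show ?thesis using A' by auto
qed

lemma req_addrows:
 fixes V :: "('m \<times> nat) set"
 shows "req n V False 0 (map (%j. (A j, B j, D j)) js @ map (%j. (A' j, B' j, D j)) js)
   (map (%j. (A j, B j + B' j, D j)) js @ map (%j. (A' j - A j, B' j, D j)) js)"
proof (induction js)
 case Nil
 show ?case by (simp add: req.ident)
next
 case (Cons j js)
 let ?R = "map (%j. (A j, B j, D j)) js" and ?R' = "map (%j. (A' j, B' j, D j)) js"
 let ?Q = "map (%j. (A j, B j + B' j, D j)) js" and ?Q' = "map (%j. (A' j - A j, B' j, D j)) js"
 have "req n V False 0 (map (%j. (A j, B j, D j)) (j # js) @ map (%j. (A' j, B' j, D j)) (j # js))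
   ((A' j, B' j, D j) # (A j, B j, D j) # ?R @ ?R')"
  by (rule req_perm) simp
 also have "req n V False 0 \<dots> ((A' j + 0 * B j + (- 1) * A j - 0 * (- 1) * B' j, B' j, D j) #
   (A j - 0 * B' j, B j - (- 1) * B' j, D j) # ?R @ ?R')"
  by (rule req.transv) simp_all
 also (req_trans0) have "req n V False 0 \<dots> ((A' j - A j, B' j, D j) # (A j, B j + B' j, D j) # ?Q @ ?Q')"
  using req.tail[OF req.tail[OF Cons]] by simp
 also (req_trans0) have "req n V False 0 \<dots>
   (map (%j. (A j, B j + B' j, D j)) (j # js) @ map (%j. (A' j - A j, B' j, D j)) (j # js))"
  by (rule req_perm) simp
 finally (req_trans0) show ?case .
qed

section \<open>Power sums as functions of elementary symmetric polynomials\<close>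

text \<open>A tuple of elementary symmetric polynomials \<open>E\<^sub>1, E\<^sub>2, \<dots>\<close> is encoded by the series
 \<open>1 + E\<^sub>1 t + E\<^sub>2 t\<^sup>2 + \<dots>\<close>; disjoint union of alphabets becomes multiplication. The power sums are
 read off the logarithmic derivative.\<close>

abbreviation cf :: "'r::zero fps => nat => 'r" where "cf \<equiv> fps_nth"

text \<open>A right inverse replaces division, the coefficients forming only a ring; it is an
  inverse when the constant coefficient is 1.\<close>

definition lgd :: "'r::comm_ring_1 fps => 'r fps" where
 "lgd L = fps_deriv L * fps_right_inverse L 1"

text \<open>For a product of factors 1 + x t the logarithmic derivative is the sum of x / (1 + x t),
  in which the power sum of exponent n appears at t^(n - 1) with sign (-1)^(n - 1).\<close>

definition psum :: "nat => 'r::comm_ring_1 fps => 'r" where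
 "psum n L = (- 1) ^ (n - 1) * cf (lgd L) (n - 1)"

lemma lgd_eq: "cf L 0 = 1 ==> L * lgd L = fps_deriv L"
 using fps_right_inverse[of L 1] by (simp add: lgd_def mult.left_commute[of L])

lemma fps_unit_cancel:
 fixes L :: "'r::comm_ring_1 fps"
 assumes "cf L 0 = 1" "L * X = L * Y"
 shows "X = Y"
proof -
 have "fps_right_inverse L 1 * (L * X) = fps_right_inverse L 1 * (L * Y)" using assms by simp
 moreover have "fps_right_inverse L 1 * L = 1"
  using fps_right_inverse[of L 1] assms by (simp add: mult.commute)
 ultimately show ?thesis by (simp add: mult.assoc[symmetric])
qed

lemma lgd_unique: "cf L 0 = 1 ==> L * X = fps_deriv L ==> lgd L = X"
 using fps_unit_cancel[of L] lgd_eq[of L] by metis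

lemma lgd_mult:
 assumes "cf L 0 = 1" "cf M 0 = 1"
 shows "lgd (L * M) = lgd L + lgd M"
proof (rule lgd_unique)
 have "L * M * (lgd L + lgd M) = (L * lgd L) * M + L * (M * lgd M)" by (simp add: algebra_simps)
 also have "\<dots> = fps_deriv (L * M)" by (simp add: lgd_eq assms algebra_simps)
 finally show "L * M * (lgd L + lgd M) = fps_deriv (L * M)" .
qed (simp add: assms)

lemma psum_mult: "cf L 0 = 1 ==> cf M 0 = 1 ==> psum n (L * M) = psum n L + psum n M"
 by (simp add: psum_def lgd_mult distrib_left)

lemma psum_1 [simp]: "psum n 1 = 0"
 using psum_mult[of 1 1 n] by simp

lemma cf_prod_0: "(!!a. a \<in> A ==> cf (f a) 0 = 1) ==> cf (prod f A) 0 = (1 :: 'r::comm_ring_1)"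
 by (induction A rule: infinite_finite_induct) auto

lemma psum_prod: "(!!a. a \<in> A ==> cf (f a) 0 = 1) ==> psum n (prod f A) = (\<Sum>a\<in>A. psum n (f a))"
proof (induction A rule: infinite_finite_induct)
 case (insert x F)
 have "cf (prod f F) 0 = 1" using insert.prems by (intro cf_prod_0) auto
 then show ?case using insert by (simp add: psum_mult)
qed auto

lemma lgd_nth:
 assumes "cf L 0 = 1"
 shows "cf (lgd L) k = of_nat (Suc k) * cf L (Suc k) - (\<Sum>i=1..k. cf L i * cf (lgd L) (k - i))"
proof -
 have "cf (L * lgd L) k = of_nat (Suc k) * cf L (Suc k)" by (simp add: lgd_eq assms)
 moreover have "cf (L * lgd L) k = cf (lgd L) k + (\<Sum>i=1..k. cf L i * cf (lgd L) (k - i))"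
  unfolding fps_mult_nth by (subst sum.atLeast_Suc_atMost) (simp_all add: assms)
 ultimately show ?thesis by (simp add: eq_diff_eq)
qed

lemma lgd_cong:
 assumes "cf L 0 = 1" "cf M 0 = 1" "!!i. i <= m ==> cf L i = cf M i"
 shows "k < m ==> cf (lgd L) k = cf (lgd M) k"
proof (induction k rule: less_induct)
 case (less k)
 have "(\<Sum>i=1..k. cf L i * cf (lgd L) (k - i)) = (\<Sum>i=1..k. cf M i * cf (lgd M) (k - i))"
  using less assms(3) by (intro sum.cong refl arg_cong2[of _ _ _ _ "(*)"]) auto
 then show ?case using less.prems assms(3)[of "Suc k"] lgd_nth[OF assms(1), of k] lgd_nth[OF assms(2), of k] by simp
qed

text \<open>Newton's identity: the top variable enters linearly.\<close>

lemma psum_top: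
 fixes L :: "'r::comm_ring_1 fps"
 assumes "cf L 0 = 1" "cf M 0 = 1" "!!i. i <= k ==> cf L i = cf M i"
 shows "psum (Suc k) L - psum (Suc k) M = (- 1) ^ k * of_nat (Suc k) * (cf L (Suc k) - cf M (Suc k))"
proof -
 have "(\<Sum>i=1..k. cf L i * cf (lgd L) (k - i)) = (\<Sum>i=1..k. cf M i * cf (lgd M) (k - i))"
  using assms lgd_cong[OF assms] by (intro sum.cong refl arg_cong2[of _ _ _ _ "(*)"]) auto
 then have "cf (lgd L) k - cf (lgd M) k = of_nat (Suc k) * (cf L (Suc k) - cf M (Suc k))"
  by (subst lgd_nth[OF assms(1)], subst lgd_nth[OF assms(2)]) (simp add: right_diff_distrib del: of_nat_Suc)
 then show ?thesis by (simp add: psum_def right_diff_distrib[symmetric] mult.assoc)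
qed

lemma psum_linear:
 fixes x :: "'r::comm_ring_1"
 shows "n > 0 ==> psum n (1 + fps_const x * fps_X) = x ^ n"
proof -
 assume n: "n > 0"
 have "lgd (1 + fps_const x * fps_X) = Abs_fps (%k. x * (- x) ^ k)"
 proof (rule lgd_unique)
  show "(1 + fps_const x * fps_X) * Abs_fps (%k. x * (- x) ^ k) = fps_deriv (1 + fps_const x * fps_X)"
  proof (rule fps_ext)
   fix k
   show "cf ((1 + fps_const x * fps_X) * Abs_fps (%k. x * (- x) ^ k)) k = cf (fps_deriv (1 + fps_const x * fps_X)) k"
    by (cases k) (simp_all add: distrib_right mult.assoc)
  qed
 qed simp
 then have "psum n (1 + fps_const x * fps_X) = x * ((- 1) ^ (n - 1) * (- x) ^ (n - 1))"
  by (simp add: psum_def mult_ac)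
 also have "(- 1) ^ (n - 1) * (- x) ^ (n - 1) = x ^ (n - 1)"
  by (simp flip: power_mult_distrib)
 also have "x * x ^ (n - 1) = x ^ n" using n by (cases n) simp_all
 finally show ?thesis .
qed

text \<open>The mixed second derivative at the origin, computed from additivity.\<close>

definition bnd :: "nat => 'r => 'r::comm_ring_1 fps" where
 "bnd j x = Abs_fps (%i. if i = j then x else 0)"

lemma cf_bnd [simp]: "cf (bnd j x) i = (if i = j then x else 0)"
 by (simp add: bnd_def)

lemma bnd_mult: "bnd j x * bnd k y = bnd (j + k) (x * y)"
proof (rule fps_ext)
 fix i
 have "cf (bnd j x * bnd k y) i = (\<Sum>l=0..i. if l = j then (if i - j = k then x * y else 0) else 0)"
  unfolding fps_mult_nth by (intro sum.cong refl) auto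
 then show "cf (bnd j x * bnd k y) i = cf (bnd (j + k) (x * y)) i" by (auto simp: sum.delta)
qed

text \<open>The product of \<open>1 + bnd j x\<close> and \<open>1 + bnd k y\<close> differs from
  \<open>1 + bnd j x + bnd k y\<close> only by \<open>x * y\<close> in the coefficient of index
  \<open>Suc N\<close>. Power sums are additive on products, and \<open>psum_top\<close> evaluates
  the effect of that one coefficient.\<close>

lemma psum_hessian:
 fixes x y :: "'r::comm_ring_1"
 assumes "0 < j" "0 < k" "j + k = Suc N"
 shows "psum (Suc N) (1 + bnd j x + bnd k y) =
  psum (Suc N) (1 + bnd j x) + psum (Suc N) (1 + bnd k y) - (- 1) ^ N * of_nat (Suc N) * (x * y)"
proof -
 let ?P = "(1 + bnd j x) * (1 + bnd k y)" and ?S = "1 + bnd j x + bnd k y"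
 have P: "?P = ?S + bnd (Suc N) (x * y)"
  by (simp add: algebra_simps bnd_mult assms(3)[symmetric])
 have "psum (Suc N) ?P - psum (Suc N) ?S = (- 1) ^ N * of_nat (Suc N) * (cf ?P (Suc N) - cf ?S (Suc N))"
  unfolding P using assms by (intro psum_top) auto
 also have "cf ?P (Suc N) - cf ?S (Suc N) = x * y" unfolding P by simp
 finally have "psum (Suc N) ?P - psum (Suc N) ?S = (- 1) ^ N * of_nat (Suc N) * (x * y)" .
 moreover have "psum (Suc N) ?P = psum (Suc N) (1 + bnd j x) + psum (Suc N) (1 + bnd k y)"
  using assms by (intro psum_mult) auto
 moreover have "s = a + b - k" if "p - s = k" "p = a + b" for p s k a b :: 'r
  using that by (simp add: algebra_simps)
 ultimately show ?thesis by blast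
qed

subsection \<open>Graded series over polynomial rings\<close>

definition fmap :: "('v mpol => 'w mpol) => 'v mpol fps => 'w mpol fps" where
 "fmap f L = Abs_fps (%i. f (cf L i))"

lemma cf_fmap [simp]: "cf (fmap f L) i = f (cf L i)"
 by (simp add: fmap_def)

lemma fmap_mult: "fmap (subst s) (L * M) = fmap (subst s) L * fmap (subst s) M"
 by (rule fps_ext) (simp add: fps_mult_nth subst_simps)
lemma fmap_add: "fmap (subst s) (L + M) = fmap (subst s) L + fmap (subst s) M"
 by (rule fps_ext) (simp add: subst_simps)
lemma fmap_diff: "fmap (subst s) (L - M) = fmap (subst s) L - fmap (subst s) M"
 by (rule fps_ext) (simp add: subst_simps)
lemma fmap_1 [simp]: "fmap (subst s) 1 = 1"
 by (rule fps_ext) simp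
lemma fmap_prod: "fmap (subst s) (prod f A) = (\<Prod>a\<in>A. fmap (subst s) (f a))"
 by (induction A rule: infinite_finite_induct) (simp_all add: fmap_mult)
lemma psum_fmap:
 assumes "cf L 0 = 1"
 shows "subst s (psum n L) = psum n (fmap (subst s) L)"
proof -
 have "lgd (fmap (subst s) L) = fmap (subst s) (lgd L)"
 proof (rule lgd_unique)
  show "cf (fmap (subst s) L) 0 = 1" using assms by simp
  have "fmap (subst s) L * fmap (subst s) (lgd L) = fmap (subst s) (fps_deriv L)"
   by (simp add: fmap_mult[symmetric] lgd_eq assms)
  also have "\<dots> = fps_deriv (fmap (subst s) L)"
   by (rule fps_ext) (simp add: subst_simps del: of_nat_add of_nat_Suc)
  finally show "fmap (subst s) L * fmap (subst s) (lgd L) = fps_deriv (fmap (subst s) L)" .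
 qed
 then show ?thesis
  using subst_power[of s "-1" "n - 1"] by (simp add: psum_def subst_simps)
qed

definition gser :: "('m \<times> nat) set => ('m \<times> nat) mpol fps => bool" where
 "gser V L \<longleftrightarrow> cf L 0 = 1 & (\<forall>j. cf L j \<in> hm V (2 * int j))"

lemma gserD: "gser V L ==> cf L 0 = 1" "gser V L ==> cf L j \<in> hm V (2 * int j)"
 by (auto simp: gser_def)

lemma gser_mono: "gser V L ==> V <= V' ==> gser V' L"
 unfolding gser_def using hmg_mono by blast

lemma gser_1 [simp]: "gser V 1"
 by (simp add: gser_def)

lemma gser_mult:
 assumes "gser V L" "gser V M"
 shows "gser V (L * M)"
 unfolding gser_def
proof (intro conjI allI)
 show "cf (L * M) 0 = 1" using assms by (simp add: gserD)
 fix j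
 show "cf (L * M) j \<in> hm V (2 * int j)"
  unfolding fps_mult_nth
 proof (rule hmg_sum)
  fix i assume "i \<in> {0..j}"
  then show "cf L i * cf M (j - i) \<in> hm V (2 * int j)"
   by (intro hmg_mult'[OF gserD(2)[OF assms(1)] gserD(2)[OF assms(2)]]) auto
 qed
qed

lemma gser_prod: "(!!a. a \<in> A ==> gser V (f a)) ==> gser V (prod f A)"
 by (induction A rule: infinite_finite_induct) (auto intro: gser_mult)

lemma gser_lgd:
 assumes "gser V L"
 shows "cf (lgd L) k \<in> hm V (2 * int (Suc k))"
proof (induction k rule: less_induct)
 case (less k)
 have "of_nat (Suc k) * cf L (Suc k) \<in> hm V (2 * int (Suc k))"
  unfolding Cst_of_nat[symmetric] by (rule hmg_Cst_mult[OF gserD(2)[OF assms]])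
 moreover have "(\<Sum>i=1..k. cf L i * cf (lgd L) (k - i)) \<in> hm V (2 * int (Suc k))"
 proof (rule hmg_sum)
  fix i assume i: "i \<in> {1..k}"
  have "cf (lgd L) (k - i) \<in> hm V (2 * int (Suc (k - i)))" using i by (intro less) auto
  then show "cf L i * cf (lgd L) (k - i) \<in> hm V (2 * int (Suc k))"
   using i by (intro hmg_mult'[OF gserD(2)[OF assms]]) auto
 qed
 ultimately show ?case by (subst lgd_nth[OF gserD(1)[OF assms]]) (rule hmg_diff)
qed

lemma gser_ps:
 assumes "gser V L"
 shows "psum (Suc k) L \<in> hm V (2 * int (Suc k))"
proof -
 have "((- 1) ^ k :: ('a \<times> nat) mpol) = Cst ((- 1) ^ k)" by (induction k) (simp_all add: Cst_mult Cst_minus)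
 then show ?thesis unfolding psum_def using hmg_Cst_mult[OF gser_lgd[OF assms]] by simp
qed

text \<open>The series of an alphabet of \<open>c\<close> letters named \<open>m\<close> in which
  the elementary symmetric polynomials are independent variables. Every other series is treated as a
  specialization of such a one.\<close>

definition ser :: "'m => nat => ('m \<times> nat) mpol fps" where
 "ser m c = Abs_fps (%j. if j = 0 then 1 else if j <= c then Var (m, j) else 0)"

lemma cf_ser: "cf (ser m c) j = (if j = 0 then 1 else if j <= c then Var (m, j) else 0)"
 by (simp add: ser_def)

lemma gser_ser: "(!!j. 1 <= j ==> j <= c ==> (m, j) \<in> V) ==> gser V (ser m c)"
 using hmg_Var[of "(m, _)" V wt] unfolding gser_def cf_ser by (auto simp: wt_def)

definition trc :: "nat => 'r::zero fps => bool" where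
 "trc m L \<longleftrightarrow> (\<forall>j>m. cf L j = 0)"

lemma trc_ser: "trc c (ser m c)"
 by (auto simp: trc_def cf_ser)
lemma trc_1 [simp]: "trc m (1 :: 'r::comm_ring_1 fps)"
 by (auto simp: trc_def)

lemma trc_mult: "trc a L ==> trc b M ==> trc (a + b) (L * M :: 'r::comm_ring_1 fps)"
 unfolding trc_def fps_mult_nth
proof (intro allI impI sum.neutral ballI)
 fix j i assume "\<forall>j>a. cf L j = 0" "\<forall>j>b. cf M j = 0" "a + b < j" "i \<in> {0..j}"
 then show "cf L i * cf M (j - i) = 0" by (cases "i > a") auto
qed

lemma trc_prod: "(!!a. a \<in> A ==> trc (c a) (f a)) ==> trc (sum c A) (prod f A :: 'r::comm_ring_1 fps)"
 by (induction A rule: infinite_finite_induct) (auto intro: trc_mult)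

lemma fmap_ser:
 assumes "cf L 0 = 1" "trc c L" "!!j. 1 <= j ==> j <= c ==> s (m, j) = cf L j"
 shows "fmap (subst s) (ser m c) = L"
 using assms by (intro fps_ext) (auto simp: cf_ser trc_def)

section \<open>Blocks\<close>

lemma hmg_empty: "f \<in> hmg w {} d ==> d ~= 0 ==> f = 0"
proof (rule ccontr)
 assume f: "f \<in> hmg w {} d" "d ~= 0" "f ~= 0"
 then obtain t where t: "t \<in> keys f" by (metis keys_eq_empty equals0I)
 have "keys t <= {}" "wdeg w t = d" using hmg_single_part[OF f(1) t] by auto
 then show False using f(2) by (simp add: keys_eq_empty)
qed

lemma subst_zero_hmg: "f \<in> hmg w V d ==> d ~= 0 ==> (!!x. x \<in> V ==> s x = 0) ==> subst s f = 0"
 using hmg_subst[of f w V d s "%_. 0" "{}"] hmg_empty by fastforce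

text \<open>Weights are positive here, so a variable heavier than the polynomial divides none of its
  monomials.\<close>

lemma hm_low:
 assumes f: "f \<in> hm V d" and V: "!!x. x \<in> V ==> 0 < snd x"
 shows "f \<in> hm {x \<in> V. wt x <= d} d"
proof (rule hmgI)
 show "wdeg wt t = d" if "t \<in> keys f" for t by (rule hmg_wdeg[OF f that])
 show "pvars f <= {x \<in> V. wt x <= d}"
 proof
  fix x assume "x \<in> pvars f"
  then obtain t where t: "t \<in> keys f" "x \<in> keys t" by (auto simp: pvars_def)
  note t' = hmg_single_part[OF f t(1)]
  have "wt x * 1 <= wt x * int (lkp t x)"
   using t(2) by (intro mult_left_mono) (auto simp: in_keys_iff wt_def)
  also have "\<dots> <= wdeg wt t" unfolding wdeg_def
   using t(2) by (intro member_le_sum) (auto simp: wt_def)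
  finally show "x \<in> {x \<in> V. wt x <= d}" using t t' by auto
 qed
qed

lemma rows_ok_subst:
 assumes "\<forall>r\<in>set rs. row_ok n V r" "!!x. x \<in> V ==> s x \<in> hm V' (wt x)"
 shows "\<forall>r\<in>set (map (mrow (subst s)) rs). row_ok n V' r"
proof
 fix r assume "r \<in> set (map (mrow (subst s)) rs)"
 then obtain r' where r': "r' \<in> set rs" "r = mrow (subst s) r'" by auto
 show "row_ok n V' r" unfolding r'(2) using assms r'(1) by (intro row_ok_subst[of n V]) auto
qed

text \<open>Interpolates from \<open>L\<close> at \<open>j = 1\<close> to \<open>M\<close> at
  \<open>j = m + 1\<close>, as the arguments of p in the definition of U_j do; coefficients above
  \<open>m\<close> are cut off because p has \<open>m\<close> arguments.\<close>

definition mix :: "nat => 'r::comm_ring_1 fps => 'r fps => nat => 'r fps" where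
 "mix m L M j = Abs_fps (%i. if i = 0 then 1 else if m < i then 0 else if i < j then cf M i else cf L i)"

lemma cf_mix: "cf (mix m L M j) i = (if i = 0 then 1 else if m < i then 0 else if i < j then cf M i else cf L i)"
 by (simp add: mix_def)

text \<open>The universal difference quotients live in the ring with variables \<open>(0, i)\<close> for the first
 argument and \<open>(1, i)\<close> for the second.\<close>

definition U :: "nat => nat => nat => (nat \<times> nat) mpol" where
 "U N m j = (SOME q. q \<in> hm ({0, 1} \<times> {1..m}) (2 * int (Suc N) - 2 * int j) &
   psum (Suc N) (mix m (ser 0 m) (ser 1 m) j) - psum (Suc N) (mix m (ser 0 m) (ser 1 m) (Suc j)) =
    (Var (0, j) - Var (1, j)) * q)"

text \<open>Neighbouring interpolations differ by the substitution of \<open>(1, j)\<close> for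
  \<open>(0, j)\<close>, so \<open>factor_theorem\<close> provides the quotient that
  \<open>SOME\<close> selects.\<close>

lemma U_props:
 assumes "1 <= j" "j <= m"
 shows "U N m j \<in> hm ({0, 1} \<times> {1..m}) (2 * int (Suc N) - 2 * int j)"
  and "psum (Suc N) (mix m (ser 0 m) (ser 1 m) j) - psum (Suc N) (mix m (ser 0 m) (ser 1 m) (Suc j)) =
    (Var (0, j) - Var (1, j)) * U N m j"
proof -
 let ?V = "{0::nat, 1} \<times> {1..m}" and ?f = "%j. mix m (ser 0 m) (ser 1 m) j"
 have g: "gser ?V (?f j)" for j
 proof -
  have v: "Var (c, i) \<in> hm ?V (2 * int i)" if "c \<in> {0, 1}" "1 <= i" "i <= m" for c i
   using hmg_Var[of "(c, i)" ?V wt] that by (simp add: wt_def)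
  show ?thesis unfolding gser_def cf_mix cf_ser using v by auto
 qed
 have e: "?f (Suc j) = fmap (subst (Var((0, j) := Var (1, j)))) (?f j)"
 proof (rule fps_ext)
  fix i
  show "cf (?f (Suc j)) i = cf (fmap (subst (Var((0, j) := Var (1, j)))) (?f j)) i"
   using assms by (cases "i = j") (auto simp: cf_mix cf_ser less_Suc_eq)
 qed
 have "\<exists>q \<in> hm ?V (2 * int (Suc N) - wt (0 :: nat, j)).
   psum (Suc N) (?f j) - subst (Var((0, j) := Var (1, j))) (psum (Suc N) (?f j)) = (Var (0, j) - Var (1, j)) * q"
  using assms hmg_Var[of "(1, j)" ?V wt] by (intro factor_theorem gser_ps g) (auto simp: wt_def)
 then have "\<exists>q. q \<in> hm ?V (2 * int (Suc N) - 2 * int j) &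
   psum (Suc N) (?f j) - psum (Suc N) (?f (Suc j)) = (Var (0, j) - Var (1, j)) * q"
  unfolding e psum_fmap[OF gserD(1)[OF g]] by (auto simp: wt_def)
 from someI_ex[OF this] show "U N m j \<in> hm ?V (2 * int (Suc N) - 2 * int j)"
  "psum (Suc N) (?f j) - psum (Suc N) (?f (Suc j)) = (Var (0, j) - Var (1, j)) * U N m j"
  unfolding U_def by blast+
qed

definition sub2 :: "'w mpol fps => 'w mpol fps => nat \<times> nat => 'w mpol" where
 "sub2 L M = (%(c, i). cf (if c = 0 then L else M) i)"

text \<open>Specializing a universal quotient, rather than dividing in place, commutes with
  substitutions by construction and makes sense even where the coefficients of \<open>L\<close> and
  \<open>M\<close> coincide, as on a closed circle with one mark.\<close>

definition UU where "UU N m L M j = subst (sub2 L M) (U N m j)"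

lemma UU_tele:
 assumes "1 <= j" "j <= m"
 shows "UU N m L M j * (cf L j - cf M j) = psum (Suc N) (mix m L M j) - psum (Suc N) (mix m L M (Suc j))"
proof -
 have e: "fmap (subst (sub2 L M)) (mix m (ser 0 m) (ser 1 m) i) = mix m L M i" for i
  by (rule fps_ext) (auto simp: cf_mix cf_ser sub2_def)
 have "subst (sub2 L M) ((Var (0, j) - Var (1, j)) * U N m j) = UU N m L M j * (cf L j - cf M j)"
  by (simp add: subst_simps UU_def sub2_def)
 moreover have "subst (sub2 L M) (psum (Suc N) (mix m (ser 0 m) (ser 1 m) i)) = psum (Suc N) (mix m L M i)" for i
  using psum_fmap[of "mix m (ser 0 m) (ser 1 m) i" "sub2 L M"] e[of i] by (simp add: cf_mix)
 ultimately show ?thesis using arg_cong[OF U_props(2)[OF assms, of N], of "subst (sub2 L M)"]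
  by (simp add: subst_simps)
qed

lemma UU_hm:
 assumes "gser V L" "gser V M" "1 <= j" "j <= m"
 shows "UU N m L M j \<in> hm V (2 * int (Suc N) - 2 * int j)"
 unfolding UU_def
 using gserD(2)[OF assms(1)] gserD(2)[OF assms(2)]
 by (intro hmg_subst[OF U_props(1)[OF assms(3,4)]]) (auto simp: sub2_def wt_def)

lemma subst_UU: "subst s (UU N m L M j) = UU N m (fmap (subst s) L) (fmap (subst s) M) j"
 unfolding UU_def subst_subst by (rule subst_cong) (auto simp: sub2_def)

text \<open>The rows of a piece with series \<open>L\<close> at its outgoing and \<open>M\<close> at
  its incoming ends, and \<open>m\<close> variables on either side; the quantum shift of the piece
  is kept apart.\<close>

definition blk :: "nat => nat => 'v mpol fps => 'v mpol fps => 'v row list" where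
 "blk N m L M = map (%j. (UU N m L M j, cf L j - cf M j, 2 * int j)) [1..<Suc m]"

lemma map_blk: "map (mrow (subst s)) (blk N m L M) = blk N m (fmap (subst s) L) (fmap (subst s) M)"
 unfolding blk_def by (simp add: subst_UU subst_simps del: upt_Suc)

lemma blk_row_ok:
 assumes "gser V L" "gser V M"
 shows "\<forall>r\<in>set (blk N m L M). row_ok (int (Suc N)) V r"
 using UU_hm[OF assms] gserD(2)[OF assms(1)] gserD(2)[OF assms(2)]
 by (auto simp: blk_def row_ok_def intro!: hmg_diff)

lemma telescope_upt: "(\<Sum>j\<leftarrow>[1..<Suc m]. f j - f (Suc j)) = f 1 - (f (Suc m) :: 'r::ab_group_add)"
 by (induction m) simp_all

text \<open>The products telescope along \<open>mix\<close>, whose extreme members are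
  \<open>L\<close> and \<open>M\<close> because both are truncated at \<open>m\<close>.\<close>

lemma pot_blk_aux:
 assumes "cf L 0 = 1" "cf M 0 = 1" "trc m L" "trc m M"
 shows "(\<Sum>j\<leftarrow>[1..<Suc m]. UU N m L M j * (cf L j - cf M j)) = psum (Suc N) L - psum (Suc N) M"
proof -
 have "(\<Sum>j\<leftarrow>[1..<Suc m]. UU N m L M j * (cf L j - cf M j)) =
   (\<Sum>j\<leftarrow>[1..<Suc m]. psum (Suc N) (mix m L M j) - psum (Suc N) (mix m L M (Suc j)))"
  by (intro arg_cong[where f = sum_list] map_cong refl UU_tele) (auto simp del: upt_Suc)
 also have "\<dots> = psum (Suc N) (mix m L M 1) - psum (Suc N) (mix m L M (Suc m))"
  by (rule telescope_upt)
 also have "mix m L M 1 = L" using assms by (intro fps_ext) (auto simp: cf_mix trc_def)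
 also have "mix m L M (Suc m) = M" using assms by (intro fps_ext) (auto simp: cf_mix trc_def)
 finally show ?thesis .
qed

lemma pot_blk:
 assumes "cf L 0 = 1" "cf M 0 = 1" "trc m L" "trc m M"
 shows "pot (blk N m L M) = psum (Suc N) L - psum (Suc N) M"
 unfolding blk_def pot_map by (rule pot_blk_aux[OF assms])

subsection \<open>Eliminating variables\<close>

text \<open>Here the other rows may contain \<open>v\<close>. Transvections with the pivot row
  subtract multiples of its second entry until those rows have become their substituted versions;
  then \<open>pkeq_elim\<close> applies.\<close>

lemma pkeq_elim_subst:
 assumes ok: "\<forall>r\<in>set rs. row_ok n (insert v V) r" and a: "a \<in> hm (insert v V) (2 * n - wt v)"
  and c: "c ~= 0" and f: "f \<in> hm V (wt v)" and v: "v \<notin> V"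
  and p0: "pot ((a, Cst c * (Var v - f), wt v) # rs) = 0"
 shows "pkeq n False 0 (insert v V) ((a, Cst c * (Var v - f), wt v) # rs) V (map (mrow (subst (Var(v := f)))) rs)"
proof -
 let ?s = "Var(v := f)" and ?V = "insert v V"
 define b where "b = Cst c * (Var v - f)"
 have fV: "f \<in> hm ?V (wt v)" using f by (rule hmg_mono) auto
 have ex: "\<exists>q \<in> hm ?V (d - wt v). x - q * b = subst ?s x" if x: "x \<in> hm ?V d" for x d
 proof -
  obtain q where q: "q \<in> hm ?V (d - wt v)" "x - subst ?s x = (Var v - f) * q"
   using factor_theorem[OF x fV] by auto
  have "Cst (1 / c) * q * b = (Cst (1 / c) * Cst c) * ((Var v - f) * q)"
   unfolding b_def by (simp only: mult_ac)
  also have "\<dots> = x - subst ?s x" using c by (simp add: Cst_mult[symmetric] q(2))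
  finally have "x - Cst (1 / c) * q * b = subst ?s x" by simp
  then show ?thesis using hmg_Cst_mult[OF q(1)] by blast
 qed
 define js where "js = [0..<length rs]"
 define A where "A j = fst (rs ! j)" for j
 define B where "B j = fst (snd (rs ! j))" for j
 define D where "D j = snd (snd (rs ! j))" for j
 have rs: "rs = map (%j. (A j, B j, D j)) js"
  by (rule nth_equalityI) (simp_all add: js_def A_def B_def D_def)
 have AB: "A j \<in> hm ?V (2 * n - D j)" "B j \<in> hm ?V (D j)" if "j \<in> set js" for j
 proof -
  have "row_ok n ?V (A j, B j, D j)" using ok that unfolding rs by auto
  then show "A j \<in> hm ?V (2 * n - D j)" "B j \<in> hm ?V (D j)" by (simp_all add: row_ok_def)
 qed
 have "\<exists>k. \<forall>j\<in>set js. k j \<in> hm ?V (2 * n - D j - wt v) & A j - k j * b = subst ?s (A j)"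
  using ex[OF AB(1)] by (intro bchoice) blast
 then obtain k where k: "!!j. j \<in> set js ==> k j \<in> hm ?V (2 * n - D j - wt v)"
  "!!j. j \<in> set js ==> A j - k j * b = subst ?s (A j)" by blast
 have "\<exists>e. \<forall>j\<in>set js. e j \<in> hm ?V (D j - wt v) & B j - e j * b = subst ?s (B j)"
  using ex[OF AB(2)] by (intro bchoice) blast
 then obtain e where e: "!!j. j \<in> set js ==> e j \<in> hm ?V (D j - wt v)"
  "!!j. j \<in> set js ==> B j - e j * b = subst ?s (B j)" by blast
 have k1: "k j \<in> hm ?V (2 * n - wt v - D j)" if "j \<in> set js" for j
  using k(1)[OF that] by (simp add: algebra_simps)
 obtain a' where a': "req n ?V False 0 ((a, b, wt v) # map (%j. (A j, B j, D j)) js)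
   ((a', b, wt v) # map (%j. (A j - k j * b, B j - e j * b, D j)) js)"
  using req_transv_all[of js k ?V n "wt v" D e a b A B] k1 e(1) by blast
 have m: "map (%j. (A j - k j * b, B j - e j * b, D j)) js = map (mrow (subst ?s)) rs"
  unfolding rs map_map using k(2) e(2) by (intro map_cong) auto
 have bV: "b \<in> hm ?V (wt v)" unfolding b_def
  by (intro hmg_Cst_mult hmg_diff hmg_Var fV) auto
 have 1: "pkeq n False 0 ?V ((a, b, wt v) # rs) ?V ((a', b, wt v) # map (mrow (subst ?s)) rs)"
 proof (rule req_pkeq)
  show "req n ?V False 0 ((a, b, wt v) # rs) ((a', b, wt v) # map (mrow (subst ?s)) rs)"
   using a'[unfolded m, folded rs] .
  show "\<forall>r\<in>set ((a, b, wt v) # rs). row_ok n ?V r" using ok a bV by (simp add: row_ok_def)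
  show "pot ((a, b, wt v) # rs) = 0" using p0 by (simp add: b_def)
 qed
 have s: "?s x \<in> hm V (wt x)" if "x \<in> ?V" for x
  using that f by (cases "x = v") (auto intro: hmg_Var)
 have "pkeq n False 0 ?V ((a', Cst c * Var v + Cst c * (- f), wt v) # map (mrow (subst ?s)) rs) V (map (mrow (subst ?s)) rs)"
 proof (rule pkeq_elim)
  show "\<forall>r\<in>set (map (mrow (subst ?s)) rs). row_ok n V r"
   by (rule rows_ok_subst[OF ok s])
  show "a' \<in> hm ?V (2 * n - wt v)" using pkeqD(2)[OF 1] by (simp add: row_ok_def)
  show "Cst c * (- f) \<in> hm V (wt v)" using f by (intro hmg_Cst_mult) simp
  show "pot ((a', Cst c * Var v + Cst c * (- f), wt v) # map (mrow (subst ?s)) rs) = 0"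
   using pkeqD(4)[OF 1] by (simp add: b_def right_diff_distrib)
 qed (use c v in auto)
 then have "pkeq n False 0 ?V ((a', b, wt v) # map (mrow (subst ?s)) rs) V (map (mrow (subst ?s)) rs)"
  by (simp add: b_def right_diff_distrib)
 from pkeq_trans[OF 1 this] show ?thesis by (simp add: b_def)
qed

lemma mrow_mrow: "mrow f (mrow g r) = mrow (%x. f (g x)) r"
 by (cases r) simp

text \<open>The values \<open>f j\<close> contain none of the eliminated variables, so the
  successive substitutions compose to the simultaneous substitution \<open>s\<close>.\<close>

lemma pkeq_elim_list:
 fixes v :: "'j => 'm \<times> nat"
 assumes "distinct (map v js)" "!!j. j \<in> set js ==> v j \<notin> V & f j \<in> hm V (wt (v j))"
  and "\<forall>r\<in>set rs. row_ok n (V \<union> v ` set js) r"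
  and "!!j. j \<in> set js ==> A j \<in> hm (V \<union> v ` set js) (2 * n - wt (v j))"
  and "c ~= 0" and "!!j. j \<in> set js ==> s (v j) = f j" "!!x. x \<in> V ==> s x = Var x"
  and "pot (map (%j. (A j, Cst c * (Var (v j) - f j), wt (v j))) js @ rs) = 0"
 shows "pkeq n False 0 (V \<union> v ` set js) (map (%j. (A j, Cst c * (Var (v j) - f j), wt (v j))) js @ rs)
   V (map (mrow (subst s)) rs)"
 using assms
proof (induction js arbitrary: A rs)
 case Nil
 have "map (mrow (subst s)) rs = rs"
  using Nil.prems by (intro map_idI mrow_ident[of n V]) auto
 then show ?case using Nil.prems pkeq_refl by simp
next
 case (Cons i js)
 let ?s = "Var(v i := f i)" and ?W = "V \<union> v ` set js"
 let ?M = "map (%j. (A j, Cst c * (Var (v j) - f j), wt (v j))) js"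
 have W: "V \<union> v ` set (i # js) = insert (v i) ?W" by auto
 have vi: "v i \<notin> ?W" using Cons.prems(1,2) by auto
 have fi: "f i \<in> hm ?W (wt (v i))" using Cons.prems(2)[of i] by (auto intro: hmg_mono)
 have okM: "\<forall>r\<in>set ?M. row_ok n (insert (v i) ?W) r"
  using Cons.prems(2,4) unfolding W row_ok_def
  by (auto intro!: hmg_Cst_mult hmg_diff hmg_Var intro: hmg_mono[of _ _ V])
 have 1: "pkeq n False 0 (insert (v i) ?W) ((A i, Cst c * (Var (v i) - f i), wt (v i)) # ?M @ rs)
   ?W (map (mrow (subst ?s)) (?M @ rs))"
 proof (rule pkeq_elim_subst)
  show "\<forall>r\<in>set (?M @ rs). row_ok n (insert (v i) ?W) r"
   using okM Cons.prems(3) unfolding W by auto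
  show "A i \<in> hm (insert (v i) ?W) (2 * n - wt (v i))" using Cons.prems(4)[of i] unfolding W by simp
  show "pot ((A i, Cst c * (Var (v i) - f i), wt (v i)) # ?M @ rs) = 0" using Cons.prems(8) by simp
 qed (use vi fi Cons.prems(5) in auto)
 have s: "?s x \<in> hm ?W (wt x)" if "x \<in> insert (v i) ?W" for x
  using that fi by (cases "x = v i") (auto intro: hmg_Var)
 let ?rs = "map (mrow (subst ?s)) rs"
 have fix1: "subst ?s (f j) = f j" if "j \<in> set js" for j
 proof -
  have "v i \<notin> pvars (f j)"
   using Cons.prems(2)[of j] Cons.prems(2)[of i] that hmg_pvars[of "f j" wt V "wt (v j)"] by auto
  then show ?thesis by (intro subst_ident) auto
 qed
 have ne: "v j ~= v i" if "j \<in> set js" for j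
 proof -
  have "v i \<notin> v ` set js" using Cons.prems(1) by simp
  then show ?thesis using that by (metis imageI)
 qed
 have M': "map (mrow (subst ?s)) ?M = map (%j. (subst ?s (A j), Cst c * (Var (v j) - f j), wt (v j))) js"
  using fix1 ne by (simp add: subst_simps)
 have 2: "pkeq n False 0 ?W (map (%j. (subst ?s (A j), Cst c * (Var (v j) - f j), wt (v j))) js @ ?rs)
   V (map (mrow (subst s)) ?rs)"
 proof (rule Cons.IH)
  show "\<forall>r\<in>set ?rs. row_ok n ?W r"
   using Cons.prems(3) unfolding W by (rule rows_ok_subst) (rule s)
  show "subst ?s (A j) \<in> hm ?W (2 * n - wt (v j))" if "j \<in> set js" for j
   using Cons.prems(4)[of j] that s unfolding W by (intro hmg_subst[of _ wt "insert (v i) ?W"]) auto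
  show "pot (map (%j. (subst ?s (A j), Cst c * (Var (v j) - f j), wt (v j))) js @ ?rs) = 0"
   using pkeqD(4)[OF 1] unfolding map_append M' .
 qed (use Cons.prems in auto)
 have e: "map (mrow (subst s)) ?rs = map (mrow (subst s)) rs"
 proof -
  have "subst s (subst ?s x) = subst s x" for x
  proof -
   have "subst s (f i) = f i" using Cons.prems(2)[of i] Cons.prems(7) hmg_pvars[of "f i" wt V]
    by (intro subst_ident) auto
   then show ?thesis unfolding subst_subst using Cons.prems(6)[of i] by (intro subst_cong) auto
  qed
  then show ?thesis by (simp add: mrow_mrow)
 qed
 then show ?case using pkeq_trans[OF 1[unfolded map_append M'] 2] unfolding W e by simp
qed

text \<open>A block with generic series at one end equates the variables of that end with the
  coefficients of the other, so the whole end can be forgotten. Whether the generic end is outgoing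
  or incoming affects only the sign \<open>e\<close> of the second entries.\<close>

lemma pkeq_blk_elim:
 fixes V :: "('m \<times> nat) set"
 assumes M: "gser V M" and y: "!!i. (y, i) \<notin> V"
  and rs: "\<forall>r\<in>set rs. row_ok (int (Suc N)) (V \<union> {y} \<times> {1..c}) r"
  and bl: "bl = blk N c (ser y c) M \<or> bl = blk N c M (ser y c)" and p0: "pot (bl @ rs) = 0"
  and s: "!!i. 1 <= i ==> i <= c ==> s (y, i) = cf M i" "!!x. x \<in> V ==> s x = Var x"
 shows "pkeq (int (Suc N)) False 0 (V \<union> {y} \<times> {1..c}) (bl @ rs) V (map (mrow (subst s)) rs)"
proof -
 let ?W = "V \<union> {y} \<times> {1..c}" and ?js = "[1..<Suc c]"
 have W: "V \<union> (%j. (y, j)) ` set ?js = ?W" by (auto simp del: upt_Suc)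
 have gM: "gser ?W M" using M by (rule gser_mono) auto
 have gy: "gser ?W (ser y c)" by (rule gser_ser) auto
 have "\<exists>A e. e ~= 0 & (\<forall>j\<in>set ?js. A j \<in> hm ?W (2 * int (Suc N) - 2 * int j)) &
   bl = map (%j. (A j, Cst e * (Var (y, j) - cf M j), wt (y, j))) ?js"
  using bl
 proof
  assume bl: "bl = blk N c (ser y c) M"
  show ?thesis
   by (rule exI[of _ "UU N c (ser y c) M"], rule exI[of _ 1])
    (use UU_hm[OF gy gM] in \<open>auto simp: bl blk_def cf_ser wt_def simp del: upt_Suc\<close>)
 next
  assume bl: "bl = blk N c M (ser y c)"
  show ?thesis
   by (rule exI[of _ "UU N c M (ser y c)"], rule exI[of _ "-1"])
    (use UU_hm[OF gM gy] in \<open>auto simp: bl blk_def cf_ser wt_def Cst_minus simp del: upt_Suc\<close>)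
 qed
 then obtain A e where A: "e ~= 0" "\<forall>j\<in>set ?js. A j \<in> hm ?W (2 * int (Suc N) - 2 * int j)"
  "bl = map (%j. (A j, Cst e * (Var (y, j) - cf M j), wt (y, j))) ?js" by blast
 have "pkeq (int (Suc N)) False 0 (V \<union> (%j. (y, j)) ` set ?js)
   (map (%j. (A j, Cst e * (Var (y, j) - cf M j), wt (y, j))) ?js @ rs) V (map (mrow (subst s)) rs)"
 proof (rule pkeq_elim_list)
  show "pot (map (%j. (A j, Cst e * (Var (y, j) - cf M j), wt (y, j))) ?js @ rs) = 0"
   using p0 unfolding A(3) .
  show "A j \<in> hm (V \<union> (%j. (y, j)) ` set ?js) (2 * int (Suc N) - wt (y, j))" if "j \<in> set ?js" for j
   using A(2) that unfolding W by (simp add: wt_def del: upt_Suc)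
  show "(y, j) \<notin> V & cf M j \<in> hm V (wt (y, j))" for j
   using gserD(2)[OF M, of j] y by (simp add: wt_def)
  show "\<forall>r\<in>set rs. row_ok (int (Suc N)) (V \<union> (%j. (y, j)) ` set ?js) r" using rs unfolding W .
  show "s (y, j) = cf M j" if "j \<in> set ?js" for j using that by (intro s(1)) (auto simp del: upt_Suc)
 qed (use A(1) s(2) in \<open>auto simp: distinct_map inj_on_def simp del: upt_Suc\<close>)
 then show ?thesis unfolding A(3) W .
qed

subsection \<open>Removing a loop\<close>

lemma Cst_eq_0:
 assumes "Cst c = (0 :: 'x mpol)"
 shows "c = 0"
 using arg_cong[OF assms, of "%f. lkp f 0"] by (simp add: lookup_Cst)

lemma m1_power_Cst: "(- 1) ^ k = Cst ((- 1) ^ k)"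
 by (induction k) (simp_all add: Cst_mult Cst_minus)

text \<open>The value is read off from a difference of evaluations to which only the linear terms contribute.\<close>

lemma UU_diag:
 assumes j: "1 <= j" and k: "1 <= k" and jk: "j + k = Suc N"
 shows "UU N N (1 + bnd k 1) (1 + bnd k 1) j = Cst (- ((- 1) ^ N * of_nat (Suc N)))"
proof -
 let ?V = "{0::nat, 1} \<times> {1..N}" and ?u = "U N N j" and ?e = "%i. bnd i 1 :: 'a mpol fps"
 have u: "?u \<in> hm ?V (wt (0 :: nat, k))"
 proof -
  have "2 * int (Suc N) - 2 * int j = wt (0 :: nat, k)" using jk by (simp add: wt_def)
  then show ?thesis using U_props(1)[of j N N] j k jk by simp
 qed
 obtain a g1 where 1: "?u = Cst a * Var (0, k) + g1" "g1 \<in> hm (?V - {(0, k)}) (wt (0 :: nat, k))"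
  by (rule hmg_linear_part[OF u]) (use j k jk in \<open>auto simp: wt_def\<close>)
 have g1: "g1 \<in> hm (?V - {(0, k)}) (wt (1 :: nat, k))" using 1(2) by (simp add: wt_def)
 obtain b g where 2: "g1 = Cst b * Var (1, k) + g" "g \<in> hm (?V - {(0, k)} - {(1, k)}) (wt (1 :: nat, k))"
  by (rule hmg_linear_part[OF g1]) (use j k jk in \<open>auto simp: wt_def\<close>)
 have UU: "UU N N X Y j = Cst a * cf X k + Cst b * cf Y k + subst (sub2 X Y) g" for X Y :: "'a mpol fps"
  unfolding UU_def 1(1) 2(1) by (simp add: subst_simps sub2_def add_ac)
 \<comment> \<open>From the second pair to the first, coefficient \<open>k\<close> grows by 1 in
   both arguments, which changes the value by \<open>a + b\<close>, also when \<open>j = k\<close>.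
   Within each pair only coefficient \<open>j\<close> differs, so each value is a difference of two
   power sums, and together they form the mixed difference of \<open>psum_hessian\<close>.\<close>
 let ?X1 = "1 + ?e j + ?e k" and ?Y1 = "1 + ?e k" and ?X2 = "1 + ?e j" and ?Y2 = "1 :: 'a mpol fps"
 have tele: "UU N N X Y j = psum (Suc N) X - psum (Suc N) Y"
  if X: "X = Y + ?e j" and Y: "cf Y 0 = 1" "trc N Y" for X Y
 proof -
  have jN: "j <= N" using j k jk by simp
  have "mix N X Y j = X" "mix N X Y (Suc j) = Y"
   using X Y j jN by (auto intro!: fps_ext simp: cf_mix trc_def)
  then show ?thesis using UU_tele[OF j jN, of N X Y] X by simp
 qed
 have trc: "trc N (1 + ?e k)" using j k jk by (auto simp: trc_def)
 have "?X1 = ?Y1 + ?e j" by (simp add: algebra_simps)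
 then have e1: "UU N N ?X1 ?Y1 j = psum (Suc N) ?X1 - psum (Suc N) ?Y1" using trc k by (intro tele) auto
 have e2: "UU N N ?X2 ?Y2 j = psum (Suc N) ?X2" by (subst tele) auto
 have "pvars g <= ?V - {(0, k)} - {(1, k)}" by (rule hmg_pvars[OF 2(2)])
 then have g12: "subst (sub2 ?X1 ?Y1) g = subst (sub2 ?X2 ?Y2) g"
  by (intro subst_cong) (auto simp: sub2_def)
 have "UU N N ?X1 ?Y1 j - UU N N ?X2 ?Y2 j = Cst a + Cst b"
  unfolding UU g12 using k by (simp add: algebra_simps)
 moreover have "UU N N ?X1 ?Y1 j - UU N N ?X2 ?Y2 j = - ((- 1) ^ N * of_nat (Suc N))"
  unfolding e1 e2 using psum_hessian[of j k N "1 :: 'a mpol" 1] j k jk by simp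
 ultimately have ab: "Cst a + Cst b = - ((- 1) ^ N * of_nat (Suc N) :: 'a mpol)" by simp
 \<comment> \<open>No variable of \<open>g\<close> survives: those of index \<open>k\<close> are
   excluded, and all others are sent to 0.\<close>
 have "subst (sub2 ?Y1 ?Y1) g = 0"
  using k by (intro subst_zero_hmg[OF 2(2)]) (auto simp: sub2_def wt_def split: if_splits)
 then have "UU N N ?Y1 ?Y1 j = Cst a + Cst b" unfolding UU using k by simp
 then show ?thesis unfolding ab m1_power_Cst by (simp only: Cst_minus Cst_mult Cst_of_nat)
qed

text \<open>The quantum shift that results from interchanging the entries of the rows after
  \<open>r\<close> in a block of size \<open>N\<close>. For \<open>r = 0\<close> it vanishes, so
  that interchanging a whole block of size \<open>N\<close> can only affect the parity.\<close>

lemma sum_upt_shift: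
 "r <= N ==> (\<Sum>j\<leftarrow>[Suc r..<Suc N]. 2 * int j - int (Suc N)) = int (N - r) * int r"
proof (induction "N - r" arbitrary: r)
 case 0
 then show ?case by simp
next
 case (Suc d)
 have e: "[Suc r..<Suc N] = Suc r # [Suc (Suc r)..<Suc N]" using Suc by (intro upt_conv_Cons) simp
 have IH: "(\<Sum>j\<leftarrow>[Suc (Suc r)..<Suc N]. 2 * int j - int (Suc N)) = int (N - Suc r) * int (Suc r)"
  using Suc by (intro Suc(1)) auto
 have "N = r + Suc d" using Suc by simp
 then show ?case unfolding e using IH by (simp add: algebra_simps del: upt_Suc)
qed

text \<open>The second entries are the coefficients of S (P - Q), a unitriangular combination of the
  \<open>r\<close> differences between \<open>P\<close> and \<open>Q\<close>. Elimination leaves the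
  last \<open>s\<close> rows with second entry 0 and their old first entries. The first entries of
  the other rows are normalized by \<open>req_twist\<close>; the potential is the right one because
  power sums are additive on products, so that \<open>S\<close> cancels.\<close>

lemma loop_universal:
 assumes N: "N = r + s"
 defines "S \<equiv> ser (0::nat) s" and "P \<equiv> ser 1 r" and "Q \<equiv> ser 2 r"
 shows "req (int (Suc N)) ({0} \<times> {1..s} \<union> {1, 2} \<times> {1..r}) False 0 (blk N N (S * P) (S * Q))
   (blk N r P Q @ map (%j. (UU N N (S * P) (S * Q) j, 0, 2 * int j)) [Suc r..<Suc N])"
proof -
 let ?V = "{0::nat} \<times> {1..s} \<union> {1, 2} \<times> {1..r}" and ?n = "int (Suc N)" and ?D = "%j. 2 * int j"
 have g: "gser ?V S" "gser ?V P" "gser ?V Q" unfolding S_def P_def Q_def by (intro gser_ser; auto)+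
 let ?A = "UU N N (S * P) (S * Q)" and ?bt = "%l. cf P l - cf Q l" and ?T = "%j l. cf S (j - l)"
 have P0: "?bt 0 = 0" "!!l. r < l ==> ?bt l = 0" by (auto simp: P_def Q_def cf_ser)
 have B: "cf (S * P) j - cf (S * Q) j = (\<Sum>l=1..min j r. ?T j l * ?bt l)" for j
 proof -
  have "cf (S * P) j - cf (S * Q) j = (\<Sum>l=0..j. ?T j l * ?bt l)"
   unfolding mult.commute[of S] fps_mult_nth by (simp add: sum_subtractf[symmetric] algebra_simps)
  also have "\<dots> = (\<Sum>l=1..min j r. ?T j l * ?bt l)"
  proof (rule sum.mono_neutral_right)
   show "\<forall>l\<in>{0..j} - {1..min j r}. ?T j l * ?bt l = 0"
   proof
    fix l assume "l \<in> {0..j} - {1..min j r}"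
    then have "l = 0 \<or> r < l" by auto
    then show "?T j l * ?bt l = 0" using P0 by auto
   qed
  qed auto
  finally show ?thesis .
 qed
 have "\<exists>A'. (\<forall>j. r < j --> A' j = ?A j) &
   req ?n ?V False 0 (map (%j. (?A j, cf (S * P) j - cf (S * Q) j, ?D j)) [1..<Suc N])
    (map (%j. (A' j, if j <= r then ?bt j else 0, ?D j)) [1..<Suc N])"
 proof (rule req_triangular[where T = ?T and c = "%_. 1"])
  show "?T j l \<in> hm ?V (?D j - ?D l)" if "1 <= l" "l < j" for j l
   using gserD(2)[OF g(1), of "j - l"] that by (simp add: of_nat_diff)
 qed (use N g B in \<open>auto simp: gserD(1)\<close>)
 then obtain A' where A': "\<forall>j. r < j --> A' j = ?A j"
  "req ?n ?V False 0 (blk N N (S * P) (S * Q)) (map (%j. (A' j, if j <= r then ?bt j else 0, ?D j)) [1..<Suc N])"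
  unfolding blk_def by blast
 let ?R2 = "map (%j. (?A j, 0, ?D j)) [Suc r..<Suc N]"
 have upt: "[1..<Suc N] = [1..<Suc r] @ [Suc r..<Suc N]"
  using upt_add_eq_append[of 1 "Suc r" s] N by (simp del: upt_Suc)
 have m: "map (%j. (A' j, if j <= r then ?bt j else 0, ?D j)) [1..<Suc N] =
   map (%j. (A' j, ?bt j, ?D j)) [1..<Suc r] @ ?R2"
  unfolding upt map_append using A'(1) by (intro arg_cong2[of _ _ _ _ append] map_cong) (auto simp del: upt_Suc)
 have SPQ: "gser ?V (S * P)" "gser ?V (S * Q)" using g by (auto intro: gser_mult)
 have tr: "trc N (S * P)" "trc N (S * Q)" "trc r P" "trc r Q"
  unfolding N add.commute[of r] S_def P_def Q_def by (intro trc_mult trc_ser)+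
 have ok: "\<forall>x\<in>set (map (%j. (A' j, ?bt j, ?D j)) [1..<Suc r] @ ?R2). row_ok ?n ?V x"
  using req_row_ok[OF A'(2)] blk_row_ok[OF SPQ] unfolding m by blast
 have pot: "(\<Sum>j\<leftarrow>[1..<Suc r]. A' j * ?bt j) = psum (Suc N) P - psum (Suc N) Q"
 proof -
  have "pot (map (%j. (A' j, ?bt j, ?D j)) [1..<Suc r] @ ?R2) = psum (Suc N) (S * P) - psum (Suc N) (S * Q)"
   using req_pot[OF A'(2)] pot_blk[of "S * P" "S * Q" N N] g tr unfolding m by (simp add: gserD(1) del: upt_Suc)
  moreover have "pot ?R2 = 0" unfolding pot_map by (simp del: upt_Suc)
  ultimately show ?thesis using g by (simp add: pot_map psum_mult gserD(1) del: upt_Suc)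
 qed
 have "req ?n ?V False 0 (map (%j. (A' j, ?bt j, wt (1 :: nat, j))) [1..<Suc r])
   (map (%j. (UU N r P Q j, ?bt j, wt (1 :: nat, j))) [1..<Suc r])"
 proof (rule req_twist[where f = "%j. Var (2, j)"])
  show "?bt j = Var (1, j) - Var (2, j) & (1, j) \<in> ?V & Var (2, j) \<in> hm ?V (wt (1 :: nat, j)) & (1 :: nat, j) \<notin> pvars (Var (2, j))"
   if "j \<in> set [1..<Suc r]" for j
   using that hmg_Var[of "(2, j)" ?V wt] by (auto simp: P_def Q_def cf_ser wt_def simp del: upt_Suc)
  show "sorted_wrt (%i j. (1, i) \<notin> pvars (?bt j)) [1..<Suc r]"
  proof (rule sorted_wrt_mono_rel[OF _ sorted_wrt_upt])
   fix i j assume "i \<in> set [1..<Suc r]" "j \<in> set [1..<Suc r]" "i < j"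
   then show "(1, i) \<notin> pvars (?bt j)"
    using pvars_diff[of "Var (1::nat, j)" "Var (2::nat, j)"] by (auto simp: P_def Q_def cf_ser simp del: upt_Suc)
  qed
  show "A' j \<in> hm ?V (2 * ?n - wt (1 :: nat, j)) & UU N r P Q j \<in> hm ?V (2 * ?n - wt (1 :: nat, j))"
   if "j \<in> set [1..<Suc r]" for j
  proof
   have "row_ok ?n ?V (A' j, ?bt j, ?D j)" using ok that by (auto simp del: upt_Suc)
   then show "A' j \<in> hm ?V (2 * ?n - wt (1 :: nat, j))" by (simp add: row_ok_def wt_def)
   show "UU N r P Q j \<in> hm ?V (2 * ?n - wt (1 :: nat, j))"
    using that UU_hm[OF g(2,3), of j r N] by (auto simp: wt_def simp del: upt_Suc)
  qed
  show "(\<Sum>j\<leftarrow>[1..<Suc r]. A' j * ?bt j) = (\<Sum>j\<leftarrow>[1..<Suc r]. UU N r P Q j * ?bt j)"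
   unfolding pot using pot_blk_aux[of P Q r N] g tr by (simp add: gserD(1) del: upt_Suc)
 qed
 then have "req ?n ?V False 0 (map (%j. (A' j, ?bt j, ?D j)) [1..<Suc r]) (blk N r P Q)"
  by (simp add: blk_def wt_def del: upt_Suc)
 from req_trans0[OF A'(2)[unfolded m] req_append_right[OF this]] show ?thesis .
qed

text \<open>Rows are eliminated from the front: the variable of a row is absent from all later rows,
  as \<open>pkeq_elim\<close> demands.\<close>

lemma pkeq_elim_units:
 fixes v :: "'j => 'm \<times> nat"
 assumes "distinct (map v js)" "!!j. j \<in> set js ==> v j \<notin> V & c j ~= 0"
  and "!!j. j \<in> set js ==> g j \<in> hm (V \<union> v ` set js) (wt (v j)) & v j \<notin> pvars (g j)"
  and "sorted_wrt (%i j. v i \<notin> pvars (g j)) js"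
  and "\<forall>r\<in>set rs. row_ok n V r" "pot rs = 0"
 shows "pkeq n False 0 (V \<union> v ` set js) (map (%j. (0, Cst (c j) * Var (v j) + g j, wt (v j))) js @ rs) V rs"
 using assms
proof (induction js)
 case Nil
 then show ?case by (simp add: pkeq_refl)
next
 case (Cons i js)
 let ?W = "V \<union> v ` set js"
 let ?M = "map (%j. (0, Cst (c j) * Var (v j) + g j, wt (v j))) js"
 have W: "V \<union> v ` set (i # js) = insert (v i) ?W" by auto
 have vi: "v i \<notin> ?W" using Cons.prems(1,2) by auto
 have g: "g j \<in> hm ?W (wt (v j))" if "j \<in> set (i # js)" for j
 proof -
  have "v i \<notin> pvars (g j)" using that Cons.prems(3)[of i] Cons.prems(4) by auto
  then show ?thesis using Cons.prems(3)[OF that] unfolding W hmg_def by auto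
 qed
 have ok: "\<forall>r\<in>set (?M @ rs). row_ok n ?W r"
  using Cons.prems(5) g unfolding row_ok_def
  by (auto intro!: hmg_add hmg_Cst_mult hmg_Var intro: hmg_mono[of _ _ V])
 have pM: "pot ?M = 0" unfolding pot_map by simp
 have 1: "pkeq n False 0 (insert (v i) ?W) ((0, Cst (c i) * Var (v i) + g i, wt (v i)) # ?M @ rs) ?W (?M @ rs)"
  using ok vi g[of i] Cons.prems(2)[of i] Cons.prems(6) pM by (intro pkeq_elim) auto
 have 2: "pkeq n False 0 ?W (?M @ rs) V rs"
 proof (rule Cons.IH)
  show "g j \<in> hm ?W (wt (v j)) & v j \<notin> pvars (g j)" if "j \<in> set js" for j
   using g[of j] Cons.prems(3)[of j] that by auto
 qed (use Cons.prems in auto)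
 show ?case using pkeq_trans[OF 1 2] unfolding W by simp
qed

text \<open>A loop \<open>z\<close> of color \<open>s\<close> that is fused with an edge of color
  \<open>r\<close> to color \<open>N\<close> can be removed. By \<open>loop_universal\<close> there
  remain \<open>s\<close> extra rows \<open>(w j, 0)\<close>. With their entries interchanged they
  read \<open>(0, w j)\<close>, where \<open>w j\<close> is a nonzero multiple of the loop variable
  of index \<open>N + 1 - j\<close> plus terms in loop variables of smaller index and in
  \<open>V\<close>. These rows eliminate exactly the loop variables.\<close>

lemma pkeq_loop:
 fixes V :: "('m \<times> nat) set"
 assumes N: "N = r + s" and z: "!!i. (z, i) \<notin> V" and V: "!!x. x \<in> V ==> 0 < snd x"
  and P: "gser V P" "trc r P" and Q: "gser V Q" "trc r Q"
  and rs: "\<forall>x\<in>set rs. row_ok (int (Suc N)) V x" and p0: "pot (blk N r P Q @ rs) = 0"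
 shows "pkeq (int (Suc N)) (odd s) (int s * int r) (V \<union> {z} \<times> {1..s})
   (blk N N (ser z s * P) (ser z s * Q) @ rs) V (blk N r P Q @ rs)"
proof -
 let ?n = "int (Suc N)" and ?W = "V \<union> {z} \<times> {1..s}" and ?Vu = "{0::nat} \<times> {1..s} \<union> {1, 2} \<times> {1..r}"
 let ?S = "ser (0::nat) s" and ?P = "ser (1::nat) r" and ?Q = "ser (2::nat) r" and ?js = "[Suc r..<Suc N]"
 define \<sigma> where "\<sigma> = (%(a::nat, i). if a = 0 then Var (z, i) else if a = 1 then cf P i else cf Q i)"
 have \<sigma>: "\<sigma> x \<in> hm ?W (wt x)" if "x \<in> ?Vu" for x
 proof -
  have "cf P i \<in> hm ?W (2 * int i)" "cf Q i \<in> hm ?W (2 * int i)" for i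
   using gserD(2)[OF P(1)] gserD(2)[OF Q(1)] by (auto intro: hmg_mono)
  moreover have "Var (z, i) \<in> hm ?W (2 * int i)" if "1 <= i" "i <= s" for i
   using hmg_Var[of "(z, i)" ?W wt] that by (simp add: wt_def)
  ultimately show ?thesis using that by (auto simp: \<sigma>_def wt_def)
 qed
 have fm: "fmap (subst \<sigma>) ?S = ser z s" "fmap (subst \<sigma>) ?P = P" "fmap (subst \<sigma>) ?Q = Q"
  using P Q by (auto intro!: fmap_ser simp: \<sigma>_def gserD(1) trc_ser cf_ser)
 let ?u = "%j. UU N N (?S * ?P) (?S * ?Q) j"
 define w where "w = (%j. subst \<sigma> (?u j))"
 have "req ?n ?W False 0 (map (mrow (subst \<sigma>)) (blk N N (?S * ?P) (?S * ?Q)))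
   (map (mrow (subst \<sigma>)) (blk N r ?P ?Q @ map (%j. (?u j, 0, 2 * int j)) ?js))"
  by (rule req_subst[OF loop_universal[OF N] \<sigma>])
 then have 1: "req ?n ?W False 0 (blk N N (ser z s * P) (ser z s * Q))
   (blk N r P Q @ map (%j. (w j, 0, 2 * int j)) ?js)"
  unfolding map_append map_blk fmap_mult fm w_def by (simp add: comp_def del: upt_Suc)
 let ?X = "map (%j. (w j, 0, 2 * int j)) ?js" and ?R = "blk N r P Q @ rs"
 have len: "length ?X = s" by (simp add: N del: upt_Suc)
 have "(\<Sum>(a, b, d)\<leftarrow>?X. d - ?n) = (\<Sum>j\<leftarrow>?js. 2 * int j - int (Suc N))"
  by (simp add: comp_def del: upt_Suc)
 also have "\<dots> = int s * int r" using sum_upt_shift[of r N] N by simp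
 finally have sh: "(\<Sum>(a, b, d)\<leftarrow>?X. d - ?n) = int s * int r" .
 define Y :: "('m \<times> nat) row list" where "Y = map (%j. (0, w j, 2 * ?n - 2 * int j)) ?js"
 have 2: "req ?n ?W (odd s) (int s * int r) ?X Y"
  using req_abswap_all[of ?n ?W ?X] unfolding len sh Y_def by (simp add: comp_def del: upt_Suc)
 have 3: "req ?n ?W (odd s) (int s * int r) (blk N N (ser z s * P) (ser z s * Q) @ rs) (Y @ ?R)"
 proof -
  have "req ?n ?W False 0 (blk N N (ser z s * P) (ser z s * Q) @ rs) ((blk N r P Q @ ?X) @ rs)"
   by (rule req_append_right[OF 1])
  moreover have "req ?n ?W False 0 ((blk N r P Q @ ?X) @ rs) (?X @ ?R)" by (rule req_perm) simp
  ultimately have "req ?n ?W False 0 (blk N N (ser z s * P) (ser z s * Q) @ rs) (?X @ ?R)" by (rule req_trans0)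
  then show ?thesis using req_append_right[OF 2] by (rule req_trans1)
 qed
 have gz: "gser ?W (ser z s)" by (rule gser_ser) auto
 have PW: "gser ?W P" "gser ?W Q" using P(1) Q(1) by (auto intro: gser_mono)
 have trN: "trc N (ser z s * P)" "trc N (ser z s * Q)"
  unfolding N add.commute[of r] by (intro trc_mult trc_ser P Q)+
 have ok3: "\<forall>x\<in>set (blk N N (ser z s * P) (ser z s * Q) @ rs). row_ok ?n ?W x"
 proof -
  have "\<forall>x\<in>set (blk N N (ser z s * P) (ser z s * Q)). row_ok ?n ?W x"
   using gz PW by (intro blk_row_ok gser_mult)
  moreover have "\<forall>x\<in>set rs. row_ok ?n ?W x"
   using rs by (auto simp: row_ok_def intro: hmg_mono[of _ _ V])
  ultimately show ?thesis by auto
 qed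
 have pot3: "pot (blk N N (ser z s * P) (ser z s * Q) @ rs) = 0"
  using p0 pot_blk[of "ser z s * P" "ser z s * Q" N N] pot_blk[of P Q r N] trN P Q gz
  by (simp add: gserD(1) psum_mult)
 note k3 = req_pkeq[OF 3 ok3 pot3]
 have lin: "\<exists>c g. c ~= 0 & g \<in> hm (V \<union> {z} \<times> {1..<Suc N - j}) (wt (z, Suc N - j)) &
   w j = Cst c * Var (z, Suc N - j) + g" if j: "j \<in> set ?js" for j
 proof -
  let ?k = "Suc N - j"
  have jk: "1 <= j" "j <= N" "1 <= ?k" "?k <= s" "j + ?k = Suc N" using j N by (auto simp del: upt_Suc)
  have gu: "gser ?Vu (?S * ?P)" "gser ?Vu (?S * ?Q)" by (auto intro!: gser_mult gser_ser)
  have u: "?u j \<in> hm ?Vu (wt (0::nat, ?k))"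
   using UU_hm[OF gu jk(1,2), of N] jk by (simp add: wt_def of_nat_diff algebra_simps)
  obtain c g where cg: "?u j = Cst c * Var (0, ?k) + g" "g \<in> hm (?Vu - {(0, ?k)}) (wt (0::nat, ?k))"
   by (rule hmg_linear_part[OF u]) (use jk in \<open>auto simp: wt_def\<close>)
  \<comment> \<open>By degree only variables of index at most \<open>?k\<close> occur, which makes
    the rows triangular in the loop variables.\<close>
  have g': "g \<in> hm {x \<in> ?Vu - {(0, ?k)}. wt x <= wt (0::nat, ?k)} (wt (0::nat, ?k))"
   using cg(2) by (rule hm_low) auto
  \<comment> \<open>At this point the series of the loop is \<open>1 + bnd ?k 1\<close> and the
    other two are 1. All variables of \<open>g\<close> vanish, so only the coefficient
    \<open>c\<close> is left, and \<open>UU_diag\<close> evaluates it.\<close>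
  let ?ev = "%x. if x = (0::nat, ?k) then 1 else (0 :: (nat \<times> nat) mpol)"
  have e1: "fmap (subst ?ev) ?S = 1 + bnd ?k 1" "fmap (subst ?ev) ?P = 1" "fmap (subst ?ev) ?Q = 1"
   using jk by (auto intro!: fps_ext simp: cf_ser)
  have "subst ?ev (?u j) = Cst (- ((- 1) ^ N * of_nat (Suc N)))"
   unfolding subst_UU fmap_mult e1 mult_1_right by (rule UU_diag[OF jk(1,3,5)])
  moreover have "subst ?ev g = 0"
   using jk by (intro subst_zero_hmg[OF cg(2)]) (auto simp: wt_def)
  ultimately have "Cst c = (Cst (- ((- 1) ^ N * of_nat (Suc N))) :: (nat \<times> nat) mpol)"
   unfolding cg(1) by (simp add: subst_simps)
  moreover have "- ((- 1) ^ N * of_nat (Suc N)) ~= (0 :: complex)" by (simp del: of_nat_Suc)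
  ultimately have c: "c ~= 0" using Cst_eq_0 Cst_0 by metis
  have "subst \<sigma> g \<in> hm (V \<union> {z} \<times> {1..<?k}) (wt (0::nat, ?k))"
  proof (rule hmg_subst[OF g'])
   fix x assume x: "x \<in> {x \<in> ?Vu - {(0, ?k)}. wt x <= wt (0::nat, ?k)}"
   obtain a i where ai: "x = (a, i)" by (cases x)
   have "cf P i \<in> hm (V \<union> {z} \<times> {1..<?k}) (2 * int i)" "cf Q i \<in> hm (V \<union> {z} \<times> {1..<?k}) (2 * int i)"
    using gserD(2)[OF P(1)] gserD(2)[OF Q(1)] by (auto intro: hmg_mono)
   moreover have "Var (z, i) \<in> hm (V \<union> {z} \<times> {1..<?k}) (2 * int i)" if "a = 0"
   proof -
    have "i <= ?k" "i ~= ?k" "1 <= i" using x that by (auto simp: ai wt_def)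
    then have "(z, i) \<in> V \<union> {z} \<times> {1..<?k}" by auto
    from hmg_Var[OF this, of wt] show ?thesis by (simp add: wt_def)
   qed
   ultimately show "\<sigma> x \<in> hm (V \<union> {z} \<times> {1..<?k}) (wt x)" by (simp add: \<sigma>_def ai wt_def)
  qed
  moreover have "w j = Cst c * Var (z, ?k) + subst \<sigma> g"
   unfolding w_def cg(1) by (simp add: subst_simps \<sigma>_def)
  ultimately show ?thesis using c by (auto simp: wt_def)
 qed
 then obtain c g where cg: "!!j. j \<in> set ?js ==> c j ~= 0"
  "!!j. j \<in> set ?js ==> g j \<in> hm (V \<union> {z} \<times> {1..<Suc N - j}) (wt (z, Suc N - j))"
  "!!j. j \<in> set ?js ==> w j = Cst (c j) * Var (z, Suc N - j) + g j"
  by metis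
 let ?v = "%j. (z, Suc N - j)"
 have W: "?W = V \<union> ?v ` set ?js"
 proof -
  have "(%j. Suc N - j) ` {Suc r..<Suc N} = {1..s}"
  proof (intro equalityI subsetI)
   fix i assume "i \<in> {1..s}"
   then show "i \<in> (%j. Suc N - j) ` {Suc r..<Suc N}"
    using N by (intro image_eqI[of _ _ "Suc N - i"]) auto
  qed (use N in auto)
  then have "Pair z ` (%j. Suc N - j) ` {Suc r..<Suc N} = Pair z ` {1..s}" by (rule arg_cong)
  moreover have "Pair z ` {1..s} = {z} \<times> {1..s}" by auto
  ultimately show ?thesis unfolding image_image set_upt by simp
 qed
 have Y: "Y = map (%j. (0, Cst (c j) * Var (?v j) + g j, wt (?v j))) ?js"
  unfolding Y_def using cg(3) by (intro map_cong refl) (auto simp: wt_def of_nat_diff simp del: upt_Suc)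
 have 4: "pkeq ?n False 0 (V \<union> ?v ` set ?js) (map (%j. (0, Cst (c j) * Var (?v j) + g j, wt (?v j))) ?js @ ?R) V ?R"
 proof (rule pkeq_elim_units)
  show "distinct (map ?v ?js)" by (auto simp: distinct_map inj_on_def simp del: upt_Suc)
  show "?v j \<notin> V & c j ~= 0" if "j \<in> set ?js" for j using cg(1)[OF that] z by auto
  have pv: "pvars (g j) <= V \<union> {z} \<times> {1..<Suc N - j}" if "j \<in> set ?js" for j
   by (rule hmg_pvars[OF cg(2)[OF that]])
  show "g j \<in> hm (V \<union> ?v ` set ?js) (wt (?v j)) & ?v j \<notin> pvars (g j)" if "j \<in> set ?js" for j
  proof
   show "?v j \<notin> pvars (g j)" using pv[OF that] z by auto
   show "g j \<in> hm (V \<union> ?v ` set ?js) (wt (?v j))"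
    unfolding W[symmetric] using that N by (intro hmg_mono[OF cg(2)[OF that]]) (auto simp del: upt_Suc)
  qed
  show "sorted_wrt (%i j. ?v i \<notin> pvars (g j)) ?js"
  proof (rule sorted_wrt_mono_rel[OF _ sorted_wrt_upt])
   fix i j assume "i \<in> set ?js" "j \<in> set ?js" "i < j"
   show "?v i \<notin> pvars (g j)"
   proof
    assume "?v i \<in> pvars (g j)"
    then have "Suc N - i < Suc N - j" using pv[OF \<open>j \<in> set ?js\<close>] z by auto
    then show False using \<open>i < j\<close> by linarith
   qed
  qed
  show "\<forall>x\<in>set ?R. row_ok ?n V x" using blk_row_ok[OF P(1) Q(1), of N r] rs by auto
  show "pot ?R = 0" by (rule p0)
 qed
 have 5: "pkeq ?n False 0 ?W (Y @ ?R) V ?R" unfolding Y W by (rule 4)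
 show ?thesis using pkeq_trans[OF k3 5] by simp
qed

subsection \<open>Exchanging the ends of two thick edges\<close>

lemma gser_dif: "gser V A ==> gser V B ==> gser V (A - B + 1)"
 unfolding gser_def by (auto intro!: hmg_add hmg_diff)

lemma sum_Pair: "(\<Sum>v\<in>Pair a ` A. f v) = (\<Sum>j\<in>A. f (a, j))"
 by (subst sum.reindex) (auto simp: inj_on_def)

text \<open>The mixed difference vanishes when the variables of \<open>D\<close>, or those of
  \<open>E\<close>, are set to 0, so it is a combination of products of one variable from each, with
  coefficients \<open>C j k\<close>. For j + k = N + 1 the degree of \<open>C j k\<close> is 0, and
  the constant is the one of \<open>psum_hessian\<close>. The summands 1 restore the constant
  coefficient that a difference of series loses.\<close>

lemma second_difference:
 fixes N :: nat
 defines "L \<equiv> ser (0::nat) N" and "D \<equiv> ser 1 N" and "E \<equiv> ser 2 N" and "V \<equiv> {0, 1, 2} \<times> {1..N}"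
 defines "f \<equiv> psum (Suc N) (L - D + 1 - E + 1) - psum (Suc N) (L - E + 1) - psum (Suc N) (L - D + 1) + psum (Suc N) L"
 shows "\<exists>C. (\<forall>j\<in>{1..N}. \<forall>k\<in>{1..N}. C j k \<in> hm V (2 * int (Suc N) - 2 * int j - 2 * int k)) &
  f = (\<Sum>j\<in>{1..N}. Var (1, j) * (\<Sum>k\<in>{1..N}. Var (2, k) * C j k)) &
  (\<forall>j\<in>{1..N}. \<forall>k\<in>{1..N}. j + k = Suc N --> C j k = Cst (- ((- 1) ^ N * of_nat (Suc N))))"
proof -
 have g: "gser V L" "gser V D" "gser V E" unfolding L_def D_def E_def V_def by (intro gser_ser; auto)+
 have gs: "gser V (L - D + 1 - E + 1)" "gser V (L - E + 1)" "gser V (L - D + 1)"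
  using g by (intro gser_dif; simp)+
 have fV: "f \<in> hm V (2 * int (Suc N))"
  unfolding f_def by (intro hmg_add hmg_diff gser_ps gs g)
 have sf: "subst s f = psum (Suc N) (fmap (subst s) L - fmap (subst s) D + 1 - fmap (subst s) E + 1)
   - psum (Suc N) (fmap (subst s) L - fmap (subst s) E + 1) - psum (Suc N) (fmap (subst s) L - fmap (subst s) D + 1)
   + psum (Suc N) (fmap (subst s) L)" for s :: "nat \<times> nat => (nat \<times> nat) mpol"
  unfolding f_def subst_add subst_diff psum_fmap[OF gserD(1)[OF gs(1)]] psum_fmap[OF gserD(1)[OF gs(2)]]
   psum_fmap[OF gserD(1)[OF gs(3)]] psum_fmap[OF gserD(1)[OF g(1)]] fmap_add fmap_diff fmap_1 ..
 define z where "z a = (%x. if x \<in> set (map (Pair a) [1..<Suc N]) then 0 else Var x)" for a :: nat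
 have z: "z a (b, j) = (if a = b & 1 <= j & j <= N then 0 else Var (b, j))" for a b j
  by (auto simp: z_def simp del: upt_Suc)
 have set: "set (map (Pair a) [1..<Suc N]) = Pair a ` {1..N}" for a :: nat by (auto simp del: upt_Suc)
 have di: "distinct (map (Pair a) [1..<Suc N])" for a :: nat by (auto simp: distinct_map inj_on_def simp del: upt_Suc)
 have sub: "set (map (Pair a) [1..<Suc N]) <= V" if "a \<in> {1, 2}" for a
  unfolding set V_def using that by auto
 have "fmap (subst (z 1)) L = L" "fmap (subst (z 1)) D = 1" "fmap (subst (z 1)) E = E"
  "fmap (subst (z 2)) L = L" "fmap (subst (z 2)) D = D" "fmap (subst (z 2)) E = 1"
  by (auto intro!: fps_ext simp: L_def D_def E_def cf_ser z)
 then have z0: "subst (z 1) f = 0" "subst (z 2) f = 0" unfolding sf by simp_all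
 obtain q where q: "\<forall>v\<in>set (map (Pair 1) [1..<Suc N]). q v \<in> hm V (2 * int (Suc N) - wt v)"
  "f - subst (z 1) f = (\<Sum>v\<in>set (map (Pair 1) [1..<Suc N]). Var v * q v)"
  using zero_locus_ideal[OF di[of 1] sub[of 1] fV] unfolding z_def by blast
 have qV: "q (1, j) \<in> hm V (2 * int (Suc N) - 2 * int j)" if "j \<in> {1..N}" for j
  using q(1) that unfolding set by (auto simp: wt_def)
 have f1: "f = (\<Sum>j\<in>{1..N}. Var (1, j) * q (1, j))"
  using q(2) z0 unfolding set sum_Pair by simp
 have "\<forall>j\<in>{1..N}. \<exists>c. (\<forall>v\<in>set (map (Pair 2) [1..<Suc N]). c v \<in> hm V (2 * int (Suc N) - 2 * int j - wt v)) &
  q (1, j) - subst (z 2) (q (1, j)) = (\<Sum>v\<in>set (map (Pair 2) [1..<Suc N]). Var v * c v)"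
 proof
  fix j assume "j \<in> {1..N}"
  from zero_locus_ideal[OF di[of 2] sub[of 2] qV[OF this]]
  show "\<exists>c. (\<forall>v\<in>set (map (Pair 2) [1..<Suc N]). c v \<in> hm V (2 * int (Suc N) - 2 * int j - wt v)) &
   q (1, j) - subst (z 2) (q (1, j)) = (\<Sum>v\<in>set (map (Pair 2) [1..<Suc N]). Var v * c v)"
   unfolding z_def by simp
 qed
 from bchoice[OF this] obtain c where c0: "\<forall>j\<in>{1..N}. (\<forall>v\<in>set (map (Pair 2) [1..<Suc N]).
   c j v \<in> hm V (2 * int (Suc N) - 2 * int j - wt v)) &
  q (1, j) - subst (z 2) (q (1, j)) = (\<Sum>v\<in>set (map (Pair 2) [1..<Suc N]). Var v * c j v)" ..
 have c: "c j v \<in> hm V (2 * int (Suc N) - 2 * int j - wt v)" if "j \<in> {1..N}" "v \<in> set (map (Pair 2) [1..<Suc N])" for j v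
  using c0 that by (simp only:)
 have c2: "q (1, j) - subst (z 2) (q (1, j)) = (\<Sum>v\<in>set (map (Pair 2) [1..<Suc N]). Var v * c j v)"
  if "j \<in> {1..N}" for j
  using c0 that by (simp only:)
 define C where "C j k = c j (2, k)" for j k
 have CV: "C j k \<in> hm V (2 * int (Suc N) - 2 * int j - 2 * int k)" if "j \<in> {1..N}" "k \<in> {1..N}" for j k
  using c[OF that(1), of "(2, k)"] that(2) unfolding set C_def by (simp add: wt_def)
 have Cq: "q (1, j) - subst (z 2) (q (1, j)) = (\<Sum>k\<in>{1..N}. Var (2, k) * C j k)" if "j \<in> {1..N}" for j
  using c2[OF that] unfolding set sum_Pair C_def .
 have "f = f - subst (z 2) f" using z0 by simp
 also have "\<dots> = (\<Sum>j\<in>{1..N}. Var (1, j) * q (1, j)) - (\<Sum>j\<in>{1..N}. Var (1, j) * subst (z 2) (q (1, j)))"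
  unfolding f1 by (simp add: subst_simps z)
 also have "\<dots> = (\<Sum>j\<in>{1..N}. Var (1, j) * (\<Sum>k\<in>{1..N}. Var (2, k) * C j k))"
  unfolding sum_subtractf[symmetric] right_diff_distrib[symmetric] by (intro sum.cong refl arg_cong2[of _ _ _ _ "(*)"] Cq)
 finally have f2: "f = (\<Sum>j\<in>{1..N}. Var (1, j) * (\<Sum>k\<in>{1..N}. Var (2, k) * C j k))" .
 have const: "C j k = Cst (- ((- 1) ^ N * of_nat (Suc N)))" if j: "j \<in> {1..N}" and k: "k \<in> {1..N}" and jk: "j + k = Suc N" for j k
 proof -
  have "2 * int (Suc N) - 2 * int j - 2 * int k = 0" unfolding jk[symmetric] by simp
  then have "C j k \<in> hm V 0" using CV[OF j k] by simp
  then have C0: "C j k = Cst (lkp (C j k) 0)" by (rule hmg_const) (auto simp: V_def wt_def)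
  \<comment> \<open>Only the product of \<open>(1, j)\<close> and \<open>(2, k)\<close> survives, so
    \<open>f\<close> takes the value of \<open>C j k\<close>; on the other side it becomes the mixed
    difference of \<open>psum_hessian\<close> with both arguments -1.\<close>
  let ?ev = "%x. if x = (1, j) \<or> x = (2, k) then 1 else (0 :: (nat \<times> nat) mpol)"
  have "fmap (subst ?ev) L = 1" "fmap (subst ?ev) D = 1 + bnd j 1" "fmap (subst ?ev) E = 1 + bnd k 1"
   using j k by (auto intro!: fps_ext simp: L_def D_def E_def cf_ser)
  then have "subst ?ev f = psum (Suc N) (1 - (1 + bnd j 1) + 1 - (1 + bnd k 1) + 1) - psum (Suc N) (1 - (1 + bnd k 1) + 1)
   - psum (Suc N) (1 - (1 + bnd j 1) + 1)"
   unfolding sf by simp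
  moreover have m: "1 - (1 + bnd j 1) + 1 - (1 + bnd k 1) + 1 = 1 + bnd j (- 1) + (bnd k (- 1) :: (nat \<times> nat) mpol fps)"
   "1 - (1 + bnd k 1) + 1 = 1 + (bnd k (- 1) :: (nat \<times> nat) mpol fps)"
   "1 - (1 + bnd j 1) + 1 = 1 + (bnd j (- 1) :: (nat \<times> nat) mpol fps)"
   by (auto intro!: fps_ext)
  ultimately have "subst ?ev f = psum (Suc N) (1 + bnd j (- 1) + bnd k (- 1)) - psum (Suc N) (1 + bnd k (- 1)) - psum (Suc N) (1 + bnd j (- 1))"
   unfolding m by (simp only:)
  also have "\<dots> = - ((- 1) ^ N * of_nat (Suc N))"
   using psum_hessian[of j k N "- 1 :: (nat \<times> nat) mpol" "- 1"] j k jk by (simp del: of_nat_Suc)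
  finally have "subst ?ev f = - ((- 1) ^ N * of_nat (Suc N))" .
  moreover have "subst ?ev f = subst ?ev (C j k)"
  proof -
   have d: "(\<Sum>i\<in>{1..N}. (if i = i0 then 1 else 0) * g i) = g i0" if "i0 \<in> {1..N}"
    for i0 and g :: "nat => (nat \<times> nat) mpol"
   proof -
    have "(\<Sum>i\<in>{1..N}. (if i = i0 then 1 else 0) * g i) = (\<Sum>i\<in>{1..N}. if i = i0 then g i else 0)"
     by (intro sum.cong refl) simp
    then show ?thesis using that by simp
   qed
   have "subst ?ev f = (\<Sum>i\<in>{1..N}. (if i = j then 1 else 0) * (\<Sum>l\<in>{1..N}. (if l = k then 1 else 0) * subst ?ev (C i l)))"
    by (subst f2) (simp add: subst_sum subst_mult subst_Var)
   then show ?thesis unfolding d[OF j] d[OF k] .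
  qed
  ultimately have "Cst (lkp (C j k) 0) = - ((- 1) ^ N * of_nat (Suc N) :: (nat \<times> nat) mpol)"
   by (subst (asm) C0) simp
  then show ?thesis using C0 unfolding m1_power_Cst by (simp only: Cst_minus Cst_mult Cst_of_nat)
 qed
 show ?thesis using CV f2 const by (intro exI[of _ C]) blast
qed

lemma upt_conv_interval: "(\<Sum>j\<leftarrow>[1..<Suc N]. f j) = (\<Sum>j\<in>{1..N}. f j)"
 by (simp add: sum_list_distinct_conv_sum_set atLeastLessThanSuc_atLeastAtMost del: upt_Suc)

text \<open>A normal form for two blocks. After rows are added, the second entries are the total
  differences and those of the second block, still linear in the private variables of
  \<open>X\<close> and \<open>Z\<close>. By \<open>req_twist\<close> any homogeneous first entries
  with the correct potential may then be put in. In the proof a row is indexed by a pair whose flag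
  marks the second block.\<close>

lemma req_two_blocks:
 fixes a b c d N :: nat
 assumes dist: "distinct [a, b, c, d]"
 defines "X \<equiv> ser a N" and "Y \<equiv> ser b N" and "Z \<equiv> ser c N" and "W \<equiv> ser d N" and "V \<equiv> {a, b, c, d} \<times> {1..N}"
 assumes \<alpha>: "!!j. j \<in> {1..N} ==> \<alpha> j \<in> hm V (2 * int (Suc N) - 2 * int j)"
  and gm: "!!j. j \<in> {1..N} ==> gm j \<in> hm V (2 * int (Suc N) - 2 * int j)"
  and pot: "(\<Sum>j\<in>{1..N}. \<alpha> j * (cf X j - cf Y j + (cf Z j - cf W j))) + (\<Sum>j\<in>{1..N}. gm j * (cf Z j - cf W j)) =
   psum (Suc N) X - psum (Suc N) Y + (psum (Suc N) Z - psum (Suc N) W)"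
 shows "req (int (Suc N)) V False 0 (blk N N X Y @ blk N N Z W)
  (map (%j. (\<alpha> j, cf X j - cf Y j + (cf Z j - cf W j), 2 * int j)) [1..<Suc N] @
   map (%j. (gm j, cf Z j - cf W j, 2 * int j)) [1..<Suc N])"
proof -
 let ?n = "int (Suc N)" and ?js = "[1..<Suc N]"
 have g: "gser V X" "gser V Y" "gser V Z" "gser V W"
  unfolding X_def Y_def Z_def W_def V_def by (intro gser_ser; auto)+
 have tr: "trc N X" "trc N Y" "trc N Z" "trc N W"
  unfolding X_def Y_def Z_def W_def by (rule trc_ser)+
 define A where "A = (%(e, j). if e then UU N N Z W j - UU N N X Y j else UU N N X Y j)"
 define A' where "A' = (%(e, j). if e then gm j else \<alpha> j)"
 define B where "B = (%(e, j). if e then cf Z j - cf W j else cf X j - cf Y j + (cf Z j - cf W j))"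
 define v where "v = (%(e, j::nat). (if e then c else a, j))"
 define f where "f = (%(e, j). if e then cf W j else cf Y j - (cf Z j - cf W j))"
 let ?ls = "map (Pair False) ?js @ map (Pair True) ?js"
 have 1: "req ?n V False 0 (blk N N X Y @ blk N N Z W) (map (%j. (A j, B j, wt (v j))) ?ls)"
  using req_addrows[of ?n V "UU N N X Y" "%j. cf X j - cf Y j" "%j. 2 * int j" ?js "UU N N Z W" "%j. cf Z j - cf W j"]
  by (simp add: blk_def A_def B_def v_def wt_def comp_def del: upt_Suc)
 have ok: "\<forall>r\<in>set (map (%j. (A j, B j, wt (v j))) ?ls). row_ok ?n V r"
  using req_row_ok[OF 1] blk_row_ok[OF g(1,2), of N N] blk_row_ok[OF g(3,4), of N N] by auto
 have ser_simps: "cf X j = Var (a, j)" "cf Y j = Var (b, j)" "cf Z j = Var (c, j)" "cf W j = Var (d, j)"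
  if "1 <= j" "j <= N" for j using that unfolding X_def Y_def Z_def W_def by (simp_all add: cf_ser)
 have 2: "req ?n V False 0 (map (%j. (A j, B j, wt (v j))) ?ls) (map (%j. (A' j, B j, wt (v j))) ?ls)"
 proof (rule req_twist[where f = f])
  fix l assume "l \<in> set ?ls"
  obtain e j where l1: "l = (e, j)" by (cases l)
  have l: "l = (e, j)" "1 <= j" "j <= N" using \<open>l \<in> set ?ls\<close> l1 by (auto simp del: upt_Suc)
  have V: "Var (b, j) \<in> hm V (wt (v l))" "Var (c, j) \<in> hm V (wt (v l))" "Var (d, j) \<in> hm V (wt (v l))"
   using hmg_Var[of "(b, j)" V wt] hmg_Var[of "(c, j)" V wt] hmg_Var[of "(d, j)" V wt] l
   by (auto simp: V_def v_def wt_def)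
  have pv: "pvars (f l) <= (if e then {(d, j)} else {(b, j), (c, j), (d, j)})"
   using pvars_diff[of "Var (b, j)" "Var (c, j) - Var (d, j)"] pvars_diff[of "Var (c, j)" "Var (d, j)"] l
   by (auto simp: f_def ser_simps)
  have "B l = Var (v l) - f l"
   by (cases e) (simp_all add: l(1) B_def v_def f_def ser_simps[OF l(2,3)])
  moreover have "v l \<in> V" using l by (auto simp: v_def V_def)
  moreover have "f l \<in> hm V (wt (v l))"
   using V l by (cases e) (auto simp: f_def ser_simps intro!: hmg_diff)
  moreover have "v l \<notin> pvars (f l)"
   using pv dist by (auto simp: l v_def split: if_splits)
  ultimately show "B l = Var (v l) - f l & v l \<in> V & f l \<in> hm V (wt (v l)) & v l \<notin> pvars (f l)" by blast
  have "A l \<in> hm V (2 * ?n - wt (v l))"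
  proof -
   have "(A l, B l, wt (v l)) \<in> set (map (%j. (A j, B j, wt (v j))) ?ls)" using \<open>l \<in> set ?ls\<close> by (rule image_eqI[of _ "%j. (A j, B j, wt (v j))" l "set ?ls", OF refl, unfolded set_map[symmetric]])
   then have "row_ok ?n V (A l, B l, wt (v l))" using ok by blast
   then show ?thesis by (simp add: row_ok_def)
  qed
  moreover have "A' l \<in> hm V (2 * ?n - wt (v l))"
   using \<alpha>[of j] gm[of j] l by (cases e) (auto simp: A'_def v_def wt_def)
  ultimately show "A l \<in> hm V (2 * ?n - wt (v l)) & A' l \<in> hm V (2 * ?n - wt (v l))" by blast
 next
  show "sorted_wrt (%i j. v i \<notin> pvars (B j)) ?ls"
  proof -
   have pB: "pvars (B (e, j)) <= (if e then {(c, j), (d, j)} else {(a, j), (b, j), (c, j), (d, j)})"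
    if "1 <= j" "j <= N" for e j
    using pvars_add[of "Var (a, j) - Var (b, j)" "Var (c, j) - Var (d, j)"]
     pvars_diff[of "Var (c, j)" "Var (d, j)"] pvars_diff[of "Var (a, j)" "Var (b, j)"]
    by (auto simp: B_def ser_simps[OF that])
   have s: "sorted_wrt (%i j. v (e, i) \<notin> pvars (B (e, j))) ?js" for e
   proof (rule sorted_wrt_mono_rel[OF _ sorted_wrt_upt])
    fix i j assume "i \<in> set ?js" "j \<in> set ?js" "i < j"
    then show "v (e, i) \<notin> pvars (B (e, j))" using pB[of j e] by (auto simp: v_def split: if_splits)
   qed
   have m: "v (False, i) \<notin> pvars (B (True, j))" if "j \<in> set ?js" for i j
    using pB[of j True] that dist by (auto simp: v_def simp del: upt_Suc)
   show ?thesis unfolding sorted_wrt_append sorted_wrt_map using s m by (auto simp del: upt_Suc)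
  qed
  have "(\<Sum>j\<leftarrow>?ls. A j * B j) = pot (blk N N X Y @ blk N N Z W)"
   using req_pot[OF 1, unfolded pot_map] by (rule sym)
  also have "\<dots> = psum (Suc N) X - psum (Suc N) Y + (psum (Suc N) Z - psum (Suc N) W)"
   using g tr by (simp add: pot_blk gserD(1))
  also have "\<dots> = (\<Sum>j\<leftarrow>?ls. A' j * B j)"
   unfolding pot[symmetric] map_append sum_list_append map_map upt_conv_interval[symmetric]
   by (simp add: A'_def B_def comp_def del: upt_Suc)
  finally show "(\<Sum>j\<leftarrow>?ls. A j * B j) = (\<Sum>j\<leftarrow>?ls. A' j * B j)" .
 qed
 show ?thesis using req_trans0[OF 1 2] by (simp add: A'_def B_def v_def wt_def comp_def del: upt_Suc)
qed

lemma mset_reindex: "mset (map (%j. h (Suc N - j)) [1..<Suc N]) = mset (map h [1..<Suc N])"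
proof -
 have img: "(%j. Suc N - j) ` {1..<Suc N} = {1..<Suc N}"
 proof
  show "(%j. Suc N - j) ` {1..<Suc N} <= {1..<Suc N}" by auto
  show "{1..<Suc N} <= (%j. Suc N - j) ` {1..<Suc N}"
  proof
   fix i assume i: "i \<in> {1..<Suc N}"
   then have "i = Suc N - (Suc N - i)" "Suc N - i \<in> {1..<Suc N}" by auto
   then show "i \<in> (%j. Suc N - j) ` {1..<Suc N}" by (rule image_eqI)
  qed
 qed
 have "mset (map (%j. h (Suc N - j)) [1..<Suc N]) = image_mset h (image_mset (%j. Suc N - j) (mset_set {1..<Suc N}))"
  by (simp add: image_mset.compositionality comp_def del: upt_Suc)
 also have "image_mset (%j. Suc N - j) (mset_set {1..<Suc N}) = mset_set ((%j. Suc N - j) ` {1..<Suc N})"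
  by (rule image_mset_mset_set) (auto simp: inj_on_def)
 also note img
 finally show ?thesis by (simp del: upt_Suc)
qed

text \<open>The total differences \<open>s\<close> do not see how the ends are paired, and neither
  do the first entries \<open>\<alpha>\<close>, since \<open>K\<close> is symmetric in
  \<open>M1\<close> and \<open>M2\<close>. The remaining rows have second entries L2 - M2 for one
  pairing and L2 - M1 for the other. For the first pairing their first entries \<open>gm\<close> can
  be chosen as combinations of L2 - M1; interchanging entries and eliminating leads to the second
  pairing.\<close>

lemma swap_universal:
 fixes N :: nat
 defines "L1 \<equiv> ser (0::nat) N" and "L2 \<equiv> ser 1 N" and "M1 \<equiv> ser 2 N" and "M2 \<equiv> ser 3 N"
  and "V \<equiv> {0, 1, 2, 3} \<times> {1..N}"
 shows "req (int (Suc N)) V (odd N) 0 (blk N N L1 M1 @ blk N N L2 M2) (blk N N L2 M1 @ blk N N L1 M2)"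
proof -
 let ?n = "int (Suc N)" and ?js = "[1..<Suc N]"
 have g: "gser V L1" "gser V L2" "gser V M1" "gser V M2"
  unfolding L1_def L2_def M1_def M2_def V_def by (intro gser_ser; auto)+
 have tr: "trc N L1" "trc N L2" "trc N M1" "trc N M2"
  unfolding L1_def L2_def M1_def M2_def by (rule trc_ser)+
 let ?V3 = "{0::nat, 1, 2} \<times> {1..N}"
 let ?f = "psum (Suc N) (ser (0::nat) N - ser 1 N + 1 - ser 2 N + 1) - psum (Suc N) (ser 0 N - ser 2 N + 1)
  - psum (Suc N) (ser 0 N - ser 1 N + 1) + psum (Suc N) (ser 0 N)"
 obtain C where C: "!!j k. j \<in> {1..N} ==> k \<in> {1..N} ==> C j k \<in> hm ?V3 (2 * int (Suc N) - 2 * int j - 2 * int k)"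
  "?f = (\<Sum>j\<in>{1..N}. Var (1, j) * (\<Sum>k\<in>{1..N}. Var (2, k) * C j k))"
  "!!j k. j \<in> {1..N} ==> k \<in> {1..N} ==> j + k = Suc N ==> C j k = Cst (- ((- 1) ^ N * of_nat (Suc N)))"
  using second_difference[of N] by blast
 define dl where "dl j = cf L2 j - cf M2 j" for j
 define ep where "ep j = cf L2 j - cf M1 j" for j
 have dlep: "dl j \<in> hm V (2 * int j)" "ep j \<in> hm V (2 * int j)" for j
  unfolding dl_def ep_def using g by (auto intro: hmg_diff gserD(2))
 \<comment> \<open>The second difference is specialized to base point \<open>L2\<close> and
   increments L2 - M2 and L2 - M1. Its four corners are then \<open>K\<close>, \<open>M1\<close>,
   \<open>M2\<close> and \<open>L2\<close>.\<close>
 define tau where "tau = (%(m::nat, j). if m = 0 then cf L2 j else if m = 1 then dl j else ep j)"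
 have tau: "tau x \<in> hm V (wt x)" for x
  using dlep gserD(2)[OF g(2)] by (cases x) (simp add: tau_def wt_def)
 define T where "T j k = subst tau (C j k)" for j k
 have TV: "T j k \<in> hm V (2 * int (Suc N) - 2 * int j - 2 * int k)" if "j \<in> {1..N}" "k \<in> {1..N}" for j k
  unfolding T_def by (rule hmg_subst[OF C(1)[OF that] tau])
 define gm where "gm j = (\<Sum>k\<in>{1..N}. ep k * T j k)" for j
 \<comment> \<open>Chosen such that L1 - K is the total difference: the rows with second entries
   \<open>s\<close> carry the potential from \<open>L1\<close> to \<open>K\<close>, and the rest of
   the potential is the second difference.\<close>
 define K where "K = M1 - L2 + M2"
 have K: "gser V K" unfolding K_def gser_def using g by (auto simp: gserD(1) intro!: hmg_add hmg_diff gserD(2))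
 have trK: "trc N K" using tr unfolding K_def trc_def by simp
 define \<alpha> where "\<alpha> = UU N N L1 K"
 have \<alpha>V: "\<alpha> j \<in> hm V (2 * ?n - 2 * int j)" if "j \<in> {1..N}" for j
  using that unfolding \<alpha>_def by (intro UU_hm g K) auto
 have gmV: "gm j \<in> hm V (2 * ?n - 2 * int j)" if "j \<in> {1..N}" for j
  unfolding gm_def using that by (intro hmg_sum hmg_mult'[OF dlep(2) TV]) auto
 define s where "s j = cf L1 j - cf M1 j + (cf L2 j - cf M2 j)" for j
 have sK: "cf L1 j - cf K j = s j" for j by (simp add: s_def K_def)
 have pot\<alpha>: "(\<Sum>j\<in>{1..N}. \<alpha> j * s j) = psum (Suc N) L1 - psum (Suc N) K"
  using pot_blk_aux[of L1 K N N] g K tr trK unfolding upt_conv_interval \<alpha>_def sK by (simp add: gserD(1))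
 have potgm: "(\<Sum>j\<in>{1..N}. gm j * dl j) = psum (Suc N) K - psum (Suc N) M1 - psum (Suc N) M2 + psum (Suc N) L2"
 proof -
  have fm: "fmap (subst tau) (ser 0 N) = L2" "fmap (subst tau) (ser 1 N) = L2 - M2 + 1" "fmap (subst tau) (ser 2 N) = L2 - M1 + 1"
   using g tr by (auto intro!: fmap_ser simp: tau_def dl_def ep_def gserD(1) trc_def)
  have "subst tau ?f = (\<Sum>j\<in>{1..N}. dl j * gm j)"
   unfolding C(2) gm_def T_def by (simp add: subst_simps tau_def)
  moreover have "subst tau ?f = psum (Suc N) (L2 - (L2 - M2 + 1) + 1 - (L2 - M1 + 1) + 1) -
    psum (Suc N) (L2 - (L2 - M1 + 1) + 1) - psum (Suc N) (L2 - (L2 - M2 + 1) + 1) + psum (Suc N) L2"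
  proof -
   have c: "cf (ser (0::nat) N - ser 1 N + 1 - ser 2 N + 1) 0 = 1" "cf (ser (0::nat) N - ser 2 N + 1) 0 = 1"
    "cf (ser (0::nat) N - ser 1 N + 1) 0 = 1" "cf (ser (0::nat) N) 0 = 1" by (simp_all add: cf_ser)
   show ?thesis
    by (simp only: subst_add subst_diff psum_fmap[OF c(1)] psum_fmap[OF c(2)] psum_fmap[OF c(3)] psum_fmap[OF c(4)]
      fmap_add fmap_diff fmap_1 fm)
  qed
  moreover have "L2 - (L2 - M2 + 1) + 1 - (L2 - M1 + 1) + 1 = K" "L2 - (L2 - M1 + 1) + 1 = M1" "L2 - (L2 - M2 + 1) + 1 = M2"
   by (simp_all add: K_def algebra_simps)
  ultimately show ?thesis by (simp add: mult.commute)
 qed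
 have V1: "{0, 2, 1, 3} \<times> {1..N} = V" "{0, 3, 1, 2} \<times> {1..N} = V" unfolding V_def by auto
 have A1: "req ?n V False 0 (blk N N L1 M1 @ blk N N L2 M2)
   (map (%j. (\<alpha> j, s j, 2 * int j)) ?js @ map (%j. (gm j, dl j, 2 * int j)) ?js)"
  using req_two_blocks[of 0 2 1 3 N \<alpha> gm] pot\<alpha> potgm \<alpha>V gmV unfolding V1 s_def dl_def L1_def[symmetric] L2_def[symmetric] M1_def[symmetric] M2_def[symmetric]
  by (simp del: upt_Suc)
 have A2: "req ?n V (odd N) 0 (map (%j. (gm j, dl j, 2 * int j)) ?js) (map (%j. (dl j, gm j, 2 * ?n - 2 * int j)) ?js)"
 proof -
  have "(\<Sum>(a, b, d)\<leftarrow>map (%j. (gm j, dl j, 2 * int j)) ?js. d - ?n) = 0"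
   using sum_upt_shift[of 0 N] by (simp add: comp_def del: upt_Suc)
  then show ?thesis
   using req_abswap_all[of ?n V "map (%j. (gm j, dl j, 2 * int j)) ?js"] by (simp add: comp_def del: upt_Suc)
 qed
 let ?b = "%k. gm (Suc N - k)"
 \<comment> \<open>After the interchange row j has a second entry of degree 2 (N + 1 - j).
   Renumbering by k = N + 1 - j restores degree 2k and turns the constant antidiagonal of
   \<open>T\<close> into a diagonal.\<close>
 have A3: "req ?n V False 0 (map (%j. (dl j, gm j, 2 * ?n - 2 * int j)) ?js) (map (%k. (dl (Suc N - k), ?b k, 2 * int k)) ?js)"
 proof (rule req_perm)
  have E: "map (%j. (dl j, gm j, 2 * ?n - 2 * int j)) ?js =
    map (%j. (%k. (dl (Suc N - k), ?b k, 2 * int k)) (Suc N - j)) ?js"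
   by (intro map_cong refl) (auto simp: of_nat_diff simp del: upt_Suc)
  show "mset (map (%j. (dl j, gm j, 2 * ?n - 2 * int j)) ?js) = mset (map (%k. (dl (Suc N - k), ?b k, 2 * int k)) ?js)"
   unfolding E by (rule mset_reindex[where h = "%k. (dl (Suc N - k), ?b k, 2 * int k)"])
 qed
 have "\<exists>A'. (\<forall>j. N < j --> A' j = dl (Suc N - j)) &
   req ?n V False 0 (map (%k. (dl (Suc N - k), ?b k, 2 * int k)) ?js)
    (map (%k. (A' k, if k <= N then ep k else 0, 2 * int k)) ?js)"
 proof (rule req_triangular[where T = "%k l. T (Suc N - k) l" and c = "%_. - ((- 1) ^ N * of_nat (Suc N))"])
  show "?b k = (\<Sum>l = 1..min k N. T (Suc N - k) l * ep l)" if k: "k \<in> {1..N}" for k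
  proof -
   have "?b k = (\<Sum>l\<in>{1..N}. T (Suc N - k) l * ep l)" unfolding gm_def by (simp add: mult.commute)
   also have "\<dots> = (\<Sum>l = 1..min k N. T (Suc N - k) l * ep l)"
   proof (rule sum.mono_neutral_right)
    show "\<forall>l\<in>{1..N} - {1..min k N}. T (Suc N - k) l * ep l = 0"
    proof
     fix l assume l: "l \<in> {1..N} - {1..min k N}"
     \<comment> \<open>Beyond the diagonal the coefficients have negative degree.\<close>
     have "T (Suc N - k) l = 0"
     proof (rule hmg_neg[OF TV])
      show "2 * int (Suc N) - 2 * int (Suc N - k) - 2 * int l < 0" using l k by (auto simp: of_nat_diff)
     qed (use k l in \<open>auto simp: wt_def\<close>)
     then show "T (Suc N - k) l * ep l = 0" by simp
    qed
   qed auto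
   finally show ?thesis .
  qed
  show "T (Suc N - k) k = Cst (- ((- 1) ^ N * of_nat (Suc N))) & - ((- 1) ^ N * of_nat (Suc N)) ~= (0 :: complex)"
   if "k \<in> {1..N}" for k
   using C(3)[of "Suc N - k" k] that by (auto simp: T_def simp del: of_nat_Suc)
  show "T (Suc N - k) l \<in> hm V (2 * int k - 2 * int l)" if "1 <= l" "l < k" "k <= N" for k l
  proof -
   have kl: "Suc N - k \<in> {1..N}" "l \<in> {1..N}" using that by auto
   have "2 * int (Suc N) - 2 * int (Suc N - k) - 2 * int l = 2 * int k - 2 * int l"
    using that by (simp add: of_nat_diff)
   then show ?thesis using TV[OF kl] by (simp only:)
  qed
 qed simp
 then obtain A' where "req ?n V False 0 (map (%k. (dl (Suc N - k), ?b k, 2 * int k)) ?js)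
    (map (%k. (A' k, if k <= N then ep k else 0, 2 * int k)) ?js)" by blast
 moreover have "map (%k. (A' k, if k <= N then ep k else 0, 2 * int k)) ?js = map (%k. (A' k, ep k, 2 * int k)) ?js"
  by (intro map_cong refl) (auto simp del: upt_Suc)
 ultimately have A4: "req ?n V False 0 (map (%k. (dl (Suc N - k), ?b k, 2 * int k)) ?js) (map (%k. (A' k, ep k, 2 * int k)) ?js)"
  by (simp only:)
 let ?S = "map (%j. (\<alpha> j, s j, 2 * int j)) ?js" and ?E = "map (%k. (A' k, ep k, 2 * int k)) ?js"
 have A: "req ?n V (odd N) 0 (blk N N L1 M1 @ blk N N L2 M2) (?S @ ?E)"
  by (rule req_trans1[OF A1 req_append_left[OF req_trans2[OF A2 req_trans0[OF A3 A4]]]])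
 have A'V: "A' j \<in> hm V (2 * ?n - 2 * int j)" if "j \<in> {1..N}" for j
 proof -
  have "\<forall>r\<in>set (blk N N L1 M1 @ blk N N L2 M2). row_ok ?n V r"
   using blk_row_ok[OF g(1,3), of N N] blk_row_ok[OF g(2,4), of N N] by auto
  then have "\<forall>r\<in>set (?S @ ?E). row_ok ?n V r" using req_row_ok[OF A] by blast
  moreover have "(A' j, ep j, 2 * int j) \<in> set (?S @ ?E)" using that by (auto simp del: upt_Suc)
  ultimately have "row_ok ?n V (A' j, ep j, 2 * int j)" by blast
  then show ?thesis by (simp add: row_ok_def)
 qed
 have potA: "(\<Sum>j\<in>{1..N}. \<alpha> j * s j) + (\<Sum>j\<in>{1..N}. A' j * ep j) =
   psum (Suc N) L1 - psum (Suc N) M1 + (psum (Suc N) L2 - psum (Suc N) M2)"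
  using req_pot[OF A] g tr unfolding pot_simps pot_map upt_conv_interval by (simp add: pot_blk gserD(1))
 have s': "s j = cf L1 j - cf M2 j + (cf L2 j - cf M1 j)" for j by (simp add: s_def)
 \<comment> \<open>The rows just obtained are also a normal form for the other pairing. The first
   entries \<open>A'\<close> are never computed: row operations preserve the potential, and that is
   all the normal form asks for.\<close>
 have B: "req ?n V False 0 (blk N N L1 M2 @ blk N N L2 M1) (?S @ ?E)"
  using req_two_blocks[of 0 3 1 2 N \<alpha> A'] potA \<alpha>V A'V unfolding V1 s' ep_def L1_def[symmetric] L2_def[symmetric] M1_def[symmetric] M2_def[symmetric]
  by (simp add: algebra_simps del: upt_Suc)
 have "req ?n V (odd N) 0 (blk N N L1 M1 @ blk N N L2 M2) (blk N N L1 M2 @ blk N N L2 M1)"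
  by (rule req_trans2[OF A req_sym0[OF B]])
 moreover have "req ?n V False 0 (blk N N L1 M2 @ blk N N L2 M1) (blk N N L2 M1 @ blk N N L1 M2)"
  by (rule req_perm) simp
 ultimately show ?thesis by (rule req_trans2)
qed

lemma req_swap:
 fixes V :: "('m \<times> nat) set"
 assumes "gser V L1" "gser V L2" "gser V M1" "gser V M2" "trc N L1" "trc N L2" "trc N M1" "trc N M2"
 shows "req (int (Suc N)) V (odd N) 0 (blk N N L1 M1 @ blk N N L2 M2) (blk N N L2 M1 @ blk N N L1 M2)"
proof -
 define \<sigma> where "\<sigma> = (%(a::nat, i). cf (if a = 0 then L1 else if a = 1 then L2 else if a = 2 then M1 else M2) i)"
 have "\<sigma> x \<in> hm V (wt x)" for x
  using assms by (cases x) (auto simp: \<sigma>_def wt_def gserD(2))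
 from req_subst[OF swap_universal[of N] this]
 have "req (int (Suc N)) V (odd N) 0 (map (mrow (subst \<sigma>)) (blk N N (ser 0 N) (ser 2 N) @ blk N N (ser 1 N) (ser 3 N)))
   (map (mrow (subst \<sigma>)) (blk N N (ser 1 N) (ser 2 N) @ blk N N (ser 0 N) (ser 3 N)))" .
 moreover have "fmap (subst \<sigma>) (ser 0 N) = L1" "fmap (subst \<sigma>) (ser 1 N) = L2"
   "fmap (subst \<sigma>) (ser 2 N) = M1" "fmap (subst \<sigma>) (ser 3 N) = M2"
  using assms by (auto intro!: fmap_ser simp: \<sigma>_def gserD(1))
 ultimately show ?thesis by (simp add: map_blk)
qed

section \<open>Symmetric polynomials in several alphabets\<close>

definition mo :: "'x set => ('x \<Rightarrow>\<^sub>0 nat)" where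
 "mo B = (\<Sum>x\<in>B. Poly_Mapping.single x 1)"

lemma lookup_mo: "finite B ==> lkp (mo B) x = (if x \<in> B then 1 else 0)"
 unfolding mo_def lookup_sum by (simp add: lookup_single when_def sum.delta)

lemma keys_mo: "finite B ==> keys (mo B) = B"
 by (auto simp: in_keys_iff lookup_mo split: if_splits)

lemma prod_Var: "finite B ==> (\<Prod>x\<in>B. Var x) = Poly_Mapping.single (mo B) 1"
 by (induction B rule: finite_induct) (auto simp: mo_def Var_def mult_single)

lemma finite_subsets_card: "finite A ==> finite {B. B <= A & card B = j}"
 by (rule finite_subset[of _ "Pow A"]) auto

lemma keys_esym:
 assumes "finite A"
 shows "lkp (esym j A) t = (if \<exists>B. B <= A & card B = j & t = mo B then 1 else 0)"
proof -
 let ?S = "{B. B <= A & card B = j}"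
 have fS: "finite ?S" by (rule finite_subsets_card[OF assms])
 have "lkp (esym j A) t = (\<Sum>B\<in>?S. if mo B = t then 1 else 0)"
  unfolding esym_def lookup_sum
  by (intro sum.cong refl) (auto simp: prod_Var finite_subset[OF _ assms] lookup_single when_def)
 also have "\<dots> = (if \<exists>B. B <= A & card B = j & t = mo B then 1 else 0)"
 proof (cases "\<exists>B. B <= A & card B = j & t = mo B")
  case True
  then obtain B where B: "B \<in> ?S" "t = mo B" by auto
  have "mo C = t \<longleftrightarrow> C = B" if "C \<in> ?S" for C
  proof -
   have f: "finite C" "finite B" using that B finite_subset[OF _ assms] by blast+
   show ?thesis unfolding B(2) by (metis keys_mo f)
  qed
  then have "(\<Sum>B\<in>?S. if mo B = t then 1 else 0) = (\<Sum>C\<in>?S. if C = B then 1 else (0 :: complex))"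
   by (intro sum.cong refl) auto
  then show ?thesis using B fS True by (simp add: sum.delta)
 next
  case False
  then show ?thesis by (auto intro!: sum.neutral)
 qed
 finally show ?thesis .
qed

lemma esym_wdeg:
 assumes "finite A"
 shows "esym j A \<in> hmg (%_. 2) A (2 * int j)"
proof -
 have "esym j A \<in> hmg (%_. 2) A (2 * int j)" unfolding esym_def
 proof (rule hmg_sum)
  fix B assume B: "B \<in> {B. B <= A & card B = j}"
  have "(\<Prod>x\<in>B. Var x) \<in> hmg (%_. 2) A (\<Sum>x\<in>B. 2)"
   using B by (intro hmg_prod hmg_Var[of _ A "%_. 2"]) auto
  then show "(\<Prod>x\<in>B. Var x) \<in> hmg (%_. 2) A (2 * int j)" using B by (simp add: mult.commute)
 qed
 then show ?thesis .
qed

lemma subst_perm_esym: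
 assumes "bij prm" "prm ` A = A" "finite A"
 shows "subst (%x. Var (prm x)) (esym j A) = esym j A"
proof -
 let ?S = "{B. B <= A & card B = j}"
 have inj: "inj prm" using assms(1) by (rule bij_is_inj)
 have "subst (%x. Var (prm x)) (esym j A) = (\<Sum>B\<in>?S. \<Prod>x\<in>prm ` B. Var x)"
  unfolding esym_def by (simp add: subst_simps prod.reindex inj_on_subset[OF inj])
 also have "\<dots> = (\<Sum>B\<in>(`) prm ` ?S. \<Prod>x\<in>B. Var x)"
  using inj by (subst sum.reindex) (auto simp: inj_on_def inj_image_eq_iff)
 also have "(`) prm ` ?S = ?S"
 proof
  show "(`) prm ` ?S <= ?S" using assms(2) by (auto simp: card_image inj_on_subset[OF inj])
  show "?S <= (`) prm ` ?S"
  proof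
   fix B assume B: "B \<in> ?S"
   have e: "prm ` (prm -` B) = B" using bij_is_surj[OF assms(1)] by (rule surj_image_vimage_eq)
   have "prm -` B <= A"
   proof
    fix x assume "x \<in> prm -` B"
    then have "prm x \<in> prm ` A" using B assms(2) by auto
    then show "x \<in> A" using inj by (auto simp: inj_def)
   qed
   moreover have "card (prm -` B) = j"
    using card_image[OF inj_on_subset[OF inj], of "prm -` B"] e B by auto
   ultimately show "B \<in> (`) prm ` ?S" using e by (intro image_eqI[of _ _ "prm -` B"]) auto
  qed
 qed
 finally show ?thesis unfolding esym_def .
qed

lemma Sym_esym:
 assumes "A \<in> \<A>" "pairwise disjnt \<A>" "finite A"
 shows "esym j A \<in> Sym \<A>"
proof -
 have "subst (%x. Var (prm x)) (esym j A) = esym j A" if "A' \<in> \<A>" "prm permutes A'" for A' prm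
 proof (rule subst_perm_esym)
  show "bij prm" using that(2) by (rule permutes_bij)
  show "prm ` A = A"
  proof (cases "A = A'")
   case True
   then show ?thesis using that permutes_image by auto
  next
   case False
   then have "A \<inter> A' = {}" using assms that by (auto simp: pairwise_def disjnt_def)
   then have "prm x = x" if "x \<in> A" for x using that \<open>prm permutes A'\<close> by (auto simp: permutes_def)
   then show ?thesis by force
  qed
 qed (rule assms(3))
 then show ?thesis using hmg_pvars[OF esym_wdeg[OF assms(3)], of j] assms(1) by (auto simp: Sym_def)
qed

lemma Sym_add: "f \<in> Sym \<A> ==> g \<in> Sym \<A> ==> f + g \<in> Sym \<A>"
 using pvars_add[of f g] by (auto simp: Sym_def subst_simps)
lemma Sym_mult: "f \<in> Sym \<A> ==> g \<in> Sym \<A> ==> f * g \<in> Sym \<A>"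
 using pvars_mult[of f g] by (auto simp: Sym_def subst_simps)
lemma Sym_Cst: "Cst c \<in> Sym \<A>"
 by (simp add: Sym_def)
lemma Sym_0: "0 \<in> Sym \<A>"
 using Sym_Cst[of 0] by simp
lemma Sym_1: "1 \<in> Sym \<A>"
 using Sym_Cst[of 1] by simp
lemma Sym_diff: "f \<in> Sym \<A> ==> g \<in> Sym \<A> ==> f - g \<in> Sym \<A>"
 using Sym_add[of f \<A> "Cst (- 1) * g"] Sym_mult[OF Sym_Cst, of g \<A> "-1"] by (simp add: Cst_minus)
lemma Sym_power: "f \<in> Sym \<A> ==> f ^ n \<in> Sym \<A>"
 by (induction n) (auto intro: Sym_mult Sym_1)
lemma Sym_sum: "(!!a. a \<in> S ==> f a \<in> Sym \<A>) ==> sum f S \<in> Sym \<A>"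
 by (induction S rule: infinite_finite_induct) (auto intro: Sym_add Sym_0)
lemma Sym_prod: "(!!a. a \<in> S ==> f a \<in> Sym \<A>) ==> prod f S \<in> Sym \<A>"
 by (induction S rule: infinite_finite_induct) (auto intro: Sym_mult Sym_1)
lemma Sym_subst:
 assumes "!!x. x \<in> pvars f ==> s x \<in> Sym \<A>"
 shows "subst s f \<in> Sym \<A>"
 unfolding subst_def using assms
 by (intro Sym_sum Sym_mult Sym_Cst Sym_prod Sym_power) (auto simp: pvars_def)

subsection \<open>The fundamental theorem\<close>

lemma less_pm: "(f :: nat \<Rightarrow>\<^sub>0 nat) < g \<longleftrightarrow> (\<exists>k. lkp f k < lkp g k & (\<forall>k'<k. lkp f k' = lkp g k'))"
 by (simp add: less_poly_mapping.rep_eq less_fun_def)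

text \<open>The setting of the fundamental theorem for several alphabets: a variable
  \<open>v\<close> stands for the elementary symmetric polynomial of index \<open>ix v\<close> in
  the alphabet \<open>al v\<close>, and each of positive index is represented exactly once.
  \<open>\<iota>\<close> numbers the letters, to compare monomials.\<close>

locale alphabets =
 fixes V :: "'v set" and al :: "'v => 'x set" and ix :: "'v => nat" and \<A> :: "'x set set" and \<iota> :: "'x => nat"
 assumes finA: "finite \<A>" "!!A. A \<in> \<A> ==> finite A" and disj: "pairwise disjnt \<A>"
  and bij: "bij_betw (%v. (al v, ix v)) V {(A, j). A \<in> \<A> & 1 <= j & j <= card A}"
  and \<iota>: "inj_on \<iota> (\<Union>\<A>)"
begin

abbreviation "X \<equiv> \<Union>\<A>"

lemma finX: "finite X" using finA by auto

definition e where "e v = esym (ix v) (al v)"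
definition ev :: "'v mpol => 'x mpol" where "ev = subst e"
abbreviation "R \<equiv> rnm \<iota>"
definition rk where "rk A x = card {y \<in> A. \<iota> y <= \<iota> x}"
text \<open>The first \<open>ix v\<close> letters of \<open>al v\<close>; their product is the
  leading monomial of \<open>e v\<close>.\<close>

definition F where "F v = {x \<in> al v. rk (al v) x <= ix v}"

lemma V: "v \<in> V ==> al v \<in> \<A>" "v \<in> V ==> 1 <= ix v" "v \<in> V ==> ix v <= card (al v)"
 using bij by (auto simp: bij_betw_def)

lemma V_inj: "v \<in> V ==> v' \<in> V ==> al v = al v' ==> ix v = ix v' ==> v = v'"
 using bij unfolding bij_betw_def inj_on_def by blast

lemma V_ex: "A \<in> \<A> ==> 1 <= j ==> j <= card A ==> \<exists>v\<in>V. al v = A & ix v = j"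
proof -
 assume "A \<in> \<A>" "1 <= j" "j <= card A"
 then have "(A, j) \<in> (%v. (al v, ix v)) ` V" using bij by (simp add: bij_betw_def)
 then show ?thesis by auto
qed

lemma finV: "finite V"
proof -
 have "{(A, j). A \<in> \<A> & 1 <= j & j <= card A} <= (SIGMA A:\<A>. {..card A})" by auto
 then have "finite {(A, j). A \<in> \<A> & 1 <= j & j <= card A}" by (rule finite_subset) (use finA in auto)
 then show ?thesis using bij bij_betw_finite by blast
qed

lemma rk_mono:
 assumes "A \<in> \<A>" "x \<in> A" "y \<in> A" "\<iota> x < \<iota> y"
 shows "rk A x < rk A y"
proof -
 have "y \<in> {z \<in> A. \<iota> z <= \<iota> y}" "y \<notin> {z \<in> A. \<iota> z <= \<iota> x}" using assms by auto
 moreover have "{z \<in> A. \<iota> z <= \<iota> x} <= {z \<in> A. \<iota> z <= \<iota> y}" using assms by auto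
 ultimately have "{z \<in> A. \<iota> z <= \<iota> x} \<subset> {z \<in> A. \<iota> z <= \<iota> y}" by blast
 then show ?thesis unfolding rk_def using finA(2)[OF assms(1)] by (intro psubset_card_mono) auto
qed

lemma rk_bij:
 assumes A: "A \<in> \<A>"
 shows "bij_betw (rk A) A {1..card A}"
proof -
 note fA = finA(2)[OF A]
 have inj: "inj_on (rk A) A"
 proof (rule inj_onI)
  fix x y assume xy: "x \<in> A" "y \<in> A" "rk A x = rk A y"
  then have "~ \<iota> x < \<iota> y" "~ \<iota> y < \<iota> x" using rk_mono[OF A, of x y] rk_mono[OF A, of y x] by auto
  then have "\<iota> x = \<iota> y" by simp
  then show "x = y" using \<iota> xy A by (auto dest: inj_onD)
 qed
 have "rk A ` A <= {1..card A}"
 proof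
  fix i assume "i \<in> rk A ` A"
  then obtain x where x: "x \<in> A" "i = rk A x" by auto
  have "x \<in> {y \<in> A. \<iota> y <= \<iota> x}" using x by simp
  then have "0 < rk A x" unfolding rk_def using fA by (subst card_gt_0_iff) auto
  moreover have "rk A x <= card A" unfolding rk_def using fA by (intro card_mono) auto
  ultimately show "i \<in> {1..card A}" using x by simp
 qed
 moreover have "card (rk A ` A) = card {1..card A}" using card_image[OF inj] by simp
 ultimately have "rk A ` A = {1..card A}" by (intro card_subset_eq) auto
 then show ?thesis using inj by (simp add: bij_betw_def)
qed

lemma finF: "v \<in> V ==> finite (F v)" "v \<in> V ==> F v <= al v"
 using finA(2)[OF V(1)] by (auto simp: F_def)

lemma card_F: "v \<in> V ==> card (F v) = ix v"
proof -
 assume v: "v \<in> V"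
 note b = rk_bij[OF V(1)[OF v]]
 have "rk (al v) ` F v = {1..ix v}"
 proof
  show "rk (al v) ` F v <= {1..ix v}" using b by (auto simp: F_def bij_betw_def)
  show "{1..ix v} <= rk (al v) ` F v"
  proof
   fix i assume i: "i \<in> {1..ix v}"
   then have "i \<in> rk (al v) ` al v" using b V(3)[OF v] by (auto simp: bij_betw_def)
   then show "i \<in> rk (al v) ` F v" using i by (auto simp: F_def)
  qed
 qed
 moreover have "inj_on (rk (al v)) (F v)" using b finF(2)[OF v] by (auto simp: bij_betw_def inj_on_subset)
 ultimately show ?thesis using card_image by fastforce
qed

lemma inj_R: "inj_on R {t. keys t <= X}"
 by (rule inj_on_rnm[OF \<iota> finX])

lemma lookup_R: "keys t <= X ==> x \<in> X ==> lkp (R t) (\<iota> x) = lkp t x"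
 by (rule lookup_rnm[OF \<iota> finX])

lemma lookup_R_out: "keys t <= X ==> k \<notin> \<iota> ` X ==> lkp (R t) k = 0"
 unfolding rnm_superset[OF finX] lookup_sum
 by (intro sum.neutral) (auto simp: lookup_single when_def)

text \<open>At the first place where \<open>B\<close> and \<open>F v\<close> differ the letter
  belongs to \<open>F v\<close>. If it belonged to \<open>B\<close>, all letters of
  \<open>F v\<close> would come earlier and lie in \<open>B\<close> as well, and \<open>B\<close>
  would have more than \<open>ix v\<close> elements.\<close>

lemma R_mo_le:
 assumes v: "v \<in> V" and B: "B <= al v" "card B = ix v"
 shows "R (mo B) <= R (mo (F v))"
proof (cases "B = F v")
 case False
 let ?A = "al v"
 have A: "?A \<in> \<A>" "finite ?A" using V(1)[OF v] finA(2) by auto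
 have fin: "finite B" "finite (F v)" using B(1) A(2) finF[OF v] finite_subset by auto
 have kX: "keys (mo B) <= X" "keys (mo (F v)) <= X"
  using B(1) A(1) finF(2)[OF v] by (auto simp: keys_mo[OF fin(1)] keys_mo[OF fin(2)])
 define D where "D = \<iota> ` ((B - F v) \<union> (F v - B))"
 have "D ~= {}" "finite D" using False fin by (auto simp: D_def)
 define k where "k = Min D"
 have kD: "k \<in> D" and kmin: "!!k'. k' \<in> D ==> k <= k'"
  using \<open>D ~= {}\<close> \<open>finite D\<close> by (auto simp: k_def)
 have agree: "x \<in> B \<longleftrightarrow> x \<in> F v" if "\<iota> x < k" for x
  using kmin[of "\<iota> x"] that by (force simp: D_def)
 obtain x where x: "k = \<iota> x" "x \<in> (B - F v) \<union> (F v - B)" using kD by (auto simp: D_def)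
 have "x \<in> F v - B"
 proof (rule ccontr)
  assume "x \<notin> F v - B"
  then have xB: "x \<in> B" "x \<notin> F v" using x(2) by auto
  have "y \<in> B" if y: "y \<in> F v" for y
  proof -
   have "\<iota> y < \<iota> x"
   proof (rule ccontr)
    assume "~ \<iota> y < \<iota> x"
    then have "\<iota> x <= \<iota> y" by simp
    then have "rk ?A x <= rk ?A y" unfolding rk_def using A(2) by (intro card_mono) auto
    then have "x \<in> F v" using y xB B(1) by (auto simp: F_def)
    then show False using xB by simp
   qed
   then show ?thesis using agree[of y] y x(1) by simp
  qed
  then have "insert x (F v) <= B" using xB by auto
  then have "card (insert x (F v)) <= card B" using fin by (intro card_mono)
  then show False using xB fin card_F[OF v] B(2) by simp
 qed
 then have xF: "x \<in> F v" "x \<notin> B" by auto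
 have xX: "x \<in> X" using xF finF(2)[OF v] A by auto
 have "R (mo B) < R (mo (F v))"
  unfolding less_pm
 proof (intro exI[of _ k] conjI allI impI)
  show "lkp (R (mo B)) k < lkp (R (mo (F v))) k"
   using xF by (simp add: x(1) lookup_R[OF kX(1) xX] lookup_R[OF kX(2) xX] lookup_mo fin)
  fix k' assume k': "k' < k"
  show "lkp (R (mo B)) k' = lkp (R (mo (F v))) k'"
  proof (cases "k' \<in> \<iota> ` X")
   case True
   then obtain y where y: "y \<in> X" "k' = \<iota> y" by auto
   then show ?thesis using agree[of y] k' lookup_R[OF kX(1) y(1)] lookup_R[OF kX(2) y(1)]
    by (simp add: lookup_mo fin)
  qed (simp add: lookup_R_out kX)
 qed
 then show ?thesis by simp
qed simp

definition lead :: "'x mpol => ('x \<Rightarrow>\<^sub>0 nat) => bool" where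
 "lead f t \<longleftrightarrow> pvars f <= X & keys t <= X & lkp f t = 1 & (\<forall>u\<in>keys f. R u <= R t)"

lemma lead_mult:
 assumes "lead f t" "lead g s"
 shows "lead (f * g) (t + s)"
proof -
 have k: "keys f <= {t. keys t <= X}" "keys g <= {t. keys t <= X}"
  "t \<in> {t. keys t <= X}" "s \<in> {t. keys t <= X}"
  using assms by (auto simp: lead_def pvars_def)
 have i: "inj_on R (insert t (keys f))" "inj_on R (insert s (keys g))"
  by (rule inj_on_subset[OF inj_R], use k in blast)+
 have f: "R u <= R t" if "u \<in> keys f" for u using assms that by (simp add: lead_def)
 have g: "R u <= R s" if "u \<in> keys g" for u using assms that by (simp add: lead_def)
 note lm = leading_mult[of R f t g s, OF rnm_add f i(1) g i(2)]
 have "keys (t + s) <= X" using keys_add[of t s] k by auto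
 moreover have "pvars (f * g) <= X" using pvars_mult[of f g] assms by (auto simp: lead_def)
 ultimately show ?thesis using lm assms unfolding lead_def by auto
qed

lemma lead_1: "lead 1 0"
 by (auto simp: lead_def lookup_one)

lemma lead_prod: "finite S ==> (!!a. a \<in> S ==> lead (f a) (t a)) ==> lead (prod f S) (sum t S)"
 by (induction S rule: finite_induct) (auto intro: lead_1 lead_mult)

lemma lead_power: "lead f t ==> lead (f ^ n) (\<Sum>i<n. t)"
 using lead_prod[of "{..<n}" "%_. f" "%_. t"] by simp

lemma lead_e:
 assumes v: "v \<in> V"
 shows "lead (e v) (mo (F v))"
proof -
 have A: "al v \<in> \<A>" "finite (al v)" using V(1)[OF v] finA(2) by auto
 have "R u <= R (mo (F v))" if "u \<in> keys (e v)" for u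
  using that R_mo_le[OF v] unfolding e_def in_keys_iff keys_esym[OF A(2)] by (auto split: if_splits)
 moreover have "lkp (e v) (mo (F v)) = 1"
  unfolding e_def keys_esym[OF A(2)] using card_F[OF v] finF[OF v] by auto
 moreover have "pvars (e v) <= X" unfolding e_def using hmg_pvars[OF esym_wdeg[OF A(2)]] A(1) by blast
 moreover have "keys (mo (F v)) <= X" using finF[OF v] A by (auto simp: keys_mo)
 ultimately show ?thesis unfolding lead_def by blast
qed

text \<open>The exponent of the leading monomial of \<open>mprod e s\<close>.\<close>

definition tht :: "('v \<Rightarrow>\<^sub>0 nat) => ('x \<Rightarrow>\<^sub>0 nat)" where
 "tht s = (\<Sum>v\<in>keys s. \<Sum>i<lkp s v. mo (F v))"

lemma lead_mprod: "keys s <= V ==> lead (mprod e s) (tht s)"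
 unfolding mprod_def tht_def by (intro lead_prod lead_power lead_e) auto

lemma lookup_tht:
 assumes "keys s <= V"
 shows "lkp (tht s) x = (\<Sum>v\<in>V. if x \<in> F v then lkp s v else 0)"
proof -
 have "lkp (tht s) x = (\<Sum>v\<in>keys s. if x \<in> F v then lkp s v else 0)"
  unfolding tht_def lookup_sum using assms finF(1)
  by (intro sum.cong refl) (auto simp: lookup_mo subset_iff)
 also have "\<dots> = (\<Sum>v\<in>V. if x \<in> F v then lkp s v else 0)"
  using assms finV by (intro sum.mono_neutral_left) (auto simp: in_keys_iff)
 finally show ?thesis .
qed

lemma F_iff:
 assumes "A \<in> \<A>" "x \<in> A" "v \<in> V"
 shows "x \<in> F v \<longleftrightarrow> al v = A & rk A x <= ix v"
proof -
 have "al v = A" if "x \<in> al v"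
  using assms V(1)[OF assms(3)] disj that by (auto simp: pairwise_def disjnt_def)
 then show ?thesis using assms(2) by (auto simp: F_def)
qed

text \<open>A letter of rank i belongs to the leading monomials of index at least i, so the
  exponents of the letters are tail sums of \<open>s\<close>.\<close>

lemma tht_step:
 assumes s: "keys s <= V" and v: "v \<in> V" and x: "x \<in> al v" "rk (al v) x = ix v"
 shows "lkp (tht s) x = lkp s v + (\<Sum>v'\<in>V. if al v' = al v & ix v < ix v' then lkp s v' else 0)"
proof -
 have "lkp (tht s) x = (\<Sum>v'\<in>V. (if v' = v then lkp s v' else 0) + (if al v' = al v & ix v < ix v' then lkp s v' else 0))"
  unfolding lookup_tht[OF s]
 proof (rule sum.cong[OF refl])
  fix v' assume v': "v' \<in> V"
  have "x \<in> F v' \<longleftrightarrow> al v' = al v & ix v <= ix v'" using F_iff[OF V(1)[OF v] x(1) v'] x(2) by simp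
  moreover have "v' = v \<longleftrightarrow> al v' = al v & ix v' = ix v" using V_inj[OF v' v] by auto
  ultimately show "(if x \<in> F v' then lkp s v' else 0) =
    (if v' = v then lkp s v' else 0) + (if al v' = al v & ix v < ix v' then lkp s v' else 0)"
   by auto
 qed
 also have "\<dots> = lkp s v + (\<Sum>v'\<in>V. if al v' = al v & ix v < ix v' then lkp s v' else 0)"
  using finV v by (simp add: sum.distrib sum.delta)
 finally show ?thesis .
qed

lemma ex_rank: "v \<in> V ==> \<exists>x\<in>al v. rk (al v) x = ix v"
proof -
 assume v: "v \<in> V"
 have "ix v \<in> rk (al v) ` al v" using rk_bij[OF V(1)[OF v]] V(2,3)[OF v] by (auto simp: bij_betw_def)
 then show ?thesis by auto
qed

text \<open>Tail sums determine the exponents, from the largest index of each alphabet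
  downwards.\<close>

lemma tht_inj:
 assumes s: "keys s <= V" and s': "keys s' <= V" and eq: "tht s = tht s'"
 shows "s = s'"
proof -
 have "lkp s v = lkp s' v" if "v \<in> V" for v
  using that
 proof (induction "card (al v) - ix v" arbitrary: v rule: less_induct)
  case less
  obtain x where x: "x \<in> al v" "rk (al v) x = ix v" using ex_rank[OF less.prems] by auto
  have "(\<Sum>v'\<in>V. if al v' = al v & ix v < ix v' then lkp s v' else 0) =
    (\<Sum>v'\<in>V. if al v' = al v & ix v < ix v' then lkp s' v' else 0)"
  proof (intro sum.cong refl)
   fix v' assume v': "v' \<in> V"
   show "(if al v' = al v & ix v < ix v' then lkp s v' else 0) = (if al v' = al v & ix v < ix v' then lkp s' v' else 0)"
   proof (cases "al v' = al v & ix v < ix v'")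
    case True
    then have "card (al v') - ix v' < card (al v) - ix v" using V(3)[OF v'] by auto
    then show ?thesis using less.hyps[OF _ v'] by simp
   qed auto
  qed
  then show ?case using tht_step[OF s less.prems x] tht_step[OF s' less.prems x] eq by simp
 qed
 moreover have "lkp s v = lkp s' v" if "v \<notin> V" for v
 proof -
  have "v \<notin> keys s" "v \<notin> keys s'" using that s s' by auto
  then show ?thesis by (simp add: in_keys_iff)
 qed
 ultimately show ?thesis by (intro poly_mapping_eqI) blast
qed

text \<open>Algebraic independence: distinct monomials have distinct leading exponents by
  \<open>tht_inj\<close>, so the largest one cannot be cancelled.\<close>

lemma ev_inj:
 assumes "pvars g <= V" "ev g = 0"
 shows "g = 0"
proof (rule ccontr)
 assume "g ~= 0"
 have kV: "keys s <= V" if "s \<in> keys g" for s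
  using that assms(1) by (auto simp: pvars_def)
 let ?T = "(%s. R (tht s)) ` keys g"
 have "?T ~= {}" "finite ?T" using \<open>g ~= 0\<close> by (auto simp: keys_eq_empty)
 then have "Max ?T \<in> ?T" by simp
 then obtain s0 where s0: "s0 \<in> keys g" "R (tht s0) = Max ?T" by auto
 have mx: "R (tht s) <= R (tht s0)" if "s \<in> keys g" for s using that s0(2) by simp
 have z: "lkp (mprod e s) (tht s0) = (if s = s0 then 1 else 0)" if s: "s \<in> keys g" for s
 proof (cases "s = s0")
  case True
  then show ?thesis using lead_mprod[OF kV[OF s]] by (simp add: lead_def)
 next
  case False
  have l: "lead (mprod e s) (tht s)" "lead (mprod e s0) (tht s0)" using lead_mprod kV s s0 by auto
  have "tht s ~= tht s0" using tht_inj[OF kV[OF s] kV[OF s0(1)]] False by auto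
  then have "R (tht s) ~= R (tht s0)" using inj_R l by (auto simp: lead_def inj_on_def)
  then have "R (tht s) < R (tht s0)" using mx[OF s] by simp
  then have "tht s0 \<notin> keys (mprod e s)" using l(1) by (auto simp: lead_def dest!: bspec)
  then show ?thesis using False by (simp add: in_keys_iff)
 qed
 have "lkp (ev g) (tht s0) = (\<Sum>s\<in>keys g. lkp g s * lkp (mprod e s) (tht s0))"
  unfolding ev_def subst_def mprod_def[symmetric] by (simp add: lookup_sum lookup_Cst_mult)
 also have "\<dots> = (\<Sum>s\<in>keys g. if s = s0 then lkp g s else 0)"
  by (intro sum.cong refl) (simp add: z)
 also have "\<dots> = lkp g s0" using s0 by (simp add: sum.delta)
 finally show False using assms(2) s0(1) by (simp add: in_keys_iff)
qed

lemma e_Sym: "v \<in> V ==> e v \<in> Sym \<A>"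
 unfolding e_def using V(1) finA disj by (intro Sym_esym) auto

lemma ev_Sym: "pvars g <= V ==> ev g \<in> Sym \<A>"
 unfolding ev_def by (intro Sym_subst e_Sym) auto

lemma ev_hmg:
 assumes "g \<in> hmg (%v. 2 * int (ix v)) V d"
 shows "ev g \<in> hmg (%_. 2) X d"
 unfolding ev_def
proof (rule hmg_subst[OF assms])
 fix v assume v: "v \<in> V"
 show "e v \<in> hmg (%_. 2) X (2 * int (ix v))"
  unfolding e_def using esym_wdeg[OF finA(2)[OF V(1)[OF v]], of "ix v"] V(1)[OF v] by (auto elim!: hmg_mono)
qed

lemma perm_lookup:
 assumes "f \<in> Sym \<A>" "A \<in> \<A>" "x \<in> A" "y \<in> A" "t \<in> keys f"
 shows "\<exists>t' \<in> keys f. \<forall>z. lkp t' z = lkp t (Transposition.transpose x y z)"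
proof -
 let ?prm = "Transposition.transpose x y"
 have perm: "?prm permutes A" using assms by (intro permutes_swap_id)
 have inj: "inj ?prm" by simp
 define P where "P u = Poly_Mapping.map_key ?prm u" for u :: "'x \<Rightarrow>\<^sub>0 nat"
 have lP: "lkp (P u) z = lkp u (?prm z)" for u z
  unfolding P_def by (simp add: map_key.rep_eq inj)
 have PP: "P (P u) = u" for u by (rule poly_mapping_eqI) (simp add: lP)
 have kP: "keys (P u) = ?prm ` keys u" for u
 proof (intro set_eqI iffI)
  fix z assume "z \<in> keys (P u)"
  then have "?prm z \<in> keys u" by (simp add: in_keys_iff lP)
  then show "z \<in> ?prm ` keys u" by (intro image_eqI[of _ _ "?prm z"]) auto
 qed (auto simp: in_keys_iff lP)
 have mp: "mprod (%x. Var (?prm x)) u = Poly_Mapping.single (P u) 1" for u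
 proof -
  have "mprod Var (P u) = mprod (%x. Var (?prm x)) u"
   unfolding mprod_def kP by (subst prod.reindex) (auto simp: lP inj_on_subset[OF inj])
  then show ?thesis by (simp add: mprod_Var)
 qed
 have "lkp (subst (%x. Var (?prm x)) f) (P t) = (\<Sum>u\<in>keys f. if u = t then lkp f u else 0)"
  unfolding subst_def mprod_def[symmetric] mp lookup_sum lookup_Cst_mult
 proof (intro sum.cong refl)
  fix u
  have "P u = P t \<longleftrightarrow> u = t" using PP by metis
  then show "lkp f u * lkp (Poly_Mapping.single (P u) 1) (P t) = (if u = t then lkp f u else 0)"
   by (simp add: lookup_single when_def)
 qed
 also have "\<dots> = lkp f t" using assms(5) by (simp add: sum.delta)
 finally have "lkp f (P t) = lkp f t" using assms(1,2) perm by (auto simp: Sym_def)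
 then have "P t \<in> keys f" using assms(5) by (simp add: in_keys_iff)
 then show ?thesis using lP by blast
qed

text \<open>Otherwise the transposition of \<open>x\<close> and \<open>y\<close>, which fixes
  \<open>f\<close>, would produce a larger monomial of \<open>f\<close>.\<close>

lemma lead_decreasing:
 assumes f: "f \<in> Sym \<A>" and t: "t \<in> keys f" "!!u. u \<in> keys f ==> R u <= R t"
  and A: "A \<in> \<A>" "x \<in> A" "y \<in> A" "\<iota> x < \<iota> y"
 shows "lkp t y <= lkp t x"
proof (rule ccontr)
 assume n: "~ lkp t y <= lkp t x"
 obtain t' where t': "t' \<in> keys f" "!!z. lkp t' z = lkp t (Transposition.transpose x y z)"
  using perm_lookup[OF f A(1-3) t(1)] by blast
 have kX: "keys u <= X" if "u \<in> keys f" for u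
  using f that by (auto simp: Sym_def pvars_def)
 have xy: "x \<in> X" "y \<in> X" using A by auto
 have "R t < R t'"
  unfolding less_pm
 proof (intro exI[of _ "\<iota> x"] conjI allI impI)
  show "lkp (R t) (\<iota> x) < lkp (R t') (\<iota> x)"
   using n by (simp add: lookup_R[OF kX[OF t(1)] xy(1)] lookup_R[OF kX[OF t'(1)] xy(1)] t'(2))
  fix k assume k: "k < \<iota> x"
  show "lkp (R t) k = lkp (R t') k"
  proof (cases "k \<in> \<iota> ` X")
   case True
   then obtain z where z: "z \<in> X" "k = \<iota> z" by auto
   then have "z ~= x" "z ~= y" using k A(4) by auto
   then show ?thesis
    using lookup_R[OF kX[OF t(1)] z(1)] lookup_R[OF kX[OF t'(1)] z(1)] z(2) by (simp add: t'(2) Transposition.transpose_def)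
  qed (simp add: lookup_R_out kX t(1) t'(1))
 qed
 then show False using t(2)[OF t'(1)] by simp
qed

text \<open>Inverts the tail sums: the exponent of \<open>v\<close> is the drop of \<open>t\<close>
  from rank \<open>ix v\<close> to the next rank, the value beyond the last letter being 0.
  Subtraction of natural numbers is exact because \<open>t\<close> decreases along each
  alphabet.\<close>

lemma decreasing_tht:
 assumes t: "keys t <= X"
  and dec: "!!A x y. A \<in> \<A> ==> x \<in> A ==> y \<in> A ==> \<iota> x < \<iota> y ==> lkp t y <= lkp t x"
 shows "\<exists>s. keys s <= V & tht s = t"
proof -
 define g where "g A i = (if i <= card A then lkp t (inv_into A (rk A) i) else 0)" for A i
 define f where "f v = (if v \<in> V then g (al v) (ix v) - g (al v) (Suc (ix v)) else 0)" for v
 define s where "s = Abs_poly_mapping f"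
 have fin: "finite {v. f v ~= 0}" by (rule finite_subset[OF _ finV]) (auto simp: f_def split: if_splits)
 have ls: "lkp s v = f v" for v unfolding s_def using fin by simp
 have sV: "keys s <= V" by (auto simp: in_keys_iff ls f_def split: if_splits)
 have gdec: "g A (Suc i) <= g A i" if A: "A \<in> \<A>" and i: "1 <= i" for A i
 proof (cases "Suc i <= card A")
  case True
  note b = rk_bij[OF A]
  let ?x = "inv_into A (rk A) i" and ?y = "inv_into A (rk A) (Suc i)"
  have i': "i \<in> rk A ` A" "Suc i \<in> rk A ` A" using b True i by (auto simp: bij_betw_def)
  have xy: "?x \<in> A" "?y \<in> A" "rk A ?x = i" "rk A ?y = Suc i"
   using inv_into_into[OF i'(1)] inv_into_into[OF i'(2)] f_inv_into_f[OF i'(1)] f_inv_into_f[OF i'(2)] by auto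
  have "\<iota> ?x < \<iota> ?y"
  proof (rule ccontr)
   assume "~ \<iota> ?x < \<iota> ?y"
   then have "rk A ?y <= rk A ?x" unfolding rk_def using finA(2)[OF A] by (intro card_mono) auto
   then show False using xy by simp
  qed
  then show ?thesis using dec[OF A xy(1,2)] True by (simp add: g_def)
 qed (simp add: g_def)
 have tail: "g (al v) (ix v) = f v + (\<Sum>v'\<in>V. if al v' = al v & ix v < ix v' then f v' else 0)" if "v \<in> V" for v
  using that
 proof (induction "card (al v) - ix v" arbitrary: v rule: less_induct)
  case less
  note v = less.prems
  show ?case
  proof (cases "ix v < card (al v)")
   case False
   then have "ix v = card (al v)" using V(3)[OF v] by simp
   moreover have "(\<Sum>v'\<in>V. if al v' = al v & ix v < ix v' then f v' else 0) = 0"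
    using V(3) calculation by (intro sum.neutral) (fastforce simp: leD)
   ultimately show ?thesis using v by (simp add: f_def g_def)
  next
   case True
   obtain w where w: "w \<in> V" "al w = al v" "ix w = Suc (ix v)" using V_ex[OF V(1)[OF v], of "Suc (ix v)"] True by auto
   have IH: "g (al w) (ix w) = f w + (\<Sum>v'\<in>V. if al v' = al w & ix w < ix v' then f v' else 0)"
    using w True by (intro less.hyps) auto
   have "(\<Sum>v'\<in>V. if al v' = al v & ix v < ix v' then f v' else 0) =
     (\<Sum>v'\<in>V. (if v' = w then f v' else 0) + (if al v' = al w & ix w < ix v' then f v' else 0))"
   proof (intro sum.cong refl)
    fix v' assume v': "v' \<in> V"
    have "v' = w \<longleftrightarrow> al v' = al w & ix v' = ix w" using V_inj[OF v' w(1)] by auto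
    then show "(if al v' = al v & ix v < ix v' then f v' else 0) =
      (if v' = w then f v' else 0) + (if al v' = al w & ix w < ix v' then f v' else 0)"
     using w by auto
   qed
   also have "\<dots> = g (al v) (Suc (ix v))" using IH w finV by (simp add: sum.distrib sum.delta)
   finally show ?thesis using gdec[OF V(1)[OF v] V(2)[OF v]] v by (simp add: f_def)
  qed
 qed
 have "lkp (tht s) x = lkp t x" for x
 proof (cases "x \<in> X")
  case True
  then obtain A where A: "A \<in> \<A>" "x \<in> A" by auto
  have r: "rk A x \<in> {1..card A}" using rk_bij[OF A(1)] A(2) by (auto simp: bij_betw_def)
  then obtain v where v: "v \<in> V" "al v = A" "ix v = rk A x" using V_ex[OF A(1), of "rk A x"] by auto
  have "lkp (tht s) x = g A (rk A x)"
   using tht_step[OF sV v(1), of x] tail[OF v(1)] A v unfolding ls by simp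
  also have "\<dots> = lkp t x"
   using r inv_into_f_f[OF bij_betw_imp_inj_on[OF rk_bij[OF A(1)]] A(2)] by (simp add: g_def)
  finally show ?thesis .
 next
  case False
  have "lkp (tht s) x = 0" unfolding lookup_tht[OF sV]
   using False finF(2) V(1) by (intro sum.neutral) auto
  moreover have "lkp t x = 0" using False t by (auto simp: in_keys_iff)
  ultimately show ?thesis by simp
 qed
 then show ?thesis using sV poly_mapping_eqI by blast
qed

lemma finite_monomials: "finite {u. keys u <= X & wdeg (%_. 2) u = d}"
proof -
 let ?M = "{u :: 'x \<Rightarrow>\<^sub>0 nat. keys u <= X & wdeg (%_. 2) u = d}"
 let ?B = "{0..nat d}"
 have "finite {f. \<forall>x. (x \<in> X --> f x \<in> ?B) & (x \<notin> X --> f x = 0)}"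
  using finX by (intro finite_set_of_finite_funs) auto
 moreover have "lkp ` ?M <= {f. \<forall>x. (x \<in> X --> f x \<in> ?B) & (x \<notin> X --> f x = 0)}"
 proof
  fix f assume "f \<in> lkp ` ?M"
  then obtain u where u: "f = lkp u" "keys u <= X" "wdeg (%_. 2) u = d" by auto
  have "int (lkp u x) <= d" for x
  proof (cases "x \<in> keys u")
   case True
   have "2 * int (lkp u x) <= wdeg (%_. 2) u"
    unfolding wdeg_def using True by (intro member_le_sum) auto
   then show ?thesis using u(3) by simp
  next
   case False
   have "0 <= wdeg (%_. 2) u" unfolding wdeg_def by (intro sum_nonneg) auto
   then show ?thesis using False u(3) by (simp add: in_keys_iff)
  qed
  then have "lkp u x \<in> ?B" for x unfolding atLeastAtMost_iff using nat_mono[of "int (lkp u x)" d] by simp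
  moreover have "lkp u x = 0" if "x \<notin> X" for x using u(2) that by (auto simp: in_keys_iff)
  ultimately show "f \<in> {f. \<forall>x. (x \<in> X --> f x \<in> ?B) & (x \<notin> X --> f x = 0)}" using u(1) by simp
 qed
 ultimately have "finite (lkp ` ?M)" by (rule finite_subset[rotated])
 moreover have "inj_on lkp ?M" by (rule inj_onI) (metis poly_mapping_eqI)
 ultimately show ?thesis by (rule finite_imageD)
qed

text \<open>The classical descent: a multiple of a product of elementary symmetric polynomials with
  the same leading term is subtracted. It ends because only finitely many monomials of degree
  \<open>d\<close> lie below a leading one. The degree bookkeeping makes the preimage
  homogeneous.\<close>

lemma ev_surj:
 assumes "f \<in> Sym \<A>" "f \<in> hmg (%_. 2) X d"
 shows "\<exists>g \<in> hmg (%v. 2 * int (ix v)) V d. ev g = f"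
proof -
 let ?M = "{u. keys u <= X & wdeg (%_. 2) u = d}"
 let ?S = "%f. {u \<in> ?M. \<exists>k\<in>keys f. R u <= R k}"
 show ?thesis using assms
 proof (induction "card (?S f)" arbitrary: f rule: less_induct)
  case less
  show ?case
  proof (cases "f = 0")
   case True
   then show ?thesis by (intro bexI[of _ 0]) (auto simp: ev_def)
  next
   case False
   obtain t where t: "t \<in> keys f" "!!u. u \<in> keys f ==> R u <= R t"
    using exists_leading[OF False, of R] by auto
   have tX: "keys t <= X" "wdeg (%_. 2) t = d"
    using hmg_single_part[OF less.prems(2) t(1)] by auto
   obtain s where s: "keys s <= V" "tht s = t"
    using decreasing_tht[OF tX(1)] lead_decreasing[OF less.prems(1) t] by blast
   let ?p = "Poly_Mapping.single s (lkp f t)"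
   have ev_p: "ev ?p = Cst (lkp f t) * mprod e s" by (simp add: ev_def subst_single)
   have ld: "lead (mprod e s) t" using lead_mprod[OF s(1)] s(2) by simp
   have pV: "pvars ?p <= V" using s(1) by (auto simp: pvars_def split: if_splits)
   have "t \<in> keys (mprod e s)" using ld by (simp add: lead_def in_keys_iff)
   moreover have "mprod e s \<in> hmg (%_. 2) X (wdeg (%v. 2 * int (ix v)) s)"
   proof (rule hmg_mprod)
    fix v assume "v \<in> keys s"
    then have v: "v \<in> V" using s(1) by auto
    show "e v \<in> hmg (%_. 2) X (2 * int (ix v))"
     unfolding e_def using esym_wdeg[OF finA(2)[OF V(1)[OF v]], of "ix v"] V(1)[OF v] by (auto elim!: hmg_mono)
   qed
   ultimately have ds: "wdeg (%v. 2 * int (ix v)) s = d" using hmg_wdeg tX(2) by metis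
   have p: "?p \<in> hmg (%v. 2 * int (ix v)) V d"
    using pV ds by (intro hmgI) (auto split: if_splits)
   let ?f = "f - ev ?p"
   have fS: "?f \<in> Sym \<A>" using less.prems(1) ev_Sym[OF pV] by (rule Sym_diff)
   have fH: "?f \<in> hmg (%_. 2) X d" using less.prems(2) ev_hmg[OF p] by (rule hmg_diff)
   have lt: "R k < R t" if k: "k \<in> keys ?f" for k
   proof -
    have "k ~= t"
     using k ld by (auto simp: in_keys_iff lookup_minus ev_p lookup_Cst_mult lead_def)
    moreover have "k \<in> keys f \<or> k \<in> keys (mprod e s)"
     using k by (auto simp: in_keys_iff lookup_minus ev_p lookup_Cst_mult)
    then have "R k <= R t" using t(2) ld by (auto simp: lead_def)
    moreover have "keys k <= X" using hmg_single_part[OF fH k] by simp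
    ultimately show ?thesis using inj_R tX(1) by (auto simp: inj_on_def order_le_less)
   qed
   have "?S ?f \<subset> ?S f"
   proof
    show "?S ?f <= ?S f"
    proof
     fix u assume "u \<in> ?S ?f"
     then obtain k where "u \<in> ?M" "k \<in> keys ?f" "R u <= R k" by auto
     then show "u \<in> ?S f" using lt[of k] t(1) by (auto intro!: bexI[of _ t])
    qed
    have "t \<in> ?S f" using t(1) tX by auto
    moreover have "t \<notin> ?S ?f"
    proof
     assume "t \<in> ?S ?f"
     then obtain k where "k \<in> keys ?f" "R t <= R k" by blast
     then show False using lt[of k] by simp
    qed
    ultimately show "?S ?f ~= ?S f" by blast
   qed
   moreover have "finite (?S f)" by (rule finite_subset[OF _ finite_monomials[of d]]) auto
   ultimately have "card (?S ?f) < card (?S f)" by (intro psubset_card_mono)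
   then obtain g where g: "g \<in> hmg (%v. 2 * int (ix v)) V d" "ev g = ?f" using less.hyps[OF _ fS fH] by blast
   have "ev (g + ?p) = f" using g(2) by (simp add: ev_def subst_add)
   then show ?thesis using hmg_add[OF g(1) p] by blast
  qed
 qed
qed

end

section \<open>From families of maps to maps of factorizations\<close>

lemma homogeneous_wdeg: "homogeneous k f \<longleftrightarrow> (\<forall>t\<in>keys f. wdeg (%_. 2) t = k)"
 by (simp add: homogeneous_def wdeg_def sum_distrib_left)

lemma homogeneous_hmg: "pvars f <= V ==> homogeneous k f \<longleftrightarrow> f \<in> hmg (%_. 2) V k"
 by (simp add: homogeneous_wdeg hmg_def)

definition hpart :: "int => 'x mpol => 'x mpol" where
 "hpart d f = (\<Sum>t\<in>{t\<in>keys f. wdeg (%_. 2) t = d}. Poly_Mapping.single t (lkp f t))"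

lemma lookup_hpart: "lkp (hpart d f) t = (if wdeg (%_. 2) t = d then lkp f t else 0)"
proof -
 have "lkp (hpart d f) t = (\<Sum>s\<in>{t\<in>keys f. wdeg (%_. 2) t = d}. if s = t then lkp f t else 0)"
  unfolding hpart_def lookup_sum by (intro sum.cong refl) (auto simp: lookup_single when_def)
 then show ?thesis by (auto simp: sum.delta in_keys_iff)
qed

lemma hpart_add: "hpart d (f + g) = hpart d f + hpart d g"
 by (rule poly_mapping_eqI) (simp add: lookup_hpart lookup_add)

lemma hpart_0 [simp]: "hpart d 0 = 0"
 by (simp add: hpart_def)

lemma keys_hpart: "keys (hpart d f) = {t \<in> keys f. wdeg (%_. 2) t = d}"
 by (auto simp: in_keys_iff lookup_hpart split: if_splits)

lemma hpart_homogeneous: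
 assumes "!!t. t \<in> keys f ==> wdeg (%_. 2) t = e"
 shows "hpart d f = (if d = e then f else 0)"
 by (rule poly_mapping_eqI) (use assms in \<open>auto simp: lookup_hpart in_keys_iff\<close>)

lemma hpart_subst: "hpart d (subst (%x. Var (prm x)) f) = subst (%x. Var (prm x)) (hpart d f)"
proof (induction f rule: mpol_single_induct)
 case (single t c)
 have "Cst c * mprod (%x. Var (prm x)) t \<in> hmg (%_. 2) UNIV (wdeg (%_. 2) t)"
  by (intro hmg_Cst_mult hmg_mprod) (rule hmg_Var[of _ UNIV "%_. 2"], simp)
 then have 1: "hpart d (Cst c * mprod (%x. Var (prm x)) t) = (if d = wdeg (%_. 2) t then Cst c * mprod (%x. Var (prm x)) t else 0)"
  by (intro hpart_homogeneous hmg_wdeg)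
 have 2: "hpart d (Poly_Mapping.single t c) = (if d = wdeg (%_. 2) t then Poly_Mapping.single t c else 0)"
  by (rule hpart_homogeneous) (auto split: if_splits)
 show ?case unfolding subst_single 1 2 by (simp add: subst_single)
next
 case (add f g)
 then show ?case by (simp add: hpart_add subst_add)
qed

lemma Sym_hpart: "f \<in> Sym \<A> ==> hpart d f \<in> Sym \<A>"
proof -
 assume f: "f \<in> Sym \<A>"
 have "pvars (hpart d f) <= pvars f" by (auto simp: pvars_def keys_hpart)
 moreover have "subst (%x. Var (prm x)) (hpart d f) = hpart d f" if "A \<in> \<A>" "prm permutes A" for A prm
  unfolding hpart_subst[symmetric] using f that by (simp add: Sym_def)
 ultimately show ?thesis using f by (auto simp: Sym_def)
qed

definition proj :: "('b, 'x) factorization => bool \<times> int => ('b => 'x mpol) => 'b => 'x mpol" where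
 "proj M i u = (%b. if b \<in> gens M & odd_gen M b = fst i then hpart (snd i - qdeg M b) (u b) else 0)"

abbreviation comp_at where "comp_at M i \<equiv> component M (fst i) (snd i)"

text \<open>Glues maps given in each bidegree to one map on the whole module, as
  \<open>mf_homotopy_equivalent\<close> requires. With finitely many generators an element has
  finitely many nonzero components.\<close>

definition tot :: "('b, 'x) factorization => (bool => int => ('b => 'x mpol) => 'c => 'y mpol) => ('b => 'x mpol) => 'c => 'y mpol" where
 "tot M F u = (\<Sum>i | proj M i u ~= 0. F (fst i) (snd i) (proj M i u))"

lemma sub_elems: "sub (elems M)"
 unfolding sub_def elems_def scl_def by (auto intro: Sym_0 Sym_add Sym_mult Sym_Cst)

lemma homogeneous_add: "homogeneous k f ==> homogeneous k g ==> homogeneous k (f + g)"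
 using hmg_add[of f "%_. 2" UNIV k g] by (simp add: homogeneous_hmg[of _ UNIV])
lemma homogeneous_Cst_mult: "homogeneous k f ==> homogeneous k (Cst c * f)"
 using hmg_Cst_mult[of f "%_. 2" UNIV k c] by (simp add: homogeneous_hmg[of _ UNIV])

lemma sub_component: "sub (component M ep k)"
proof -
 have "0 \<in> component M ep k"
  using subD(1)[OF sub_elems[of M]] by (simp add: component_def homogeneous_wdeg)
 moreover have "u + v \<in> component M ep k" if "u \<in> component M ep k" "v \<in> component M ep k" for u v
  using that by (auto simp: component_def intro!: subD(2)[OF sub_elems] homogeneous_add)
 moreover have "scl c u \<in> component M ep k" if "u \<in> component M ep k" for c u
 proof -
  have "scl c u \<in> elems M" using that by (intro subD(3)[OF sub_elems]) (simp add: component_def)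
  then show ?thesis using that by (auto simp: component_def scl_def intro: homogeneous_Cst_mult)
 qed
 ultimately show ?thesis unfolding sub_def by blast
qed

lemma component_elems: "u \<in> component M ep k ==> u \<in> elems M"
 by (simp add: component_def)

lemma proj_component: "u \<in> elems M ==> proj M i u \<in> comp_at M i"
 unfolding component_def elems_def proj_def
 by (auto intro: Sym_hpart simp: Sym_0 homogeneous_wdeg keys_hpart)

lemma proj_add: "proj M i (u + v) = proj M i u + proj M i v"
 by (simp add: proj_def fun_eq_iff hpart_add)

lemma proj_of_component:
 assumes "u \<in> component M ep k"
 shows "proj M i u = (if i = (ep, k) then u else 0)"
proof
 fix b
 show "proj M i u b = (if i = (ep, k) then u else 0) b"
 proof (cases "b \<in> gens M")
  case True
  have h: "homogeneous (k - qdeg M b) (u b)" "odd_gen M b ~= ep --> u b = 0"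
   using assms True by (auto simp: component_def)
  have "hpart (snd i - qdeg M b) (u b) = (if snd i - qdeg M b = k - qdeg M b then u b else 0)"
   by (rule hpart_homogeneous) (use h(1) in \<open>simp add: homogeneous_wdeg\<close>)
  moreover note h(2)
  ultimately
  show ?thesis using True by (cases i) (auto simp: proj_def)
 next
  case False
  then show ?thesis using assms by (auto simp: proj_def component_def elems_def)
 qed
qed

lemma finite_proj:
 assumes "finite (gens M)"
 shows "finite {i. proj M i u ~= 0}"
proof (rule finite_subset)
 show "{i. proj M i u ~= 0} <= (%(b, t). (odd_gen M b, qdeg M b + wdeg (%_. 2) t)) ` (SIGMA b:gens M. keys (u b))"
 proof
  fix i assume "i \<in> {i. proj M i u ~= 0}"
  then obtain b where "proj M i u b ~= 0" by (auto simp: fun_eq_iff)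
  then have b: "b \<in> gens M" "odd_gen M b = fst i" "hpart (snd i - qdeg M b) (u b) ~= 0"
   by (auto simp: proj_def split: if_splits)
  then obtain t where "t \<in> keys (hpart (snd i - qdeg M b) (u b))" by fastforce
  then have t: "t \<in> keys (u b)" "wdeg (%_. 2) t = snd i - qdeg M b" by (simp_all add: keys_hpart)
  have "i = (%(b, t). (odd_gen M b, qdeg M b + wdeg (%_. 2) t)) (b, t)"
   using b(2) t(2) by (cases i) auto
  then show "i \<in> (%(b, t). (odd_gen M b, qdeg M b + wdeg (%_. 2) t)) ` (SIGMA b:gens M. keys (u b))"
   by (rule image_eqI) (use b(1) t(1) in auto)
 qed
qed (use assms in auto)

lemma sum_at: "(\<Sum>i\<in>T. f i) b = (\<Sum>i\<in>T. f i b)"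
 by (induction T rule: infinite_finite_induct) auto

lemma sum_proj:
 fixes M :: "('b, 'x) factorization"
 assumes M: "finite (gens M)" and u: "u \<in> elems M"
 shows "u = (\<Sum>i | proj M i u ~= 0. proj M i u)"
proof
 fix b
 let ?S = "{i. proj M i u ~= 0}"
 show "u b = (\<Sum>i\<in>?S. proj M i u) b"
 proof (cases "b \<in> gens M")
  case True
  show ?thesis
  proof (rule poly_mapping_eqI)
   fix t :: "'x \<Rightarrow>\<^sub>0 nat"
   let ?i = "(odd_gen M b, qdeg M b + wdeg (%_. 2) t)"
   have "lkp ((\<Sum>i\<in>?S. proj M i u) b) t = (\<Sum>i\<in>?S. if i = ?i then lkp (u b) t else 0)"
    unfolding sum_at lookup_sum using True by (intro sum.cong refl) (auto simp: proj_def lookup_hpart)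
   also have "\<dots> = lkp (u b) t"
   proof (cases "?i \<in> ?S")
    case False
    then have "lkp (proj M ?i u b) t = 0" by simp
    then have "lkp (u b) t = 0" using True by (simp add: proj_def lookup_hpart)
    then show ?thesis by (simp only: if_cancel sum.neutral_const)
   qed (use finite_proj[OF M, of u] in \<open>simp add: sum.delta\<close>)
   finally show "lkp (u b) t = lkp ((\<Sum>i\<in>?S. proj M i u) b) t" by simp
  qed
 next
  case False
  then show ?thesis using u by (simp add: sum_at proj_def elems_def)
 qed
qed

lemma sub_sum: "sub S ==> (!!i. i \<in> T ==> w i \<in> S) ==> (\<Sum>i\<in>T. w i) \<in> S"
 by (induction T rule: infinite_finite_induct) (auto simp: subD)

lemma tot_homogeneous:
 assumes F: "gmap (component M) C' F" and u: "u \<in> component M ep k"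
 shows "tot M F u = F ep k u"
proof (cases "u = 0")
 case True
 then have "{i. proj M i u ~= 0} = {}" by (auto simp: proj_def fun_eq_iff)
 then have "tot M F u = 0" by (simp only: tot_def sum.empty)
 then show ?thesis using lin_0[OF gmapD(1)[OF F] subD(1)[OF sub_component[of M ep k]]] True by simp
next
 case False
 then have "{i. proj M i u ~= 0} = {(ep, k)}" by (auto simp: proj_of_component[OF u])
 then show ?thesis by (simp add: tot_def proj_of_component[OF u])
qed

lemma tot_add:
 assumes M: "finite (gens M)" and F: "gmap (component M) C' F" and u: "u \<in> elems M" "v \<in> elems M"
 shows "tot M F (u + v) = tot M F u + tot M F v"
proof -
 let ?T = "{i. proj M i u ~= 0} \<union> {i. proj M i v ~= 0} \<union> {i. proj M i (u + v) ~= 0}"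
 have T: "finite ?T" using finite_proj[OF M] by simp
 have F0: "F (fst i) (snd i) 0 = 0" for i by (rule lin_0[OF gmapD(1)[OF F] subD(1)[OF sub_component]])
 have ex: "tot M F w = (\<Sum>i\<in>?T. F (fst i) (snd i) (proj M i w))" if "w \<in> {u, v, u + v}" for w
  unfolding tot_def using that by (intro sum.mono_neutral_left[OF T]) (auto simp: F0)
 have "F (fst i) (snd i) (proj M i (u + v)) = F (fst i) (snd i) (proj M i u) + F (fst i) (snd i) (proj M i v)" for i
  unfolding proj_add by (intro linD(1)[OF gmapD(1)[OF F]] proj_component u)
 then show ?thesis by (simp add: ex sum.distrib)
qed

text \<open>The bidegrees \<open>l i\<close> may coincide for different \<open>i\<close>, so the
  formula also covers images of components under maps that shift degrees.\<close>

lemma tot_sum: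
 assumes M: "finite (gens M)" and F: "gmap (component M) C' F" and w: "!!i. i \<in> T ==> w i \<in> comp_at M (l i)"
 shows "tot M F (\<Sum>i\<in>T. w i) = (\<Sum>i\<in>T. F (fst (l i)) (snd (l i)) (w i))"
 using w
proof (induction T rule: infinite_finite_induct)
 case (insert i T)
 have "tot M F (w i + (\<Sum>i\<in>T. w i)) = tot M F (w i) + tot M F (\<Sum>i\<in>T. w i)"
  using insert.prems by (intro tot_add[OF M F] sub_sum[OF sub_elems]) (auto dest: component_elems)
 moreover have "tot M F (\<Sum>i\<in>T. w i) = (\<Sum>i\<in>T. F (fst (l i)) (snd (l i)) (w i))"
  using insert by simp
 moreover have "tot M F (w i) = F (fst (l i)) (snd (l i)) (w i)"
  by (rule tot_homogeneous[OF F insert.prems]) simp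
 ultimately show ?case unfolding sum.insert[OF insert(1,2)] by (simp only:)
next
 have "tot M F 0 = 0"
  using tot_homogeneous[OF F subD(1)[OF sub_component[of M True 0]]] lin_0[OF gmapD(1)[OF F] subD(1)[OF sub_component[of M True 0]]]
  by (rule trans)
 then show "tot M F (\<Sum>i\<in>{}. w i) = (\<Sum>i\<in>{}. F (fst (l i)) (snd (l i)) (w i))"
  and "!!T. infinite T ==> tot M F (\<Sum>i\<in>T. w i) = (\<Sum>i\<in>T. F (fst (l i)) (snd (l i)) (w i))"
  by (simp_all only: sum.empty sum.infinite not_False_eq_True)
qed

lemma scl_sum: "scl c (\<Sum>i\<in>T. f i) = (\<Sum>i\<in>T. scl c (f i))"
 by (rule ext) (simp add: scl_def sum_at sum_distrib_left)

lemma hom_map_tot: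
 assumes M: "finite (gens M)" and F: "gmap (component M) (%ep k. component M' (ep ~= dl) (k + s)) F"
 shows "hom_map M M' dl s (tot M F)"
 unfolding hom_map_def
proof (intro conjI allI ballI)
 fix u assume u: "u \<in> elems M"
 let ?S = "{i. proj M i u ~= 0}"
 note ts = tot_sum[OF M F]
 have Fu: "tot M F u = (\<Sum>i\<in>?S. F (fst i) (snd i) (proj M i u))" by (simp add: tot_def)
 show "tot M F u \<in> elems M'" unfolding Fu
  using gmapD(2)[OF F proj_component[OF u]] by (intro sub_sum[OF sub_elems] component_elems)
 show "tot M F (%b. u b + v b) = (%b. tot M F u b + tot M F v b)" if "v \<in> elems M" for v
  using tot_add[OF M F u that] by (simp add: plus_fun_def)
 fix c
 have "tot M F (scl c u) = tot M F (\<Sum>i\<in>?S. scl c (proj M i u))"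
  by (subst sum_proj[OF M u]) (simp only: scl_sum)
 also have "\<dots> = (\<Sum>i\<in>?S. F (fst i) (snd i) (scl c (proj M i u)))"
  using proj_component[OF u] by (intro ts subD(3)[OF sub_component])
 also have "\<dots> = scl c (tot M F u)" unfolding Fu scl_sum
  by (intro sum.cong refl linD(2)[OF gmapD(1)[OF F]] proj_component u)
 finally show "tot M F (%b. Cst c * u b) = (%b. Cst c * tot M F u b)" by (simp add: scl_def)
next
 fix ep j u assume "u \<in> component M ep j"
 then show "tot M F u \<in> component M' (ep ~= dl) (j + s)"
  using gmapD(2)[OF F] by (simp add: tot_homogeneous[OF F])
qed

lemma diffl_add: "diffl M (u + v) = diffl M u + diffl M v"
 by (simp add: diffl_def fun_eq_iff distrib_right sum.distrib)
lemma diffl_sum: "diffl M (\<Sum>i\<in>T. w i) = (\<Sum>i\<in>T. diffl M (w i))"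
 by (rule ext) (simp add: diffl_def sum_at sum_distrib_right, subst sum.swap, simp)
lemma lin_diffl: "lin UNIV (diffl M)"
 unfolding lin_def by (simp add: diffl_add) (simp add: diffl_def fun_eq_iff scl_def sum_distrib_left mult.assoc)

text \<open>Chain maps and homotopies of \<open>heq\<close> are glued by \<open>tot\<close>. Every
  element is the sum of its components, so the required identities hold because they hold in each
  bidegree.\<close>

theorem heq_mf_homotopy_equivalent:
 assumes M: "finite (gens M)" "cplx (int N + 1) (component M) (diffl M)"
  and M': "finite (gens M')" "cplx (int N + 1) (component M') (diffl M')"
  and h: "heq (int N + 1) (component M) (diffl M) (component M') (diffl M')"
 shows "mf_homotopy_equivalent N M M'"
proof -
 let ?n = "int N + 1"
 have mor: "mf_morphism A B (tot A F)"
  if A: "finite (gens A)" "cplx ?n (component A) (diffl A)" and F: "cmap ?n (component A) (diffl A) (component B) (diffl B) F"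
  for A :: "('p, 'q) factorization" and B :: "('r, 's) factorization" and F
 proof -
  note g = cmapD(1)[OF F]
  have "tot A F (diffl A u) = diffl B (tot A F u)" if u: "u \<in> elems A" for u
  proof -
   let ?S = "{i. proj A i u ~= 0}"
   have "tot A F (diffl A u) = tot A F (\<Sum>i\<in>?S. diffl A (proj A i u))"
    by (subst sum_proj[OF A(1) u]) (simp only: diffl_sum)
   also have "\<dots> = (\<Sum>i\<in>?S. F (~ fst i) (snd i + ?n) (diffl A (proj A i u)))"
    using tot_sum[OF A(1) g, of ?S "%i. diffl A (proj A i u)" "%i. (~ fst i, snd i + ?n)"]
     cplxD(3)[OF A(2) proj_component[OF u]] by simp
   also have "\<dots> = diffl B (tot A F u)"
    unfolding tot_def diffl_sum by (intro sum.cong refl cmapD(2)[OF F] proj_component u)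
   finally show ?thesis .
  qed
  moreover have "hom_map A B False 0 (tot A F)" using g by (intro hom_map_tot A) simp
  ultimately show ?thesis by (simp add: mf_morphism_def)
 qed
 have hot: "mf_homotopic N A A (tot B G \<circ> tot A F) id"
  if A: "finite (gens A)" "cplx ?n (component A) (diffl A)" and B: "finite (gens B)"
   and F: "gmap (component A) (component B) F" and G: "gmap (component B) (component A) G"
   and P: "hty ?n (component A) (diffl A) (%ep k x. G ep k (F ep k x))"
  for A :: "('p, 'q) factorization" and B :: "('r, 's) factorization" and F G
 proof -
  obtain h where h0: "gmap (component A) (%ep k. component A (~ ep) (k - ?n)) h &
   (\<forall>ep k. \<forall>x\<in>component A ep k. G ep k (F ep k x) - x = diffl A (h ep k x) + h (~ ep) (k + ?n) (diffl A x))"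
   using P unfolding hty_def ..
  note h = h0[THEN conjunct1] h0[THEN conjunct2, rule_format]
  have "hom_map A A True (- ?n) (tot A h)" using h(1)
   by (intro hom_map_tot A) (simp only: eq_True add_uminus_conv_diff)
  moreover have "(%b. (tot B G \<circ> tot A F) u b - id u b) = (%b. diffl A (tot A h u) b + tot A h (diffl A u) b)"
   if u: "u \<in> elems A" for u
  proof -
   let ?S = "{i. proj A i u ~= 0}"
   note pc = proj_component[OF u]
   have "tot B G (tot A F u) = (\<Sum>i\<in>?S. G (fst i) (snd i) (F (fst i) (snd i) (proj A i u)))"
    unfolding tot_def[of A F] by (intro tot_sum[OF B G]) (use gmapD(2)[OF F pc] in simp)
   then have "tot B G (tot A F u) - u = (\<Sum>i\<in>?S. G (fst i) (snd i) (F (fst i) (snd i) (proj A i u)) - proj A i u)"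
    by (simp add: sum_subtractf sum_proj[OF A(1) u, symmetric])
   also have "\<dots> = (\<Sum>i\<in>?S. diffl A (h (fst i) (snd i) (proj A i u))) + (\<Sum>i\<in>?S. h (~ fst i) (snd i + ?n) (diffl A (proj A i u)))"
    unfolding sum.distrib[symmetric] by (intro sum.cong refl h(2) pc)
   also have "(\<Sum>i\<in>?S. h (~ fst i) (snd i + ?n) (diffl A (proj A i u))) = tot A h (\<Sum>i\<in>?S. diffl A (proj A i u))"
    using tot_sum[OF A(1) h(1), of ?S "%i. diffl A (proj A i u)" "%i. (~ fst i, snd i + ?n)"]
     cplxD(3)[OF A(2) pc] by simp
   also have "(\<Sum>i\<in>?S. diffl A (proj A i u)) = diffl A u"
    unfolding diffl_sum[symmetric] sum_proj[OF A(1) u, symmetric] ..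
   also have "(\<Sum>i\<in>?S. diffl A (h (fst i) (snd i) (proj A i u))) = diffl A (tot A h u)"
    unfolding tot_def diffl_sum ..
   finally show ?thesis by (simp add: fun_eq_iff)
  qed
  ultimately show ?thesis unfolding mf_homotopic_def by blast
 qed
 obtain F G where FG: "cmap ?n (component M) (diffl M) (component M') (diffl M') F"
   "cmap ?n (component M') (diffl M') (component M) (diffl M) G"
   "hty ?n (component M) (diffl M) (%ep k x. G ep k (F ep k x))"
   "hty ?n (component M') (diffl M') (%ep k x. F ep k (G ep k x))"
  using h unfolding heq_def by blast
 note gF = cmapD(1)[OF FG(1)] and gG = cmapD(1)[OF FG(2)]
 have "mf_homotopic N M M (tot M' G \<circ> tot M F) id" by (rule hot[OF M M'(1) gF gG FG(3)])
 moreover have "mf_homotopic N M' M' (tot M F \<circ> tot M' G) id" by (rule hot[OF M' M(1) gG gF FG(4)])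
 ultimately show ?thesis unfolding mf_homotopy_equivalent_def
  using mor[OF M FG(1)] mor[OF M' FG(2)] by (intro exI conjI)
qed

section \<open>Power sums and the coefficients of a piece\<close>

definition eser :: "'x set => 'x mpol fps" where
 "eser A = Abs_fps (%j. esym j A)"

lemma cf_eser [simp]: "cf (eser A) j = esym j A"
 by (simp add: eser_def)

lemma eser_prod:
 assumes "finite A"
 shows "eser A = (\<Prod>x\<in>A. 1 + fps_const (Var x) * fps_X)"
proof (rule fps_ext)
 fix j
 have p: "(\<Prod>x\<in>B. fps_const (Var x) * fps_X) = fps_const (\<Prod>x\<in>B. Var x) * fps_X ^ card B" if "finite B" for B :: "'a set"
  using that by (induction B rule: finite_induct) (auto simp: fps_const_mult[symmetric] algebra_simps simp del: fps_const_mult)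
 have "(\<Prod>x\<in>A. 1 + fps_const (Var x) * fps_X) = (\<Prod>x\<in>A. fps_const (Var x) * fps_X + 1)"
  by (simp only: add.commute)
 also have "\<dots> = (\<Sum>B\<in>Pow A. fps_const (\<Prod>x\<in>B. Var x) * fps_X ^ card B)"
  unfolding prod_add[OF assms] using finite_subset[OF _ assms] by (intro sum.cong refl) (simp add: p)
 also have "cf \<dots> j = (\<Sum>B\<in>Pow A. if card B = j then \<Prod>x\<in>B. Var x else 0)"
  unfolding fps_sum_nth by (intro sum.cong refl) simp
 also have "\<dots> = esym j A"
  unfolding esym_def using assms by (subst sum.inter_filter[symmetric]) (auto intro!: sum.cong)
 finally show "cf (eser A) j = cf (\<Prod>x\<in>A. 1 + fps_const (Var x) * fps_X) j" by simp
qed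

lemma esym_0: "finite A ==> esym 0 A = 1"
proof -
 assume A: "finite A"
 have "{B. B <= A & card B = 0} = {{}}" using finite_subset[OF _ A] by auto
 then show ?thesis by (simp add: esym_def)
qed

lemma esym_gt: "finite A ==> card A < j ==> esym j A = 0"
proof -
 assume A: "finite A" "card A < j"
 have "card B ~= j" if "B <= A" for B using card_mono[OF A(1) that] A(2) by simp
 then have "{B. B <= A & card B = j} = {}" by blast
 then show ?thesis by (simp only: esym_def sum.empty)
qed

lemma psum_eser: "finite A ==> psum (Suc N) (eser A) = (\<Sum>x\<in>A. Var x ^ Suc N)"
 unfolding eser_prod by (subst psum_prod) (simp_all add: psum_linear del: power_Suc)

lemma eser_UNION:
 assumes "finite S" "!!s. s \<in> S ==> finite (A s)" "!!s t. s \<in> S ==> t \<in> S ==> s ~= t ==> A s \<inter> A t = {}"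
 shows "eser (\<Union>s\<in>S. A s) = (\<Prod>s\<in>S. eser (A s))"
proof -
 have "eser (\<Union>s\<in>S. A s) = (\<Prod>x\<in>(\<Union>s\<in>S. A s). 1 + fps_const (Var x) * fps_X)"
  using assms by (intro eser_prod) auto
 also have "\<dots> = (\<Prod>s\<in>S. \<Prod>x\<in>A s. 1 + fps_const (Var x) * fps_X)"
  using assms by (intro prod.UNION_disjoint) auto
 also have "\<dots> = (\<Prod>s\<in>S. eser (A s))" using assms by (intro prod.cong refl eser_prod[symmetric]) auto
 finally show ?thesis .
qed

text \<open>The polynomial described by \<open>THE\<close> is the power sum of a generic series: it
  takes the right value on elementary symmetric polynomials, and it is unique by their algebraic
  independence in a single alphabet. Every substitution into it is therefore again the power sum of
  a series.\<close>

lemma subst_power_sum_poly: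
 "subst s (power_sum_poly m (Suc N)) = psum (Suc N) (Abs_fps (%j. if j = 0 then 1 else if j <= m then s j else 0))"
proof -
 let ?w = "psum (Suc N) (ser () m)" and ?A = "{1..m}"
 define p where "p = subst (%(u, j). Var j) ?w"
 have sp: "subst s p = psum (Suc N) (Abs_fps (%j. if j = 0 then 1 else if j <= m then s j else 0))" for s :: "nat => 'z mpol"
 proof -
  have "cf (ser () m) 0 = 1" by (simp add: cf_ser)
  then have "subst s p = psum (Suc N) (fmap (subst (%x. subst s (case x of (u, j) => Var j))) (ser () m))"
   unfolding p_def subst_subst by (rule psum_fmap)
  also have "fmap (subst (%x. subst s (case x of (u, j) => Var j))) (ser () m) =
    Abs_fps (%j. if j = 0 then 1 else if j <= m then s j else 0)"
   by (rule fps_ext) (simp add: cf_ser)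
  finally show ?thesis .
 qed
 have sx: "subst (%j. esym j ?A) p = (\<Sum>i=1..m. Var i ^ Suc N)"
 proof -
  have "Abs_fps (%j. if j = 0 then 1 else if j <= m then esym j ?A else 0) = eser ?A"
   by (rule fps_ext) (auto simp: esym_0 esym_gt)
  then show ?thesis unfolding sp using psum_eser[of ?A N] by simp
 qed
 have pv: "pvars p <= ?A"
 proof -
  have "pvars ?w <= {()} \<times> {1..m}"
   by (rule hmg_pvars[OF gser_ps[OF gser_ser]]) auto
  moreover have "pvars p <= (\<Union>x\<in>pvars ?w. pvars (case x of (u, j) => Var j))" unfolding p_def by (rule pvars_subst)
  ultimately show ?thesis by fastforce
 qed
 interpret S: alphabets ?A "%_. ?A" "%v. v" "{?A}" "%v. v"
  by unfold_locales (auto simp: bij_betw_def inj_on_def pairwise_def)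
 have "power_sum_poly m (Suc N) = p"
  unfolding power_sum_poly_def
 proof (rule the_equality)
  show "pvars p <= ?A & subst (%j. esym j ?A) p = (\<Sum>i=1..m. Var i ^ Suc N)" using pv sx by blast
  fix q assume q: "pvars q <= ?A & subst (%j. esym j ?A) q = (\<Sum>i=1..m. Var i ^ Suc N)"
  have e: "S.e = (%j. esym j ?A)" by (rule ext) (rule S.e_def)
  have "S.ev (q - p) = 0" unfolding S.ev_def e subst_diff using q sx by simp
  moreover have "pvars (q - p) <= ?A" using pvars_diff[of q p] q pv by blast
  ultimately have "q - p = 0" by (rule S.ev_inj[rotated])
  then show "q = p" by simp
 qed
 then show ?thesis by (simp only: sp)
qed

text \<open>A product of \<open>j\<close> letters of \<open>X\<close> does not occur in
  \<open>esym j Y\<close>, the alphabets being disjoint. This makes the exact quotient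
  \<open>U_quot\<close> unique.\<close>

lemma esym_neq:
 assumes "finite X" "finite Y" "X \<inter> Y = {}" "1 <= j" "j <= card X"
 shows "esym j X - esym j Y ~= 0"
proof -
 obtain B where B: "B <= X" "card B = j" using obtain_subset_with_card_n[OF assms(5)] by blast
 have fB: "finite B" using B(1) assms(1) by (rule finite_subset)
 have "mo B ~= mo C" if "C <= Y" for C
 proof
  assume "mo B = mo C"
  then have "B = C" by (metis keys_mo fB finite_subset[OF that assms(2)])
  then have "B = {}" using B(1) that assms(3) by blast
  then show False using B(2) assms(4) by simp
 qed
 then have "lkp (esym j Y) (mo B) = 0" using keys_esym[OF assms(2)] by auto
 moreover have "lkp (esym j X) (mo B) = 1" using keys_esym[OF assms(1)] B by auto
 ultimately have "lkp (esym j X - esym j Y) (mo B) ~= 0" by (simp add: lookup_minus)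
 then show ?thesis by auto
qed

text \<open>Both sides solve the telescoping equation of \<open>UU_tele\<close>, and the divisor is
  not zero.\<close>

lemma U_quot_eq:
 assumes X: "finite X" and Y: "finite Y" and m: "card X = m" "card Y = m" and d: "X \<inter> Y = {}" and j: "1 <= j" "j <= m"
 shows "U_quot N X Y j = UU N m (eser X) (eser Y) j"
proof -
 let ?L = "eser X" and ?M = "eser Y"
 have a: "Abs_fps (%i. if i = 0 then 1 else if i <= m then if i < j then esym i Y else esym i X else 0) = mix m ?L ?M j" for j
  by (rule fps_ext) (simp add: cf_mix)
 have b: "Abs_fps (%i. if i = 0 then 1 else if i <= m then if i <= j then esym i Y else esym i X else 0) = mix m ?L ?M (Suc j)"
  by (rule fps_ext) (auto simp: cf_mix)
 have t: "UU N m ?L ?M j * (esym j X - esym j Y) = psum (Suc N) (mix m ?L ?M j) - psum (Suc N) (mix m ?L ?M (Suc j))"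
  using UU_tele[OF j, of N ?L ?M] by simp
 have "U_quot N X Y j = (THE u. u * (esym j X - esym j Y) = psum (Suc N) (mix m ?L ?M j) - psum (Suc N) (mix m ?L ?M (Suc j)))"
  by (simp only: U_quot_def Let_def m Suc_eq_plus1[symmetric] subst_power_sum_poly a b)
 also have "\<dots> = UU N m ?L ?M j"
 proof (rule the_equality)
  show "UU N m ?L ?M j * (esym j X - esym j Y) = psum (Suc N) (mix m ?L ?M j) - psum (Suc N) (mix m ?L ?M (Suc j))" by (rule t)
  fix u assume "u * (esym j X - esym j Y) = psum (Suc N) (mix m ?L ?M j) - psum (Suc N) (mix m ?L ?M (Suc j))"
  then have "(u - UU N m ?L ?M j) * (esym j X - esym j Y) = 0" unfolding left_diff_distrib t by simp
  then have "u - UU N m ?L ?M j = 0" using mpol_no_zero_divisors esym_neq[OF X Y d j(1)] j(2) m(1) by blast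
  then show "u = UU N m ?L ?M j" by simp
 qed
 finally show ?thesis .
qed

section \<open>Tensor products as Koszul complexes\<close>

lemma diffl_tensor:
 assumes fin: "finite (gens M)" "finite (gens M')" and b: "b \<in> gens M" "bs \<in> gens M'"
 shows "diffl (tensor M M') u (b # bs) = diffl M (%b1. u (b1 # bs)) b +
  (if odd_gen M b then - diffl M' (%y. u (b # y)) bs else diffl M' (%y. u (b # y)) bs)"
proof -
 let ?s = "%x. if odd_gen M b then - x else x" and ?G = "gens M" and ?G' = "gens M'"
 have g: "gens (tensor M M') = (%(b, bs). b # bs) ` (?G \<times> ?G')" by (auto simp: tensor_def)
 have "diffl (tensor M M') u (b # bs) = (\<Sum>x\<in>gens (tensor M M'). u x * mat (tensor M M') x (b # bs))"
  using b unfolding diffl_def g by auto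
 also have "\<dots> = (\<Sum>(c, cs)\<in>?G \<times> ?G'. u (c # cs) * mat (tensor M M') (c # cs) (b # bs))"
  unfolding g by (subst sum.reindex) (auto simp: inj_on_def case_prod_unfold)
 also have "\<dots> = (\<Sum>c\<in>?G. \<Sum>cs\<in>?G'. u (c # cs) * mat (tensor M M') (c # cs) (b # bs))"
  by (simp add: sum.cartesian_product)
 also have "\<dots> = (\<Sum>c\<in>?G. \<Sum>cs\<in>?G'. (if cs = bs then u (c # bs) * mat M c b else 0) + (if c = b then ?s (u (b # cs) * mat M' cs bs) else 0))"
  by (intro sum.cong refl) (auto simp: tensor_def algebra_simps)
 also have "\<dots> = (\<Sum>c\<in>?G. \<Sum>cs\<in>?G'. if cs = bs then u (c # bs) * mat M c b else 0) +
   (\<Sum>c\<in>?G. \<Sum>cs\<in>?G'. if c = b then ?s (u (b # cs) * mat M' cs bs) else 0)"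
  by (simp only: sum.distrib)
 also have "(\<Sum>c\<in>?G. \<Sum>cs\<in>?G'. if cs = bs then u (c # bs) * mat M c b else 0) = diffl M (%b1. u (b1 # bs)) b"
  using fin b by (simp add: diffl_def)
 also have "(\<Sum>c\<in>?G. \<Sum>cs\<in>?G'. if c = b then ?s (u (b # cs) * mat M' cs bs) else 0) =
   (\<Sum>c\<in>?G. if c = b then \<Sum>cs\<in>?G'. ?s (u (b # cs) * mat M' cs bs) else 0)"
  by (intro sum.cong refl) simp
 also have "\<dots> = (\<Sum>cs\<in>?G'. ?s (u (b # cs) * mat M' cs bs))" using fin b by simp
 also have "\<dots> = ?s (diffl M' (%y. u (b # y)) bs)" using b by (simp add: diffl_def sum_negf)
 finally show ?thesis .
qed

lemma par_append: "par (x @ y) = (par x ~= par y)"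
 by (induction x) auto

lemma qd_append: "length x = length rs ==> qd n (rs @ rs') (x @ y) = qd n rs x + qd n rs' y"
proof (induction rs arbitrary: x)
 case (Cons r rs)
 then obtain c z where "x = c # z" "length z = length rs" by (cases x) auto
 then show ?case using Cons.IH by (cases r) simp
qed simp

lemma kd_append:
 "length x = length rs ==> kd (rs @ rs') u (x @ y) = kd rs (%z. u (z @ y)) x +
   (if par x then - kd rs' (%z. u (x @ z)) y else kd rs' (%z. u (x @ z)) y)"
proof (induction rs arbitrary: x u)
 case (Cons r rs)
 then obtain c z where x: "x = c # z" "length z = length rs" by (cases x) auto
 obtain a b d where r: "r = (a, b, d)" by (cases r) auto
 show ?case using Cons.IH[OF x(2), of "%w. u (c # w)"] by (cases c) (simp_all add: x r)
qed simp

lemma kd_cong: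
 "length x = length rs ==> (!!z. length z = length rs ==> u z = v z) ==> kd rs u x = kd rs v x"
proof (induction rs arbitrary: x u v)
 case (Cons r rs)
 then obtain c z where x: "x = c # z" "length z = length rs" by (cases x) auto
 obtain a b d where r: "r = (a, b, d)" by (cases r) auto
 have "kd rs (%y. u (c # y)) z = kd rs (%y. v (c # y)) z" using x Cons.prems by (intro Cons.IH) auto
 then show ?case using Cons.prems(2)[of "True # z"] Cons.prems(2)[of "False # z"] by (cases c) (simp_all add: x r)
qed simp

text \<open>Conditions are imposed at generators only, since the fields of a factorization are
  arbitrary elsewhere; \<open>t\<close> is an overall quantum shift.\<close>

definition koszul_like :: "int => ('x mpol \<times> 'x mpol \<times> int) list => int => (bool list, 'x) factorization => bool" where
 "koszul_like n rs t M \<longleftrightarrow> gens M = {x. length x = length rs} &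
   (\<forall>x. length x = length rs --> odd_gen M x = par x & qdeg M x = qd n rs x + t & (\<forall>u. diffl M u x = kd rs u x))"

lemma finite_bool_lists: "finite {x :: bool list. length x = k}"
 using finite_lists_length_eq[of "UNIV :: bool set" k] by simp

lemma koszul_like_koszul:
 "koszul_like (int N + 1) (map (%(a, da, b). (a, b, 2 * int N + 2 - da)) fs) 0 (koszul N \<A> fs)"
proof (induction fs)
 case Nil
 show ?case by (auto simp: koszul_like_def koszul_def unit_factorization_def diffl_def)
next
 case (Cons f fs)
 obtain a da b where f: "f = (a, da, b)" by (cases f) auto
 let ?T = "two_term N \<A> a da b" and ?K = "koszul N \<A> fs"
 let ?rs = "map (%(a, da, b). (a, b, 2 * int N + 2 - da)) fs"
 have K: "koszul N \<A> (f # fs) = tensor ?T ?K" by (simp add: koszul_def f)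
 have g: "gens ?K = {x. length x = length fs}" using Cons by (simp add: koszul_like_def)
 have gT: "gens ?T = UNIV" by (simp add: two_term_def)
 have fin: "finite (gens ?T)" "finite (gens ?K)" unfolding g gT using finite_bool_lists by simp_all
 have dT: "diffl ?T v True = v False * a" "diffl ?T v False = v True * b" for v
  by (simp_all add: diffl_def two_term_def UNIV_bool)
 show ?case unfolding koszul_like_def
 proof (intro conjI allI impI)
  show "gens (koszul N \<A> (f # fs)) = {x. length x = length (map (%(a, da, b). (a, b, 2 * int N + 2 - da)) (f # fs))}"
   unfolding K by (auto simp: tensor_def g gT length_Suc_conv)
  fix x :: "bool list" assume "length x = length (map (%(a, da, b). (a, b, 2 * int N + 2 - da)) (f # fs))"
  then obtain c z where x: "x = c # z" "length z = length fs" by (cases x) auto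
  have o: "odd_gen ?K z = par z" "qdeg ?K z = qd (int N + 1) ?rs z" "!!u. diffl ?K u z = kd ?rs u z"
   using Cons x(2) by (simp_all add: koszul_like_def)
  show "odd_gen (koszul N \<A> (f # fs)) x = par x" unfolding K using o(1) by (simp add: tensor_def x two_term_def)
  show "qdeg (koszul N \<A> (f # fs)) x = qd (int N + 1) (map (%(a, da, b). (a, b, 2 * int N + 2 - da)) (f # fs)) x + 0"
   unfolding K using o(2) by (simp add: tensor_def x two_term_def f)
  fix u
  have "odd_gen ?T c = c" by (simp add: two_term_def)
  then show "diffl (koszul N \<A> (f # fs)) u x = kd (map (%(a, da, b). (a, b, 2 * int N + 2 - da)) (f # fs)) u x"
   unfolding K x(1) using diffl_tensor[OF fin, of c z u] x(2) g gT by (cases c) (simp_all add: dT f o(3))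
 qed
qed

lemma koszul_like_qshift: "koszul_like n rs t M ==> koszul_like n rs (t + s) (qshift s M)"
proof -
 have "diffl (qshift s M) u = diffl M u" for u by (simp add: diffl_def qshift_def fun_eq_iff)
 moreover assume "koszul_like n rs t M"
 ultimately show ?thesis by (simp add: koszul_like_def) (simp add: qshift_def)
qed

lemma alph_tensor: "alph (tensor M M') = alph M \<union> alph M'"
 by (simp add: tensor_def)

lemma alph_koszul: "alph (koszul N \<A> fs) = \<A>"
proof (induction fs)
 case (Cons f fs)
 obtain a da b where f: "f = (a, da, b)" by (cases f) auto
 have "koszul N \<A> (f # fs) = tensor (two_term N \<A> a da b) (koszul N \<A> fs)" by (simp add: koszul_def f)
 then show ?case using Cons by (simp add: alph_tensor) (simp add: two_term_def)
qed (simp add: koszul_def unit_factorization_def)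

text \<open>Generators of an iterated tensor product are lists of lists, those of a Koszul complex
  are flat lists. The lengths \<open>ls\<close> of the blocks allow flattening to be undone.\<close>

primrec unconcat :: "nat list => 'a list => 'a list list" where
 "unconcat [] z = []"
| "unconcat (l # ls) z = take l z # unconcat ls (drop l z)"

lemma unconcat_concat: "map length xs = ls ==> unconcat ls (concat xs) = xs"
 by (induction ls arbitrary: xs) auto

lemma concat_unconcat: "length z = sum_list ls ==> concat (unconcat ls z) = z"
 by (induction ls arbitrary: z) auto

lemma map_length_unconcat: "length z = sum_list ls ==> map length (unconcat ls z) = ls"
 by (induction ls arbitrary: z) auto

definition multi_koszul :: "int => nat list => ('x mpol \<times> 'x mpol \<times> int) list => int => (bool list list, 'x) factorization => bool" where
 "multi_koszul n ls rs t M \<longleftrightarrow> sum_list ls = length rs & gens M = {xs. map length xs = ls} &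
   (\<forall>xs. map length xs = ls --> odd_gen M xs = par (concat xs) & qdeg M xs = qd n rs (concat xs) + t &
    (\<forall>u. diffl M u xs = kd rs (%z. u (unconcat ls z)) (concat xs)))"

lemma finite_bool_lists_lists: "finite {xs :: bool list list. map length xs = ls}"
proof (rule finite_imageD)
 have "concat ` {xs :: bool list list. map length xs = ls} <= {x. length x = sum_list ls}" by (auto simp: length_concat)
 then show "finite (concat ` {xs :: bool list list. map length xs = ls})" using finite_bool_lists by (rule finite_subset)
 show "inj_on concat {xs :: bool list list. map length xs = ls}"
 proof (rule inj_on_inverseI)
  show "unconcat ls (concat xs) = xs" if "xs \<in> {xs :: bool list list. map length xs = ls}" for xs
   using that by (simp add: unconcat_concat)
 qed
qed

lemma multi_koszul_tensor:
 fixes f :: "'p => (bool list, 'x) factorization"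
 assumes "!!p. p \<in> set qs ==> koszul_like n (R p) (s p) (f p)"
 shows "multi_koszul n (map (%p. length (R p)) qs) (concat (map R qs)) (\<Sum>p\<leftarrow>qs. s p) (foldr tensor (map f qs) (unit_factorization \<A>))"
 using assms
proof (induction qs)
 case Nil
 show ?case by (auto simp: multi_koszul_def unit_factorization_def diffl_def)
next
 case (Cons p qs)
 let ?T = "foldr tensor (map f qs) (unit_factorization \<A>)" and ?ls = "map (%p. length (R p)) qs" and ?rs = "concat (map R qs)"
 have p: "koszul_like n (R p) (s p) (f p)" and T: "multi_koszul n ?ls ?rs (\<Sum>p\<leftarrow>qs. s p) ?T" using Cons by auto
 have gp: "gens (f p) = {x. length x = length (R p)}" using p by (simp add: koszul_like_def)
 have gT: "gens ?T = {xs. map length xs = ?ls}" using T by (simp add: multi_koszul_def)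
 have fin: "finite (gens (f p))" "finite (gens ?T)" unfolding gp gT by (rule finite_bool_lists finite_bool_lists_lists)+
 have F: "foldr tensor (map f (p # qs)) (unit_factorization \<A>) = tensor (f p) ?T" by simp
 show ?case unfolding multi_koszul_def F
 proof (intro conjI allI impI)
  show "sum_list (map (%p. length (R p)) (p # qs)) = length (concat (map R (p # qs)))"
   using T by (simp add: multi_koszul_def)
  show "gens (tensor (f p) ?T) = {xs. map length xs = map (%p. length (R p)) (p # qs)}"
   by (auto simp: tensor_def gp gT Cons_eq_map_conv map_eq_Cons_conv)
  fix xs :: "bool list list" assume "map length xs = map (%p. length (R p)) (p # qs)"
  then obtain b bs where xs: "xs = b # bs" "length b = length (R p)" "map length bs = ?ls" by (cases xs) auto
  have pb: "odd_gen (f p) b = par b" "qdeg (f p) b = qd n (R p) b + s p" "!!u. diffl (f p) u b = kd (R p) u b"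
   using p xs(2) by (simp_all add: koszul_like_def)
  have Tb: "odd_gen ?T bs = par (concat bs)" "qdeg ?T bs = qd n ?rs (concat bs) + (\<Sum>p\<leftarrow>qs. s p)"
   "!!u. diffl ?T u bs = kd ?rs (%z. u (unconcat ?ls z)) (concat bs)"
   using T xs(3) by (simp_all add: multi_koszul_def)
  show "odd_gen (tensor (f p) ?T) xs = par (concat xs)" using pb Tb by (simp add: tensor_def xs par_append)
  show "qdeg (tensor (f p) ?T) xs = qd n (concat (map R (p # qs))) (concat xs) + (\<Sum>p\<leftarrow>p # qs. s p)"
   using pb Tb xs(2) by (simp add: tensor_def xs qd_append)
  fix u :: "bool list list => 'x mpol"
  let ?u = "%z :: bool list. u (unconcat (map (%p. length (R p)) (p # qs)) z)"
  have "kd (R p) (%z. ?u (z @ concat bs)) b = kd (R p) (%z. u (z # bs)) b"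
   using xs(2) unconcat_concat[OF xs(3)] by (intro kd_cong) simp_all
  moreover have "kd ?rs (%z. ?u (b @ z)) = kd ?rs (%z. u (b # unconcat ?ls z))" using xs(2) by simp
  ultimately have "kd (R p @ ?rs) ?u (b @ concat bs) = kd (R p) (%z. u (z # bs)) b +
    (if par b then - kd ?rs (%z. u (b # unconcat ?ls z)) (concat bs) else kd ?rs (%z. u (b # unconcat ?ls z)) (concat bs))"
   unfolding kd_append[OF xs(2)] by (simp only:)
  then show "diffl (tensor (f p) ?T) u xs = kd (concat (map R (p # qs))) ?u (concat xs)"
   using diffl_tensor[OF fin, of b bs u] xs(2,3) by (simp add: xs(1) gp gT pb Tb)
 qed
qed

lemma alph_foldr_tensor: "alph (foldr tensor Ms (unit_factorization \<A>)) = \<A> \<union> (\<Union>M\<in>set Ms. alph M)"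
proof (induction Ms)
 case (Cons M Ms)
 then show ?case by (simp add: alph_tensor Un_ac)
qed (simp add: unit_factorization_def)

lemma wt_snd: "wt = (%v. 2 * int (snd v))"
 by (rule ext) (simp add: wt_def)

lemma cplx_of_iso:
 assumes C: "cplx n C d" and F: "!!ep k x. x \<in> C ep k ==> F x \<in> C' ep k & F (d x) = d' (F x)"
  and G: "!!ep k y. y \<in> C' ep k ==> G y \<in> C ep k & F (G y) = y" and F0: "F 0 = 0"
  and C': "!!ep k. sub (C' ep k)" "lin UNIV d'"
 shows "cplx n C' d'"
 unfolding cplx_def
proof (intro conjI allI ballI C')
 fix ep k
 have d': "d' y = F (d (G y)) & d (G y) \<in> C (~ ep) (k + n)" if "y \<in> C' ep k" for y
  using F[of "G y" ep k] G[OF that] cplxD(3)[OF C, of "G y" ep k] by simp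
 show "d' ` C' ep k <= C' (~ ep) (k + n)"
  using d' F by auto
 fix y assume y: "y \<in> C' ep k"
 have "d' (d' y) = F (d (d (G y)))" using d'[OF y] F[of "d (G y)" "~ ep" "k + n"] by simp
 also have "d (d (G y)) = 0" by (rule cplxD(4)[OF C]) (use G[OF y] in blast)
 finally have "d' (d' y) = F 0" .
 then show "d' (d' y) = 0" by (simp only: F0)
qed

section \<open>Transfer from symmetric polynomials to a polynomial ring\<close>

context
 fixes V :: "('m \<times> nat) set" and al :: "'m \<times> nat => 'x set" and \<A> :: "'x set set" and \<iota> :: "'x => nat"
  and rs :: "('m \<times> nat) row list" and M :: "(bool list list, 'x) factorization" and ls t n
 assumes alph: "alphabets V al snd \<A> \<iota>"
  and M: "multi_koszul n ls (map (mrow (alphabets.ev al snd)) rs) t M" "factorization.alph M = \<A>"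
  and ok: "\<forall>r\<in>set rs. row_ok n V r" "pot rs = 0"
begin

interpretation alphabets V al snd \<A> \<iota> by (rule alph)

text \<open>The inverse of \<open>ev\<close>, determined on its image by algebraic
  independence.\<close>

abbreviation (input) "iv f \<equiv> (SOME g. pvars g <= V & ev g = f)"

lemma iv_ev: "pvars g <= V ==> iv (ev g) = g"
proof -
 assume g: "pvars g <= V"
 have "pvars (iv (ev g)) <= V & ev (iv (ev g)) = ev g"
  by (rule someI[of "%h. pvars h <= V & ev h = ev g" g]) (use g in simp)
 then have "ev (iv (ev g) - g) = 0" "pvars (iv (ev g) - g) <= V"
  using g pvars_diff[of "iv (ev g)" g] by (auto simp: ev_def subst_diff)
 then have "iv (ev g) - g = 0" by (rule ev_inj[rotated])
 then show ?thesis by simp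
qed

lemma ev_iv:
 assumes f: "f \<in> Sym \<A>" "homogeneous d f"
 shows "iv f \<in> hm V d & ev (iv f) = f"
proof -
 have "f \<in> hmg (%_. 2) X d" using f homogeneous_hmg[of f X d] by (simp add: Sym_def)
 from ev_surj[OF f(1) this] obtain g where g: "g \<in> hm V d" "ev g = f" unfolding wt_snd by blast
 then show ?thesis using iv_ev[OF hmg_pvars[OF g(1)]] by simp
qed

definition to_mf :: "(bool list => ('m \<times> nat) mpol) => bool list list => 'x mpol" where
 "to_mf u = (%xs. if map length xs = ls then ev (u (concat xs)) else 0)"

definition of_mf :: "(bool list list => 'x mpol) => bool list => ('m \<times> nat) mpol" where
 "of_mf w = (%z. if length z = length rs then iv (w (unconcat ls z)) else 0)"

lemma sum_ls: "sum_list ls = length rs" and gens_M: "gens M = {xs. map length xs = ls}"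
 and odd_M: "map length xs = ls ==> odd_gen M xs = par (concat xs)"
 and qdeg_M: "map length xs = ls ==> qdeg M xs = qd n rs (concat xs) + t"
 and diffl_M: "map length xs = ls ==> diffl M u xs = kd (map (mrow ev) rs) (%z. u (unconcat ls z)) (concat xs)"
proof -
 have q: "qd n (map (mrow f) rs) x = qd n rs x" for f :: "('m \<times> nat) mpol => 'x mpol" and rs x
  by (induction n rs x rule: qd.induct) auto
 show "sum_list ls = length rs" "gens M = {xs. map length xs = ls}"
  "map length xs = ls ==> odd_gen M xs = par (concat xs)"
  "map length xs = ls ==> qdeg M xs = qd n rs (concat xs) + t"
  "map length xs = ls ==> diffl M u xs = kd (map (mrow ev) rs) (%z. u (unconcat ls z)) (concat xs)"
  using M(1) by (simp_all add: multi_koszul_def q)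
qed

lemma len_concat: "map length xs = ls ==> length (concat xs) = length rs"
 by (simp add: length_concat sum_ls[symmetric])

lemma to_mf_component:
 assumes u: "u \<in> shf False t (Kc n V rs) ep k"
 shows "to_mf u \<in> component M ep k"
proof -
 have K: "u \<in> Kc n V rs ep (k - t)" using u by (simp add: shf_def)
 have h: "u (concat xs) \<in> hm V (k - qdeg M xs)" if "map length xs = ls" for xs
  using KcD(3)[OF K len_concat[OF that]] qdeg_M[OF that] by (simp add: algebra_simps)
 have "ev (u (concat xs)) \<in> Sym \<A>" "homogeneous (k - qdeg M xs) (ev (u (concat xs)))" if "map length xs = ls" for xs
 proof -
  show "ev (u (concat xs)) \<in> Sym \<A>" by (rule ev_Sym[OF hmg_pvars[OF h[OF that]]])
  have e: "ev (u (concat xs)) \<in> hmg (%_. 2) X (k - qdeg M xs)" using h[OF that] unfolding wt_snd by (rule ev_hmg)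
  show "homogeneous (k - qdeg M xs) (ev (u (concat xs)))" using e by (simp only: homogeneous_hmg[OF hmg_pvars[OF e]])
 qed
 moreover have "u (concat xs) = 0" if "map length xs = ls" "odd_gen M xs ~= ep" for xs
  using KcD(2)[OF K len_concat[OF that(1)]] odd_M[OF that(1)] that(2) by simp
 moreover have "ev 0 = 0" by (simp add: ev_def)
 ultimately show ?thesis
  unfolding component_def elems_def to_mf_def gens_M M(2) by auto
qed

lemma of_mf_Kc:
 assumes w: "w \<in> component M ep k"
 shows "of_mf w \<in> shf False t (Kc n V rs) ep k" and "to_mf (of_mf w) = w"
proof -
 have w': "w xs \<in> Sym \<A>" "homogeneous (k - qdeg M xs) (w xs)" "odd_gen M xs ~= ep ==> w xs = 0"
  if "map length xs = ls" for xs
  using w that unfolding component_def elems_def gens_M M(2) by auto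
 have w0: "w xs = 0" if "map length xs ~= ls" for xs
  using w that by (auto simp: component_def elems_def gens_M)
 have iv0: "iv 0 = 0" using iv_ev[of 0] by (simp add: ev_def)
 have "of_mf w \<in> Kc n V rs ep (k - t)"
 proof (rule KcI)
  show "of_mf w \<in> supp (length rs)" by (simp add: supp_def of_mf_def)
  fix z :: "bool list" assume z: "length z = length rs"
  let ?xs = "unconcat ls z"
  have z': "length z = sum_list ls" using z sum_ls by simp
  have xs: "map length ?xs = ls" "concat ?xs = z"
   by (rule map_length_unconcat[OF z']) (rule concat_unconcat[OF z'])
  show "of_mf w z = 0" if "par z ~= ep"
   using w'(3)[OF xs(1)] odd_M[OF xs(1)] that xs(2) z iv0 by (simp add: of_mf_def)
  have "iv (w ?xs) \<in> hm V (k - qdeg M ?xs)" using ev_iv[OF w'(1,2)[OF xs(1)]] by blast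
  moreover have "k - qdeg M ?xs = k - t - qd n rs z" using qdeg_M[OF xs(1)] xs(2) by simp
  ultimately show "of_mf w z \<in> hm V (k - t - qd n rs z)" using z by (simp add: of_mf_def)
 qed
 then show "of_mf w \<in> shf False t (Kc n V rs) ep k" by (simp add: shf_def)
 show "to_mf (of_mf w) = w"
 proof
  fix xs
  show "to_mf (of_mf w) xs = w xs"
  proof (cases "map length xs = ls")
   case True
   then show ?thesis
    using ev_iv[OF w'(1,2)[OF True]] len_concat[OF True] unconcat_concat[OF True] by (simp add: to_mf_def of_mf_def)
  qed (simp add: to_mf_def w0)
 qed
qed

lemma of_to_mf:
 assumes u: "u \<in> shf False t (Kc n V rs) ep k"
 shows "of_mf (to_mf u) = u"
proof
 fix z
 have K: "u \<in> Kc n V rs ep (k - t)" using u by (simp add: shf_def)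
 show "of_mf (to_mf u) z = u z"
 proof (cases "length z = length rs")
  case True
  then have z': "length z = sum_list ls" using sum_ls by simp
  have "pvars (u z) <= V" using KcD(3)[OF K True] by (rule hmg_pvars)
  then show ?thesis
   using iv_ev map_length_unconcat[OF z'] concat_unconcat[OF z'] True by (simp add: of_mf_def to_mf_def)
 next
  case False
  then show ?thesis using suppD[OF KcD(1)[OF K] False] by (simp add: of_mf_def)
 qed
qed

lemma to_mf_kd: "to_mf (kd rs u) = diffl M (to_mf u)"
proof
 fix xs
 show "to_mf (kd rs u) xs = diffl M (to_mf u) xs"
 proof (cases "map length xs = ls")
  case True
  have "to_mf (kd rs u) xs = kd (map (mrow ev) rs) (%z. ev (u z)) (concat xs)"
   using True subst_kd by (simp add: to_mf_def ev_def)
  also have "\<dots> = kd (map (mrow ev) rs) (%z. to_mf u (unconcat ls z)) (concat xs)"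
  proof (rule kd_cong)
   show "length (concat xs) = length (map (mrow ev) rs)" using len_concat[OF True] by simp
   fix z :: "bool list" assume "length z = length (map (mrow ev) rs)"
   then have z': "length z = sum_list ls" using sum_ls by simp
   show "ev (u z) = to_mf u (unconcat ls z)"
    using map_length_unconcat[OF z'] concat_unconcat[OF z'] by (simp add: to_mf_def)
  qed
  finally show ?thesis using diffl_M[OF True] by simp
 next
  case False
  then show ?thesis by (simp add: to_mf_def diffl_def gens_M)
 qed
qed

lemma to_mf_add: "to_mf (u + v) = to_mf u + to_mf v" and to_mf_scl: "to_mf (scl c u) = scl c (to_mf u)"
 by (auto simp: to_mf_def ev_def subst_add scl_def subst_mult fun_eq_iff)

text \<open>Coefficient by coefficient, \<open>ev\<close> identifies polynomials in \<open>V\<close>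
  with symmetric polynomials, degrees included; together with flattening of generators this is an
  isomorphism of complexes.\<close>

theorem koszul_transfer:
 "cplx n (component M) (diffl M)" "heq n (component M) (diffl M) (shf False t (Kc n V rs)) (kd rs)" "finite (gens M)"
proof -
 let ?C = "shf False t (Kc n V rs)"
 have C: "cplx n ?C (kd rs)" by (rule cplx_shf[OF cplx_Kc[OF ok]])
 show M': "cplx n (component M) (diffl M)"
 proof (rule cplx_of_iso[OF C, where F = to_mf and G = of_mf])
  show "to_mf x \<in> component M ep k & to_mf (kd rs x) = diffl M (to_mf x)" if "x \<in> ?C ep k" for ep k x
   using to_mf_component[OF that] to_mf_kd by blast
  show "of_mf y \<in> ?C ep k & to_mf (of_mf y) = y" if "y \<in> component M ep k" for ep k y
   using of_mf_Kc[OF that] by blast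
  show "to_mf 0 = 0" using to_mf_scl[of 0 0] by simp
 qed (rule sub_component lin_diffl)+
 have lin_to: "lin S to_mf" for S unfolding lin_def using to_mf_add to_mf_scl by blast
 have lin_of: "lin (component M ep k) of_mf" for ep k
  unfolding lin_def
 proof (intro conjI ballI allI)
  fix u assume u: "u \<in> component M ep k"
  note U = of_mf_Kc[OF u]
  have s: "sub (?C ep k)" by (rule cplxD(2)[OF C])
  show "of_mf (u + v) = of_mf u + of_mf v" if v: "v \<in> component M ep k" for v
  proof -
   note W = of_mf_Kc[OF v]
   have "of_mf (to_mf (of_mf u + of_mf v)) = of_mf u + of_mf v" by (rule of_to_mf[OF subD(2)[OF s U(1) W(1)]])
   then show ?thesis by (simp only: to_mf_add U(2) W(2))
  qed
  show "of_mf (scl c u) = scl c (of_mf u)" for c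
  proof -
   have "of_mf (to_mf (scl c (of_mf u))) = scl c (of_mf u)" by (rule of_to_mf[OF subD(3)[OF s U(1)]])
   then show ?thesis by (simp only: to_mf_scl U(2))
  qed
 qed
 have "heq n ?C (kd rs) (component M) (diffl M)"
 proof (rule heq_iso[where F = "%_ _. to_mf" and G = "%_ _. of_mf"])
  show "cmap n ?C (kd rs) (component M) (diffl M) (%_ _. to_mf)"
   unfolding cmap_def gmap_def using lin_to to_mf_component to_mf_kd by auto
  show "gmap (component M) ?C (%_ _. of_mf)"
   unfolding gmap_def using lin_of of_mf_Kc(1) by blast
  show "to_mf (of_mf x) = x" if "x \<in> component M ep k" for ep k x by (rule of_mf_Kc(2)[OF that])
  show "of_mf (to_mf x) = x" if "x \<in> ?C ep k" for ep k x by (rule of_to_mf[OF that])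
 qed (rule cplxD(1,2,3)[OF C] cplxD(1,2,3)[OF M'], assumption?)+
 then show "heq n (component M) (diffl M) ?C (kd rs)" by (rule heq_sym)
 show "finite (gens M)" unfolding gens_M by (rule finite_bool_lists_lists)
qed

end

section \<open>Reversing a circuit of Koszul blocks\<close>

text \<open>From here on the parity is existential, since the goal allows either one. The quantum
  shift has to be followed exactly.\<close>

definition pke :: "int => int => ('m \<times> nat) set => ('m \<times> nat) row list => ('m \<times> nat) set => ('m \<times> nat) row list => bool" where
 "pke n t V rs V' rs' \<longleftrightarrow> (\<exists>dl. pkeq n dl t V rs V' rs')"

lemma pkeI: "pkeq n dl t V rs V' rs' ==> pke n t V rs V' rs'"
 unfolding pke_def by (rule exI)
lemma pke_trans: "pke n t V rs V' rs' ==> pke n t' V' rs' V'' rs'' ==> pke n (t + t') V rs V'' rs''"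
 unfolding pke_def by (elim exE) (rule exI, rule pkeq_trans)
lemma pke_sym: "pke n t V rs V' rs' ==> pke n (- t) V' rs' V rs"
 unfolding pke_def by (elim exE) (rule exI, rule pkeq_sym)
lemma pke_refl: "\<forall>r\<in>set rs. row_ok n V r ==> pot rs = 0 ==> pke n 0 V rs V rs"
 by (rule pkeI[OF pkeq_refl])
lemma pkeD:
 assumes "pke n t V rs V' rs'"
 shows "\<forall>r\<in>set rs. row_ok n V r" "\<forall>r\<in>set rs'. row_ok n V' r" "pot rs = 0" "pot rs' = 0"
proof -
 obtain dl where "pkeq n dl t V rs V' rs'" using assms unfolding pke_def ..
 from pkeqD(1-4)[OF this] show "\<forall>r\<in>set rs. row_ok n V r" "\<forall>r\<in>set rs'. row_ok n V' r" "pot rs = 0" "pot rs' = 0" .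
qed
lemma req_pke: "req n V dl t rs rs' ==> \<forall>r\<in>set rs. row_ok n V r ==> pot rs = 0 ==> pke n t V rs V rs'"
 by (rule pkeI[OF req_pkeq])
lemma pke_perm:
 assumes "mset rs = mset rs'" "\<forall>r\<in>set rs. row_ok n V r" "pot rs = 0"
 shows "pke n 0 V rs V rs'"
 by (rule req_pke[OF req_perm[OF assms(1)] assms(2,3)])
lemma pke_mset:
 assumes p: "pke n t V rs V' rs'" and m: "mset rs = mset qs" "mset rs' = mset qs'"
 shows "pke n t V qs V' qs'"
proof -
 note d = pkeD[OF p]
 have "pke n (0 + (t + 0)) V qs V' qs'"
 proof (rule pke_trans[OF _ pke_trans[OF p]])
  show "pke n 0 V qs V rs" using pke_sym[OF pke_perm[OF m(1) d(1,3)]] by simp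
  show "pke n 0 V' rs' V' qs'" by (rule pke_perm[OF m(2) d(2,4)])
 qed
 then show ?thesis by simp
qed
lemma pot_mset: "mset rs = mset (rs' :: ('m \<times> nat) row list) ==> pot rs = pot rs'"
 by (rule req_pot[OF req_perm])

lemma row_ok_mono: "row_ok n V r ==> V <= V' ==> row_ok n V' r"
 by (cases r) (auto simp: row_ok_def intro: hmg_mono)

text \<open>Loops are removed one at a time; the blocks that still carry a loop count among the
  remaining rows.\<close>

lemma pke_loops:
 fixes V :: "('m \<times> nat) set" and z :: "'i => 'm"
 assumes V: "!!x. x \<in> V ==> 0 < snd x" and dis: "distinct is" "inj_on z (set is)"
  and a: "!!i. i \<in> set is ==> N = r i + s i & (\<forall>j. (z i, j) \<notin> V) & gser V (P i) & trc (r i) (P i) & gser V (Q i) & trc (r i) (Q i)"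
  and rs: "\<forall>x\<in>set rs. row_ok (int (Suc N)) V x"
  and p0: "pot (concat (map (%i. blk N (r i) (P i) (Q i)) is) @ rs) = 0"
 shows "pke (int (Suc N)) (\<Sum>i\<leftarrow>is. int (s i) * int (r i)) (V \<union> (\<Union>i\<in>set is. {z i} \<times> {1..s i}))
   (concat (map (%i. blk N N (ser (z i) (s i) * P i) (ser (z i) (s i) * Q i)) is) @ rs)
   V (concat (map (%i. blk N (r i) (P i) (Q i)) is) @ rs)"
 using dis a rs p0
proof (induction "is" arbitrary: rs)
 case Nil
 then show ?case using pke_refl[of rs "int (Suc N)" V] by simp
next
 case (Cons i "is")
 let ?n = "int (Suc N)" and ?V' = "V \<union> (\<Union>i\<in>set is. {z i} \<times> {1..s i})"
 let ?big = "%i. blk N N (ser (z i) (s i) * P i) (ser (z i) (s i) * Q i)" and ?sm = "%i. blk N (r i) (P i) (Q i)"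
 have ai: "N = r i + s i" "\<forall>j. (z i, j) \<notin> V" "gser V (P i)" "trc (r i) (P i)" "gser V (Q i)" "trc (r i) (Q i)"
  using Cons.prems(3)[of i] by simp_all
 have 1: "pke ?n (\<Sum>i\<leftarrow>is. int (s i) * int (r i)) ?V' (concat (map ?big is) @ (?sm i @ rs)) V (concat (map ?sm is) @ (?sm i @ rs))"
 proof (rule Cons.IH)
  show "distinct is" "inj_on z (set is)" using Cons.prems(1,2) by auto
  show "N = r i + s i & (\<forall>j. (z i, j) \<notin> V) & gser V (P i) & trc (r i) (P i) & gser V (Q i) & trc (r i) (Q i)"
   if "i \<in> set is" for i using Cons.prems(3)[of i] that by simp
  show "\<forall>x\<in>set (?sm i @ rs). row_ok ?n V x"
   using blk_row_ok[OF ai(3,5), of N "r i"] Cons.prems(4) by auto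
  have "pot (concat (map ?sm is) @ (?sm i @ rs)) = pot (concat (map ?sm (i # is)) @ rs)" by (rule pot_mset) simp
  from this Cons.prems(5) show "pot (concat (map ?sm is) @ (?sm i @ rs)) = 0" by (rule trans)
 qed
 note d = pkeD[OF 1]
 have "pkeq ?n (odd (s i)) (int (s i) * int (r i)) (?V' \<union> {z i} \<times> {1..s i})
   (?big i @ (concat (map ?big is) @ rs)) ?V' (?sm i @ (concat (map ?big is) @ rs))"
 proof (rule pkeq_loop[OF ai(1)])
  show "(z i, j) \<notin> ?V'" for j using ai(2) Cons.prems(1,2) by (auto simp: inj_on_def)
  show "0 < snd x" if "x \<in> ?V'" for x using that V[of x] by auto
  show "gser ?V' (P i)" "gser ?V' (Q i)" using gser_mono[OF ai(3), of ?V'] gser_mono[OF ai(5), of ?V'] by auto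
  show "\<forall>x\<in>set (concat (map ?big is) @ rs). row_ok ?n ?V' x" using d(1) by auto
  have "pot (?sm i @ (concat (map ?big is) @ rs)) = pot (concat (map ?big is) @ (?sm i @ rs))" by (rule pot_mset) simp
  from this d(3) show "pot (?sm i @ (concat (map ?big is) @ rs)) = 0" by (rule trans)
 qed (rule ai)+
 from pkeI[OF this] have "pke ?n (int (s i) * int (r i)) (?V' \<union> {z i} \<times> {1..s i})
   (?big i @ (concat (map ?big is) @ rs)) ?V' (concat (map ?big is) @ (?sm i @ rs))"
  by (rule pke_mset) simp_all
 from pke_trans[OF this 1]
 have 2: "pke ?n (int (s i) * int (r i) + (\<Sum>i\<leftarrow>is. int (s i) * int (r i))) (?V' \<union> {z i} \<times> {1..s i})
   (?big i @ (concat (map ?big is) @ rs)) V (concat (map ?sm is) @ (?sm i @ rs))" .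
 have VV: "?V' \<union> {z i} \<times> {1..s i} = V \<union> (\<Union>j\<in>set (i # is). {z j} \<times> {1..s j})" by auto
 have "pke ?n (int (s i) * int (r i) + (\<Sum>i\<leftarrow>is. int (s i) * int (r i))) (V \<union> (\<Union>j\<in>set (i # is). {z j} \<times> {1..s j}))
   (concat (map ?big (i # is)) @ rs) V (concat (map ?sm (i # is)) @ rs)"
  by (rule pke_mset[OF 2[unfolded VV]]) simp_all
 then show ?case by simp
qed

abbreviation "blks N Ls Ms \<equiv> concat (map2 (blk N N) Ls Ms)"

text \<open>A cyclic permutation is a product of neighbouring transpositions: \<open>M\<close> is
  carried past one block after the other by \<open>req_swap\<close>.\<close>

lemma req_rotate:
 fixes V :: "('m \<times> nat) set"
 assumes "length Ls = Suc (length Ms)" "\<forall>L\<in>set (M # Ls @ Ms). gser V L & trc N L"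
 shows "\<exists>dl. req (int (Suc N)) V dl 0 (blks N Ls (M # Ms)) (blks N Ls (Ms @ [M]))"
 using assms
proof (induction Ms arbitrary: M Ls)
 case Nil
 then obtain L where "Ls = [L]" by (cases Ls) auto
 then show ?case using req.ident by auto
next
 case (Cons M1 Ms)
 let ?n = "int (Suc N)"
 obtain L L' Ls' where Ls: "Ls = L # L' # Ls'" "length Ls' = length Ms"
  using Cons.prems(1) by (cases Ls; cases "tl Ls") auto
 obtain dl where dl: "req ?n V dl 0 (blks N (L' # Ls') (M # Ms)) (blks N (L' # Ls') (Ms @ [M]))"
  using Cons.IH[of "L' # Ls'" M] Cons.prems(2) Ls by auto
 have "req ?n V (odd N) 0 (blk N N L M @ blk N N L' M1) (blk N N L' M @ blk N N L M1)"
  by (rule req_swap) (use Cons.prems(2) Ls in auto)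
 then have "req ?n V (odd N) 0 ((blk N N L M @ blk N N L' M1) @ blks N Ls' Ms) ((blk N N L' M @ blk N N L M1) @ blks N Ls' Ms)"
  by (rule req_append_right)
 moreover have "req ?n V False 0 ((blk N N L' M @ blk N N L M1) @ blks N Ls' Ms) (blk N N L M1 @ blks N (L' # Ls') (M # Ms))"
  by (rule req_perm) simp
 ultimately have "req ?n V (odd N) 0 ((blk N N L M @ blk N N L' M1) @ blks N Ls' Ms) (blk N N L M1 @ blks N (L' # Ls') (M # Ms))"
  by (rule req_trans2)
 from req.comp[OF this req_append_left[OF dl, of "blk N N L M1"]] show ?case
  by (intro exI[of _ "odd N ~= dl"]) (simp add: Ls)
qed

lemma mrow_fixed:
 assumes "\<forall>r\<in>set rs. row_ok n V r" "!!x. x \<in> V ==> s x = Var x"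
 shows "map (mrow (subst s)) rs = rs"
proof (rule map_idI)
 fix r assume "r \<in> set rs"
 then obtain a b d where r: "r = (a, b, d)" "a \<in> hm V (2 * n - d)" "b \<in> hm V d"
  using assms(1) by (cases r) (auto simp: row_ok_def)
 then show "mrow (subst s) r = r"
  using hmg_pvars[OF r(2)] hmg_pvars[OF r(3)] by (auto intro!: subst_ident assms(2))
qed

lemma fmap_fixed: "gser V L ==> (!!x. x \<in> V ==> s x = Var x) ==> fmap (subst s) L = L"
proof (rule fps_ext)
 fix j assume L: "gser V L" and s: "!!x. x \<in> V ==> s x = Var x"
 have "pvars (cf L j) <= V" by (rule hmg_pvars[OF gserD(2)[OF L]])
 then show "cf (fmap (subst s) L) j = cf L j" using s by (auto intro!: subst_ident)
qed

text \<open>The vertex block has the generic end \<open>y\<close>, which is eliminated as the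
  product of \<open>ser x k\<close> with the side series \<open>A\<close>. Then
  \<open>ser x k\<close> is a common factor of both ends of the block of size \<open>N\<close>, that
  is, a fused loop, and \<open>pkeq_loop\<close> removes it. The two cases of \<open>cs\<close> are
  the two directions of the vertex.\<close>

lemma pke_node:
 fixes V :: "('m \<times> nat) set"
 assumes N: "N = k + r" and nm: "!!i. (x, i) \<notin> V" "!!i. (y, i) \<notin> V" "x ~= y" and V: "!!v. v \<in> V ==> 0 < snd v"
  and A: "gser V A" "trc c A" and kk: "kk = k + c" and P: "gser V P" "trc (N - kk) P" "kk <= N" and Q: "gser V Q" "trc r Q"
  and rs: "\<forall>v\<in>set rs. row_ok (int (Suc N)) V v"
  and cs: "(b1 = blk N kk (ser y kk) (ser x k * A) & b2 = blk N N (ser x k * Q) (ser y kk * P) & b3 = blk N r Q (A * P)) \<or>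
   (b1 = blk N kk (ser x k * A) (ser y kk) & b2 = blk N N (ser y kk * P) (ser x k * Q) & b3 = blk N r (A * P) Q)"
  and p0: "pot (b1 @ b2 @ rs) = 0"
 shows "pke (int (Suc N)) (int k * int r) (V \<union> {x} \<times> {1..k} \<union> {y} \<times> {1..kk}) (b1 @ b2 @ rs) V (b3 @ rs)"
proof -
 let ?n = "int (Suc N)" and ?W = "V \<union> {x} \<times> {1..k}"
 let ?V = "?W \<union> {y} \<times> {1..kk}"
 have sx: "gser ?W (ser x k)" by (rule gser_ser) auto
 have sy: "gser ?V (ser y kk)" by (rule gser_ser) auto
 have WV: "?W <= ?V" "V <= ?W" "V <= ?V" by auto
 have gM: "gser ?W (ser x k * A)" using sx gser_mono[OF A(1) WV(2)] by (rule gser_mult)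
 have tM: "trc kk (ser x k * A)" unfolding kk by (rule trc_mult[OF trc_ser A(2)])
 define s where "s v = (if fst v = y then cf (ser x k * A) (snd v) else Var v)" for v :: "'m \<times> nat"
 have sW: "s v = Var v" if "v \<in> ?W" for v using that nm by (cases v) (auto simp: s_def)
 have fy: "fmap (subst s) (ser y kk) = ser x k * A"
  by (rule fmap_ser[OF gserD(1)[OF gM] tM]) (simp add: s_def)
 have f: "fmap (subst s) (ser x k) = ser x k" "fmap (subst s) Q = Q" "fmap (subst s) P = P"
  using fmap_fixed[OF sx sW] fmap_fixed[OF gser_mono[OF Q(1) WV(2)] sW] fmap_fixed[OF gser_mono[OF P(1) WV(2)] sW] by blast+
 have AP: "gser V (A * P)" "trc r (A * P)"
 proof -
  show "gser V (A * P)" by (rule gser_mult[OF A(1) P(1)])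
  have "r = c + (N - kk)" using N kk P(3) by simp
  then show "trc r (A * P)" using trc_mult[OF A(2) P(2)] by simp
 qed
 have mr: "map (mrow (subst s)) rs = rs" by (rule mrow_fixed[OF rs]) (use sW in auto)
 have "\<forall>v\<in>set rs. row_ok ?n ?V v" using rs row_ok_mono[OF _ WV(3)] by auto
 moreover have "\<forall>v\<in>set b2. row_ok ?n ?V v"
 proof -
  have "gser ?V (ser x k * Q)" "gser ?V (ser y kk * P)"
   using gser_mult[OF gser_mono[OF sx WV(1)] gser_mono[OF Q(1) WV(3)]] gser_mult[OF sy gser_mono[OF P(1) WV(3)]] by auto
  from blk_row_ok[OF this, of N N] blk_row_ok[OF this(2,1), of N N] show ?thesis using cs by auto
 qed
 ultimately have ok: "\<forall>v\<in>set (b2 @ rs). row_ok ?n ?V v" by auto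
 have "pkeq ?n False 0 ?V (b1 @ (b2 @ rs)) ?W (map (mrow (subst s)) (b2 @ rs))"
 proof (rule pkeq_blk_elim[OF gM _ ok _ p0])
  show "(y, i) \<notin> ?W" for i using nm by auto
  show "b1 = blk N kk (ser y kk) (ser x k * A) \<or> b1 = blk N kk (ser x k * A) (ser y kk)" using cs by blast
  show "s (y, i) = cf (ser x k * A) i" for i by (simp add: s_def)
 qed (rule sW)
 then have 1: "pke ?n 0 ?V (b1 @ b2 @ rs) ?W (map (mrow (subst s)) b2 @ rs)" using mr by (auto intro: pkeI)
 note d = pkeD[OF 1]
 have loop: "pke ?n (int k * int r) ?W (blk N N (ser x k * A') (ser x k * B') @ rs) V (blk N r A' B' @ rs)"
  if A': "gser V A'" "trc r A'" and B': "gser V B'" "trc r B'" and p: "pot (blk N N (ser x k * A') (ser x k * B') @ rs) = 0" for A' B'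
 proof (rule pkeI[OF pkeq_loop])
  have c0: "cf (ser x k) 0 = 1" by (simp add: cf_ser)
  have t: "trc N (ser x k * A')" "trc N (ser x k * B')" using trc_mult[OF trc_ser A'(2)] trc_mult[OF trc_ser B'(2)] N by auto
  have "pot (blk N N (ser x k * A') (ser x k * B')) = pot (blk N r A' B')"
   using t A' B' c0 by (simp add: pot_blk gserD(1) psum_mult)
  then show "pot (blk N r A' B' @ rs) = 0" using p by simp
 qed (use N nm V A' B' rs in \<open>auto simp: add.commute\<close>)
 from cs have "pke ?n (int k * int r) ?W (map (mrow (subst s)) b2 @ rs) V (b3 @ rs)"
 proof
  assume c: "b1 = blk N kk (ser y kk) (ser x k * A) & b2 = blk N N (ser x k * Q) (ser y kk * P) & b3 = blk N r Q (A * P)"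
  then have "map (mrow (subst s)) b2 = blk N N (ser x k * Q) (ser x k * (A * P))" by (simp add: map_blk fmap_mult fy f mult.assoc)
  then show ?thesis using loop[OF Q AP] d(4) c by simp
 next
  assume c: "b1 = blk N kk (ser x k * A) (ser y kk) & b2 = blk N N (ser y kk * P) (ser x k * Q) & b3 = blk N r (A * P) Q"
  then have "map (mrow (subst s)) b2 = blk N N (ser x k * (A * P)) (ser x k * Q)" by (simp add: map_blk fmap_mult fy f mult.assoc)
  then show ?thesis using loop[OF AP Q] d(4) c by simp
 qed
 from pke_trans[OF 1 this] show ?thesis by simp
qed

text \<open>The situation at a vertex of the circuit after the ends have been exchanged:
  \<open>hn\<close> names the end of the circuit edge that arrives, of color \<open>kh\<close>, and
  \<open>tn\<close> the beginning of the one that leaves, of color \<open>kt\<close>.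
  \<open>B\<close> is the series of the side edges, \<open>P\<close> and \<open>Q\<close> are those
  of the inserted loops, and \<open>mg\<close> says that the vertex is a merge.\<close>

definition node_pre where
 "node_pre N mg hn kh tn kt B P Q = (if mg then blk N kt (ser tn kt) (ser hn kh * B) else blk N kh (ser tn kt * B) (ser hn kh)) @
   blk N N (ser hn kh * P) (ser tn kt * Q)"

definition node_post where
 "node_post N mg kh kt B P Q = (if mg then blk N (N - kh) P (B * Q) else blk N (N - kt) (B * P) Q)"

lemma pke_nodes:
 fixes V :: "('m \<times> nat) set" and hn tn :: "'i => 'm"
 assumes V: "!!x. x \<in> V ==> 0 < snd x" and dis: "distinct is" "inj_on hn (set is)" "inj_on tn (set is)"
  "!!i j. i \<in> set is ==> j \<in> set is ==> hn i ~= tn j"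
  and a: "!!i. i \<in> set is ==> (\<forall>j. (hn i, j) \<notin> V) & (\<forall>j. (tn i, j) \<notin> V) & kh i <= N & kt i <= N &
   (if mg i then kt i = kh i + c i else kh i = kt i + c i) & gser V (B i) & trc (c i) (B i) &
   gser V (P i) & trc (N - kh i) (P i) & gser V (Q i) & trc (N - kt i) (Q i)"
  and rs: "\<forall>x\<in>set rs. row_ok (int (Suc N)) V x"
  and p0: "pot (concat (map (%i. node_pre N (mg i) (hn i) (kh i) (tn i) (kt i) (B i) (P i) (Q i)) is) @ rs) = 0"
 shows "pke (int (Suc N)) (\<Sum>i\<leftarrow>is. if mg i then int (kh i) * int (N - kh i) else int (kt i) * int (N - kt i))
   (V \<union> (\<Union>i\<in>set is. {hn i} \<times> {1..kh i} \<union> {tn i} \<times> {1..kt i}))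
   (concat (map (%i. node_pre N (mg i) (hn i) (kh i) (tn i) (kt i) (B i) (P i) (Q i)) is) @ rs)
   V (concat (map (%i. node_post N (mg i) (kh i) (kt i) (B i) (P i) (Q i)) is) @ rs)"
 using dis a rs p0
proof (induction "is" arbitrary: rs)
 case Nil
 then show ?case using pke_refl[of rs "int (Suc N)" V] by simp
next
 case (Cons i "is")
 let ?n = "int (Suc N)" and ?V' = "V \<union> (\<Union>i\<in>set is. {hn i} \<times> {1..kh i} \<union> {tn i} \<times> {1..kt i})"
 let ?pre = "%i. node_pre N (mg i) (hn i) (kh i) (tn i) (kt i) (B i) (P i) (Q i)"
  and ?post = "%i. node_post N (mg i) (kh i) (kt i) (B i) (P i) (Q i)"
 let ?t = "%i. if mg i then int (kh i) * int (N - kh i) else int (kt i) * int (N - kt i)"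
 note pr = Cons.prems(5)
 have ai: "\<forall>j. (hn i, j) \<notin> V" "\<forall>j. (tn i, j) \<notin> V" "kh i <= N" "kt i <= N"
  "if mg i then kt i = kh i + c i else kh i = kt i + c i"
  and gi: "gser V (B i)" "trc (c i) (B i)" "gser V (P i)" "trc (N - kh i) (P i)" "gser V (Q i)" "trc (N - kt i) (Q i)"
  using pr[of i] by simp_all
 have VV': "V <= ?V'" by auto
 have ok': "\<forall>x\<in>set (concat (map ?pre is) @ rs). row_ok ?n ?V' x"
 proof -
  have "\<forall>x\<in>set (?pre j). row_ok ?n ?V' x" if j: "j \<in> set is" for j
  proof -
   have g: "gser V (B j)" "gser V (P j)" "gser V (Q j)" using pr[of j] j by simp_all
   note g = g[THEN gser_mono[OF _ VV']]
   have h: "gser ?V' (ser (hn j) (kh j))" "gser ?V' (ser (tn j) (kt j))" using j by (auto intro!: gser_ser)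
   note m = gser_mult[OF h(1) g(1)] gser_mult[OF h(2) g(1)] gser_mult[OF h(1) g(2)] gser_mult[OF h(2) g(3)]
   show ?thesis unfolding node_pre_def
    using blk_row_ok[OF h(2) m(1)] blk_row_ok[OF m(2) h(1)] blk_row_ok[OF m(3,4)] by auto
  qed
  moreover have "\<forall>x\<in>set rs. row_ok ?n ?V' x" using Cons.prems(6) row_ok_mono[OF _ VV'] by blast
  ultimately show ?thesis by auto
 qed
 have ne: "hn i ~= hn j" "tn i ~= tn j" "hn i ~= tn j" "tn i ~= hn j" if j: "j \<in> set is" for j
 proof -
  have "i ~= j" using Cons.prems(1) j by auto
  then show "hn i ~= hn j" "tn i ~= tn j" using inj_onD[OF Cons.prems(2), of i j] inj_onD[OF Cons.prems(3), of i j] j by auto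
  show "hn i ~= tn j" "tn i ~= hn j" using Cons.prems(4)[of i j] Cons.prems(4)[of j i] j by simp_all
 qed
 have nm: "(hn i, j) \<notin> ?V'" "(tn i, j) \<notin> ?V'" for j
  using ai(1,2) ne by auto
 have ht: "hn i ~= tn i" using Cons.prems(4)[of i i] by simp
 have V': "0 < snd x" if "x \<in> ?V'" for x using that V[of x] by auto
 note g' = gi(1,3,5)[THEN gser_mono[OF _ VV']]
 have p1: "pot (?pre i @ (concat (map ?pre is) @ rs)) = 0" using Cons.prems(7) by simp
 have 1: "pke ?n (?t i) (?V' \<union> ({hn i} \<times> {1..kh i} \<union> {tn i} \<times> {1..kt i}))
   (?pre i @ (concat (map ?pre is) @ rs)) ?V' (?post i @ (concat (map ?pre is) @ rs))"
 proof (cases "mg i")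
  case True
  have "pke ?n (int (kh i) * int (N - kh i)) (?V' \<union> {hn i} \<times> {1..kh i} \<union> {tn i} \<times> {1..kt i})
   (blk N (kt i) (ser (tn i) (kt i)) (ser (hn i) (kh i) * B i) @ blk N N (ser (hn i) (kh i) * P i) (ser (tn i) (kt i) * Q i) @ (concat (map ?pre is) @ rs))
   ?V' (blk N (N - kh i) (P i) (B i * Q i) @ (concat (map ?pre is) @ rs))"
   by (rule pke_node[OF _ nm ht V' g'(1) gi(2) _ g'(3) gi(6) ai(4) g'(2) gi(4) ok'])
    (use True ai p1 in \<open>simp_all add: node_pre_def\<close>)
  then show ?thesis using True by (simp add: node_pre_def node_post_def Un_assoc)
 next
  case False
  have "pke ?n (int (kt i) * int (N - kt i)) (?V' \<union> {tn i} \<times> {1..kt i} \<union> {hn i} \<times> {1..kh i})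
   (blk N (kh i) (ser (tn i) (kt i) * B i) (ser (hn i) (kh i)) @ blk N N (ser (hn i) (kh i) * P i) (ser (tn i) (kt i) * Q i) @ (concat (map ?pre is) @ rs))
   ?V' (blk N (N - kt i) (B i * P i) (Q i) @ (concat (map ?pre is) @ rs))"
   by (rule pke_node[OF _ nm(2,1) ht[symmetric] V' g'(1) gi(2) _ g'(2) gi(4) ai(3) g'(3) gi(6) ok'])
    (use False ai p1 in \<open>simp_all add: node_pre_def\<close>)
  then show ?thesis using False by (simp add: node_pre_def node_post_def Un_ac)
 qed
 note d = pkeD[OF 1]
 have "pke ?n (\<Sum>i\<leftarrow>is. ?t i) ?V' (concat (map ?pre is) @ (?post i @ rs)) V (concat (map ?post is) @ (?post i @ rs))"
 proof (rule Cons.IH)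
  show "distinct is" "inj_on hn (set is)" "inj_on tn (set is)" using Cons.prems(1-3) by auto
  show "hn j ~= tn k" if "j \<in> set is" "k \<in> set is" for j k using Cons.prems(4) that by simp
  note gm = gser_mult[OF gi(1,5)] gser_mult[OF gi(1,3)]
  show "\<forall>x\<in>set (?post i @ rs). row_ok ?n V x"
   unfolding node_post_def using blk_row_ok[OF gi(3) gm(1)] blk_row_ok[OF gm(2) gi(5)] Cons.prems(6) by auto
  have "pot (concat (map ?pre is) @ (?post i @ rs)) = pot (?post i @ (concat (map ?pre is) @ rs))" by (rule pot_mset) simp
  from this d(4) show "pot (concat (map ?pre is) @ (?post i @ rs)) = 0" by (rule trans)
 qed (rule pr, simp)
 then have 2: "pke ?n (\<Sum>i\<leftarrow>is. ?t i) ?V' (?post i @ (concat (map ?pre is) @ rs)) V (concat (map ?post (i # is)) @ rs)"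
  by (rule pke_mset) simp_all
 have VV: "?V' \<union> ({hn i} \<times> {1..kh i} \<union> {tn i} \<times> {1..kt i}) = V \<union> (\<Union>j\<in>set (i # is). {hn j} \<times> {1..kh j} \<union> {tn j} \<times> {1..kt j})" by auto
 from pke_trans[OF 1 2, unfolded VV] show ?case by simp
qed

text \<open>\<open>T i\<close> and \<open>H i\<close> name the alphabets at the beginning and the
  end of circuit edge i, and \<open>Z i\<close> the loop beside it. Before the rotation the i-th
  block of size \<open>N\<close> joins both ends of one edge. Afterwards it joins the end of edge i
  with the beginning of edge \<open>nx i\<close>, which meet at the same vertex, so all old
  variables can be removed locally. What survives at the vertex leads from \<open>Z (nx i)\<close>
  to \<open>Z i\<close>, against the old orientation.\<close>

lemma circuit_pke:
 fixes V :: "('m \<times> nat) set" and T H Z :: "nat => 'm"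
 assumes V: "!!x. x \<in> V ==> 0 < snd x" and L: "0 < L"
  and inj: "inj_on T {..<L}" "inj_on H {..<L}" "inj_on Z {..<L}"
   "!!i j. T i ~= H j" "!!i j. T i ~= Z j" "!!i j. H i ~= Z j"
  and fresh: "!!i j. (T i, j) \<notin> V" "!!i j. (H i, j) \<notin> V" "!!i j. (Z i, j) \<notin> V"
 defines "nx i \<equiv> Suc i mod L"
 assumes k: "!!i. i < L ==> k i <= N"
  and kc: "!!i. i < L ==> if mg i then k (nx i) = k i + c i else k i = k (nx i) + c i"
  and B: "!!i. i < L ==> gser V (B i) & trc (c i) (B i)"
  and rs: "\<forall>x\<in>set rs. row_ok (int (Suc N)) V x"
 defines "vb i \<equiv> if mg i then blk N (k (nx i)) (ser (T (nx i)) (k (nx i))) (ser (H i) (k i) * B i)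
   else blk N (k i) (ser (T (nx i)) (k (nx i)) * B i) (ser (H i) (k i))"
  and "vb' i \<equiv> if mg i then blk N (N - k i) (ser (Z i) (N - k i)) (B i * ser (Z (nx i)) (N - k (nx i)))
   else blk N (N - k (nx i)) (B i * ser (Z i) (N - k i)) (ser (Z (nx i)) (N - k (nx i)))"
  and "ar i \<equiv> blk N (k i) (ser (H i) (k i)) (ser (T i) (k i))"
 assumes p0: "pot (concat (map ar [0..<L]) @ concat (map vb [0..<L]) @ rs) = 0"
 shows "pke (int (Suc N))
  ((\<Sum>i\<leftarrow>[0..<L]. if mg i then int (k i) * int (N - k i) else int (k (nx i)) * int (N - k (nx i))) - (\<Sum>i\<leftarrow>[0..<L]. int (N - k i) * int (k i)))
  (V \<union> (\<Union>i<L. {T i, H i} \<times> {1..k i})) (concat (map ar [0..<L]) @ concat (map vb [0..<L]) @ rs)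
  (V \<union> (\<Union>i<L. {Z i} \<times> {1..N - k i})) (concat (map vb' [0..<L]) @ rs)"
proof -
 let ?n = "int (Suc N)" and ?is = "[0..<L]"
 let ?V1 = "V \<union> (\<Union>i<L. {T i, H i} \<times> {1..k i})" and ?VZ = "V \<union> (\<Union>i<L. {Z i} \<times> {1..N - k i})"
 let ?V2 = "?V1 \<union> (\<Union>i<L. {Z i} \<times> {1..N - k i})"
 let ?T = "%i. ser (T i) (k i)" and ?H = "%i. ser (H i) (k i)" and ?Z = "%i. ser (Z i) (N - k i)"
 have nL: "nx i < L" for i using L by (simp add: nx_def)
 have nx_eq: "nx i = (if Suc i = L then 0 else Suc i)" if "i < L" for i
  using that by (simp add: nx_def)
 have nxinj: "inj_on nx {..<L}" by (rule inj_onI) (auto simp: nx_eq split: if_splits)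
 have nxim: "nx ` {..<L} = {..<L}"
  using endo_inj_surj[of "{..<L}" nx] nxinj nL by auto
 have gT: "gser ?V1 (?T i)" "gser ?V1 (?H i)" if "i < L" for i using that by (auto intro!: gser_ser)
 have gZ: "gser ?VZ (?Z i)" if "i < L" for i using that by (auto intro!: gser_ser)
 have sub: "V <= ?V1" "V <= ?VZ" "?V1 <= ?V2" "?VZ <= ?V2" by auto
 have vok: "\<forall>x\<in>set (concat (map vb ?is) @ rs). row_ok ?n ?V1 x"
 proof -
  have "\<forall>x\<in>set (vb i). row_ok ?n ?V1 x" if i: "i < L" for i
  proof -
   have b: "gser ?V1 (B i)" using B[OF i] gser_mono[OF _ sub(1)] by blast
   show ?thesis unfolding vb_def
    using blk_row_ok[OF gT(1)[OF nL] gser_mult[OF gT(2)[OF i] b]] blk_row_ok[OF gser_mult[OF gT(1)[OF nL] b] gT(2)[OF i]] by auto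
  qed
  moreover have "\<forall>x\<in>set rs. row_ok ?n ?V1 x" using rs row_ok_mono[OF _ sub(1)] by blast
  ultimately show ?thesis by auto
 qed
 let ?big = "%i. blk N N (?Z i * ?H i) (?Z i * ?T i)"
 have lt: "{..<L} = set ?is" by auto
 \<comment> \<open>Insertion of loops is their removal read backwards, hence the negative
   shift.\<close>
 have A: "pke ?n (- (\<Sum>i\<leftarrow>?is. int (N - k i) * int (k i))) ?V1 (concat (map ar ?is) @ (concat (map vb ?is) @ rs))
   ?V2 (concat (map ?big ?is) @ (concat (map vb ?is) @ rs))"
  unfolding ar_def lt
 proof (rule pke_sym[OF pke_loops[OF _ _ _ _ vok[unfolded lt]]])
  show "0 < snd x" if "x \<in> V \<union> (\<Union>i\<in>set ?is. {T i, H i} \<times> {1..k i})" for x using that V[of x] by auto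
  show "inj_on Z (set ?is)" using inj(3) by (simp add: lt)
  fix i assume "i \<in> set ?is"
  then have i: "i < L" by simp
  show "N = k i + (N - k i) & (\<forall>j. (Z i, j) \<notin> V \<union> (\<Union>i\<in>set ?is. {T i, H i} \<times> {1..k i})) &
   gser (V \<union> (\<Union>i\<in>set ?is. {T i, H i} \<times> {1..k i})) (?H i) & trc (k i) (?H i) &
   gser (V \<union> (\<Union>i\<in>set ?is. {T i, H i} \<times> {1..k i})) (?T i) & trc (k i) (?T i)"
   using k[OF i] fresh inj(5,6) gT[OF i, unfolded lt] trc_ser by (auto simp: eq_commute[of "Z _"])
 qed (use p0[unfolded ar_def] in simp_all)
 note dA = pkeD[OF A]
 let ?big' = "%i. blk N N (?Z i * ?H i) (?Z (nx i) * ?T (nx i))"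
 have rot: "\<exists>dl. req ?n ?V2 dl 0 (concat (map ?big ?is)) (concat (map ?big' ?is))"
 proof -
  let ?Ls = "map (%i. ?Z i * ?H i) ?is" and ?M = "%i. ?Z i * ?T i"
  obtain l where l: "L = Suc l" using L by (cases L) auto
  have e1: "map ?M ?is = ?M 0 # map ?M [1..<L]" using L by (simp add: upt_conv_Cons)
  have e2: "map ?M [1..<L] @ [?M 0] = map (%i. ?M (nx i)) ?is"
  proof (rule nth_equalityI)
   show "length (map ?M [1..<L] @ [?M 0]) = length (map (%i. ?M (nx i)) ?is)" using L by simp
   fix i assume "i < length (map ?M [1..<L] @ [?M 0])"
   then have "i < L" using L by simp
   then show "(map ?M [1..<L] @ [?M 0]) ! i = map (%i. ?M (nx i)) ?is ! i"
    using nx_eq[of i] by (auto simp: nth_append)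
  qed
  have "\<exists>dl. req ?n ?V2 dl 0 (blks N ?Ls (?M 0 # map ?M [1..<L])) (blks N ?Ls (map ?M [1..<L] @ [?M 0]))"
  proof (rule req_rotate)
   show "length ?Ls = Suc (length (map ?M [1..<L]))" using L by simp
   have 1: "gser ?V2 (?Z i * ?H i) & trc N (?Z i * ?H i)" "gser ?V2 (?Z i * ?T i) & trc N (?Z i * ?T i)" if i: "i < L" for i
    using gser_mult[OF gser_mono[OF gZ[OF i] sub(4)] gser_mono[OF gT(2)[OF i] sub(3)]]
     gser_mult[OF gser_mono[OF gZ[OF i] sub(4)] gser_mono[OF gT(1)[OF i] sub(3)]]
     trc_mult[OF trc_ser[of "N - k i" "Z i"] trc_ser[of "k i" "H i"]] trc_mult[OF trc_ser[of "N - k i" "Z i"] trc_ser[of "k i" "T i"]] k[OF i]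
    by auto
   show "\<forall>X\<in>set (?M 0 # ?Ls @ map ?M [1..<L]). gser ?V2 X & trc N X" using 1 L by auto
  qed
  moreover have "map2 (blk N N) ?Ls (map f ?is) = map (%i. blk N N (?Z i * ?H i) (f i)) ?is" for f
   by (simp add: zip_map_map zip_same_conv_map)
  ultimately show ?thesis unfolding e2 e1[symmetric] by simp
 qed
 then obtain dl where dl: "req ?n ?V2 dl 0 (concat (map ?big ?is)) (concat (map ?big' ?is))" ..
 have Bt: "pke ?n 0 ?V2 (concat (map ?big ?is) @ (concat (map vb ?is) @ rs)) ?V2 (concat (map ?big' ?is) @ (concat (map vb ?is) @ rs))"
  by (rule req_pke[OF req_append_right[OF dl] dA(2,4)])
 note dB = pkeD[OF Bt]
 let ?pre = "%i. node_pre N (mg i) (H i) (k i) (T (nx i)) (k (nx i)) (B i) (?Z i) (?Z (nx i))"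
  and ?post = "%i. node_post N (mg i) (k i) (k (nx i)) (B i) (?Z i) (?Z (nx i))"
 have pre: "?pre i = vb i @ ?big' i" for i by (simp add: node_pre_def vb_def mult.commute)
 have post: "?post i = vb' i" for i by (simp add: node_post_def vb'_def)
 have ms: "mset (concat (map ?big' ?is) @ (concat (map vb ?is) @ rs)) = mset (concat (map ?pre ?is) @ rs)"
 proof -
  have "mset (concat (map f xs)) + mset (concat (map g xs)) = mset (concat (map (%i. g i @ f i) xs))"
   for f g :: "nat => ('m \<times> nat) row list" and xs by (induction xs) auto
  then show ?thesis unfolding pre by (simp add: add.assoc[symmetric])
 qed
 have C: "pke ?n (\<Sum>i\<leftarrow>?is. if mg i then int (k i) * int (N - k i) else int (k (nx i)) * int (N - k (nx i)))
   (?VZ \<union> (\<Union>i\<in>set ?is. {H i} \<times> {1..k i} \<union> {T (nx i)} \<times> {1..k (nx i)}))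
   (concat (map ?pre ?is) @ rs) ?VZ (concat (map ?post ?is) @ rs)"
 proof (rule pke_nodes)
  show "0 < snd x" if "x \<in> ?VZ" for x using that V[of x] by auto
  show "distinct ?is" "inj_on H (set ?is)" using inj(2) by (simp_all add: lt)
  have "inj_on (T \<circ> nx) {..<L}" using nxinj inj(1) nxim by (intro comp_inj_on) auto
  then show "inj_on (%i. T (nx i)) (set ?is)" by (simp add: comp_def lt)
  show "H i ~= T (nx j)" for i j using inj(4)[of "nx j" i] by simp
  show "\<forall>x\<in>set rs. row_ok ?n ?VZ x" using rs row_ok_mono[OF _ sub(2)] by blast
  show "pot (concat (map ?pre ?is) @ rs) = 0" by (rule trans[OF sym[OF pot_mset[OF ms]] dB(4)])
  fix i assume "i \<in> set ?is"
  then have i: "i < L" by simp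
  have "gser ?VZ (B i)" using B[OF i] gser_mono[OF _ sub(2)] by blast
  then show "(\<forall>j. (H i, j) \<notin> ?VZ) & (\<forall>j. (T (nx i), j) \<notin> ?VZ) & k i <= N & k (nx i) <= N &
   (if mg i then k (nx i) = k i + c i else k i = k (nx i) + c i) & gser ?VZ (B i) & trc (c i) (B i) &
   gser ?VZ (?Z i) & trc (N - k i) (?Z i) & gser ?VZ (?Z (nx i)) & trc (N - k (nx i)) (?Z (nx i))"
   using fresh inj(5,6) k[OF i] k[OF nL] kc[OF i] B[OF i] gZ[OF i] gZ[OF nL] trc_ser by auto
 qed
 have VV: "?VZ \<union> (\<Union>i\<in>set ?is. {H i} \<times> {1..k i} \<union> {T (nx i)} \<times> {1..k (nx i)}) = ?V2"
 proof -
  have "(\<Union>i<L. {T (nx i)} \<times> {1..k (nx i)}) = (\<Union>i\<in>nx ` {..<L}. {T i} \<times> {1..k i})" by simp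
  then have "(\<Union>i<L. {T (nx i)} \<times> {1..k (nx i)}) = (\<Union>i<L. {T i} \<times> {1..k i})" unfolding nxim .
  moreover have "(\<Union>i\<in>set ?is. {H i} \<times> {1..k i} \<union> {T (nx i)} \<times> {1..k (nx i)}) =
    (\<Union>i<L. {H i} \<times> {1..k i}) \<union> (\<Union>i<L. {T (nx i)} \<times> {1..k (nx i)})" by auto
  moreover have "(\<Union>i<L. {T i, H i} \<times> {1..k i}) = (\<Union>i<L. {H i} \<times> {1..k i}) \<union> (\<Union>i<L. {T i} \<times> {1..k i})" by auto
  ultimately show ?thesis by (simp add: Un_ac)
 qed
 have "pke ?n (\<Sum>i\<leftarrow>?is. if mg i then int (k i) * int (N - k i) else int (k (nx i)) * int (N - k (nx i)))
   ?V2 (concat (map ?big' ?is) @ (concat (map vb ?is) @ rs)) ?VZ (concat (map ?post ?is) @ rs)"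
  by (rule pke_mset[OF C[unfolded VV] ms[symmetric] refl])
 from pke_trans[OF A pke_trans[OF Bt this]] show ?thesis by (simp add: post)
qed

text \<open>Circles of colors k and N - k are both obtained from the fusion of the two by treating
  the other one as the loop. The shifts of the two removals agree and cancel.\<close>

lemma circle_pke:
 fixes V :: "('m \<times> nat) set"
 assumes V: "!!x. x \<in> V ==> 0 < snd x" and fresh: "!!j. (T, j) \<notin> V" "!!j. (Z, j) \<notin> V" "T ~= Z" and k: "k <= N"
  and rs: "\<forall>x\<in>set rs. row_ok (int (Suc N)) V x" and p0: "pot (blk N k (ser T k) (ser T k) @ rs) = 0"
 shows "pke (int (Suc N)) 0 (V \<union> {T} \<times> {1..k}) (blk N k (ser T k) (ser T k) @ rs)
  (V \<union> {Z} \<times> {1..N - k}) (blk N (N - k) (ser Z (N - k)) (ser Z (N - k)) @ rs)"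
proof -
 let ?n = "int (Suc N)"
 have loop: "pke ?n (int b * int a) (V \<union> {x} \<times> {1..a} \<union> {y} \<times> {1..b}) (blk N N (ser y b * ser x a) (ser y b * ser x a) @ rs)
   (V \<union> {x} \<times> {1..a}) (blk N a (ser x a) (ser x a) @ rs)"
  if "N = a + b" "!!j. (x, j) \<notin> V" "!!j. (y, j) \<notin> V" "x ~= y" for a b x y
 proof (rule pkeI[OF pkeq_loop[OF that(1)]])
  show "(y, i) \<notin> V \<union> {x} \<times> {1..a}" for i using that by auto
  show "0 < snd v" if "v \<in> V \<union> {x} \<times> {1..a}" for v using that V[of v] by auto
  show "gser (V \<union> {x} \<times> {1..a}) (ser x a)" "gser (V \<union> {x} \<times> {1..a}) (ser x a)" by (rule gser_ser, simp)+
  show "\<forall>v\<in>set rs. row_ok ?n (V \<union> {x} \<times> {1..a}) v" using rs row_ok_mono[of ?n V _ "V \<union> {x} \<times> {1..a}"] by auto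
  have "pot (blk N a (ser x a) (ser x a)) = 0" "pot (blk N k (ser T k) (ser T k)) = 0"
   by (subst pot_blk; simp add: cf_ser trc_ser)+
  then show "pot (blk N a (ser x a) (ser x a) @ rs) = 0" using p0 by simp
 qed (rule trc_ser)+
 have 1: "pke ?n (int (N - k) * int k) (V \<union> {T} \<times> {1..k} \<union> {Z} \<times> {1..N - k}) (blk N N (ser Z (N - k) * ser T k) (ser Z (N - k) * ser T k) @ rs)
   (V \<union> {T} \<times> {1..k}) (blk N k (ser T k) (ser T k) @ rs)"
  using k fresh by (intro loop) auto
 have 2: "pke ?n (int k * int (N - k)) (V \<union> {Z} \<times> {1..N - k} \<union> {T} \<times> {1..k}) (blk N N (ser T k * ser Z (N - k)) (ser T k * ser Z (N - k)) @ rs)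
   (V \<union> {Z} \<times> {1..N - k}) (blk N (N - k) (ser Z (N - k)) (ser Z (N - k)) @ rs)"
  using k fresh by (intro loop) auto
 have e: "V \<union> {Z} \<times> {1..N - k} \<union> {T} \<times> {1..k} = V \<union> {T} \<times> {1..k} \<union> {Z} \<times> {1..N - k}" by auto
 from pke_trans[OF pke_sym[OF 1] 2[unfolded e mult.commute[of "ser T k"]]] show ?thesis by (simp add: mult.commute)
qed

section \<open>The Koszul complex of a graph\<close>

text \<open>The combinatorial part of being a MOY graph, on which the computation of rows,
  potentials and shifts rests. It passes to the reversed graph by
  \<open>net_reverse_circuit\<close>.\<close>

definition net :: "'e plane_graph => bool" where
 "net G \<longleftrightarrow> finite (verts G) & finite (edges G) &
   (\<forall>e\<in>edges G. ~ is_circle G e --> pathstart (curve G e) \<in> verts G & pathfinish (curve G e) \<in> verts G) &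
   (\<forall>v\<in>verts G. in_edges G v ~= {} & out_edges G v ~= {} &
    (\<Sum>e\<in>in_edges G v. color G e) = (\<Sum>e\<in>out_edges G v. color G e))"

abbreviation "col G s \<equiv> color G (fst s)"

definition marks :: "'e plane_graph => ('e => nat) => ('e \<times> nat) set" where
 "marks G mu = {(e, i). e \<in> edges G & i < mu e}"

definition pvs :: "'e plane_graph => ('e => nat) => ('e \<times> nat => 'm) => ('m \<times> nat) set" where
 "pvs G mu nu = (\<Union>s\<in>marks G mu. {nu s} \<times> {1..col G s})"

definition pblk :: "nat => 'e plane_graph => ('e \<times> nat => 'm) => ('e \<times> nat) set \<times> ('e \<times> nat) set => ('m \<times> nat) row list" where
 "pblk N G nu p = blk N (\<Sum>s\<in>snd p. col G s) (\<Prod>s\<in>snd p. ser (nu s) (col G s)) (\<Prod>s\<in>fst p. ser (nu s) (col G s))"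

definition psh :: "'e plane_graph => ('e \<times> nat) set \<times> ('e \<times> nat) set => int" where
 "psh G p = - int (\<Sum>B | B <= snd p & card B = 2. \<Prod>s\<in>B. card (alphabet G s))"

lemma alphabet_image: "alphabet G s = (%k. (fst s, snd s, k)) ` {..<col G s}"
 by (cases s) (auto simp: alphabet_def)
lemma finite_alphabet [simp]: "finite (alphabet G s)"
 by (simp add: alphabet_image)
lemma card_alphabet [simp]: "card (alphabet G s) = col G s"
 unfolding alphabet_image by (subst card_image) (auto simp: inj_on_def)
lemma alphabet_disjoint: "s ~= t ==> alphabet G s \<inter> alphabet G t = {}"
 by (auto simp: alphabet_image prod_eq_iff)

lemma finite_in_out: "finite (edges G) ==> finite (in_edges G v)" "finite (edges G) ==> finite (out_edges G v)"
 by (simp_all add: in_edges_def out_edges_def)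

lemma finite_marks: "finite (edges G) ==> finite (marks G mu)"
proof -
 assume "finite (edges G)"
 then have "finite (SIGMA e:edges G. {..<mu e})" by simp
 moreover have "marks G mu = (SIGMA e:edges G. {..<mu e})" by (auto simp: marks_def)
 ultimately show ?thesis by simp
qed

lemma piece_props:
 assumes G: "net G" and mu: "\<forall>e\<in>edges G. 1 <= mu e" and p: "p \<in> pieces G mu"
 shows "fst p <= marks G mu" "snd p <= marks G mu" "finite (fst p)" "finite (snd p)"
  "(\<Sum>s\<in>fst p. col G s) = (\<Sum>s\<in>snd p. col G s)"
  "\<forall>e\<in>edges G. 2 <= mu e ==> fst p \<inter> snd p = {}"
proof -
 have io: "in_edges G v <= edges G" "out_edges G v <= edges G" for v by (auto simp: in_edges_def out_edges_def)
 consider (arc) e i where "p = ({(e, i)}, {(e, Suc i)})" "e \<in> edges G" "Suc i < mu e"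
  | (circle) e where "p = ({(e, mu e - 1)}, {(e, 0)})" "e \<in> edges G"
  | (vertex) v where "p = ((%e. (e, mu e - 1)) ` in_edges G v, (%e. (e, 0)) ` out_edges G v)" "v \<in> verts G"
  using p unfolding pieces_def by blast
 note cs = this
 have lt: "mu e - 1 < mu e" "0 < mu e" if "e \<in> edges G" for e using mu that by (auto simp: Suc_le_eq)
 have im: "(%e. (e, g e)) ` A <= marks G mu" if "A <= edges G" "!!e. e \<in> edges G ==> g e < mu e" for g A
  using that by (auto simp: marks_def)
 from cs have 1: "fst p <= marks G mu & snd p <= marks G mu"
 proof cases
  case (vertex v)
  then show ?thesis using im[OF io(1) lt(1)] im[OF io(2) lt(2)] by (simp only: fst_conv snd_conv)
 qed (use lt in \<open>auto simp: marks_def\<close>)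
 then show "fst p <= marks G mu" "snd p <= marks G mu" by (rule conjunct1, rule conjunct2)
 have "finite (marks G mu)" using G finite_marks by (auto simp: net_def)
 then show "finite (fst p)" "finite (snd p)" using 1 finite_subset by auto
 from cs show "(\<Sum>s\<in>fst p. col G s) = (\<Sum>s\<in>snd p. col G s)"
 proof cases
  case (vertex v)
  have "(\<Sum>s\<in>fst p. col G s) = (\<Sum>e\<in>in_edges G v. color G e)" "(\<Sum>s\<in>snd p. col G s) = (\<Sum>e\<in>out_edges G v. color G e)"
   unfolding vertex fst_conv snd_conv by (subst sum.reindex; simp add: inj_on_def)+
  then show ?thesis using G vertex(2) by (auto simp: net_def)
 qed simp_all
 show "fst p \<inter> snd p = {}" if m2: "\<forall>e\<in>edges G. 2 <= mu e"
 proof -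
  have m: "mu e - 1 ~= 0" if "e \<in> edges G" for e using m2 that by force
  have "(e, mu e - 1) ~= (e', 0)" if "e \<in> in_edges G v" for e e' v using m[OF subsetD[OF io(1) that]] by simp
  then have "(%e. (e, mu e - 1)) ` in_edges G v \<inter> (%e. (e, 0)) ` out_edges G w = {}" for v w by blast
  with cs m show ?thesis by cases auto
 qed
qed

text \<open>\<open>tau\<close> and \<open>eta\<close> name the alphabets at the first and at the
  last mark of an edge: a circle is closed up from its last mark to its first, and a vertex joins
  last marks of entering edges to first marks of leaving ones.\<close>

definition ends where
 "ends N G tau eta el vl = concat (map (%e. blk N (color G e) (ser (tau e) (color G e)) (ser (eta e) (color G e))) (filter (is_circle G) el)) @
   concat (map (%v. blk N (\<Sum>e\<in>out_edges G v. color G e) (\<Prod>e\<in>out_edges G v. ser (tau e) (color G e)) (\<Prod>e\<in>in_edges G v. ser (eta e) (color G e))) vl)"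

definition arcs where
 "arcs N G nu mu e = concat (map (%i. blk N (color G e) (ser (nu (e, Suc i)) (color G e)) (ser (nu (e, i)) (color G e))) [0..<mu e - 1])"

definition rowsG where
 "rowsG N G nu el vl mu = concat (map (arcs N G nu mu) el) @ ends N G (%e. nu (e, 0)) (%e. nu (e, mu e - 1)) el vl"

text \<open>The pieces in the order in which \<open>rowsG\<close> lists their rows; any other list
  of the pieces is a permutation of this one.\<close>

definition cps where
 "cps G el vl mu = concat (map (%e. map (%i. ({(e, i)}, {(e, Suc i)})) [0..<mu e - 1]) el) @
   map (%e. ({(e, mu e - 1)}, {(e, 0)})) (filter (is_circle G) el) @
   map (%v. ((%e. (e, mu e - 1)) ` in_edges G v, (%e. (e, 0 :: nat)) ` out_edges G v)) vl"

lemma concat_map_concat: "concat (map f (concat xss)) = concat (map (%xs. concat (map f xs)) xss)"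
 by (induction xss) auto

lemma rowsG_cps: "concat (map (pblk N G nu) (cps G el vl mu)) = rowsG N G nu el vl mu"
proof -
 have a: "pblk N G nu ({(e, i)}, {(e, j)}) = blk N (color G e) (ser (nu (e, j)) (color G e)) (ser (nu (e, i)) (color G e))" for e i j
  by (simp add: pblk_def)
 have v: "pblk N G nu ((%e. (e, mu e - 1)) ` A, (%e. (e, 0)) ` B) =
   blk N (\<Sum>e\<in>B. color G e) (\<Prod>e\<in>B. ser (nu (e, 0)) (color G e)) (\<Prod>e\<in>A. ser (nu (e, mu e - 1)) (color G e))" for A B
 proof -
  have i: "inj_on (%e. (e, mu e - 1)) A" "inj_on (%e. (e, 0 :: nat)) B" by (auto simp: inj_on_def)
  show ?thesis unfolding pblk_def fst_conv snd_conv sum.reindex[OF i(2)] prod.reindex[OF i(1)] prod.reindex[OF i(2)]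
   by (simp add: comp_def)
 qed
 show ?thesis
  unfolding cps_def rowsG_def ends_def arcs_def map_append concat_append concat_map_concat map_map comp_def a v ..
qed

lemma set_cps:
 assumes "set el = edges G" "set vl = verts G"
 shows "set (cps G el vl mu) = pieces G mu"
 unfolding cps_def pieces_def using assms by auto

text \<open>A piece is only a pair of sets of end points, so coincidences must be excluded: arcs end
  at a mark of positive index, circles do not occur at vertices, and a vertex is determined by any
  edge that enters it.\<close>

lemma distinct_cps:
 assumes G: "net G" and el: "distinct el" "set el = edges G" and vl: "distinct vl" "set vl = verts G"
 shows "distinct (cps G el vl mu)"
proof -
 let ?P = "concat (map (%e. map (%i. ({(e, i)}, {(e, Suc i)})) [0..<mu e - 1]) el)"
  and ?Q = "map (%e. ({(e, mu e - 1)}, {(e, 0 :: nat)})) (filter (is_circle G) el)"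
  and ?R = "map (%v. ((%e. (e, mu e - 1)) ` in_edges G v, (%e. (e, 0 :: nat)) ` out_edges G v)) vl"
 have 1: "distinct (?P)"
  using el(1) by (induction el) (auto simp: distinct_map inj_on_def)
 have 2: "distinct (?Q)"
  using el(1) by (auto simp: distinct_map inj_on_def)
 have ne: "in_edges G v ~= {}" "out_edges G v ~= {}" if "v \<in> set vl" for v using that G vl(2) by (auto simp: net_def)
 have 3: "distinct (?R)"
  unfolding distinct_map
 proof (intro conjI vl(1) inj_onI)
  fix v w assume v: "v \<in> set vl" and
   eq: "((%e. (e, mu e - 1)) ` in_edges G v, (%e. (e, 0 :: nat)) ` out_edges G v) =
    ((%e. (e, mu e - 1)) ` in_edges G w, (%e. (e, 0)) ` out_edges G w)"
  obtain e where e: "e \<in> in_edges G v" using ne(1)[OF v] by blast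
  then have "(e, mu e - 1) \<in> (%e. (e, mu e - 1)) ` in_edges G w" using eq by auto
  then have "e \<in> in_edges G w" by auto
  then show "v = w" using e by (simp add: in_edges_def)
 qed
 have d12: "({(e, i)}, {(e, Suc i)}) ~= ({(e', j)}, {(e', 0 :: nat)})" for e e' :: 'a and i j by simp
 have d13: "({(e, i)}, {(e, Suc i)}) ~= ((%e. (e, mu e - 1)) ` A, (%e. (e, 0 :: nat)) ` B)" for e :: 'a and i A B
 proof
  assume "({(e, i)}, {(e, Suc i)}) = ((%e. (e, mu e - 1)) ` A, (%e. (e, 0 :: nat)) ` B)"
  then have "(e, Suc i) \<in> (%e. (e, 0 :: nat)) ` B" by auto
  then show False by auto
 qed
 have d23: "({(e, j)}, {(e, 0 :: nat)}) ~= ((%e. (e, mu e - 1)) ` in_edges G v, (%e. (e, 0 :: nat)) ` out_edges G v)"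
  if "is_circle G e" "v \<in> set vl" for e v j
 proof
  assume "({(e, j)}, {(e, 0 :: nat)}) = ((%e. (e, mu e - 1)) ` in_edges G v, (%e. (e, 0 :: nat)) ` out_edges G v)"
  then have "(e, 0) \<in> (%e. (e, 0 :: nat)) ` out_edges G v" by auto
  then show False using that(1) by (auto simp: out_edges_def)
 qed
 show ?thesis unfolding cps_def distinct_append
 proof (intro conjI 1 2 3)
  show "set (?Q) \<inter>
   set (?R) = {}"
   using d23 by fastforce
  show "set (?P) \<inter>
   set (?Q @
    ?R) = {}"
  proof (rule equals0I)
   fix x assume x: "x \<in> set ?P \<inter> set (?Q @ ?R)"
   then obtain e i where e: "x = ({(e, i)}, {(e, Suc i)})" by auto
   from x have "x \<in> set ?Q \<or> x \<in> set ?R" by simp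
   then show False
   proof
    assume "x \<in> set ?Q"
    then obtain e' where "x = ({(e', mu e' - 1)}, {(e', 0)})" by auto
    then show False unfolding e using d12 by blast
   next
    assume "x \<in> set ?R"
    then obtain v where "x = ((%e. (e, mu e - 1)) ` in_edges G v, (%e. (e, 0)) ` out_edges G v)" by auto
    then show False unfolding e using d13 by (rule notE[rotated])
   qed
  qed
 qed
qed

lemma pblk_row_ok:
 assumes "net G" "\<forall>e\<in>edges G. 1 <= mu e" "p \<in> pieces G mu"
 shows "\<forall>r\<in>set (pblk N G nu p). row_ok (int (Suc N)) (pvs G mu nu) r"
proof -
 have "gser (pvs G mu nu) (ser (nu s) (col G s))" if "s \<in> marks G mu" for s
  using that by (intro gser_ser) (auto simp: pvs_def)
 then show ?thesis unfolding pblk_def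
  using piece_props(1,2)[OF assms] by (intro blk_row_ok gser_prod) auto
qed

lemma rowsG_ok:
 assumes G: "net G" and mu: "\<forall>e\<in>edges G. 1 <= mu e" and el: "set el = edges G" "set vl = verts G"
 shows "\<forall>r\<in>set (rowsG N G nu el vl mu). row_ok (int (Suc N)) (pvs G mu nu) r"
proof
 fix r assume "r \<in> set (rowsG N G nu el vl mu)"
 then obtain p where p: "p \<in> pieces G mu" "r \<in> set (pblk N G nu p)"
  unfolding rowsG_cps[symmetric] set_concat set_map set_cps[OF el] by blast
 show "row_ok (int (Suc N)) (pvs G mu nu) r" by (rule bspec[OF pblk_row_ok[OF G mu p(1)] p(2)])
qed

lemma pot_concat: "pot (concat (map f xs)) = (\<Sum>x\<leftarrow>xs. pot (f x))"
 by (induction xs) auto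

text \<open>The power sum of each marked point occurs once with either sign, for the piece that it
  ends and the piece that it begins. For edges that are not circles the outer ends are collected by
  summing over vertices.\<close>

lemma pot_rowsG:
 assumes G: "net G" and el: "distinct el" "set el = edges G" and vl: "distinct vl" "set vl = verts G"
 shows "pot (rowsG N G nu el vl mu) = 0"
proof -
 define f where "f s = psum (Suc N) (ser (nu s) (col G s))" for s
 have c0: "cf (ser (nu s) c) 0 = 1" for s c by (simp add: cf_ser)
 have b: "pot (blk N c (ser x c) (ser y c)) = psum (Suc N) (ser x c) - psum (Suc N) (ser y c)" for x y :: 'b and c
  by (rule pot_blk) (simp_all add: cf_ser trc_ser)
 have ar: "pot (arcs N G nu mu e) = f (e, mu e - 1) - f (e, 0)" for e
 proof -
  have "(\<Sum>i\<leftarrow>[0..<m]. f (e, Suc i) - f (e, i)) = f (e, m) - f (e, 0)" for m by (induction m) auto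
  then show ?thesis unfolding arcs_def pot_concat b f_def by simp
 qed
 have finE: "finite (edges G)" "finite (verts G)" using G by (auto simp: net_def)
 have vt: "pot (blk N (\<Sum>e\<in>out_edges G v. color G e) (\<Prod>e\<in>out_edges G v. ser (nu (e, 0)) (color G e)) (\<Prod>e\<in>in_edges G v. ser (nu (e, mu e - 1)) (color G e)))
   = (\<Sum>e\<in>out_edges G v. f (e, 0)) - (\<Sum>e\<in>in_edges G v. f (e, mu e - 1))" if "v \<in> set vl" for v
 proof -
  have c: "(\<Sum>e\<in>in_edges G v. color G e) = (\<Sum>e\<in>out_edges G v. color G e)" using G that vl(2) by (auto simp: net_def)
  have t: "trc (\<Sum>e\<in>out_edges G v. color G e) (\<Prod>e\<in>out_edges G v. ser (nu (e, 0)) (color G e))"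
   "trc (\<Sum>e\<in>out_edges G v. color G e) (\<Prod>e\<in>in_edges G v. ser (nu (e, mu e - 1)) (color G e))"
   by (rule trc_prod, rule trc_ser) (unfold c[symmetric], rule trc_prod, rule trc_ser)
  show ?thesis unfolding f_def
   by (subst pot_blk[OF _ _ t]) (simp_all add: cf_prod_0 c0 psum_prod)
 qed
 let ?C = "{e \<in> edges G. is_circle G e}" and ?S = "{e \<in> edges G. ~ is_circle G e}"
 have ES: "edges G = ?C \<union> ?S" "?C \<inter> ?S = {}" by auto
 have out: "(\<Sum>v\<in>verts G. \<Sum>e\<in>out_edges G v. g e) = (\<Sum>e\<in>?S. g e)" for g :: "'a => ('b \<times> nat) mpol"
  using sum.group[of ?S "verts G" "%e. pathstart (curve G e)" g] finE G
  by (auto simp: net_def out_edges_def conj_assoc intro!: sum.cong)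
 have inn: "(\<Sum>v\<in>verts G. \<Sum>e\<in>in_edges G v. g e) = (\<Sum>e\<in>?S. g e)" for g :: "'a => ('b \<times> nat) mpol"
  using sum.group[of ?S "verts G" "%e. pathfinish (curve G e)" g] finE G
  by (auto simp: net_def in_edges_def conj_assoc intro!: sum.cong)
 have "pot (rowsG N G nu el vl mu) = (\<Sum>e\<leftarrow>el. f (e, mu e - 1) - f (e, 0)) +
   ((\<Sum>e\<leftarrow>filter (is_circle G) el. f (e, 0) - f (e, mu e - 1)) +
   (\<Sum>v\<leftarrow>vl. (\<Sum>e\<in>out_edges G v. f (e, 0)) - (\<Sum>e\<in>in_edges G v. f (e, mu e - 1))))"
  unfolding rowsG_def ends_def pot_simps pot_concat ar b using vt
  by (simp add: f_def cong: map_cong)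
 also have "(\<Sum>e\<leftarrow>el. f (e, mu e - 1) - f (e, 0)) = (\<Sum>e\<in>edges G. f (e, mu e - 1) - f (e, 0))"
  using el by (simp add: sum_list_distinct_conv_sum_set)
 also have "(\<Sum>e\<leftarrow>filter (is_circle G) el. f (e, 0) - f (e, mu e - 1)) = (\<Sum>e\<in>?C. f (e, 0) - f (e, mu e - 1))"
  using el by (simp add: sum_list_distinct_conv_sum_set)
 also have "(\<Sum>v\<leftarrow>vl. (\<Sum>e\<in>out_edges G v. f (e, 0)) - (\<Sum>e\<in>in_edges G v. f (e, mu e - 1))) =
   (\<Sum>e\<in>?S. f (e, 0)) - (\<Sum>e\<in>?S. f (e, mu e - 1))"
  using vl by (simp add: sum_list_distinct_conv_sum_set sum_subtractf out inn)
 also have "(\<Sum>e\<in>edges G. f (e, mu e - 1) - f (e, 0)) = (\<Sum>e\<in>?C. f (e, mu e - 1) - f (e, 0)) + (\<Sum>e\<in>?S. f (e, mu e - 1) - f (e, 0))"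
  using sum.union_disjoint[of ?C ?S "%e. f (e, mu e - 1) - f (e, 0)"] finE ES by simp
 finally show ?thesis by (simp add: sum_subtractf)
qed

lemma mset_concat_map: "mset (concat (map f xs)) = (\<Sum>x\<in>#mset xs. mset (f x))"
 by (induction xs) auto
lemma sum_list_mset: "sum_list (map g xs) = (\<Sum>x\<in>#mset xs. g x)"
 by (induction xs) auto

text \<open>Each piece is a Koszul block by \<open>U_quot_eq\<close>, the tensor product
  concatenates the blocks, and \<open>koszul_transfer\<close> replaces symmetric polynomials by
  variables. Two marks on every edge ensure that the incoming and outgoing alphabets of a piece are
  disjoint, as \<open>U_quot_eq\<close> requires.\<close>

lemma C_N_koszul:
 fixes N :: nat and G :: "'e plane_graph" and nu :: "'e \<times> nat => 'm" and qs :: "(('e \<times> nat) set \<times> ('e \<times> nat) set) list"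
 assumes G: "net G" and mu: "marking G mu" and qs: "distinct qs" "set qs = pieces G mu" and nu: "inj_on nu (marks G mu)"
  and el: "distinct el" "set el = edges G" and vl: "distinct vl" "set vl = verts G"
 defines "M \<equiv> C_N N G qs" and "n \<equiv> int (Suc N)"
 shows "cplx n (component M) (diffl M)" "finite (gens M)"
  "heq n (component M) (diffl M)
   (shf False (\<Sum>p\<leftarrow>cps G el vl mu. psh G p) (Kc n (pvs G mu nu) (rowsG N G nu el vl mu))) (kd (rowsG N G nu el vl mu))"
proof -
 let ?Mk = "marks G mu" and ?V = "pvs G mu nu" and ?\<A> = "alphabet G ` marks G mu"
 have mu1: "\<forall>e\<in>edges G. 1 <= mu e" and mu2: "\<forall>e\<in>edges G. 2 <= mu e" using mu by (auto simp: marking_def)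
 have finE: "finite (edges G)" using G by (auto simp: net_def)
 note pp = piece_props[OF G mu1]
 define al where "al = (%v :: 'm \<times> nat. alphabet G (the_inv_into ?Mk nu (fst v)))"
 have al: "al (nu s, j) = alphabet G s" if "s \<in> ?Mk" for s j
  using the_inv_into_f_f[OF nu that] by (simp add: al_def)
 have finA: "finite (\<Union>?\<A>)" using finite_marks[OF finE] by auto
 obtain \<iota> :: "'e \<times> nat \<times> nat => nat" where \<iota>: "inj_on \<iota> (\<Union>?\<A>)" using finite_imp_inj_to_nat_seg[OF finA] by blast
 have A: "alphabets ?V al snd ?\<A> \<iota>"
 proof
  show "finite ?\<A>" using finite_marks[OF finE] by simp
  show "finite A" if "A \<in> ?\<A>" for A using that by auto
  show "pairwise disjnt ?\<A>"
  proof (rule pairwiseI)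
   fix A B assume "A \<in> ?\<A>" "B \<in> ?\<A>" "A ~= B"
   then obtain s t where "A = alphabet G s" "B = alphabet G t" "s ~= t" by auto
   then show "disjnt A B" using alphabet_disjoint by (simp add: disjnt_def)
  qed
  show "bij_betw (%v. (al v, snd v)) ?V {(A, j). A \<in> ?\<A> & 1 <= j & j <= card A}"
   unfolding bij_betw_def
  proof
   show "inj_on (%v. (al v, snd v)) ?V"
   proof (rule inj_onI)
    fix v w assume v: "v \<in> ?V" and w: "w \<in> ?V" and eq: "(al v, snd v) = (al w, snd w)"
    obtain s j where s: "v = (nu s, j)" "s \<in> ?Mk" "1 <= j" "j <= col G s" using v by (auto simp: pvs_def)
    obtain t i where t: "w = (nu t, i)" "t \<in> ?Mk" using w by (auto simp: pvs_def)
    have "alphabet G s = alphabet G t" using eq al s t by simp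
    moreover have "alphabet G s ~= {}" using s card_alphabet[of G s] by fastforce
    ultimately have "s = t" using alphabet_disjoint[of s t G] by auto
    then show "v = w" using s t eq by simp
   qed
   show "(%v. (al v, snd v)) ` ?V = {(A, j). A \<in> ?\<A> & 1 <= j & j <= card A}"
   proof (intro set_eqI iffI)
    fix x assume "x \<in> (%v. (al v, snd v)) ` ?V"
    then show "x \<in> {(A, j). A \<in> ?\<A> & 1 <= j & j <= card A}" by (auto simp: pvs_def al)
   next
    fix x assume "x \<in> {(A, j). A \<in> ?\<A> & 1 <= j & j <= card A}"
    then obtain s j where x: "x = (alphabet G s, j)" "s \<in> ?Mk" "1 <= j" "j <= col G s" by auto
    have "x = (%v. (al v, snd v)) (nu s, j)" using x al by simp
    moreover have "(nu s, j) \<in> ?V" using x by (auto simp: pvs_def)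
    ultimately show "x \<in> (%v. (al v, snd v)) ` ?V" by (rule image_eqI)
   qed
  qed
 qed (rule \<iota>)
 interpret alphabets ?V al snd ?\<A> \<iota> by (rule A)
 have es: "fmap ev (ser (nu s) (col G s)) = eser (alphabet G s)" if "s \<in> ?Mk" for s
  by (rule fps_ext) (auto simp: cf_ser ev_def e_def esym_0 esym_gt al[OF that])
 have ep: "fmap ev (\<Prod>s\<in>S. ser (nu s) (col G s)) = eser (\<Union>s\<in>S. alphabet G s)" if S: "S <= ?Mk" "finite S" for S
 proof -
  have "fmap ev (\<Prod>s\<in>S. ser (nu s) (col G s)) = (\<Prod>s\<in>S. eser (alphabet G s))"
   using S es unfolding ev_def fmap_prod by (intro prod.cong) (auto simp: ev_def)
  also have "\<dots> = eser (\<Union>s\<in>S. alphabet G s)" using S(2) by (intro eser_UNION[symmetric] alphabet_disjoint) simp_all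
  finally show ?thesis .
 qed
 have cardU: "card (\<Union>s\<in>S. alphabet G s) = (\<Sum>s\<in>S. col G s)" if "finite S" for S
 proof -
  have "card (\<Union>s\<in>S. alphabet G s) = (\<Sum>s\<in>S. card (alphabet G s))"
   by (rule card_UN_disjoint[OF that]) (simp_all add: alphabet_disjoint)
  then show ?thesis by simp
 qed
 have kl: "koszul_like (int N + 1) (map (mrow ev) (pblk N G nu p)) (psh G p) (piece_factorization N G p)" if p: "p \<in> set qs" for p
 proof -
  have p': "p \<in> pieces G mu" using p qs by simp
  let ?X = "\<Union>s\<in>snd p. alphabet G s" and ?Y = "\<Union>s\<in>fst p. alphabet G s" and ?m = "\<Sum>s\<in>snd p. col G s"
  let ?fs = "map (%j. (U_quot N ?X ?Y j, 2 * int N + 2 - 2 * int j, esym j ?X - esym j ?Y)) [1..<Suc (card ?X)]"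
  have cX: "card ?X = ?m" "card ?Y = ?m" using cardU pp(3,4)[OF p'] pp(5)[OF p'] by simp_all
  have fin: "finite ?X" "finite ?Y" using pp(3,4)[OF p'] by auto
  have dis: "?X \<inter> ?Y = {}"
  proof -
   have "alphabet G s \<inter> alphabet G t = {}" if "s \<in> snd p" "t \<in> fst p" for s t
    using pp(6)[OF p' mu2] that by (intro alphabet_disjoint) auto
   then show ?thesis by blast
  qed
  have "piece_factorization N G p = qshift (psh G p) (koszul N (alphabet G ` (snd p \<union> fst p)) ?fs)"
   by (cases p) (simp add: piece_factorization_def psh_def Let_def)
  moreover have "map (%(a, da, b). (a, b, 2 * int N + 2 - da)) ?fs = map (mrow ev) (pblk N G nu p)"
  proof -
   have "map (mrow ev) (pblk N G nu p) = blk N ?m (eser ?X) (eser ?Y)"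
    unfolding pblk_def using ep[OF pp(1)[OF p'] pp(3)[OF p']] ep[OF pp(2)[OF p'] pp(4)[OF p']]
    by (simp add: ev_def map_blk)
   also have "\<dots> = map (%(a, da, b). (a, b, 2 * int N + 2 - da)) ?fs"
    unfolding blk_def cX(1) map_map using U_quot_eq[OF fin cX dis, of _ N]
    by (intro map_cong refl) (simp add: less_Suc_eq_le del: upt_Suc)
   finally show ?thesis by simp
  qed
  ultimately show ?thesis
   using koszul_like_qshift[OF koszul_like_koszul[of N ?fs "alphabet G ` (snd p \<union> fst p)"], of "psh G p"] by simp
 qed
 let ?rs = "concat (map (pblk N G nu) qs)" and ?t = "\<Sum>p\<leftarrow>qs. psh G p" and ?ls = "map (%p. length (map (mrow ev) (pblk N G nu p))) qs"
 have n: "n = int N + 1" by (simp add: n_def)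
 have mk: "multi_koszul n ?ls (map (mrow ev) ?rs) ?t M"
  using multi_koszul_tensor[of qs "int N + 1" "%p. map (mrow ev) (pblk N G nu p)" "psh G" "piece_factorization N G" "{}"] kl
  unfolding M_def C_N_def n map_concat map_map comp_def by blast
 have aM: "alph M = ?\<A>"
 proof -
  have "alph M = (\<Union>p\<in>set qs. alph (piece_factorization N G p))"
   unfolding M_def C_N_def alph_foldr_tensor by simp
  also have "\<dots> = (\<Union>p\<in>pieces G mu. alphabet G ` (snd p \<union> fst p))"
   unfolding qs(2) by (intro SUP_cong refl) (auto simp: piece_factorization_def Let_def qshift_def alph_koszul split: prod.split)
  also have "\<dots> = ?\<A>"
  proof
   show "(\<Union>p\<in>pieces G mu. alphabet G ` (snd p \<union> fst p)) <= ?\<A>" using pp(1,2) by blast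
   show "?\<A> <= (\<Union>p\<in>pieces G mu. alphabet G ` (snd p \<union> fst p))"
   proof
    fix A assume "A \<in> ?\<A>"
    then obtain e i where A: "A = alphabet G (e, i)" "e \<in> edges G" "i < mu e" by (auto simp: marks_def)
    have "Suc 0 < mu e" using mu2 A(2) by force
    \<comment> \<open>An arc with \<open>(e, i)\<close> as an end. Natural subtraction yields the
      first arc of the edge for \<open>i = 0\<close> and the arc that ends at \<open>i\<close>
      otherwise.\<close>
    then have "({(e, i - 1)}, {(e, Suc (i - 1))}) \<in> pieces G mu"
     using A(2,3) unfolding pieces_def by (cases i) auto
    moreover have "(e, i) \<in> {(e, Suc (i - 1))} \<union> {(e, i - 1)}" by (cases i) auto
    ultimately show "A \<in> (\<Union>p\<in>pieces G mu. alphabet G ` (snd p \<union> fst p))"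
     unfolding A(1) by (intro UN_I[of "({(e, i - 1)}, {(e, Suc (i - 1))})"]) auto
   qed
  qed
  finally show ?thesis .
 qed
 have ms: "mset qs = mset (cps G el vl mu)"
  using qs distinct_cps[OF G el vl, of mu] set_cps[OF el(2) vl(2), of mu]
  by (simp add: set_eq_iff_mset_eq_distinct[symmetric])
 have ok: "\<forall>r\<in>set ?rs. row_ok n ?V r"
 proof
  fix r assume "r \<in> set ?rs"
  then obtain p where p: "p \<in> pieces G mu" "r \<in> set (pblk N G nu p)" unfolding set_concat set_map qs(2) by blast
  show "row_ok n ?V r" unfolding n_def by (rule bspec[OF pblk_row_ok[OF G mu1 p(1)] p(2)])
 qed
 have msr: "mset ?rs = mset (rowsG N G nu el vl mu)"
  unfolding rowsG_cps[symmetric] mset_concat_map ms ..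
 have p0: "pot ?rs = 0" using pot_mset[OF msr] pot_rowsG[OF G el vl] by (rule trans)
 note kt = koszul_transfer[OF A mk aM ok p0]
 show M1: "cplx n (component M) (diffl M)" "finite (gens M)" by (rule kt(1), rule kt(3))
 have pk: "pkeq n False 0 ?V ?rs ?V (rowsG N G nu el vl mu)" by (rule req_pkeq[OF req_perm[OF msr] ok p0])
 note pd = pkeqD[OF pk]
 have t: "?t = (\<Sum>p\<leftarrow>cps G el vl mu. psh G p)"
  unfolding sum_list_mset ms ..
 show "heq n (component M) (diffl M) (shf False (\<Sum>p\<leftarrow>cps G el vl mu. psh G p) (Kc n ?V (rowsG N G nu el vl mu))) (kd (rowsG N G nu el vl mu))"
  unfolding t[symmetric]
 proof (rule heq_trans[OF M1(1) _ _ kt(2)])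
  show "cplx n (shf False ?t (Kc n ?V ?rs)) (kd ?rs)" by (rule cplx_shf[OF cplx_Kc[OF ok p0]])
  show "cplx n (shf False ?t (Kc n ?V (rowsG N G nu el vl mu))) (kd (rowsG N G nu el vl mu))"
   by (rule cplx_shf[OF cplx_Kc[OF pd(2,4)]])
  show "heq n (shf False ?t (Kc n ?V ?rs)) (kd ?rs) (shf False ?t (Kc n ?V (rowsG N G nu el vl mu))) (kd (rowsG N G nu el vl mu))"
   using heq_shf[OF pd(5), of False ?t] by simp
 qed
qed

lemma mset_concat_split:
 assumes "distinct xs" "e \<in> set xs" "!!x. B x = A x @ (if x = e then b else [])"
 shows "mset (concat (map B xs)) = mset b + mset (concat (map A xs))"
 using assms(1,2)
proof (induction xs)
 case (Cons a xs)
 show ?case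
 proof (cases "a = e")
  case True
  then have m: "map B xs = map A xs" using Cons.prems by (intro map_cong refl) (auto simp: assms(3))
  have "B a = A a @ b" using True assms(3)[of a] by simp
  then show ?thesis unfolding list.map concat.simps m by simp
 next
  case False
  then show ?thesis using Cons by (simp add: assms(3))
 qed
qed simp

lemma in_out_subset: "in_edges G v <= edges G" "out_edges G v <= edges G"
 by (auto simp: in_edges_def out_edges_def)

lemma map_mrow_concat: "map (mrow (subst s)) (concat (map f xs)) = concat (map (%x. map (mrow (subst s)) (f x)) xs)"
 by (simp add: map_concat comp_def)

text \<open>The last mark of \<open>e0\<close> is the outgoing end of an arc, whose block expresses
  its variables through those of the mark before; the end of the edge is thereby moved to that mark.
  Rows still make sense with one mark on an edge, although the alphabets at the two ends of a circle
  then coincide.\<close>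

lemma reduce_mark:
 fixes nu :: "'e \<times> nat => 'm"
 assumes G: "net G" and el: "distinct el" "set el = edges G" and vl: "distinct vl" "set vl = verts G"
  and mu: "\<forall>e\<in>edges G. 1 <= mu e" and nu: "inj_on nu (marks G mu)" and e0: "e0 \<in> edges G" "mu e0 = Suc (Suc k)"
 defines "mu' \<equiv> mu(e0 := Suc k)"
 shows "pke (int (Suc N)) 0 (pvs G mu nu) (rowsG N G nu el vl mu) (pvs G mu' nu) (rowsG N G nu el vl mu')"
proof -
 let ?n = "int (Suc N)" and ?y = "nu (e0, Suc k)" and ?c = "color G e0"
 let ?M = "ser (nu (e0, k)) ?c" and ?W = "pvs G mu' nu"
 let ?bl = "blk N ?c (ser ?y ?c) ?M"
 let ?rest = "concat (map (arcs N G nu mu') el) @ ends N G (%e. nu (e, 0)) (%e. nu (e, mu e - 1)) el vl"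
 have mk: "marks G mu = insert (e0, Suc k) (marks G mu')" "(e0, Suc k) \<notin> marks G mu'"
  using e0 by (auto simp: marks_def mu'_def split: if_splits)
 have y: "nu t = ?y \<longleftrightarrow> t = (e0, Suc k)" if "t \<in> marks G mu" for t
  using inj_on_eq_iff[OF nu that, of "(e0, Suc k)"] mk(1) by simp
 have V: "pvs G mu nu = ?W \<union> {?y} \<times> {1..?c}" unfolding pvs_def mk(1) by auto
 have yW: "(?y, i) \<notin> ?W" for i
 proof
  assume "(?y, i) \<in> ?W"
  then obtain t where t: "t \<in> marks G mu'" "nu t = ?y" by (auto simp: pvs_def)
  then show False using y[of t] mk by auto
 qed
 define s where "s x = (if fst x = ?y then Var (nu (e0, k), snd x) else Var x)" for x :: "'m \<times> nat"
 have fs: "fmap (subst s) (ser (nu t) c) = ser (if t = (e0, Suc k) then nu (e0, k) else nu t) c" if "t \<in> marks G mu" for t c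
  by (rule fps_ext) (auto simp: cf_ser s_def y[OF that])
 have m1: "(e, 0) \<in> marks G mu" "(e, mu e - 1) \<in> marks G mu" if "e \<in> edges G" for e
  using mu that by (auto simp: marks_def Suc_le_eq)
 have f0: "fmap (subst s) (ser (nu (e, 0)) c) = ser (nu (e, 0)) c" if "e \<in> edges G" for e c
  using fs[OF m1(1)[OF that], of c] by simp
 have f1: "fmap (subst s) (ser (nu (e, mu e - 1)) c) = ser (nu (e, mu' e - 1)) c" if "e \<in> edges G" for e c
  using fs[OF m1(2)[OF that], of c] e0(2) by (auto simp: mu'_def)
 have ma: "map (mrow (subst s)) (arcs N G nu mu' e) = arcs N G nu mu' e" if e: "e \<in> edges G" for e
 proof -
  have f: "fmap (subst s) (ser (nu (e, i)) c) = ser (nu (e, i)) c" "fmap (subst s) (ser (nu (e, Suc i)) c) = ser (nu (e, Suc i)) c"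
   if "i \<in> set [0..<mu' e - 1]" for i c
  proof -
   have "(e, i) \<in> marks G mu" "(e, Suc i) \<in> marks G mu" "(e, i) ~= (e0, Suc k)" "(e, Suc i) ~= (e0, Suc k)"
    using that e e0(2) by (auto simp: marks_def mu'_def split: if_splits)
   then show "fmap (subst s) (ser (nu (e, i)) c) = ser (nu (e, i)) c" "fmap (subst s) (ser (nu (e, Suc i)) c) = ser (nu (e, Suc i)) c"
    by (simp_all only: fs if_False)
  qed
  show ?thesis unfolding arcs_def map_mrow_concat
   by (intro arg_cong[of _ _ concat] map_cong refl) (simp only: map_blk f)
 qed
 have me: "map (mrow (subst s)) (ends N G (%e. nu (e, 0)) (%e. nu (e, mu e - 1)) el vl) = ends N G (%e. nu (e, 0)) (%e. nu (e, mu' e - 1)) el vl"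
 proof -
  have "map (mrow (subst s)) (blk N c (\<Prod>e\<in>A. ser (nu (e, 0)) (color G e)) (\<Prod>e\<in>B. ser (nu (e, mu e - 1)) (color G e))) =
   blk N c (\<Prod>e\<in>A. ser (nu (e, 0)) (color G e)) (\<Prod>e\<in>B. ser (nu (e, mu' e - 1)) (color G e))" if "A <= edges G" "B <= edges G" for A B c
  proof -
   have "(\<Prod>e\<in>A. fmap (subst s) (ser (nu (e, 0)) (color G e))) = (\<Prod>e\<in>A. ser (nu (e, 0)) (color G e))"
    using that f0 by (intro prod.cong) auto
   moreover have "(\<Prod>e\<in>B. fmap (subst s) (ser (nu (e, mu e - 1)) (color G e))) = (\<Prod>e\<in>B. ser (nu (e, mu' e - 1)) (color G e))"
    using that f1 by (intro prod.cong) auto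
   ultimately show ?thesis unfolding map_blk fmap_prod by (simp only:)
  qed
  note v = this[OF in_out_subset(2,1)]
  have c: "map (mrow (subst s)) (blk N (color G e) (ser (nu (e, 0)) (color G e)) (ser (nu (e, mu e - 1)) (color G e))) =
   blk N (color G e) (ser (nu (e, 0)) (color G e)) (ser (nu (e, mu' e - 1)) (color G e))" if "e \<in> set (filter (is_circle G) el)" for e
  proof -
   have "e \<in> edges G" using that el(2) by auto
   then show ?thesis unfolding map_blk by (simp only: f0 f1)
  qed
  show ?thesis unfolding ends_def map_append map_mrow_concat v using c
   by (intro arg_cong2[of _ _ _ _ append] arg_cong[of _ _ concat] map_cong refl)
 qed
 have mr: "map (mrow (subst s)) ?rest = rowsG N G nu el vl mu'"
 proof -
  have "map (%e. map (mrow (subst s)) (arcs N G nu mu' e)) el = map (arcs N G nu mu') el"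
   using ma el(2) by (intro map_cong refl) simp
  then show ?thesis unfolding rowsG_def map_append map_mrow_concat me by (simp only:)
 qed
 have ms: "mset (rowsG N G nu el vl mu) = mset (?bl @ ?rest)"
 proof -
  have "arcs N G nu mu e = arcs N G nu mu' e @ (if e = e0 then ?bl else [])" for e
   by (simp add: arcs_def mu'_def e0(2))
  from mset_concat_split[of el e0 "arcs N G nu mu" "arcs N G nu mu'" ?bl, OF el(1) _ this] show ?thesis
   using e0(1) el(2) by (simp add: rowsG_def add.assoc)
 qed
 have rok: "\<forall>r\<in>set (rowsG N G nu el vl mu). row_ok ?n (pvs G mu nu) r" by (rule rowsG_ok[OF G mu el(2) vl(2)])
 have p0: "pot (rowsG N G nu el vl mu) = 0" by (rule pot_rowsG[OF G el vl])
 have 1: "pke ?n 0 (pvs G mu nu) (rowsG N G nu el vl mu) (pvs G mu nu) (?bl @ ?rest)" by (rule pke_perm[OF ms rok p0])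
 note d = pkeD[OF 1]
 have "pkeq ?n False 0 (?W \<union> {?y} \<times> {1..?c}) (?bl @ ?rest) ?W (map (mrow (subst s)) ?rest)"
 proof (rule pkeq_blk_elim[OF _ yW _ disjI1[OF refl] d(4)])
  have "(e0, k) \<in> marks G mu'" using e0(1) by (simp add: marks_def mu'_def)
  then show "gser ?W ?M" by (intro gser_ser) (auto simp: pvs_def)
  show "\<forall>r\<in>set ?rest. row_ok ?n (?W \<union> {?y} \<times> {1..?c}) r" using d(2) unfolding V by simp
  show "s (?y, i) = cf ?M i" if "1 <= i" "i <= ?c" for i using that by (simp add: s_def cf_ser)
  show "s x = Var x" if "x \<in> ?W" for x using that yW by (cases x) (auto simp: s_def)
 qed
 from pke_trans[OF 1 pkeI[OF this, folded V, unfolded mr]] show ?thesis by simp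
qed

lemma rowsG_cong:
 assumes el: "set el = edges G" and "!!e. e \<in> edges G ==> mu e = mu' e"
 shows "rowsG N G nu el vl mu = rowsG N G nu el vl mu'" "pvs G mu nu = pvs G mu' nu"
proof -
 have a: "map (arcs N G nu mu) el = map (arcs N G nu mu') el"
  using assms by (intro map_cong refl) (simp add: arcs_def)
 have "(\<Prod>e\<in>in_edges G v. ser (nu (e, mu e - 1)) (color G e)) = (\<Prod>e\<in>in_edges G v. ser (nu (e, mu' e - 1)) (color G e))" for v
  using assms(2) in_out_subset(1)[of G v] by (intro prod.cong refl) auto
 moreover have "map (%e. blk N (color G e) (ser (nu (e, 0)) (color G e)) (ser (nu (e, mu e - 1)) (color G e))) (filter (is_circle G) el) =
   map (%e. blk N (color G e) (ser (nu (e, 0)) (color G e)) (ser (nu (e, mu' e - 1)) (color G e))) (filter (is_circle G) el)"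
  using assms by (intro map_cong refl) auto
 ultimately show "rowsG N G nu el vl mu = rowsG N G nu el vl mu'" unfolding rowsG_def a ends_def by (simp only:)
 have "marks G mu = marks G mu'" using assms(2) by (auto simp: marks_def)
 then show "pvs G mu nu = pvs G mu' nu" by (simp add: pvs_def)
qed

lemma reduce_marks:
 fixes nu :: "'e \<times> nat => 'm"
 assumes G: "net G" and el: "distinct el" "set el = edges G" and vl: "distinct vl" "set vl = verts G"
  and "\<forall>e\<in>edges G. 1 <= mu0 e & mu0 e <= mu e" and "inj_on nu (marks G mu)"
 shows "pke (int (Suc N)) 0 (pvs G mu nu) (rowsG N G nu el vl mu) (pvs G mu0 nu) (rowsG N G nu el vl mu0)"
 using assms(6,7)
proof (induction "\<Sum>e\<in>edges G. mu e - mu0 e" arbitrary: mu rule: less_induct)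
 case less
 note h = less.prems
 have mu: "\<forall>e\<in>edges G. 1 <= mu e" using h(1) by fastforce
 show ?case
 proof (cases "\<forall>e\<in>edges G. mu e = mu0 e")
  case True
  then have "rowsG N G nu el vl mu = rowsG N G nu el vl mu0" "pvs G mu nu = pvs G mu0 nu"
   using rowsG_cong[OF el(2), of mu mu0] by blast+
  then show ?thesis
   using pke_refl[OF rowsG_ok[OF G mu el(2) vl(2), of N nu] pot_rowsG[OF G el vl, of N nu mu]] by simp
 next
  case False
  then obtain e0 where e0: "e0 \<in> edges G" "mu e0 ~= mu0 e0" by blast
  then have lt: "mu0 e0 < mu e0" "1 <= mu0 e0" using h(1) by fastforce+
  define k where "k = mu e0 - 2"
  have k: "mu e0 = Suc (Suc k)" using lt by (simp add: k_def)
  let ?mu = "mu(e0 := Suc k)"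
  have "(\<Sum>e\<in>edges G. ?mu e - mu0 e) < (\<Sum>e\<in>edges G. mu e - mu0 e)"
  proof (rule sum_strict_mono_ex1)
   show "finite (edges G)" using G by (simp add: net_def)
   show "\<forall>e\<in>edges G. ?mu e - mu0 e <= mu e - mu0 e" using k by auto
   show "\<exists>e\<in>edges G. ?mu e - mu0 e < mu e - mu0 e" using e0(1) k lt by (intro bexI[of _ e0]) auto
  qed
  moreover have "\<forall>e\<in>edges G. 1 <= mu0 e & mu0 e <= ?mu e" using h(1) lt k by auto
  moreover have "marks G ?mu <= marks G mu" using k by (auto simp: marks_def split: if_splits)
  then have "inj_on nu (marks G ?mu)" using h(2) inj_on_subset by blast
  ultimately have "pke (int (Suc N)) 0 (pvs G ?mu nu) (rowsG N G nu el vl ?mu) (pvs G mu0 nu) (rowsG N G nu el vl mu0)"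
   by (rule less.hyps)
  from pke_trans[OF reduce_mark[OF G el vl mu h(2) e0(1) k] this] show ?thesis by simp
 qed
qed

section \<open>The circuit\<close>

lemma traverse_ends:
 "cs ~= [] ==> pathstart (traverse cs) = pathstart (hd cs) & pathfinish (traverse cs) = pathfinish (last cs)"
 by (induction cs rule: traverse.induct) auto

text \<open>Induction along the concatenation: an arc splits into a first arc and a remaining one
  that meet only where they are joined, so the first starting point cannot recur.\<close>

lemma arc_traverse:
 assumes "cs ~= []" "\<forall>i. Suc i < length cs --> pathfinish (cs ! i) = pathstart (cs ! Suc i)" "arc (traverse cs)"
 shows "distinct (map pathstart cs) & pathfinish (last cs) \<notin> pathstart ` set cs & (\<forall>c\<in>set cs. arc c) &
  pathstart ` set cs <= path_image (traverse cs)"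
 using assms
proof (induction cs rule: traverse.induct)
 case (2 p)
 then show ?case using arc_distinct_ends[of p] by auto
next
 case (3 p q cs)
 have pq: "pathfinish p = pathstart (traverse (q # cs))"
  using 3(3)[rule_format, of 0] traverse_ends[of "q # cs"] by simp
 have a: "arc p" "arc (traverse (q # cs))" "path_image p \<inter> path_image (traverse (q # cs)) <= {pathstart (traverse (q # cs))}"
  using 3(4) arc_join_eq[OF pq] by auto
 have "\<forall>i. Suc i < length (q # cs) --> pathfinish ((q # cs) ! i) = pathstart ((q # cs) ! Suc i)"
  using 3(3)[rule_format, of "Suc _"] by auto
 from 3(1)[OF _ this a(2)]
 have IH: "distinct (map pathstart (q # cs))" "pathfinish (last (q # cs)) \<notin> pathstart ` set (q # cs)"
  "\<forall>c\<in>set (q # cs). arc c" "pathstart ` set (q # cs) <= path_image (traverse (q # cs))" by auto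
 have np: "pathstart p \<notin> path_image (traverse (q # cs))"
 proof
  assume "pathstart p \<in> path_image (traverse (q # cs))"
  then have "pathstart p = pathfinish p" using a(3) pq pathstart_in_path_image[of p] by auto
  then show False using arc_distinct_ends[OF a(1)] by simp
 qed
 have im: "path_image (traverse (p # q # cs)) = path_image p \<union> path_image (traverse (q # cs))"
  by (simp add: path_image_join[OF pq])
 have fin: "pathfinish (last (q # cs)) \<in> path_image (traverse (q # cs))"
  using traverse_ends[of "q # cs"] pathfinish_in_path_image[of "traverse (q # cs)"] by simp
 have "distinct (map pathstart (p # q # cs))" using IH(1,4) np by auto
 moreover have "pathfinish (last (p # q # cs)) \<notin> pathstart ` set (p # q # cs)" using IH(2) fin np by auto
 moreover have "\<forall>c\<in>set (p # q # cs). arc c" using IH(3) a(1) by simp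
 moreover have "pathstart ` set (p # q # cs) <= path_image (traverse (p # q # cs))"
  unfolding im using IH(4) pathstart_in_path_image[of p] by auto
 ultimately show ?case by blast
qed simp

text \<open>A closed simple path with at least two pieces splits into two arcs, the first piece and
  the rest, to which \<open>arc_traverse\<close> applies. A circuit with one edge is treated apart,
  since that edge is a closed curve.\<close>

lemma simple_circuit_edges:
 assumes "simple_circuit G D"
 obtains es where "es ~= []" "distinct es" "set es = D" "D <= edges G"
  "!!i. i < length es ==> pathfinish (curve G (es ! i)) = pathstart (curve G (es ! (Suc i mod length es)))"
  "distinct (map (%e. pathstart (curve G e)) es)" "1 < length es ==> \<forall>e\<in>D. arc (curve G e)"
proof -
 obtain es where es: "es ~= []" "distinct es" "set es = D" "D <= edges G"
  "\<forall>i. Suc i < length es --> pathfinish (curve G (es ! i)) = pathstart (curve G (es ! Suc i))"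
  "simple_path (traverse (map (curve G) es))"
  "pathfinish (traverse (map (curve G) es)) = pathstart (traverse (map (curve G) es))"
  using assms unfolding simple_circuit_def by blast
 let ?c = "curve G"
 have closed: "pathfinish (?c (last es)) = pathstart (?c (hd es))"
  using es(7) traverse_ends[of "map ?c es"] es(1) by (simp add: last_map hd_map)
 have next': "pathfinish (?c (es ! i)) = pathstart (?c (es ! (Suc i mod length es)))" if "i < length es" for i
 proof (cases "Suc i < length es")
  case True
  then show ?thesis using es(5) by simp
 next
  case False
  then have "Suc i = length es" using that by simp
  then have "Suc i mod length es = 0" "i = length es - 1" by auto
  then show ?thesis using closed es(1) by (simp add: last_conv_nth hd_conv_nth)
 qed
 have "distinct (map (%e. pathstart (?c e)) es) & (1 < length es --> (\<forall>e\<in>D. arc (?c e)))"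
 proof (cases es)
  case (Cons a es')
  show ?thesis
  proof (cases es')
   case Nil
   then show ?thesis using Cons by simp
  next
   case (Cons b es'')
   let ?q = "traverse (map ?c es')"
   have E: "es = a # es'" "es' ~= []" using \<open>es = a # es'\<close> Cons by auto
   have t: "traverse (map ?c es) = ?c a +++ ?q" using E Cons by simp
   have aq: "pathfinish (?c a) = pathstart ?q"
    using es(5)[rule_format, of 0] traverse_ends[of "map ?c es'"] E by (simp add: hd_map hd_conv_nth)
   obtain A: "arc (?c a)" "arc ?q" using simple_path_joinE[OF es(6)[unfolded t] aq] by blast
   have "\<forall>i. Suc i < length (map ?c es') --> pathfinish (map ?c es' ! i) = pathstart (map ?c es' ! Suc i)"
    using es(5)[rule_format, of "Suc _"] E by auto
   from arc_traverse[OF _ this A(2)] E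
   have q: "distinct (map pathstart (map ?c es'))" "pathfinish (last (map ?c es')) \<notin> pathstart ` set (map ?c es')"
    "\<forall>c\<in>set (map ?c es'). arc c" by auto
   have "pathstart (?c a) \<notin> pathstart ` set (map ?c es')"
    using q(2) closed E by (simp add: last_map)
   then show ?thesis using q A(1) es(3) E by (auto simp: comp_def)
  qed
 qed (use es in simp)
 then show ?thesis using that[OF es(1-4) next'] by blast
qed

lemma reverse_circuit_simps:
 "verts (reverse_circuit N D G) = verts G" "edges (reverse_circuit N D G) = edges G"
 "color (reverse_circuit N D G) e = (if e \<in> D then N - color G e else color G e)"
 "is_circle (reverse_circuit N D G) e = is_circle G e"
 "in_edges (reverse_circuit N D G) v = (in_edges G v - D) \<union> (out_edges G v \<inter> D)"
 "out_edges (reverse_circuit N D G) v = (out_edges G v - D) \<union> (in_edges G v \<inter> D)"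
proof -
 show ic: "is_circle (reverse_circuit N D G) e = is_circle G e" for e
  by (simp add: is_circle_def reverse_circuit_def)
 show "verts (reverse_circuit N D G) = verts G" "edges (reverse_circuit N D G) = edges G"
  "color (reverse_circuit N D G) e = (if e \<in> D then N - color G e else color G e)"
  by (simp_all add: reverse_circuit_def)
 show "in_edges (reverse_circuit N D G) v = (in_edges G v - D) \<union> (out_edges G v \<inter> D)"
  "out_edges (reverse_circuit N D G) v = (out_edges G v - D) \<union> (in_edges G v \<inter> D)"
  unfolding in_edges_def out_edges_def ic by (auto simp: reverse_circuit_def)
qed

lemma net_moy_graph:
 assumes "moy_graph G"
 shows "net G"
 unfolding net_def
proof (intro conjI ballI impI)
 show "finite (verts G)" "finite (edges G)" using assms by (simp_all add: moy_graph_def)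
 fix e assume e: "e \<in> edges G" "~ is_circle G e"
 have "path_image (curve G e) \<inter> verts G = {pathstart (curve G e), pathfinish (curve G e)}"
  using assms e unfolding moy_graph_def by auto
 then show "pathstart (curve G e) \<in> verts G" "pathfinish (curve G e) \<in> verts G" by auto
next
 fix v assume v: "v \<in> verts G"
 have "card (in_edges G v) = 2 & card (out_edges G v) = 1 \<or> card (in_edges G v) = 1 & card (out_edges G v) = 2"
  "(\<Sum>e\<in>in_edges G v. color G e) = (\<Sum>e\<in>out_edges G v. color G e)"
  using assms v unfolding moy_graph_def by auto
 then show "in_edges G v ~= {}" "out_edges G v ~= {}" "(\<Sum>e\<in>in_edges G v. color G e) = (\<Sum>e\<in>out_edges G v. color G e)"
  by auto
qed

text \<open>On the circuit, with circuit edges a entering and b leaving and side sums I and O, the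
  balance I + a = O + b turns into I + (N - b) = O + (N - a). The bound on the colors makes the
  subtractions exact.\<close>

lemma net_reverse_circuit:
 assumes G: "net G" and D: "\<forall>e\<in>D. color G e <= N"
  and v: "!!v. v \<in> verts G ==> (in_edges G v \<inter> D = {} & out_edges G v \<inter> D = {}) \<or>
   (\<exists>a\<in>D. \<exists>b\<in>D. in_edges G v \<inter> D = {a} & out_edges G v \<inter> D = {b})"
 shows "net (reverse_circuit N D G)"
proof -
 let ?G = "reverse_circuit N D G"
 note r = reverse_circuit_simps[of N D G]
 have fin: "finite (in_edges G v)" "finite (out_edges G v)" for v using G finite_in_out by (auto simp: net_def)
 have st: "pathstart (curve ?G e) \<in> verts G & pathfinish (curve ?G e) \<in> verts G" if "e \<in> edges G" "~ is_circle G e" for e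
  using G that by (auto simp: net_def reverse_circuit_def)
 have "in_edges ?G v ~= {} & out_edges ?G v ~= {} & (\<Sum>e\<in>in_edges ?G v. color ?G e) = (\<Sum>e\<in>out_edges ?G v. color ?G e)"
  if vv: "v \<in> verts G" for v
 proof -
  let ?I = "in_edges G v" and ?O = "out_edges G v"
  have ne: "?I ~= {}" "?O ~= {}" and eq: "(\<Sum>e\<in>?I. color G e) = (\<Sum>e\<in>?O. color G e)" using G vv by (auto simp: net_def)
  have sp: "(\<Sum>e\<in>A. color G e) = (\<Sum>e\<in>A - D. color G e) + (\<Sum>e\<in>A \<inter> D. color G e)" if "finite A" for A
   using sum.Int_Diff[OF that, of "color G" D] by simp
  have su: "(\<Sum>e\<in>(A - D) \<union> (B \<inter> D). color ?G e) = (\<Sum>e\<in>A - D. color G e) + (\<Sum>e\<in>B \<inter> D. N - color G e)"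
   if "finite A" "finite B" for A B
  proof -
   have "(\<Sum>e\<in>(A - D) \<union> (B \<inter> D). color ?G e) = (\<Sum>e\<in>A - D. color ?G e) + (\<Sum>e\<in>B \<inter> D. color ?G e)"
    using that by (intro sum.union_disjoint) auto
   then show ?thesis by (simp add: r(3))
  qed
  show ?thesis using v[OF vv]
  proof
   assume h: "?I \<inter> D = {} & ?O \<inter> D = {}"
   then have "?I - D = ?I" "?O - D = ?O" by auto
   then show ?thesis using h ne eq su[OF fin(1) fin(2), of v v] su[OF fin(2) fin(1), of v v] unfolding r(5,6) by simp
  next
   assume "\<exists>a\<in>D. \<exists>b\<in>D. ?I \<inter> D = {a} & ?O \<inter> D = {b}"
   then obtain a b where ab: "a \<in> D" "b \<in> D" "?I \<inter> D = {a}" "?O \<inter> D = {b}" by blast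
   have "(\<Sum>e\<in>?I - D. color G e) + color G a = (\<Sum>e\<in>?O - D. color G e) + color G b"
    using eq sp[OF fin(1)[of v]] sp[OF fin(2)[of v]] ab by simp
   moreover have "color G a <= N" "color G b <= N" using D ab by auto
   ultimately show ?thesis using su[OF fin(1) fin(2), of v v] su[OF fin(2) fin(1), of v v] ab unfolding r(5,6) by auto
  qed
 qed
 then show ?thesis unfolding net_def r(1,2,4) using G st by (simp add: net_def)
qed

text \<open>Only outgoing ends enter the quantum shift of a piece, so the incoming set is left
  empty.\<close>

definition vsh where "vsh G v = psh G ({}, (%e. (e, 0)) ` out_edges G v)"

lemma psh_single: "psh G (A, {s}) = 0"
proof -
 have "B <= {s} ==> card B ~= 2" for B :: "('a \<times> nat) set" using card_mono[of "{s}" B] by auto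
 then have "{B. B <= {s} & card B = 2} = {}" by blast
 then show ?thesis by (simp only: psh_def snd_conv sum.empty)
qed

lemma psh_pair: "s ~= t ==> psh G (A, {s, t}) = - int (col G s * col G t)"
proof -
 assume st: "s ~= t"
 have "B = {s, t}" if "B <= {s, t}" "card B = 2" for B
  by (rule card_subset_eq[OF _ that(1)]) (use that st in auto)
 then have "{B. B <= {s, t} & card B = 2} = {{s, t}}" using st by auto
 then show ?thesis using st by (simp add: psh_def)
qed

lemma vsh_single: "out_edges G v = {a} ==> vsh G v = 0"
 by (simp add: vsh_def psh_single)
lemma vsh_pair: "out_edges G v = {a, b} ==> a ~= b ==> vsh G v = - int (color G a * color G b)"
 by (simp add: vsh_def psh_pair)

lemma sum_psh_cps: "(\<Sum>p\<leftarrow>cps G el vl mu. psh G p) = (\<Sum>v\<leftarrow>vl. vsh G v)"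
proof -
 have "(\<Sum>p\<leftarrow>concat (map (%e. map (%i. ({(e, i)}, {(e, Suc i)})) [0..<mu e - 1]) el). psh G p) = 0"
  by (induction el) (simp_all add: comp_def psh_single)
 moreover have "(\<Sum>p\<leftarrow>map (%e. ({(e, mu e - 1)}, {(e, 0)})) (filter (is_circle G) el). psh G p) = 0"
  by (simp add: comp_def psh_single)
 moreover have "(\<Sum>p\<leftarrow>map (%v. ((%e. (e, mu e - 1)) ` in_edges G v, (%e. (e, 0)) ` out_edges G v)) vl. psh G p) = (\<Sum>v\<leftarrow>vl. vsh G v)"
  unfolding map_map comp_def vsh_def psh_def by simp
 ultimately show ?thesis unfolding cps_def map_append sum_list_append by (simp only: add_0)
qed

text \<open>The flag gives new names to the edges of the reversed circuit, so that old and new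
  alphabets of the same edge can live in one ring, while edges off the circuit keep their
  variables.\<close>

definition tagT :: "'e \<times> nat => bool \<times> 'e \<times> nat" where "tagT = (%(e, i). (True, e, i))"
definition tagD :: "'e set => 'e \<times> nat => bool \<times> 'e \<times> nat" where "tagD D = (%(e, i). (e \<notin> D, e, i))"

lemma tag_simps: "tagT (e, i) = (True, e, i)" "tagD D (e, i) = (e \<notin> D, e, i)"
 by (simp_all add: tagT_def tagD_def)

text \<open>The comparison is made with as few marks as possible: one on each edge of the reversed
  graph, and at most two on edges of \<open>G\<close>, where a circuit edge may need separate
  alphabets at its two ends. The final equation says that the quantum shift \<open>t\<close> is
  absorbed by the shifts at the vertices.\<close>

definition reversal where
 "reversal N G D \<longleftrightarrow> net (reverse_circuit N D G) & (\<exists>el vl mu0 t. distinct el & set el = edges G & distinct vl & set vl = verts G &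
   (\<forall>e. 1 <= mu0 e & mu0 e <= (2 :: nat)) &
   pke (int (Suc N)) t (pvs G mu0 tagT) (rowsG N G tagT el vl mu0)
    (pvs (reverse_circuit N D G) (%_. 1) (tagD D)) (rowsG N (reverse_circuit N D G) (tagD D) el vl (%_. 1)) &
   (\<Sum>v\<leftarrow>vl. vsh G v) + t = (\<Sum>v\<leftarrow>vl. vsh (reverse_circuit N D G) v))"

lemma arcs_1: "mu e = 1 ==> arcs N G nu mu e = []"
 by (simp add: arcs_def)

lemma vsh_cong:
 assumes "out_edges G v = out_edges G' v" "!!e. e \<in> out_edges G v ==> color G e = color G' e"
 shows "vsh G v = vsh G' v"
proof -
 have "(\<Prod>s\<in>B. card (alphabet G s)) = (\<Prod>s\<in>B. card (alphabet G' s))" if "B <= (%e. (e, 0 :: nat)) ` out_edges G v" for B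
  using that assms(2) by (intro prod.cong) auto
 then have "(\<Sum>B | B <= (%e. (e, 0 :: nat)) ` out_edges G v & card B = 2. \<Prod>s\<in>B. card (alphabet G s)) =
   (\<Sum>B | B <= (%e. (e, 0 :: nat)) ` out_edges G v & card B = 2. \<Prod>s\<in>B. card (alphabet G' s))"
  by (intro sum.cong refl) simp
 then show ?thesis unfolding vsh_def psh_def snd_conv assms(1) by (simp only:)
qed

lemma reversal_circle:
 assumes G: "net G" and e0: "e0 \<in> edges G" "is_circle G e0" "color G e0 <= N"
 shows "reversal N G {e0}"
proof -
 let ?D = "{e0}"
 let ?G = "reverse_circuit N ?D G"
 note r = reverse_circuit_simps[of N ?D G]
 have ic: "is_circle ?G = is_circle G" by (rule ext) (rule r(4))
 have nD: "e0 \<notin> in_edges G v" "e0 \<notin> out_edges G v" for v using e0 by (auto simp: in_edges_def out_edges_def)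
 have io: "in_edges ?G v = in_edges G v" "out_edges ?G v = out_edges G v" for v unfolding r using nD[of v] by auto
 have net': "net ?G" by (rule net_reverse_circuit[OF G]) (use e0(3) nD in auto)
 have fin: "finite (edges G)" "finite (verts G)" using G by (auto simp: net_def)
 obtain off where off: "set off = edges G - ?D" "distinct off" using finite_distinct_list[of "edges G - ?D"] fin by auto
 obtain vl where vl: "set vl = verts G" "distinct vl" using finite_distinct_list[OF fin(2)] by auto
 let ?el = "e0 # off" and ?n = "int (Suc N)"
 define X where "X e = ser (True, e, 0 :: nat) (color G e)" for e
 define V where "V = (\<Union>e\<in>edges G - ?D. {(True, e, 0 :: nat)} \<times> {1..color G e})"
 define R where "R = concat (map (%e. blk N (color G e) (X e) (X e)) (filter (is_circle G) off)) @
   concat (map (%v. blk N (\<Sum>e\<in>out_edges G v. color G e) (\<Prod>e\<in>out_edges G v. X e) (\<Prod>e\<in>in_edges G v. X e)) vl)"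
 have R1: "rowsG N G tagT ?el vl (%_. 1) = blk N (color G e0) (ser (True, e0, 0) (color G e0)) (ser (True, e0, 0) (color G e0)) @ R"
  using e0(2) by (simp add: rowsG_def arcs_def ends_def R_def X_def tag_simps)
 have R2: "rowsG N ?G (tagD ?D) ?el vl (%_. 1) = blk N (N - color G e0) (ser (False, e0, 0) (N - color G e0)) (ser (False, e0, 0) (N - color G e0)) @ R"
 proof -
  have c: "color ?G e = color G e" "tagD ?D (e, 0) = (True, e, 0)" if "e ~= e0" for e using that by (simp_all add: r tag_simps)
  have m1: "map (%e. blk N (color ?G e) (ser (tagD ?D (e, 0)) (color ?G e)) (ser (tagD ?D (e, 0)) (color ?G e))) (filter (is_circle G) off) =
    map (%e. blk N (color G e) (X e) (X e)) (filter (is_circle G) off)"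
   using off(1) by (intro map_cong refl) (auto simp: c X_def)
  have s1: "(\<Sum>e\<in>out_edges G v. color ?G e) = (\<Sum>e\<in>out_edges G v. color G e)"
   "(\<Prod>e\<in>out_edges G v. ser (tagD ?D (e, 0)) (color ?G e)) = (\<Prod>e\<in>out_edges G v. X e)"
   "(\<Prod>e\<in>in_edges G v. ser (tagD ?D (e, 0)) (color ?G e)) = (\<Prod>e\<in>in_edges G v. X e)" for v
   using nD[of v] by (auto intro!: sum.cong prod.cong simp: X_def r tag_simps)
  have f1: "filter (is_circle ?G) ?el = e0 # filter (is_circle G) off" using e0(2) unfolding ic by simp
  have a1: "arcs N ?G (tagD ?D) (%_. 1) e = []" for e by (rule arcs_1) (rule refl)
  have a: "concat (map (arcs N ?G (tagD ?D) (%_. 1)) xs) = []" for xs by (induction xs) (simp_all only: list.map concat.simps a1 append_Nil)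
  show ?thesis
   unfolding rowsG_def a unfolding ends_def f1 unfolding list.map concat.simps diff_self_eq_0 m1 io s1 R_def
   by (simp add: r tag_simps)
 qed
 have gX: "gser V (X e)" if "e \<in> edges G - ?D" for e unfolding X_def using that by (intro gser_ser) (auto simp: V_def)
 have okR: "\<forall>x\<in>set R. row_ok ?n V x"
 proof
  fix x assume "x \<in> set R"
  then consider (circle) e where "e \<in> set off" "x \<in> set (blk N (color G e) (X e) (X e))"
   | (vertex) v where "v \<in> set vl" "x \<in> set (blk N (\<Sum>e\<in>out_edges G v. color G e) (\<Prod>e\<in>out_edges G v. X e) (\<Prod>e\<in>in_edges G v. X e))"
   unfolding R_def by auto
  then show "row_ok ?n V x"
  proof cases
   case (circle e)
   then have g: "gser V (X e)" using off(1) by (intro gX) auto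
   show ?thesis by (rule bspec[OF blk_row_ok[OF g g] circle(2)])
  next
   case (vertex v)
   have "in_edges G v <= edges G - ?D" "out_edges G v <= edges G - ?D" using nD[of v] in_out_subset[of G v] by auto
   then have "gser V (\<Prod>e\<in>out_edges G v. X e)" "gser V (\<Prod>e\<in>in_edges G v. X e)" by (auto intro!: gser_prod gX)
   from bspec[OF blk_row_ok[OF this] vertex(2)] show ?thesis by blast
  qed
 qed
 have p0: "pot (blk N (color G e0) (ser (True, e0, 0) (color G e0)) (ser (True, e0, 0) (color G e0)) @ R) = 0"
  unfolding R1[symmetric] using off vl e0(1) by (intro pot_rowsG[OF G]) auto
 have "pke ?n 0 (V \<union> {(True, e0, 0)} \<times> {1..color G e0}) (blk N (color G e0) (ser (True, e0, 0) (color G e0)) (ser (True, e0, 0) (color G e0)) @ R)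
  (V \<union> {(False, e0, 0)} \<times> {1..N - color G e0}) (blk N (N - color G e0) (ser (False, e0, 0) (N - color G e0)) (ser (False, e0, 0) (N - color G e0)) @ R)"
  by (rule circle_pke[OF _ _ _ _ e0(3) okR p0]) (auto simp: V_def)
 note pk0 = this
 have pv: "pvs H (%_. 1) nu = (\<Union>e\<in>edges G - ?D. {nu (e, 0)} \<times> {1..color H e}) \<union> {nu (e0, 0)} \<times> {1..color H e0}"
  if "edges H = edges G" for H :: "'a plane_graph" and nu :: "'a \<times> nat => bool \<times> 'a \<times> nat"
 proof -
  have "marks H (%_. 1) = (%e. (e, 0)) ` (edges G - ?D) \<union> {(e0, 0)}" using e0(1) that by (auto simp: marks_def)
  then show ?thesis by (simp add: pvs_def Un_commute)
 qed
 have "(\<Union>e\<in>edges G - ?D. {tagD ?D (e, 0)} \<times> {1..color ?G e}) = V"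
  unfolding V_def by (rule SUP_cong[OF refl]) (simp add: r tag_simps)
 then have v2: "pvs ?G (%_. 1) (tagD ?D) = V \<union> {(False, e0, 0)} \<times> {1..N - color G e0}"
  using pv[OF r(2), of "tagD ?D"] by (simp only:) (simp add: r tag_simps)
 have v1: "pvs G (%_. 1) tagT = V \<union> {(True, e0, 0)} \<times> {1..color G e0}"
  unfolding pv[OF refl] V_def tag_simps ..
 have "pke ?n 0 (pvs G (%_. 1) tagT) (rowsG N G tagT ?el vl (%_. 1)) (pvs ?G (%_. 1) (tagD ?D)) (rowsG N ?G (tagD ?D) ?el vl (%_. 1))"
  unfolding R1 R2 v1 v2 by (rule pk0)
 moreover have "vsh G = vsh ?G"
 proof (rule ext, rule vsh_cong)
  fix v
  show "out_edges G v = out_edges ?G v" by (simp only: io)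
  show "color G e = color ?G e" if "e \<in> out_edges G v" for e using that nD[of v] by (auto simp: r)
 qed
 moreover have "distinct ?el" "set ?el = edges G" using off e0(1) by auto
 ultimately show ?thesis unfolding reversal_def using net' vl
  by (intro conjI exI[of _ ?el] exI[of _ vl] exI[of _ "%_. 1"] exI[of _ 0]) simp_all
qed

lemma reversal_circuit:
 fixes G :: "'e plane_graph" and es :: "'e list"
 assumes M: "moy_graph G" and Dk: "\<forall>e\<in>D. color G e <= N"
  and es: "es ~= []" "distinct es" "set es = D" "D <= edges G"
   "!!i. i < length es ==> pathfinish (curve G (es ! i)) = pathstart (curve G (es ! (Suc i mod length es)))"
   "distinct (map (%e. pathstart (curve G e)) es)"
  and nc: "\<forall>e\<in>D. ~ is_circle G e"
 shows "reversal N G D"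
proof -
 let ?G = "reverse_circuit N D G" and ?n = "int (Suc N)"
 note r = reverse_circuit_simps[of N D G]
 have ic: "is_circle ?G = is_circle G" by (rule ext) (rule r(4))
 have G: "net G" by (rule net_moy_graph[OF M])
 have fin: "finite (edges G)" "finite (verts G)" using G by (auto simp: net_def)
 note fio = finite_in_out[OF fin(1)]
 define L where "L = length es"
 define nx where "nx i = Suc i mod L" for i
 define E where "E i = es ! (i mod L)" for i
 define w where "w i = pathfinish (curve G (E i))" for i
 define k where "k i = color G (E i)" for i
 have L: "0 < L" using es(1) by (simp add: L_def)
 have nL: "nx i < L" for i using L by (simp add: nx_def)
 have Ees: "E i = es ! i" if "i < L" for i using that by (simp add: E_def)
 have ED: "E i \<in> D" for i using nth_mem[of "i mod L" es] L es(3) by (simp add: E_def L_def)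
 have DE: "\<exists>i<L. e = E i" if eD: "e \<in> D" for e
 proof -
  have "e \<in> set es" using eD es(3) by simp
  then obtain i where "i < L" "es ! i = e" unfolding L_def in_set_conv_nth by blast
  then show ?thesis using Ees[of i] by auto
 qed
 have EE: "E i \<in> edges G" "~ is_circle G (E i)" for i using ED es(4) nc by auto
 have wst: "w i = pathstart (curve G (E (nx i)))" if "i < L" for i
  using es(5)[of i] that Ees[OF that] Ees[OF nL] by (simp add: w_def L_def nx_def)
 have stinj: "i = j" if "i < L" "j < L" "pathstart (curve G (E i)) = pathstart (curve G (E j))" for i j
  using es(6) that nth_eq_iff_index_eq[OF es(6), of i j] Ees by (simp add: L_def)
 have nx_eq: "nx i = (if Suc i = L then 0 else Suc i)" if "i < L" for i using that by (simp add: nx_def)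
 have nxinj: "i = j" if "i < L" "j < L" "nx i = nx j" for i j using that nx_eq by (auto split: if_splits)
 have nxsurj: "\<exists>i<L. j = nx i" if "j < L" for j
 proof (cases j)
  case 0
  then show ?thesis using nx_eq[of "L - 1"] L by (intro exI[of _ "L - 1"]) simp
 next
  case (Suc i)
  then show ?thesis using nx_eq[of i] that by (intro exI[of _ i]) simp
 qed
 have winj: "i = j" if "i < L" "j < L" "w i = w j" for i j
  by (rule nxinj[OF that(1,2) stinj[OF nL nL]]) (simp only: wst[OF that(1), symmetric] wst[OF that(2), symmetric] that(3))
 have Einj: "i = j" if "i < L" "j < L" "E i = E j" for i j by (rule stinj[OF that(1,2)]) (simp only: that(3))
 have inD: "in_edges G (w i) \<inter> D = {E i}" if i: "i < L" for i
 proof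
  show "in_edges G (w i) \<inter> D <= {E i}"
  proof
   fix e assume e: "e \<in> in_edges G (w i) \<inter> D"
   then obtain j where j: "j < L" "e = E j" using DE by blast
   then have "w j = w i" using e by (simp add: in_edges_def w_def)
   then show "e \<in> {E i}" using winj[OF j(1) i] j by simp
  qed
  show "{E i} <= in_edges G (w i) \<inter> D" using EE ED by (simp add: in_edges_def w_def)
 qed
 have outD: "out_edges G (w i) \<inter> D = {E (nx i)}" if i: "i < L" for i
 proof
  show "out_edges G (w i) \<inter> D <= {E (nx i)}"
  proof
   fix e assume e: "e \<in> out_edges G (w i) \<inter> D"
   then obtain j where j: "j < L" "e = E j" using DE by blast
   then have "pathstart (curve G (E j)) = pathstart (curve G (E (nx i)))" using e wst[OF i] by (simp add: out_edges_def)
   then show "e \<in> {E (nx i)}" using stinj[OF j(1) nL] j by simp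
  qed
  show "{E (nx i)} <= out_edges G (w i) \<inter> D" using EE ED wst[OF i] by (simp add: out_edges_def)
 qed
 have off_v: "in_edges G v \<inter> D = {}" "out_edges G v \<inter> D = {}" if v: "v \<notin> w ` {..<L}" for v
 proof -
  show "in_edges G v \<inter> D = {}"
  proof (rule equals0I)
   fix e assume e: "e \<in> in_edges G v \<inter> D"
   then obtain j where "j < L" "e = E j" using DE by blast
   then show False using e v by (auto simp: in_edges_def w_def)
  qed
  show "out_edges G v \<inter> D = {}"
  proof (rule equals0I)
   fix e assume e: "e \<in> out_edges G v \<inter> D"
   then obtain j where j: "j < L" "e = E j" using DE by blast
   obtain i where "i < L" "j = nx i" using nxsurj[OF j(1)] by blast
   then have "w i = v" using e j wst[of i] by (simp add: out_edges_def)
   then show False using v \<open>i < L\<close> by auto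
  qed
 qed
 have wV: "w i \<in> verts G" for i using G EE[of i] by (simp add: net_def w_def)
 have net': "net ?G"
 proof (rule net_reverse_circuit[OF G Dk])
  fix v
  show "(in_edges G v \<inter> D = {} & out_edges G v \<inter> D = {}) \<or> (\<exists>a\<in>D. \<exists>b\<in>D. in_edges G v \<inter> D = {a} & out_edges G v \<inter> D = {b})"
  proof (cases "v \<in> w ` {..<L}")
   case True
   then obtain i where "i < L" "v = w i" by auto
   then show ?thesis using inD[of i] outD[of i] ED by blast
  qed (use off_v in blast)
 qed
 \<comment> \<open>At a vertex on the circuit the side edge either enters (\<open>mg\<close>, a
   merge) or leaves (a split). \<open>S i\<close> is the set of side edges, and trivalence reduces
   everything to the two cases \<open>mrg\<close> and \<open>spl\<close>.\<close>
 define mg where "mg i = (out_edges G (w i) <= D)" for i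
 define S where "S i = (if mg i then in_edges G (w i) - D else out_edges G (w i) - D)" for i
 define c where "c i = (\<Sum>e\<in>S i. color G e)" for i
 have Sp: "finite (S i)" "S i <= edges G - D" for i
  unfolding S_def using fio in_out_subset[of G "w i"] by auto
 define mrg where "mrg i \<longleftrightarrow> mg i & out_edges G (w i) = {E (nx i)} & in_edges G (w i) = insert (E i) (S i) & out_edges G (w i) - D = {} & in_edges G (w i) - D = S i" for i
 define spl where "spl i \<longleftrightarrow> ~ mg i & in_edges G (w i) = {E i} & out_edges G (w i) = insert (E (nx i)) (S i) & in_edges G (w i) - D = {} & out_edges G (w i) - D = S i & (\<exists>b. S i = {b})" for i
 have cs: "mrg i \<or> spl i" if i: "i < L" for i
 proof -
  let ?I = "in_edges G (w i)" and ?O = "out_edges G (w i)"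
  have I: "?I = insert (E i) (?I - D)" and O: "?O = insert (E (nx i)) (?O - D)" using inD[OF i] outD[OF i] by blast+
  have cI: "card ?I = Suc (card (?I - D))" "card ?O = Suc (card (?O - D))"
   using card_insert_disjoint[of "?I - D" "E i"] card_insert_disjoint[of "?O - D" "E (nx i)"] fio ED I O by auto
  have "card ?I = 2 & card ?O = 1 \<or> card ?I = 1 & card ?O = 2" using M wV[of i] unfolding moy_graph_def by simp
  then show ?thesis
  proof
   assume "card ?I = 2 & card ?O = 1"
   then have O0: "?O - D = {}" using cI fio by simp
   then have mi: "mg i" and Si: "S i = ?I - D" by (auto simp: mg_def S_def)
   have o: "?O = {E (nx i)}" by (rule trans[OF O]) (simp only: O0)
   have "?I = insert (E i) (S i)" unfolding Si by (rule I)
   then show ?thesis unfolding mrg_def by (intro disjI1 conjI mi o O0 Si[symmetric])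
  next
   assume "card ?I = 1 & card ?O = 2"
   then have I0: "?I - D = {}" and O1: "card (?O - D) = 1" using cI fio by simp_all
   obtain b where b: "?O - D = {b}" using O1 by (rule card_1_singletonE)
   then have "~ mg i" by (auto simp: mg_def)
   then have Si: "S i = ?O - D" by (simp add: S_def)
   have ii: "?I = {E i}" by (rule trans[OF I]) (simp only: I0)
   have "?O = insert (E (nx i)) (S i)" unfolding Si by (rule O)
   moreover have "S i = {b}" unfolding Si by (rule b)
   ultimately show ?thesis unfolding spl_def by (intro disjI2 conjI \<open>~ mg i\<close> ii I0 Si[symmetric] exI[of _ b])
  qed
 qed
 have nS: "E j \<notin> S i" for i j using Sp(2) ED by auto
 have kc: "if mg i then k (nx i) = k i + c i else k i = k (nx i) + c i" if i: "i < L" for i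
 proof -
  have "(\<Sum>e\<in>in_edges G (w i). color G e) = (\<Sum>e\<in>out_edges G (w i). color G e)" using G wV[of i] by (simp add: net_def)
  then show ?thesis using cs[OF i] nS Sp(1)[of i] by (auto simp: k_def c_def mrg_def spl_def)
 qed
 have kN: "k i <= N" for i using Dk ED by (simp add: k_def)
 obtain off where off: "set off = edges G - D" "distinct off" using finite_distinct_list[of "edges G - D"] fin by auto
 obtain voff where voff: "set voff = verts G - w ` {..<L}" "distinct voff" using finite_distinct_list[of "verts G - w ` {..<L}"] fin by auto
 let ?el = "map E [0..<L] @ off" and ?vl = "map w [0..<L] @ voff"
 have el: "distinct ?el" "set ?el = edges G"
 proof -
  have "inj_on E {0..<L}" using Einj by (auto simp: inj_on_def)
  then show "distinct ?el" using off ED by (auto simp: distinct_map)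
  have "E ` {0..<L} = D" using ED DE by (force simp: image_iff)
  then show "set ?el = edges G" using off(1) es(4) by auto
 qed
 have vl: "distinct ?vl" "set ?vl = verts G"
 proof -
  have "inj_on w {0..<L}" using winj by (auto simp: inj_on_def)
  then show "distinct ?vl" using voff by (auto simp: distinct_map)
  show "set ?vl = verts G" using voff(1) wV by auto
 qed
 \<comment> \<open>Circuit edges keep separate alphabets \<open>T i\<close> and \<open>H i\<close>
   at their two ends, so that each of them contributes a block \<open>ar i\<close> of its own,
   beside which a loop can be inserted.\<close>
 define mu0 where "mu0 e = (if e \<in> D then 2 else 1 :: nat)" for e
 define X where "X e = ser (True, e, 0 :: nat) (color G e)" for e
 define T where "T i = (True, E i, 0 :: nat)" for i
 define H where "H i = (True, E i, 1 :: nat)" for i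
 define Z where "Z i = (False, E i, 0 :: nat)" for i
 define V where "V = (\<Union>e\<in>edges G - D. {(True, e, 0 :: nat)} \<times> {1..color G e})"
 define B where "B i = (\<Prod>e\<in>S i. X e)" for i
 define R where "R = concat (map (%e. blk N (color G e) (X e) (X e)) (filter (is_circle G) off)) @
   concat (map (%v. blk N (\<Sum>e\<in>out_edges G v. color G e) (\<Prod>e\<in>out_edges G v. X e) (\<Prod>e\<in>in_edges G v. X e)) voff)"
 define vb where "vb i = (if mg i then blk N (k (nx i)) (ser (T (nx i)) (k (nx i))) (ser (H i) (k i) * B i)
   else blk N (k i) (ser (T (nx i)) (k (nx i)) * B i) (ser (H i) (k i)))" for i
 define vb' where "vb' i = (if mg i then blk N (N - k i) (ser (Z i) (N - k i)) (B i * ser (Z (nx i)) (N - k (nx i)))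
   else blk N (N - k (nx i)) (B i * ser (Z i) (N - k i)) (ser (Z (nx i)) (N - k (nx i))))" for i
 define ar where "ar i = blk N (k i) (ser (H i) (k i)) (ser (T i) (k i))" for i
 have gX: "gser V (X e)" if "e \<in> edges G - D" for e unfolding X_def using that by (intro gser_ser) (auto simp: V_def)
 have voff_io: "in_edges G v <= edges G - D" "out_edges G v <= edges G - D" if "v \<in> set voff" for v
  using off_v[of v] that voff(1) in_out_subset[of G v] by auto
 have okR: "\<forall>x\<in>set R. row_ok ?n V x"
 proof
  fix x assume "x \<in> set R"
  then consider (circle) e where "e \<in> set off" "x \<in> set (blk N (color G e) (X e) (X e))"
   | (vertex) v where "v \<in> set voff" "x \<in> set (blk N (\<Sum>e\<in>out_edges G v. color G e) (\<Prod>e\<in>out_edges G v. X e) (\<Prod>e\<in>in_edges G v. X e))"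
   unfolding R_def by auto
  then show "row_ok ?n V x"
  proof cases
   case (circle e)
   then have g: "gser V (X e)" using off(1) by (intro gX) auto
   show ?thesis by (rule bspec[OF blk_row_ok[OF g g] circle(2)])
  next
   case (vertex v)
   have "in_edges G v <= edges G - D" "out_edges G v <= edges G - D" using voff_io[OF vertex(1)] by auto
   then have "gser V (\<Prod>e\<in>out_edges G v. X e)" "gser V (\<Prod>e\<in>in_edges G v. X e)" by (auto intro!: gser_prod gX)
   from bspec[OF blk_row_ok[OF this] vertex(2)] show ?thesis by blast
  qed
 qed
 have concat_app: "concat (map f (xs @ ys)) = concat (map f xs) @ concat (map f ys)" for f :: "'p => 'q list" and xs ys by simp
 have fE: "filter (is_circle G) (map E [0..<L]) = []" using EE(2) by (simp add: filter_empty_conv)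
 let ?VX = "%v. blk N (\<Sum>e\<in>out_edges G v. color G e) (\<Prod>e\<in>out_edges G v. X e) (\<Prod>e\<in>in_edges G v. X e)"
 have R1: "mset (rowsG N G tagT ?el ?vl mu0) = mset (concat (map ar [0..<L]) @ concat (map vb [0..<L]) @ R)"
 proof -
  let ?tau = "%e. ser (tagT (e, 0)) (color G e)" and ?eta = "%e. ser (tagT (e, mu0 e - 1)) (color G e)"
  let ?W = "%v. blk N (\<Sum>e\<in>out_edges G v. color G e) (\<Prod>e\<in>out_edges G v. ?tau e) (\<Prod>e\<in>in_edges G v. ?eta e)"
  have ofx: "?tau e = X e" "?eta e = X e" if "e \<notin> D" for e using that by (simp_all add: X_def mu0_def tag_simps)
  have onx: "?tau (E i) = ser (T i) (k i)" "?eta (E i) = ser (H i) (k i)" for i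
   using ED[of i] by (simp_all add: T_def H_def k_def mu0_def tag_simps)
  have a1: "map (arcs N G tagT mu0) (map E [0..<L]) = map ar [0..<L]"
   using ED by (simp add: arcs_def mu0_def ar_def T_def H_def k_def tag_simps)
  have a2: "concat (map (arcs N G tagT mu0) off) = []" using off(1) by (auto simp: arcs_def mu0_def)
  have a: "concat (map (arcs N G tagT mu0) ?el) = concat (map ar [0..<L])"
   unfolding concat_app a1 a2 by (rule append_Nil2)
  have c1: "blk N (color G e) (?tau e) (?eta e) = blk N (color G e) (X e) (X e)" if "e \<in> set (filter (is_circle G) off)" for e
  proof -
   have e: "e \<notin> D" using that off(1) by auto
   show ?thesis unfolding ofx[OF e] ..
  qed
  have cc: "map (%e. blk N (color G e) (?tau e) (?eta e)) (filter (is_circle G) ?el) = map (%e. blk N (color G e) (X e) (X e)) (filter (is_circle G) off)"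
   unfolding filter_append fE append_Nil by (intro map_cong refl c1)
  have v1: "?W (w i) = vb i" if i: "i < L" for i
  proof -
   have SX: "(\<Prod>e\<in>S i. ?tau e) = B i" "(\<Prod>e\<in>S i. ?eta e) = B i"
    unfolding B_def using Sp(2)[of i] ofx by (auto intro!: prod.cong)
   have ci: "(\<Sum>e\<in>insert (E (nx i)) (S i). color G e) = k (nx i) + c i"
    using nS Sp(1) by (simp add: k_def c_def)
   have pi: "(\<Prod>e\<in>insert (E j) (S i). f e) = f (E j) * (\<Prod>e\<in>S i. f e)" for f :: "'e => ((bool \<times> 'e \<times> nat) \<times> nat) mpol fps" and j
    using nS Sp(1) by simp
   from cs[OF i] show ?thesis
   proof
    assume "mrg i"
    note h = this[unfolded mrg_def]
    from h have "out_edges G (w i) = {E (nx i)}" "in_edges G (w i) = insert (E i) (S i)" by blast+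
    then show ?thesis using h by (simp only: pi SX onx vb_def if_True) (simp add: onx[simplified] k_def)
   next
    assume "spl i"
    note h = this[unfolded spl_def]
    from h have "in_edges G (w i) = {E i}" "out_edges G (w i) = insert (E (nx i)) (S i)" by blast+
    moreover have "k i = k (nx i) + c i" using kc[OF i] h by simp
    ultimately show ?thesis using h by (simp only: pi SX onx vb_def if_False ci) (simp add: onx[simplified])
   qed
  qed
  have v2: "?W v =
   ?VX v" if v: "v \<in> set voff" for v
  proof -
   have "(\<Prod>e\<in>out_edges G v. ?tau e) = (\<Prod>e\<in>out_edges G v. X e)" "(\<Prod>e\<in>in_edges G v. ?eta e) = (\<Prod>e\<in>in_edges G v. X e)"
    using voff_io[OF v] ofx by (auto intro!: prod.cong)
   then show ?thesis by (simp only:)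
  qed
  have w1: "map ?W (map w [0..<L]) = map vb [0..<L]"
   unfolding map_map comp_def by (intro map_cong refl v1) simp
  have w2: "map ?W voff =
   map ?VX voff"
   by (intro map_cong refl v2)
  show ?thesis unfolding rowsG_def a unfolding ends_def cc unfolding concat_app w1 w2 R_def
   by (simp only: mset_append ac_simps)
 qed
 have R2: "mset (rowsG N ?G (tagD D) ?el ?vl (%_. 1)) = mset (concat (map vb' [0..<L]) @ R)"
 proof -
  let ?tau = "%e. ser (tagD D (e, 0)) (color ?G e)"
  let ?W = "%v. blk N (\<Sum>e\<in>out_edges ?G v. color ?G e) (\<Prod>e\<in>out_edges ?G v. ?tau e) (\<Prod>e\<in>in_edges ?G v. ?tau e)"
  have ofx: "?tau e = X e" "color ?G e = color G e" if "e \<notin> D" for e using that by (simp_all add: X_def tag_simps r)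
  have onx: "?tau (E i) = ser (Z i) (N - k i)" "color ?G (E i) = N - k i" for i
   using ED[of i] by (simp_all add: Z_def k_def tag_simps r)
  have a1: "arcs N ?G (tagD D) (%_. 1) e = []" for e by (rule arcs_1) (rule refl)
  have a: "concat (map (arcs N ?G (tagD D) (%_. 1)) xs) = []" for xs by (induction xs) (simp_all only: list.map concat.simps a1 append_Nil)
  have c1: "blk N (color ?G e) (?tau e) (?tau e) = blk N (color G e) (X e) (X e)" if "e \<in> set (filter (is_circle G) off)" for e
  proof -
   have e: "e \<notin> D" using that off(1) by auto
   show ?thesis unfolding ofx(1)[OF e] unfolding ofx(2)[OF e] ..
  qed
  have cc: "map (%e. blk N (color ?G e) (?tau e) (?tau e)) (filter (is_circle ?G) ?el) = map (%e. blk N (color G e) (X e) (X e)) (filter (is_circle G) off)"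
   unfolding ic filter_append fE append_Nil by (intro map_cong refl c1)
  have v1: "?W (w i) = vb' i" if i: "i < L" for i
  proof -
   have SX: "(\<Prod>e\<in>S i. ?tau e) = B i" "(\<Sum>e\<in>S i. color ?G e) = c i"
    unfolding B_def c_def using Sp(2)[of i] ofx by (auto intro!: prod.cong sum.cong)
   have ci: "(\<Sum>e\<in>insert (E i) (S i). color ?G e) = (N - k i) + c i"
    using nS Sp(1) SX(2) onx(2) by simp
   have pi: "(\<Prod>e\<in>insert (E j) (S i). f e) = f (E j) * (\<Prod>e\<in>S i. f e)" for f :: "'e => ((bool \<times> 'e \<times> nat) \<times> nat) mpol fps" and j
    using nS Sp(1) by simp
   from cs[OF i] show ?thesis
   proof
    assume "mrg i"
    note h = this[unfolded mrg_def]
    have io: "out_edges ?G (w i) = {E i}" "in_edges ?G (w i) = insert (E (nx i)) (S i)"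
     unfolding r(5,6) inD[OF i] outD[OF i] using h by auto
    have "(\<Sum>e\<in>{E i}. color ?G e) = N - k i" "(\<Prod>e\<in>{E i}. ?tau e) = ser (Z i) (N - k i)" using onx by simp_all
    then show ?thesis using h unfolding io pi SX onx(1) vb'_def by (simp add: mult.commute)
   next
    assume "spl i"
    note h = this[unfolded spl_def]
    have io: "in_edges ?G (w i) = {E (nx i)}" "out_edges ?G (w i) = insert (E i) (S i)"
     unfolding r(5,6) inD[OF i] outD[OF i] using h by auto
    have "k i = k (nx i) + c i" using kc[OF i] h by simp
    then have "(N - k i) + c i = N - k (nx i)" using kN[of i] by simp
    moreover have "(\<Prod>e\<in>{E (nx i)}. ?tau e) = ser (Z (nx i)) (N - k (nx i))" using onx by simp
    ultimately show ?thesis using h unfolding io pi SX onx(1) vb'_def ci by (simp add: mult.commute)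
   qed
  qed
  have v2: "?W v =
   ?VX v" if v: "v \<in> set voff" for v
  proof -
   have io: "out_edges ?G v = out_edges G v" "in_edges ?G v = in_edges G v" using voff_io[OF v] unfolding r(5,6) by auto
   have "(\<Prod>e\<in>out_edges G v. ?tau e) = (\<Prod>e\<in>out_edges G v. X e)" "(\<Prod>e\<in>in_edges G v. ?tau e) = (\<Prod>e\<in>in_edges G v. X e)"
    "(\<Sum>e\<in>out_edges G v. color ?G e) = (\<Sum>e\<in>out_edges G v. color G e)"
    using voff_io[OF v] ofx by (auto intro!: prod.cong sum.cong)
   then show ?thesis unfolding io by (simp only:)
  qed
  have w1: "map ?W (map w [0..<L]) = map vb' [0..<L]"
   unfolding map_map comp_def by (intro map_cong refl v1) simp
  have w2: "map ?W voff =
   map ?VX voff"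
   by (intro map_cong refl v2)
  show ?thesis unfolding rowsG_def a unfolding ends_def diff_self_eq_0 cc unfolding concat_app w1 w2 R_def
   by (simp only: mset_append append_Nil ac_simps)
 qed
 have V1: "pvs G mu0 tagT = V \<union> (\<Union>i<L. {T i, H i} \<times> {1..k i})"
 proof -
  have "marks G mu0 = (%e. (e, 0)) ` (edges G - D) \<union> (\<Union>i<L. {(E i, 0), (E i, 1)})"
  proof (intro set_eqI iffI)
   fix s :: "'e \<times> nat" assume "s \<in> marks G mu0"
   then obtain e j where s: "s = (e, j)" "e \<in> edges G" "j < mu0 e" by (auto simp: marks_def)
   show "s \<in> (%e. (e, 0)) ` (edges G - D) \<union> (\<Union>i<L. {(E i, 0), (E i, 1)})"
   proof (cases "e \<in> D")
    case True
    then obtain i where "i < L" "e = E i" using DE by blast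
    moreover have "j = 0 \<or> j = 1" using s(3) True by (auto simp: mu0_def)
    ultimately show ?thesis using s(1) by auto
   qed (use s in \<open>auto simp: mu0_def\<close>)
  next
   fix s :: "'e \<times> nat" assume "s \<in> (%e. (e, 0)) ` (edges G - D) \<union> (\<Union>i<L. {(E i, 0), (E i, 1)})"
   then show "s \<in> marks G mu0" using EE(1) ED by (auto simp: marks_def mu0_def)
  qed
  then have "pvs G mu0 tagT = (\<Union>e\<in>edges G - D. {tagT (e, 0)} \<times> {1..color G e}) \<union>
    (\<Union>i<L. {tagT (E i, 0)} \<times> {1..color G (E i)} \<union> {tagT (E i, 1)} \<times> {1..color G (E i)})"
   by (simp add: pvs_def)
  moreover have "{tagT (E i, 0)} \<times> {1..color G (E i)} \<union> {tagT (E i, 1)} \<times> {1..color G (E i)} = {T i, H i} \<times> {1..k i}" for i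
   unfolding T_def H_def k_def tag_simps by blast
  ultimately show ?thesis unfolding V_def tag_simps by (simp only:)
 qed
 have V2: "pvs ?G (%_. 1) (tagD D) = V \<union> (\<Union>i<L. {Z i} \<times> {1..N - k i})"
 proof -
  have "marks ?G (%_. 1) = (%e. (e, 0)) ` (edges G - D) \<union> (\<Union>i<L. {(E i, 0)})"
  proof (intro set_eqI iffI)
   fix s :: "'e \<times> nat" assume "s \<in> marks ?G (%_. 1)"
   then obtain e where s: "s = (e, 0)" "e \<in> edges G" by (auto simp: marks_def r)
   then show "s \<in> (%e. (e, 0)) ` (edges G - D) \<union> (\<Union>i<L. {(E i, 0)})" using DE[of e] by (cases "e \<in> D") auto
  next
   fix s :: "'e \<times> nat" assume "s \<in> (%e. (e, 0)) ` (edges G - D) \<union> (\<Union>i<L. {(E i, 0)})"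
   then show "s \<in> marks ?G (%_. 1)" using EE(1) by (auto simp: marks_def r)
  qed
  then have "pvs ?G (%_. 1) (tagD D) = (\<Union>e\<in>edges G - D. {tagD D (e, 0)} \<times> {1..color ?G e}) \<union> (\<Union>i<L. {tagD D (E i, 0)} \<times> {1..color ?G (E i)})"
   by (simp add: pvs_def)
  moreover have "(\<Union>e\<in>edges G - D. {tagD D (e, 0)} \<times> {1..color ?G e}) = V"
   unfolding V_def by (rule SUP_cong[OF refl]) (simp add: r tag_simps)
  moreover have "{tagD D (E i, 0)} \<times> {1..color ?G (E i)} = {Z i} \<times> {1..N - k i}" for i
   using ED[of i] by (simp add: r tag_simps Z_def k_def)
  ultimately show ?thesis by (simp only:)
 qed
 have p0: "pot (concat (map ar [0..<L]) @ concat (map vb [0..<L]) @ R) = 0"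
  by (rule trans[OF sym[OF pot_mset[OF R1]] pot_rowsG[OF G el vl]])
 define t where "t = (\<Sum>i\<leftarrow>[0..<L]. if mg i then int (k i) * int (N - k i) else int (k (nx i)) * int (N - k (nx i))) - (\<Sum>i\<leftarrow>[0..<L]. int (N - k i) * int (k i))"
 have "pke ?n t (V \<union> (\<Union>i<L. {T i, H i} \<times> {1..k i})) (concat (map ar [0..<L]) @ concat (map vb [0..<L]) @ R)
   (V \<union> (\<Union>i<L. {Z i} \<times> {1..N - k i})) (concat (map vb' [0..<L]) @ R)"
  unfolding t_def ar_def vb_def vb'_def nx_def
 proof (rule circuit_pke[where c = c])
  show "0 < snd x" if "x \<in> V" for x using that by (auto simp: V_def)
  show "inj_on T {..<L}" "inj_on H {..<L}" "inj_on Z {..<L}" using Einj by (auto simp: inj_on_def T_def H_def Z_def)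
  show "T i ~= H j" "T i ~= Z j" "H i ~= Z j" for i j by (simp_all add: T_def H_def Z_def)
  show "(T i, j) \<notin> V" "(H i, j) \<notin> V" "(Z i, j) \<notin> V" for i j using ED[of i] by (auto simp: T_def H_def Z_def V_def)
  show "if mg i then k (Suc i mod L) = k i + c i else k i = k (Suc i mod L) + c i" if "i < L" for i using kc[OF that] by (simp only: nx_def)
  show "gser V (B i) & trc (c i) (B i)" for i unfolding B_def c_def
   using Sp(2)[of i] by (intro conjI gser_prod gX trc_prod) (auto simp: X_def trc_ser)
  show "pot (concat (map (%i. blk N (k i) (ser (H i) (k i)) (ser (T i) (k i))) [0..<L]) @
   concat (map (%i. if mg i then blk N (k (Suc i mod L)) (ser (T (Suc i mod L)) (k (Suc i mod L))) (ser (H i) (k i) * B i)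
     else blk N (k i) (ser (T (Suc i mod L)) (k (Suc i mod L)) * B i) (ser (H i) (k i))) [0..<L]) @ R) = 0"
   using p0 unfolding ar_def vb_def nx_def .
 qed (rule L kN okR)+
 then have pk: "pke ?n t (pvs G mu0 tagT) (rowsG N G tagT ?el ?vl mu0) (pvs ?G (%_. 1) (tagD D)) (rowsG N ?G (tagD D) ?el ?vl (%_. 1))"
  unfolding V1 V2 by (rule pke_mset[OF _ R1[symmetric] R2[symmetric]])
 have sh: "(\<Sum>v\<leftarrow>?vl. vsh G v) + t = (\<Sum>v\<leftarrow>?vl. vsh ?G v)"
 proof -
  \<comment> \<open>The balance holds vertex by vertex. At a merge the shifts of inserting and
    removing a loop cancel. At a split, \<open>k i = k (nx i) + c i\<close>, and their difference
    turns the old shift \<open>- k (nx i) * c i\<close> into the new one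
    \<open>- (N - k i) * c i\<close>.\<close>
  have 1: "vsh G (w i) + ((if mg i then int (k i) * int (N - k i) else int (k (nx i)) * int (N - k (nx i))) - int (N - k i) * int (k i)) = vsh ?G (w i)"
   if i: "i < L" for i
   using cs[OF i]
  proof
   assume "mrg i"
    note h = this[unfolded mrg_def]
   have "out_edges ?G (w i) = {E i}" unfolding r(6) inD[OF i] using h by auto
   then show ?thesis using h vsh_single[of G "w i"] vsh_single[of ?G "w i"] by simp
  next
   assume "spl i"
    note h = this[unfolded spl_def]
   from h obtain b where b: "S i = {b}" by blast
   have o: "out_edges G (w i) = {E (nx i), b}" "out_edges ?G (w i) = {E i, b}" unfolding r(6) inD[OF i] using h b by auto
   have ne: "E (nx i) ~= b" "E i ~= b" using nS[of _ i] b by auto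
   have cb: "color ?G b = color G b" "c i = color G b" using Sp(2)[of i] b by (auto simp: r c_def)
   have kE: "color ?G (E i) = N - k i" using ED[of i] by (simp add: r k_def)
   have v1: "vsh G (w i) = - (int (k (nx i)) * int (c i))" using vsh_pair[OF o(1) ne(1)] by (simp add: k_def cb)
   have v2: "vsh ?G (w i) = - (int (N - k i) * int (c i))" using vsh_pair[OF o(2) ne(2)] by (simp add: kE cb)
   have ki: "int (k i) = int (k (nx i)) + int (c i)" using kc[OF i] h by simp
   have NN: "int (N - k i) = int N - (int (k (nx i)) + int (c i))" "int (N - k (nx i)) = int N - int (k (nx i))"
    using kN[of i] kN[of "nx i"] ki by (simp_all add: of_nat_diff)
   show ?thesis using h unfolding v1 v2 ki NN by (simp add: algebra_simps)
  qed
  have 2: "vsh G v = vsh ?G v" if v: "v \<in> set voff" for v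
  proof (rule vsh_cong)
   show "out_edges G v = out_edges ?G v" using voff_io[OF v] unfolding r(6) by auto
   show "color G e = color ?G e" if "e \<in> out_edges G v" for e using that voff_io[OF v] by (auto simp: r)
  qed
  have "(\<Sum>i\<leftarrow>[0..<L]. vsh G (w i)) + t = (\<Sum>i\<leftarrow>[0..<L]. vsh ?G (w i))"
   unfolding t_def sum_list_subtractf[symmetric] sum_list_addf[symmetric]
   by (intro arg_cong[of _ _ sum_list] map_cong refl 1) simp
  moreover have "(\<Sum>v\<leftarrow>voff. vsh G v) = (\<Sum>v\<leftarrow>voff. vsh ?G v)" by (intro arg_cong[of _ _ sum_list] map_cong refl 2)
  ultimately show ?thesis by (simp add: comp_def)
 qed
 have "\<forall>e. 1 <= mu0 e & mu0 e <= 2" by (simp add: mu0_def)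
 then show ?thesis unfolding reversal_def using net' el vl pk sh by blast
qed

text \<open>A vertexless circle is a closed curve, whereas in a circuit of several edges each edge
  is an arc. Hence a circuit that contains a circle consists of it alone.\<close>

lemma reversal_simple_circuit:
 assumes M: "moy_graph G" and "simple_circuit G D" and Dk: "\<forall>e\<in>D. color G e <= N"
 shows "reversal N G D"
proof -
 obtain es where es: "es ~= []" "distinct es" "set es = D" "D <= edges G"
  "!!i. i < length es ==> pathfinish (curve G (es ! i)) = pathstart (curve G (es ! (Suc i mod length es)))"
  "distinct (map (%e. pathstart (curve G e)) es)" "1 < length es ==> \<forall>e\<in>D. arc (curve G e)"
  using simple_circuit_edges[OF assms(2)] by metis
 show ?thesis
 proof (cases "\<forall>e\<in>D. ~ is_circle G e")
  case True
  show ?thesis by (rule reversal_circuit[OF M Dk es(1-4) _ es(6) True]) (rule es(5))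
 next
  case False
  then obtain e where e: "e \<in> D" "is_circle G e" by blast
  then have "e \<in> edges G" using es(4) by auto
  then have "pathfinish (curve G e) = pathstart (curve G e)" using M e(2) unfolding moy_graph_def by auto
  then have "~ arc (curve G e)" using arc_distinct_ends[of "curve G e"] by auto
  then have "~ 1 < length es" using es(7) e(1) by blast
  then obtain e' where "es = [e']" using es(1) by (cases es) auto
  then have D: "D = {e}" using es(3) e(1) by auto
  show ?thesis unfolding D
   by (rule reversal_circle[OF net_moy_graph[OF M] \<open>e \<in> edges G\<close> e(2)]) (use Dk e(1) in blast)
 qed
qed

lemma component_z2shift: "component (z2shift M) = shf True 0 (component M)"
 by (auto simp: fun_eq_iff component_def z2shift_def shf_def elems_def)

lemma diffl_z2shift: "diffl (z2shift M) = diffl M"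
 by (simp add: fun_eq_iff diffl_def z2shift_def)

theorem theorem2p11:
  fixes N :: nat and G G' :: "'e plane_graph" and D :: "'e set"
    and m m' :: "'e \<Rightarrow> nat"
    and ps ps' :: "(('e \<times> nat) set \<times> ('e \<times> nat) set) list"
  assumes "N > 0"
    and "moy_graph G"
    and "simple_circuit G D"
    and "\<forall>e\<in>D. color G e \<le> N"
    and "G' = reverse_circuit N D G"
    and "marking G m" and "distinct ps" and "set ps = pieces G m"
    and "marking G' m'" and "distinct ps'" and "set ps' = pieces G' m'"
  shows "mf_homotopy_equivalent N (C_N N G ps) (C_N N G' ps') \<or>
         mf_homotopy_equivalent N (C_N N G ps) (z2shift (C_N N G' ps'))"
proof -
 let ?n = "int (Suc N)" and ?M = "C_N N G ps" and ?M' = "C_N N G' ps'"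
 have n: "?n = int N + 1" by simp
 have G: "net G" by (rule net_moy_graph[OF assms(2)])
 have rev: "reversal N G D" by (rule reversal_simple_circuit[OF assms(2-4)])
 then have G': "net G'" by (simp add: reversal_def assms(5))
 obtain el vl mu0 t where el: "distinct el" "set el = edges G" and vl: "distinct vl" "set vl = verts G"
  and mu0: "!!e. 1 <= mu0 e & mu0 e <= (2 :: nat)"
  and pk: "pke ?n t (pvs G mu0 tagT) (rowsG N G tagT el vl mu0) (pvs G' (%_. 1) (tagD D)) (rowsG N G' (tagD D) el vl (%_. 1))"
  and sh: "(\<Sum>v\<leftarrow>vl. vsh G v) + t = (\<Sum>v\<leftarrow>vl. vsh G' v)"
  using rev unfolding reversal_def assms(5) by blast
 have el': "set el = edges G'" "set vl = verts G'" using el(2) vl(2) by (simp_all add: assms(5) reverse_circuit_simps)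
 have inj: "inj_on tagT (marks G m)" "inj_on (tagD D) (marks G' m')" by (auto simp: inj_on_def tagT_def tagD_def)
 let ?K = "Kc ?n (pvs G m tagT) (rowsG N G tagT el vl m)" and ?d = "kd (rowsG N G tagT el vl m)"
  and ?K' = "Kc ?n (pvs G' m' (tagD D)) (rowsG N G' (tagD D) el vl m')" and ?d' = "kd (rowsG N G' (tagD D) el vl m')"
 let ?s = "\<Sum>v\<leftarrow>vl. vsh G v" and ?s' = "\<Sum>v\<leftarrow>vl. vsh G' v"
 note K = C_N_koszul[OF G assms(6-8) inj(1) el vl, of N, unfolded sum_psh_cps]
 note K' = C_N_koszul[OF G' assms(9-11) inj(2) el(1) el'(1) vl(1) el'(2), of N, unfolded sum_psh_cps]
 \<comment> \<open>The given markings are related to the economical ones of \<open>reversal\<close>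
   by forgetting marks, which costs no quantum shift.\<close>
 have r1: "pke ?n 0 (pvs G m tagT) (rowsG N G tagT el vl m) (pvs G mu0 tagT) (rowsG N G tagT el vl mu0)"
 proof (rule reduce_marks[OF G el vl _ inj(1)])
  show "\<forall>e\<in>edges G. 1 <= mu0 e & mu0 e <= m e" using mu0 assms(6) unfolding marking_def by (meson le_trans)
 qed
 have r2: "pke ?n 0 (pvs G' m' (tagD D)) (rowsG N G' (tagD D) el vl m') (pvs G' (%_. 1) (tagD D)) (rowsG N G' (tagD D) el vl (%_. 1))"
 proof (rule reduce_marks[OF G' el(1) el'(1) vl(1) el'(2) _ inj(2)])
  show "\<forall>e\<in>edges G'. 1 <= (1 :: nat) & 1 <= m' e" using assms(9) unfolding marking_def by fastforce
 qed
 from pke_trans[OF pke_trans[OF r1 pk] pke_sym[OF r2]]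
 obtain dl where "pkeq ?n dl t (pvs G m tagT) (rowsG N G tagT el vl m) (pvs G' m' (tagD D)) (rowsG N G' (tagD D) el vl m')"
  unfolding pke_def by auto
 note P = pkeqD[OF this]
 have c1: "cplx ?n (shf False ?s ?K) ?d" by (rule cplx_shf[OF cplx_Kc[OF P(1,3)]])
 have c2: "cplx ?n (shf dl ?s' ?K') ?d'" by (rule cplx_shf[OF cplx_Kc[OF P(2,4)]])
 have c3: "cplx ?n (shf dl 0 (component ?M')) (diffl ?M')" by (rule cplx_shf[OF K'(1)])
 \<comment> \<open>The shift \<open>t\<close> of the row operations is exactly the difference of the
   total vertex shifts, so no quantum shift is left.\<close>
 have h1: "heq ?n (shf False ?s ?K) ?d (shf dl ?s' ?K') ?d'"
  using heq_shf[OF P(5), of False ?s] by (simp add: shf_shf sh)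
 have h2: "heq ?n (shf dl ?s' ?K') ?d' (shf dl 0 (component ?M')) (diffl ?M')"
  using heq_sym[OF heq_shf[OF K'(3), of dl 0]] by (simp add: shf_shf)
 have h: "heq ?n (component ?M) (diffl ?M) (shf dl 0 (component ?M')) (diffl ?M')"
  by (rule heq_trans[OF K(1) c1 c3 K(3) heq_trans[OF c1 c2 c3 h1 h2]])
 show ?thesis
 \<comment> \<open>The parity accumulated by the row operations decides which alternative
   holds.\<close>
 proof (cases dl)
  case False
  have "mf_homotopy_equivalent N ?M ?M'"
   by (rule heq_mf_homotopy_equivalent) (use K(1,2) K'(1,2) h False in \<open>simp_all add: n[symmetric] del: of_nat_Suc\<close>)
  then show ?thesis ..
 next
  case True
  have g: "finite (gens (z2shift ?M'))" using K'(2) by (simp add: z2shift_def)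
  have "mf_homotopy_equivalent N ?M (z2shift ?M')"
   by (rule heq_mf_homotopy_equivalent)
    (use K(1,2) g c3 h True in \<open>simp_all add: n[symmetric] component_z2shift diffl_z2shift del: of_nat_Suc\<close>)
  then show ?thesis ..
 qed
qed

end
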